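(* Let $N\ge 1$, let $\phi\in C^1((0,+\infty);(0,+\infty))$ satisfy $(\phi(s)s)'>0$ and $l-1\le \frac{(\phi(s)s)'}{\phi(s)}\le m-1$ for all $s>0$, where $1<l\le m$ are real constants. Let $V\in C^1(\mathbb R^N;\mathbb R)$ satisfy $V(x+\xi)=V(x)$ for all $x\in\mathbb R^N$, $\xi\in\mathbb Z^N$, $V\ge 0$ on $\mathbb R^N$, and $V(x)=0$ if and only if $x\in\mathbb Z^N$. Let $c^*=\inf\{V(x):\operatorname{dist}(x,\mathbb Z^N)\ge 1/2\}$. Then for every $c\in[0,c^* )$ there exist $k_c\in\mathbb N$ with $k_c\ge N$ and vectors $\xi^1,\dots,\xi^{k_c}\in\mathbb Z^N\setminus\{0\}$ such that, setting for $j\in\{1,\dots,k_c\}$ $$Z_-^j=\Big\{\sum_{i=1}^{j-1}n_i\xi^i: n_i\in\mathbb Z\Big\},\qquad Z_+^j=\mathbb Z^N\setminus Z_-^j$$ (with $Z_-^1=\{0\}$), the following hold: (a) $\xi^j\notin Z_-^j$ for every $j\in\{2,\dots,k_c\}$; (b) $\mathbb Z^N=\{\sum_{i=1}^{k_c}n_i\xi^i: n_i\in\mathbb Z\}$; and, for each $j\in\{1,\dots,k_c\}$, there exist an interval $I_j=(\alpha_j,\omega_j)\subset\mathbb R$ with $-\infty\le\alpha_j<\omega_j\le+\infty$ and a minimal $c$-connection $q_{c,j}:\bar I_j\to\mathbb R^N$ between $\mathcal V_c^-(Z_-^j)$ and $\mathcal V_c^+(Z_+^j)$ such that, moreover, $$\lim_{t\to\alpha_j^+}\operatorname{dist}(q_{c,j}(t),\mathcal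 V_{c,0})=0\quad\text{and}\quad \lim_{t\to\omega_j^-}\operatorname{dist}(q_{c,j}(t),\mathcal V_{c,\xi^j})=0.$$
   Context: Set $\Phi(s)=\int_0^{|s|}\phi(r)r\,dr$ and $G(s)=\phi(s)s^2-\Phi(s)$ for $s>0$, $G(0)=0$; $\phi(|v|)v$ is read as $0$ when $v=0$. $\operatorname{dist}$ is Euclidean distance. For an interval $I$, $L^\Phi(I;\mathbb R^N)$ is the set of $q\in L^1_{loc}(I;\mathbb R^N)$ with $\int_I\Phi(|q|/\lambda)\,dt<\infty$ for some $\lambda>0$; $W^{1,\Phi}(I;\mathbb R^N)$ is the set of $q\in L^\Phi$ with weak derivative $\dot q\in L^\Phi$; $W^{1,\Phi}_{loc}(\mathbb R;\mathbb R^N)$ consists of functions whose restriction to every compact interval $I$ lies in $W^{1,\Phi}(I;\mathbb R^N)$ (identified with continuous representatives). Under the hypotheses on $V$ one has $c^*>0$. For $c\in[0,c^* )$ let $\nu_c=(c^*-c)/2$ and fix $\delta_c\in(0,1/2)$ such that $V(x)\ge c+\nu_c$ whenever $\operatorname{dist}(x,\mathbb Z^N)>1/2-\delta_c$ (such $\delta_c$ exists). Let $\mathcal V_c=\{x: V(x)\le c\}$ and, for $\xi\in\mathbb Z^N$, $\mathcal V_{c,\xi}=\mathcal V_c\cap\overline B_{1/2-\delta_c}(\xi)$; then $\mathcal V_c=\bigcup_{\xi\in\mathbb Z^N}\mathcal V_{c,\xi}$. For a partition $\mathbb Z^N=Z_-\cup Z_+$ into disjoint nonempty sets put $\mathcal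 V_c^\pm(Z_\pm)=\bigcup_{\xi\in Z_\pm}\mathcal V_{c,\xi}$. For an interval $I$, $J_{c,I}(q)=\int_I(\Phi(|\dot q|)+V(q)-c)\,dt$ and $J_c=J_{c,\mathbb R}$. Given nonempty closed sets $\mathcal V_c^-,\mathcal V_c^+$ with $\mathcal V_c=\mathcal V_c^-\cup\mathcal V_c^+$ and $\operatorname{dist}(\mathcal V_c^-,\mathcal V_c^+)>0$, let $\Gamma_c$ be the set of $q\in W^{1,\Phi}_{loc}(\mathbb R;\mathbb R^N)$ with $V(q(t))\ge c$ for all $t$ and $\liminf_{t\to-\infty}\operatorname{dist}(q(t),\mathcal V_c^-)=\liminf_{t\to+\infty}\operatorname{dist}(q(t),\mathcal V_c^+)=0$, and $m_c=\inf_{\Gamma_c}J_c$ (both depend on the chosen decomposition). Let $I=(\alpha,\omega)$, $-\infty\le\alpha<\omega\le+\infty$, with closure $\bar I$ in $\mathbb R$. A function $q:\bar I\to\mathbb R^N$ is a minimal $c$-connection between $\mathcal V_c^-$ and $\mathcal V_c^+$ if $q\in L^\infty(I;\mathbb R^N)$ and: (i) $q\in C^1(\bar I;\mathbb R^N)\cap C^2(I;\mathbb R^N)$ and $(\phi(|\dot q|)\dot q)'=\nabla V(q)$ on $I$; (ii) $V(q(t))>c$ and $G(|\dot q(t)|)-V(q(t))=-c$ for all $t\in I$; (iii) $\lim_{t\to\alpha^+}\operatorname{dist}(q(t),\mathcal V_c^-)=\lim_{t\to\omega^-}\operatorname{dist}(q(t),\mathcal V_c^+)=0$; (iv) $J_{c,I}(q)=m_c$.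 *)

theory Defs
  imports "HOL-Analysis.Analysis"
begin

definition Phi :: "(real \<Rightarrow> real) \<Rightarrow> real \<Rightarrow> real" where
  "Phi \<phi> s = integral {0..\<bar>s\<bar>} (\<lambda>r. \<phi> r * r)"

text \<open>For every total \<open>\<phi>\<close> this formula gives \<open>Gfun \<phi> 0 = 0\<close>, and likewise
  \<open>\<phi> (norm v) *\<^sub>R v = 0\<close> for \<open>v = 0\<close>; the junk value \<open>\<phi> 0\<close> is therefore never seen.\<close>

definition Gfun :: "(real \<Rightarrow> real) \<Rightarrow> real \<Rightarrow> real" where
  "Gfun \<phi> s = \<phi> s * s\<^sup>2 - Phi \<phi> s"

definition grad :: "('a::real_inner \<Rightarrow> real) \<Rightarrow> 'a \<Rightarrow> 'a" where
  "grad V x = (THE D. GDERIV V x :> D)"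

definition C1_scalar :: "('a::real_inner \<Rightarrow> real) \<Rightarrow> bool" where
  "C1_scalar V \<longleftrightarrow> (\<forall>x. \<exists>D. GDERIV V x :> D) \<and> continuous_on UNIV (grad V)"

definition int_lattice :: "(real^'n) set" where
  "int_lattice = {x. \<forall>i. x $ i \<in> \<int>}"

definition cstar :: "(real^'n \<Rightarrow> real) \<Rightarrow> real" where
  "cstar V = (INF x\<in>{x. infdist x int_lattice \<ge> 1/2}. V x)"

definition admissible_delta :: "(real^'n \<Rightarrow> real) \<Rightarrow> real \<Rightarrow> real \<Rightarrow> bool" where
  "admissible_delta V c \<delta> \<longleftrightarrow> 0 < \<delta> \<and> \<delta> < 1/2 \<and>
     (\<forall>x. infdist x int_lattice > 1/2 - \<delta> \<longrightarrow> V x \<ge> c + (cstar V - c) / 2)"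

definition sublevel_at :: "(real^'n \<Rightarrow> real) \<Rightarrow> real \<Rightarrow> real \<Rightarrow> real^'n \<Rightarrow> (real^'n) set" where
  "sublevel_at V c \<delta> \<xi> = {x. V x \<le> c} \<inter> cball \<xi> (1/2 - \<delta>)"

definition sublevel_part :: "(real^'n \<Rightarrow> real) \<Rightarrow> real \<Rightarrow> real \<Rightarrow> (real^'n) set \<Rightarrow> (real^'n) set" where
  "sublevel_part V c \<delta> Z = (\<Union>\<xi>\<in>Z. sublevel_at V c \<delta> \<xi>)"

definition int_combinations :: "(nat \<Rightarrow> real^'n) \<Rightarrow> nat set \<Rightarrow> (real^'n) set" where
  "int_combinations \<xi> S = {\<Sum>i\<in>S. of_int (n i) *\<^sub>R \<xi> i | n :: nat \<Rightarrow> int. True}"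

definition L1_loc :: "real set \<Rightarrow> (real \<Rightarrow> real^'n) \<Rightarrow> bool" where
  "L1_loc I q \<longleftrightarrow> (\<forall>K. compact K \<and> K \<subseteq> I \<longrightarrow> set_integrable lebesgue K q)"

definition L_Phi :: "(real \<Rightarrow> real) \<Rightarrow> real set \<Rightarrow> (real \<Rightarrow> real^'n) \<Rightarrow> bool" where
  "L_Phi \<phi> I q \<longleftrightarrow> L1_loc I q \<and>
     (\<exists>r>0. (\<integral>\<^sup>+t\<in>I. ennreal (Phi \<phi> (norm (q t) / r)) \<partial>lebesgue) < \<infinity>)"

definition test_function :: "real set \<Rightarrow> (real \<Rightarrow> real) \<Rightarrow> bool" where
  "test_function U \<psi> \<longleftrightarrow> (\<forall>k t. (deriv ^^ k) \<psi> differentiable (at t)) \<and>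
     compact (closure {t. \<psi> t \<noteq> 0}) \<and> closure {t. \<psi> t \<noteq> 0} \<subseteq> U"

definition has_weak_deriv :: "real set \<Rightarrow> (real \<Rightarrow> real^'n) \<Rightarrow> (real \<Rightarrow> real^'n) \<Rightarrow> bool" where
  "has_weak_deriv I q p \<longleftrightarrow> L1_loc (interior I) q \<and> L1_loc (interior I) p \<and>
     (\<forall>\<psi>. test_function (interior I) \<psi> \<longrightarrow>
        (LINT t:interior I|lebesgue. deriv \<psi> t *\<^sub>R q t) =
        - (LINT t:interior I|lebesgue. \<psi> t *\<^sub>R p t))"

text \<open>A representative of the weak derivative, which is determined only almost everywhere.
  It is used below only under integral signs.\<close>

definition weak_deriv :: "real set \<Rightarrow> (real \<Rightarrow> real^'n) \<Rightarrow> real \<Rightarrow> real^'n" where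
  "weak_deriv I q = (SOME p. has_weak_deriv I q p)"

definition W1_Phi :: "(real \<Rightarrow> real) \<Rightarrow> real set \<Rightarrow> (real \<Rightarrow> real^'n) \<Rightarrow> bool" where
  "W1_Phi \<phi> I q \<longleftrightarrow> L_Phi \<phi> I q \<and> (\<exists>p. has_weak_deriv I q p \<and> L_Phi \<phi> I p)"

text \<open>The continuity clause selects the continuous representative.\<close>

definition W1_Phi_loc :: "(real \<Rightarrow> real) \<Rightarrow> (real \<Rightarrow> real^'n) \<Rightarrow> bool" where
  "W1_Phi_loc \<phi> q \<longleftrightarrow> continuous_on UNIV q \<and> (\<forall>a b. a < b \<longrightarrow> W1_Phi \<phi> {a..b} q)"

definition L_infinity :: "real set \<Rightarrow> (real \<Rightarrow> real^'n) \<Rightarrow> bool" where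
  "L_infinity I q \<longleftrightarrow> set_borel_measurable lebesgue I q \<and>
     (\<exists>M. AE t in lebesgue. t \<in> I \<longrightarrow> norm (q t) \<le> M)"

text \<open>The functional takes values in \<open>[0, \<infinity>]\<close>. It is only evaluated at functions with
  \<open>V (q t) \<ge> c\<close> on \<open>I\<close>, so that the integrand is nonnegative and nothing is truncated by
  \<open>ennreal\<close>.\<close>

definition action ::
  "(real \<Rightarrow> real) \<Rightarrow> (real^'n \<Rightarrow> real) \<Rightarrow> real \<Rightarrow> real set \<Rightarrow> (real \<Rightarrow> real^'n) \<Rightarrow> ennreal" where
  "action \<phi> V c I q =
     (\<integral>\<^sup>+t\<in>I. ennreal (Phi \<phi> (norm (weak_deriv I q t)) + V (q t) - c) \<partial>lebesgue)"

definition Gamma_class ::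
  "(real \<Rightarrow> real) \<Rightarrow> (real^'n \<Rightarrow> real) \<Rightarrow> real \<Rightarrow> (real^'n) set \<Rightarrow> (real^'n) set
     \<Rightarrow> (real \<Rightarrow> real^'n) set" where
  "Gamma_class \<phi> V c A B =
     {q. W1_Phi_loc \<phi> q \<and> (\<forall>t. V (q t) \<ge> c) \<and>
         Liminf at_bot (\<lambda>t. ereal (infdist (q t) A)) = 0 \<and>
         Liminf at_top (\<lambda>t. ereal (infdist (q t) B)) = 0}"

definition min_action ::
  "(real \<Rightarrow> real) \<Rightarrow> (real^'n \<Rightarrow> real) \<Rightarrow> real \<Rightarrow> (real^'n) set \<Rightarrow> (real^'n) set \<Rightarrow> ennreal" where
  "min_action \<phi> V c A B = (INF q\<in>Gamma_class \<phi> V c A B. action \<phi> V c UNIV q)"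

definition C1_on_closure :: "real set \<Rightarrow> (real \<Rightarrow> real^'n) \<Rightarrow> bool" where
  "C1_on_closure I q \<longleftrightarrow>
     (\<exists>D. (\<forall>t\<in>closure I. (q has_vector_derivative D t) (at t within closure I)) \<and>
          continuous_on (closure I) D)"

definition C2_on_open :: "real set \<Rightarrow> (real \<Rightarrow> real^'n) \<Rightarrow> bool" where
  "C2_on_open I q \<longleftrightarrow> q C1_differentiable_on I \<and>
     (\<lambda>t. vector_derivative q (at t)) C1_differentiable_on I"

text \<open>The end points \<open>\<alpha>\<close> and \<open>\<omega>\<close> are extended reals, and the limits at the end points are
  taken in \<open>ereal\<close>, which treats finite and infinite end points uniformly. Only the values of
  \<open>q\<close> on the closure of \<open>(\<alpha>, \<omega>)\<close> matter.\<close>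

definition limit_dist_left :: "ereal \<Rightarrow> (real \<Rightarrow> real^'n) \<Rightarrow> (real^'n) set \<Rightarrow> bool" where
  "limit_dist_left \<alpha> q A \<longleftrightarrow> ((\<lambda>t. infdist (q (real_of_ereal t)) A) \<longlongrightarrow> 0) (at_right \<alpha>)"

definition limit_dist_right :: "ereal \<Rightarrow> (real \<Rightarrow> real^'n) \<Rightarrow> (real^'n) set \<Rightarrow> bool" where
  "limit_dist_right \<omega> q B \<longleftrightarrow> ((\<lambda>t. infdist (q (real_of_ereal t)) B) \<longlongrightarrow> 0) (at_left \<omega>)"

definition minimal_connection ::
  "(real \<Rightarrow> real) \<Rightarrow> (real^'n \<Rightarrow> real) \<Rightarrow> real \<Rightarrow> (real^'n) set \<Rightarrow> (real^'n) set
     \<Rightarrow> ereal \<Rightarrow> ereal \<Rightarrow> (real \<Rightarrow> real^'n) \<Rightarrow> bool" where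
  "minimal_connection \<phi> V c A B \<alpha> \<omega> q \<longleftrightarrow>
     (let I = einterval \<alpha> \<omega>; q' = (\<lambda>t. vector_derivative q (at t)) in
       \<alpha> < \<omega> \<and> L_infinity I q \<and>
       C1_on_closure I q \<and> C2_on_open I q \<and>
       (\<forall>t\<in>I. ((\<lambda>s. \<phi> (norm (q' s)) *\<^sub>R q' s) has_vector_derivative grad V (q t)) (at t)) \<and>
       (\<forall>t\<in>I. V (q t) > c \<and> Gfun \<phi> (norm (q' t)) - V (q t) = - c) \<and>
       limit_dist_left \<alpha> q A \<and> limit_dist_right \<omega> q B \<and>
       action \<phi> V c I q = min_action \<phi> V c A B)"

end

theory Submission
  imports Defs "HOL-Complex_Analysis.Great_Picard"
begin

text \<open>The action is discretized: with \<open>W x = max (V x - c) 0\<close>, a path \<open>x 0, \<dots>, x n\<close> of mesh \<open>h\<close> costs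
  \<open>\<Sum>i<n. h * (\<Phi> (norm (x (Suc i) - x i) / h) + W (x i))\<close>. By compactness modulo the subgroup \<open>Z\<close> a
  cheapest discrete path exists among those that start in \<open>A\<close>, the sublevel cells around \<open>Z\<close>, and end
  in \<open>B\<close>, the remaining cells. Where \<open>V > c\<close> it satisfies a discrete Euler-Lagrange equation, which
  makes its momenta uniformly Lipschitz. As the mesh tends to 0 and the number of steps times the mesh
  tends to infinity, a subsequence therefore converges to a curve that solves the Euler-Lagrange
  equation classically; no regularity theory for minimizers is needed. Sampling a Sobolev competitor
  and applying Jensen's inequality bounds its action below by the limit \<open>L\<close> of the discrete minima,
  while the action of the limit curve is at most \<open>L\<close>. The energy of the curve is constant and vanishes
  because otherwise a slower parametrization would be cheaper.

  Time zero is chosen as the last time at which the discrete path is near \<open>Z\<close>, and space is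
  translated by \<open>Z\<close> to keep that point bounded. Hence the limit curve leaves \<open>A\<close> for good, and since it
  cannot move slowly between different cells, it tends to a single cell at each end. Adjoining to \<open>Z\<close>
  the lattice point of the cell that is reached and iterating produces the vectors \<open>\<xi>\<^sup>j\<close>; an increasing
  chain of subgroups of the lattice is finite.\<close>

section \<open>The integrand and its convex conjugate\<close>

text \<open>Three failures of compactness shape the argument. Speeds are controlled only through the
  superlinear growth of \<open>\<Phi>\<close>, which \<open>1 < l\<close> supplies; it makes paths
  of bounded cost equicontinuous. Translations in space are harmless because \<open>Z\<close> is a
  subgroup, so both end sets are invariant under it. Time is the serious obstacle: points with
  \<open>V \<le> c\<close> can be occupied at no cost, so a minimal path may wait arbitrarily long,
  and a badly placed time origin would give a constant limit. At the last visit near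
  \<open>Z\<close> the limit curve has distance at least 1/2 from the whole lattice, where
  \<open>V > c\<close> because \<open>c < cstar V\<close>; this gives it a nondegenerate interval to
  live on. Free waiting also helps: it lets paths of different durations be compared. Truncating to
  \<open>W\<close> frees competitors from the constraint \<open>V \<ge> c\<close>, and the
  Euler-Lagrange equation is used only where \<open>W = V - c\<close> is differentiable. Velocities
  are recovered from momenta through a continuous inverse, which tolerates degeneracy at speed zero;
  second derivatives exist because zero energy keeps the speed positive where
  \<open>V > c\<close>.\<close>

lemma GDERIV_of_subgradient:
  fixes F :: "'a::real_inner \<Rightarrow> 'a"
  assumes sub: "\<And>v w. f w - f v \<ge> inner (F v) (w - v)"
    and cont: "continuous (at v) F"
  shows "GDERIV f v :> F v"
proof -
  have "(f has_derivative (\<lambda>h. inner h (F v))) (at v)"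
  proof (rule has_derivativeI)
    show "bounded_linear (\<lambda>h. inner h (F v))" by (rule bounded_linear_inner_left)
    have "((\<lambda>w. F w - F v) \<longlongrightarrow> 0) (at v)"
      using cont by (simp add: continuous_within LIM_zero)
    then have *: "((\<lambda>w. norm (F w - F v)) \<longlongrightarrow> 0) (at v)"
      by (rule tendsto_norm_zero)
    show "((\<lambda>w. (f w - f v - inner (w - v) (F v)) /\<^sub>R norm (w - v)) \<longlongrightarrow> 0) (at v)"
    proof (rule Lim_null_comparison[OF _ *], rule eventuallyI)
      fix w
      have a: "f w - f v - inner (w - v) (F v) \<ge> 0"
        using sub[of v w] by (simp add: inner_commute)
      \<comment> \<open>The tangent inequality at \<open>w\<close> complements the one at
        \<open>v\<close>: the remainder is squeezed between 0 and
        \<open>inner (F w - F v) (w - v)\<close>, and continuity of \<open>F\<close> makes the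
        latter small relative to \<open>norm (w - v)\<close>.\<close>
      have "f w - f v \<le> inner (F w) (w - v)"
        using sub[of w v] by (simp add: inner_diff_right)
      then have "f w - f v - inner (w - v) (F v) \<le> inner (F w - F v) (w - v)"
        unfolding inner_diff_left[of "F w"] inner_commute[of "w - v" "F v"] by linarith
      also have "\<dots> \<le> norm (F w - F v) * norm (w - v)" by (rule norm_cauchy_schwarz)
      finally show "norm ((f w - f v - inner (w - v) (F v)) /\<^sub>R norm (w - v)) \<le> norm (F w - F v)"
        using a by (cases "w = v") (auto simp: field_simps)
    qed
  qed
  then show ?thesis by (simp add: gderiv_def)
qed

text \<open>With \<open>P s = \<phi> s * s\<close>, the quotient in \<open>dP_low\<close> is the
  logarithmic derivative \<open>s * P' s / P s\<close>; all growth estimates come from this lower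
  bound.\<close>

locale young =
  fixes \<phi> :: "real \<Rightarrow> real" and l :: real
  assumes l_gt: "1 < l"
    and phi_C1: "\<phi> C1_differentiable_on {0<..}"
    and phi_pos: "\<And>s. s > 0 \<Longrightarrow> \<phi> s > 0"
    and dP_pos: "\<And>s. s > 0 \<Longrightarrow> deriv (\<lambda>r. \<phi> r * r) s > 0"
    and dP_low: "\<And>s. s > 0 \<Longrightarrow> l - 1 \<le> deriv (\<lambda>r. \<phi> r * r) s / \<phi> s"
begin

definition P :: "real \<Rightarrow> real" where "P s = \<phi> s * s"

text \<open>The momentum belonging to the velocity \<open>v\<close>, that is, the gradient of
  \<open>\<lambda>v. \<Phi> (norm v)\<close>.\<close>

definition Pv :: "'a::real_inner \<Rightarrow> 'a" where "Pv v = \<phi> (norm v) *\<^sub>R v"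

abbreviation "\<Phi> \<equiv> Phi \<phi>"

abbreviation "G \<equiv> Gfun \<phi>"

lemma P_0 [simp]: "P 0 = 0" by (simp add: P_def)

lemma P_pos: "s > 0 \<Longrightarrow> P s > 0" by (simp add: P_def phi_pos)

lemma P_nonneg: "s \<ge> 0 \<Longrightarrow> P s \<ge> 0" using P_pos[of s] by (cases "s = 0") auto

lemma deriv_P:
  obtains D where "continuous_on {0<..} D" "\<And>s. s > 0 \<Longrightarrow> (P has_real_derivative D s) (at s)"
    "\<And>s. s > 0 \<Longrightarrow> D s > 0" "\<And>s. s > 0 \<Longrightarrow> (l - 1) * \<phi> s \<le> D s"
proof -
  obtain d where d: "\<And>s. s > 0 \<Longrightarrow> (\<phi> has_vector_derivative d s) (at s)" "continuous_on {0<..} d"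
    using phi_C1 unfolding C1_differentiable_on_def by auto
  let ?D = "\<lambda>s. d s * s + \<phi> s"
  have der: "(P has_real_derivative ?D s) (at s)" if "s > 0" for s
  proof -
    have "(\<phi> has_real_derivative d s) (at s)"
      using d(1)[OF that] by (simp add: has_real_derivative_iff_has_vector_derivative)
    then show ?thesis unfolding P_def[abs_def] by (auto intro!: derivative_eq_intros)
  qed
  have "continuous_on {0<..} \<phi>"
    using d(1) by (auto intro!: continuous_at_imp_continuous_on has_vector_derivative_continuous)
  then have "continuous_on {0<..} ?D" using d(2) by (intro continuous_intros)
  moreover have "deriv (\<lambda>r. \<phi> r * r) s = ?D s" if "s > 0" for s
    using DERIV_imp_deriv[OF der[OF that]] by (simp add: P_def[abs_def])
  ultimately show ?thesis
    using that[of ?D] der dP_pos dP_low phi_pos by (auto simp: pos_le_divide_eq)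
qed

lemma P_strict_mono: assumes "0 \<le> a" "a < b" shows "P a < P b"
proof (cases "a = 0")
  case False
  obtain D where D: "\<And>s. s > 0 \<Longrightarrow> (P has_real_derivative D s) (at s)" "\<And>s. s > 0 \<Longrightarrow> D s > 0"
    using deriv_P by metis
  show ?thesis
  proof (rule DERIV_pos_imp_increasing[OF \<open>a < b\<close>])
    fix x assume "a \<le> x"
    then have "x > 0" using False assms by simp
    then show "\<exists>y. (P has_real_derivative y) (at x) \<and> y > 0" using D by blast
  qed
qed (use P_pos assms in auto)

lemma P_mono: "0 \<le> a \<Longrightarrow> a \<le> b \<Longrightarrow> P a \<le> P b"
  using P_strict_mono[of a b] by (cases "a = b") auto

text \<open>The derivative is \<open>x powr (1 - l) * (P' x - (l - 1) * \<phi> x)\<close>,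
  nonnegative by the lower bound. Comparison with the value at 1 yields both divergence at infinity
  and decay at zero.\<close>

lemma P_powr_mono:
  assumes "0 < a" "a \<le> b" shows "a powr (1 - l) * P a \<le> b powr (1 - l) * P b"
proof -
  obtain D where D: "\<And>s. s > 0 \<Longrightarrow> (P has_real_derivative D s) (at s)"
    "\<And>s. s > 0 \<Longrightarrow> (l - 1) * \<phi> s \<le> D s"
    using deriv_P by metis
  show ?thesis
  proof (rule DERIV_nonneg_imp_nondecreasing[OF \<open>a \<le> b\<close>])
    fix x assume x: "a \<le> x" "x \<le> b"
    then have x0: "x > 0" using assms by simp
    have "((\<lambda>s. s powr (1 - l) * P s) has_real_derivative
        (1 - l) * x powr (1 - l - 1) * P x + x powr (1 - l) * D x) (at x)"
      using x0 D(1)[OF x0] by (auto intro!: derivative_eq_intros)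
    moreover have "x powr (1 - l - 1) * x = x powr (1 - l)" using x0 by (simp add: powr_diff powr_minus divide_inverse)
    then have "(1 - l) * x powr (1 - l - 1) * P x = (1 - l) * \<phi> x * x powr (1 - l)"
      by (simp add: P_def mult.assoc mult.left_commute[of _ "\<phi> x"])
    then have "(1 - l) * x powr (1 - l - 1) * P x + x powr (1 - l) * D x =
        x powr (1 - l) * (D x - (l - 1) * \<phi> x)"
      by (simp add: algebra_simps)
    moreover have "x powr (1 - l) * (D x - (l - 1) * \<phi> x) \<ge> 0"
      using D(2)[OF x0] by simp
    ultimately show "\<exists>y. ((\<lambda>s. s powr (1 - l) * P s) has_real_derivative y) (at x) \<and> y \<ge> 0"
      by metis
  qed
qed

lemma P_unbounded: "\<exists>s>0. K \<le> P s"
proof -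
  define M where "M = max 1 (K / P 1)"
  \<comment> \<open>Chosen so that \<open>s powr (l - 1) = M\<close>, whence
    \<open>P s \<ge> M * P 1\<close>; the 1 in \<open>M\<close> ensures
    \<open>s \<ge> 1\<close>.\<close>
  define s where "s = M powr (1 / (l - 1))"
  have "s powr (l - 1) = M" using l_gt by (simp add: s_def powr_powr M_def)
  then have s: "K \<le> s powr (l - 1) * P 1" "s \<ge> 1"
    using P_pos[of 1] l_gt by (auto simp: M_def s_def pos_divide_le_eq[symmetric] ge_one_powr_ge_zero)
  have "P 1 \<le> s powr (1 - l) * P s" using P_powr_mono[of 1 s] s by simp
  then have "s powr (l - 1) * P 1 \<le> s powr (l - 1) * (s powr (1 - l) * P s)"
    by (intro mult_left_mono) auto
  also have "\<dots> = P s" using s by (simp add: powr_add[symmetric] mult.assoc[symmetric])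
  finally show ?thesis using s by (intro exI[of _ s]) auto
qed

text \<open>Differentiability covers \<open>s > 0\<close>. At 0 the growth comparison takes over:
  \<open>P s \<le> s powr (l - 1) * P 1\<close> for small \<open>s\<close>, with a positive
  exponent.\<close>

lemma P_continuous: "continuous_on {0..} P"
proof -
  obtain D where D: "\<And>s. s > 0 \<Longrightarrow> (P has_real_derivative D s) (at s)" using deriv_P by metis
  have "continuous (at s within {0..}) P" if "s \<ge> 0" for s
  proof (cases "s = 0")
    case False
    then have "isCont P s" using D[of s] that DERIV_isCont by force
    then show ?thesis by (rule continuous_at_imp_continuous_at_within)
  next
    case True
    have "((\<lambda>s. s powr (l - 1) * P 1) \<longlongrightarrow> 0 powr (l - 1) * P 1) (at 0 within {0..})"
      using l_gt by (intro tendsto_mult tendsto_powr' tendsto_const tendsto_ident_at)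
        (auto simp: eventually_at_filter)
    then have lim: "((\<lambda>s. s powr (l - 1) * P 1) \<longlongrightarrow> 0) (at 0 within {0..})" by simp
    have "\<forall>\<^sub>F s in at 0 within {0..}. norm (P s) \<le> s powr (l - 1) * P 1"
      unfolding eventually_at
    proof (intro exI[of _ 1] conjI ballI impI)
      fix s :: real assume "s \<in> {0..}" "s \<noteq> 0 \<and> dist s 0 < 1"
      then have s: "0 < s" "s \<le> 1" by (auto simp: dist_real_def)
      have "s powr (1 - l) * P s \<le> P 1" using P_powr_mono[of s 1] s by simp
      then have "s powr (l - 1) * (s powr (1 - l) * P s) \<le> s powr (l - 1) * P 1"
        by (intro mult_left_mono) auto
      moreover have "s powr (l - 1) * (s powr (1 - l) * P s) = P s"
        using s by (simp add: powr_add[symmetric] mult.assoc[symmetric])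
      ultimately show "norm (P s) \<le> s powr (l - 1) * P 1" using P_pos[of s] s by simp
    qed simp
    then have "(P \<longlongrightarrow> 0) (at 0 within {0..})"
      using lim by (rule Lim_null_comparison)
    then show ?thesis using True by (simp add: continuous_within)
  qed
  then show ?thesis by (simp add: continuous_on_eq_continuous_within)
qed

lemma P_surj: assumes "r \<ge> 0" shows "\<exists>s\<ge>0. P s = r"
proof -
  obtain b where b: "b > 0" "r \<le> P b" using P_unbounded by metis
  have "\<exists>x. 0 \<le> x \<and> x \<le> b \<and> P x = r"
    by (rule IVT') (use b assms continuous_on_subset[OF P_continuous] in auto)
  then show ?thesis by auto
qed

lemma P_inj: "0 \<le> a \<Longrightarrow> 0 \<le> b \<Longrightarrow> P a = P b \<Longrightarrow> a = b"
  using P_strict_mono[of a b] P_strict_mono[of b a] by linarith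

definition Pinv :: "real \<Rightarrow> real" where "Pinv = inv_into {0..} P"

lemma Pinv_nonneg: "r \<ge> 0 \<Longrightarrow> Pinv r \<ge> 0" and P_Pinv: "r \<ge> 0 \<Longrightarrow> P (Pinv r) = r"
proof -
  assume "r \<ge> 0"
  then have "r \<in> P ` {0..}" using P_surj[of r] by auto
  then show "Pinv r \<ge> 0" "P (Pinv r) = r"
    using inv_into_into[of r P "{0..}"] f_inv_into_f[of r P "{0..}"] by (auto simp: Pinv_def)
qed

lemma Pinv_P: "s \<ge> 0 \<Longrightarrow> Pinv (P s) = s"
  using P_Pinv[of "P s"] Pinv_nonneg[of "P s"] P_nonneg[of s] P_inj by metis

lemma Pinv_0 [simp]: "Pinv 0 = 0" using Pinv_P[of 0] by simp

lemma Pinv_pos: "r > 0 \<Longrightarrow> Pinv r > 0"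
  using Pinv_nonneg[of r] P_Pinv[of r] by (cases "Pinv r = 0") auto

lemma Pinv_mono: assumes "0 \<le> a" "a \<le> b" shows "Pinv a \<le> Pinv b"
proof (rule ccontr)
  assume "\<not> ?thesis"
  then have "P (Pinv b) < P (Pinv a)" using assms by (intro P_strict_mono Pinv_nonneg) auto
  then show False using assms by (simp add: P_Pinv)
qed

text \<open>Continuity of an inverse is automatic on a compact interval; \<open>{0..b}\<close> is
  mapped onto \<open>{0..r + 1}\<close>, a neighbourhood of \<open>r\<close> in
  \<open>{0..}\<close>.\<close>

lemma Pinv_continuous: "continuous_on {0..} Pinv"
proof -
  have "continuous (at r within {0..}) Pinv" if r: "r \<ge> 0" for r
  proof -
    define b where "b = Pinv (r + 1)"
    have b: "b \<ge> 0" "P b = r + 1" using r by (auto simp: b_def Pinv_nonneg P_Pinv)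
    have im: "P ` {0..b} = {0..r + 1}"
    proof (intro equalityI subsetI)
      fix y assume "y \<in> P ` {0..b}"
      then show "y \<in> {0..r + 1}" using b P_nonneg P_mono by (force simp: b(2)[symmetric])
    next
      fix y assume y: "y \<in> {0..r + 1}"
      then have "Pinv y \<in> {0..b}" using Pinv_nonneg[of y] Pinv_mono[of y "r + 1"] by (simp add: b_def)
      then show "y \<in> P ` {0..b}" using P_Pinv[of y] y by (force intro: image_eqI[of _ _ "Pinv y"])
    qed
    have "continuous_on (P ` {0..b}) Pinv"
      by (rule continuous_on_inv) (auto simp: Pinv_P intro: continuous_on_subset[OF P_continuous])
    then have "continuous (at r within {0..r + 1}) Pinv"
      using r by (simp add: im continuous_on_eq_continuous_within)
    moreover have "at r within {0..r + 1} = at r within {0..}"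
      by (rule at_within_nhd[of _ "{..<r + 1}"]) auto
    ultimately show ?thesis by (simp add: continuous_within)
  qed
  then show ?thesis by (simp add: continuous_on_eq_continuous_within)
qed

text \<open>Zero is left out because the derivative of \<open>P\<close> may degenerate there. The
  lemma will be applied to momenta of positive norm only.\<close>

lemma deriv_Pinv:
  obtains E where "continuous_on {0<..} E" "\<And>r. r > 0 \<Longrightarrow> (Pinv has_real_derivative E r) (at r)"
proof -
  obtain D where D: "continuous_on {0<..} D" "\<And>s. s > 0 \<Longrightarrow> (P has_real_derivative D s) (at s)"
    "\<And>s. s > 0 \<Longrightarrow> D s > 0"
    using deriv_P by metis
  have ci: "continuous_on {0<..} Pinv" by (rule continuous_on_subset[OF Pinv_continuous]) auto
  have "continuous_on {0<..} (\<lambda>r. D (Pinv r))"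
    by (rule continuous_on_compose2[OF D(1) ci]) (auto simp: Pinv_pos)
  then have "continuous_on {0<..} (\<lambda>r. inverse (D (Pinv r)))"
    by (rule continuous_on_inverse) (use D(3) Pinv_pos in force)
  moreover have "(Pinv has_real_derivative inverse (D (Pinv r))) (at r)" if r: "r > 0" for r
  proof (rule DERIV_inverse_function[of P, where a = 0 and b = "r + 1"])
    show "(P has_real_derivative D (Pinv r)) (at (Pinv r))" using D(2) Pinv_pos r by blast
    show "D (Pinv r) \<noteq> 0" using D(3)[OF Pinv_pos[OF r]] by simp
    show "isCont Pinv r"
      using ci r by (simp add: continuous_on_eq_continuous_at)
  qed (use r P_Pinv in auto)
  ultimately show ?thesis using that by blast
qed

section \<open>Convexity and growth of \<Phi>\<close>

lemma Phi_eq: "s \<ge> 0 \<Longrightarrow> \<Phi> s = integral {0..s} P"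
  by (simp add: Phi_def P_def[abs_def])

lemma P_integrable: "0 \<le> a \<Longrightarrow> P integrable_on {a..b}"
  by (rule integrable_continuous_real) (auto intro: continuous_on_subset[OF P_continuous])

lemma Phi_diff: assumes "0 \<le> a" "a \<le> b" shows "\<Phi> b - \<Phi> a = integral {a..b} P"
  using Henstock_Kurzweil_Integration.integral_combine[OF assms P_integrable[of 0 b]] assms
  by (simp add: Phi_eq)

text \<open>Convexity: \<open>P\<close> is monotone, so its integral compares with the rectangle of
  height \<open>P a\<close>; for \<open>b < a\<close> both the orientation and the comparison
  flip.\<close>

lemma Phi_tangent: assumes "0 \<le> a" "0 \<le> b" shows "\<Phi> b - \<Phi> a \<ge> P a * (b - a)"
proof (cases "a \<le> b")
  case True
  have "integral {a..b} (\<lambda>_. P a) \<le> integral {a..b} P"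
    by (rule integral_le) (use assms P_integrable P_mono in auto)
  then show ?thesis using Phi_diff[OF assms(1) True] True by (simp add: mult.commute)
next
  case False
  have "integral {b..a} P \<le> integral {b..a} (\<lambda>_. P a)"
    by (rule integral_le) (use assms P_integrable P_mono in auto)
  then show ?thesis using Phi_diff[OF assms(2), of a] False by (simp add: algebra_simps)
qed

lemma Phi_0 [simp]: "\<Phi> 0 = 0" by (simp add: Phi_def)

lemma Phi_nonneg: "\<Phi> s \<ge> 0"
  using Phi_tangent[of 0 "\<bar>s\<bar>"] by (simp add: Phi_def)

lemma Phi_mono: "0 \<le> a \<Longrightarrow> a \<le> b \<Longrightarrow> \<Phi> a \<le> \<Phi> b"
  using Phi_tangent[of a b] P_nonneg[of a] mult_nonneg_nonneg[of "P a" "b - a"] by linarith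

text \<open>A tangent of slope at least \<open>K\<close> lies below \<open>\<Phi>\<close>; its
  contact point \<open>a\<close> gives \<open>C = P a * a\<close>. This is the source of
  equicontinuity for paths of bounded cost.\<close>

lemma Phi_superlinear: "\<exists>C\<ge>0. \<forall>s\<ge>0. K * s \<le> \<Phi> s + C"
proof -
  obtain a where a: "a > 0" "K \<le> P a" using P_unbounded by blast
  have "K * s \<le> \<Phi> s + P a * a" if "s \<ge> 0" for s
    using Phi_tangent[of a s] a that Phi_nonneg[of a] mult_right_mono[OF a(2) that]
    by (simp add: algebra_simps)
  then show ?thesis using a P_pos[of a] by (intro exI[of _ "P a * a"]) auto
qed

lemma Pv_0 [simp]: "Pv 0 = 0" by (simp add: Pv_def)

lemma norm_Pv: "norm (Pv v) = P (norm v)"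
  using phi_pos[of "norm v"] by (cases "v = 0") (auto simp: Pv_def P_def)

lemma inner_Pv: "inner (Pv v) v = P (norm v) * norm v"
  by (simp add: Pv_def P_def power2_norm_eq_inner[symmetric] power2_eq_square)

text \<open>Cauchy-Schwarz reduces the vector inequality to the scalar tangent inequality at the
  norms.\<close>

lemma Phi_tangent_norm: "\<Phi> (norm w) - \<Phi> (norm v) \<ge> inner (Pv v) (w - v)"
proof -
  have "inner (Pv v) (w - v) = inner (Pv v) w - P (norm v) * norm v"
    by (simp add: inner_diff_right inner_Pv)
  also have "\<dots> \<le> P (norm v) * norm w - P (norm v) * norm v"
    using norm_cauchy_schwarz[of "Pv v" w] by (simp add: norm_Pv)
  also have "\<dots> \<le> \<Phi> (norm w) - \<Phi> (norm v)"
    using Phi_tangent[of "norm v" "norm w"] by (simp add: algebra_simps)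
  finally show ?thesis .
qed

text \<open>Radial maps \<open>x \<mapsto> f \<bar>x\<bar> \<cdot> x / \<bar>x\<bar>\<close>; both \<open>Pv\<close> and its inverse are of this form.\<close>

lemma continuous_on_radial:
  fixes f :: "real \<Rightarrow> real"
  assumes "continuous_on {0..} f" "f 0 = 0"
  shows "continuous_on UNIV (\<lambda>x::'a::real_inner. (f (norm x) / norm x) *\<^sub>R x)"
proof -
  let ?g = "\<lambda>x::'a. (f (norm x) / norm x) *\<^sub>R x"
  have fn: "continuous_on UNIV (\<lambda>x::'a. f (norm x))"
    by (rule continuous_on_compose2[OF assms(1)]) (auto intro!: continuous_intros)
  have "isCont ?g x" for x
  proof (cases "x = 0")
    case True
    \<comment> \<open>At the origin the factor \<open>f (norm x) / norm x\<close> may blow up, but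
      the norm of the product is \<open>\<bar>f (norm x)\<bar>\<close>, which tends to
      \<open>f 0 = 0\<close>.\<close>
    have "isCont (\<lambda>x::'a. f (norm x)) 0" using fn by (simp add: continuous_on_eq_continuous_at)
    then have "((\<lambda>x::'a. f (norm x)) \<longlongrightarrow> 0) (at 0)" using assms(2) by (simp add: isCont_def)
    then have "((\<lambda>x. norm (?g x)) \<longlongrightarrow> 0) (at 0)"
      by (rule Lim_transform_eventually[OF tendsto_rabs_zero]) (auto simp: eventually_at_filter)
    then have "(?g \<longlongrightarrow> 0) (at 0)" by (simp only: tendsto_norm_zero_iff)
    then show ?thesis using True by (simp add: continuous_within)
  next
    case False
    have "isCont (\<lambda>x::'a. f (norm x)) x" using fn by (simp add: continuous_on_eq_continuous_at)
    then show ?thesis using False by (intro continuous_intros) auto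
  qed
  then show ?thesis by (simp add: continuous_at_imp_continuous_on)
qed

lemma Pv_radial: "Pv v = (P (norm v) / norm v) *\<^sub>R v"
  by (cases "v = 0") (auto simp: Pv_def P_def)

lemma Pv_continuous: "continuous_on UNIV (Pv :: 'a::real_inner \<Rightarrow> 'a)"
  using continuous_on_radial[OF P_continuous] by (simp add: Pv_radial[abs_def])

text \<open>The inverse of the momentum map: velocity as a function of momentum. It is also the
  gradient of the conjugate \<open>H\<close>.\<close>

definition Psi :: "'a::real_inner \<Rightarrow> 'a" where "Psi p = (Pinv (norm p) / norm p) *\<^sub>R p"

lemma Psi_0 [simp]: "Psi 0 = 0" by (simp add: Psi_def)

lemma norm_Psi: "norm (Psi p) = Pinv (norm p)"
  using Pinv_nonneg[of "norm p"] by (cases "p = 0") (auto simp: Psi_def)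

lemma Psi_continuous: "continuous_on UNIV (Psi :: 'a::real_inner \<Rightarrow> 'a)"
  using continuous_on_radial[OF Pinv_continuous] by (simp add: Psi_def[abs_def])

lemma Pv_Psi [simp]: "Pv (Psi p) = p"
proof (cases "p = 0")
  case False
  then have "Pinv (norm p) > 0" by (simp add: Pinv_pos)
  then show ?thesis using False by (simp add: Pv_radial norm_Psi P_Pinv) (simp add: Psi_def)
qed simp

lemma Psi_Pv [simp]: "Psi (Pv v) = v"
proof (cases "v = 0")
  case False
  then have "P (norm v) > 0" by (simp add: P_pos)
  then show ?thesis using False by (simp add: Psi_def norm_Pv Pinv_P) (simp add: Pv_radial)
qed simp

lemma Phi_norm_GDERIV: "GDERIV (\<lambda>v::'a::real_inner. \<Phi> (norm v)) v :> Pv v"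
  by (rule GDERIV_of_subgradient[OF Phi_tangent_norm])
    (use Pv_continuous[where 'a='a] in \<open>simp add: continuous_on_eq_continuous_at\<close>)

lemma Phi_norm_continuous: "continuous_on UNIV (\<lambda>v::'a::real_inner. \<Phi> (norm v))"
  by (intro continuous_at_imp_continuous_on ballI has_derivative_continuous[OF Phi_norm_GDERIV[unfolded gderiv_def]])

lemma Phi_DERIV: assumes "s > 0" shows "(\<Phi> has_real_derivative P s) (at s)"
proof -
  have "Pv s = P s" using assms by (simp add: Pv_def P_def)
  then have "((\<lambda>v::real. \<Phi> (norm v)) has_real_derivative P s) (at s)"
    using Phi_norm_GDERIV[of s] by (simp add: gderiv_def has_field_derivative_def mult_commute_abs)
  then show ?thesis
    by (rule has_field_derivative_transform_within[of _ _ _ _ s]) (use assms in \<open>auto simp: dist_real_def\<close>)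
qed

section \<open>The energy and the conjugate function\<close>

lemma G_eq: "G s = P s * s - \<Phi> s" by (simp add: Gfun_def P_def power2_eq_square)

text \<open>The convex conjugate of \<open>v \<mapsto> \<Phi> (norm v)\<close>: it expresses the energy \<open>G\<close> in terms of the momentum.\<close>

definition H :: "'a::real_inner \<Rightarrow> real" where "H p = inner p (Psi p) - \<Phi> (norm (Psi p))"

lemma H_Pv: "H (Pv v) = G (norm v)" by (simp add: H_def inner_Pv G_eq)

text \<open>The tangent inequality for \<open>\<Phi>\<close> between the velocities
  \<open>Psi w\<close> and \<open>Psi v\<close>, rewritten in momenta, is the tangent inequality for
  \<open>H\<close> with the two points exchanged.\<close>

lemma H_GDERIV: "GDERIV (H :: 'a::real_inner \<Rightarrow> real) p :> Psi p"
proof (rule GDERIV_of_subgradient)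
  show "H w - H v \<ge> inner (Psi v) (w - v)" for v w :: 'a
    using Phi_tangent_norm[of "Psi w" "Psi v"]
    by (simp add: H_def inner_diff_right inner_diff_left inner_commute[of "Psi v"])
  show "isCont (Psi :: 'a \<Rightarrow> 'a) p" using Psi_continuous[where 'a='a] by (simp add: continuous_on_eq_continuous_at)
qed

text \<open>An integrated form of \<open>G' s = s * P' s\<close>, obtained from convexity
  alone.\<close>

lemma G_diff: assumes "0 \<le> a" "0 \<le> b" shows "G b - G a \<ge> a * (P b - P a)"
  using Phi_tangent[of b a] assms by (simp add: G_eq algebra_simps)

lemma G_0 [simp]: "G 0 = 0" by (simp add: G_eq)

lemma G_mono: "0 \<le> a \<Longrightarrow> a \<le> b \<Longrightarrow> G a \<le> G b"
  using G_diff[of a b] P_mono[of a b] mult_nonneg_nonneg[of a "P b - P a"] by linarith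

text \<open>The bound of \<open>G_diff\<close> carries the factor \<open>a\<close>, which is useless
  at 0; hence the comparison with \<open>s / 2\<close>.\<close>

lemma G_pos: assumes "s > 0" shows "G s > 0"
proof -
  have "s / 2 * (P s - P (s / 2)) > 0" using assms P_strict_mono[of "s/2" s] by (intro mult_pos_pos) auto
  then show ?thesis using G_diff[of "s/2" s] G_mono[of 0 "s/2"] assms by simp
qed

lemma G_nonneg: "0 \<le> s \<Longrightarrow> G s \<ge> 0" using G_mono[of 0 s] by simp

lemma G_continuous: "continuous_on {0..} G"
proof -
  have "continuous_on {0..} (\<lambda>s::real. \<Phi> (norm s))"
    by (rule continuous_on_subset[OF Phi_norm_continuous]) auto
  then have "continuous_on {0..} \<Phi>" by (rule continuous_on_eq) auto
  then show ?thesis unfolding G_eq[abs_def] by (intro continuous_intros P_continuous)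
qed

text \<open>Comparison with speed 1 gives \<open>G s \<ge> P s - P 1\<close>, and \<open>P\<close>
  is unbounded.\<close>

lemma G_bounded_imp: "\<exists>b. \<forall>s\<ge>0. G s \<le> K \<longrightarrow> s \<le> b"
proof -
  obtain b where b: "b > 0" "K + P 1 + 1 \<le> P b" using P_unbounded by blast
  have "s \<le> b" if "s \<ge> 0" "G s \<le> K" for s
  proof (rule ccontr)
    assume "\<not> s \<le> b"
    then have "P b \<le> P s" using b by (intro P_mono) auto
    then show False using G_diff[of 1 s] b that G_nonneg[of 1] by simp
  qed
  then show ?thesis by blast
qed

lemma G_small_imp: assumes "e > 0" shows "\<exists>d>0. \<forall>s\<ge>0. G s < d \<longrightarrow> s < e"
  using G_pos[OF assms] G_mono[of e] assms by (intro exI[of _ "G e"]) (meson less_imp_le not_less)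

end

section \<open>Periodic potentials\<close>

lemma int_lattice_0 [simp]: "0 \<in> int_lattice" by (simp add: int_lattice_def)

lemma int_lattice_add: "x \<in> int_lattice \<Longrightarrow> y \<in> int_lattice \<Longrightarrow> x + y \<in> int_lattice"
  by (simp add: int_lattice_def)

lemma int_lattice_minus: "x \<in> int_lattice \<Longrightarrow> - x \<in> int_lattice"
  by (simp add: int_lattice_def)

lemma int_lattice_diff: "x \<in> int_lattice \<Longrightarrow> y \<in> int_lattice \<Longrightarrow> x - y \<in> int_lattice"
  by (simp add: int_lattice_def)

lemma dist_int_lattice:
  assumes "x \<in> int_lattice" "y \<in> int_lattice" "x \<noteq> y" shows "dist x y \<ge> 1"
proof -
  obtain i where i: "x $ i \<noteq> y $ i" using assms(3) by (auto simp: vec_eq_iff)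
  have "x $ i - y $ i \<in> \<int>" using assms by (auto simp: int_lattice_def)
  then have "1 \<le> \<bar>(x - y) $ i\<bar>" using i by (simp add: Ints_nonzero_abs_ge1)
  then show ?thesis using component_le_norm_cart[of "x - y" i] by (simp add: dist_norm)
qed

lemma infdist_int_lattice_attained:
  assumes "S \<subseteq> int_lattice" "S \<noteq> {}"
  obtains \<xi> where "\<xi> \<in> S" "infdist x S = dist x \<xi>"
proof -
  have "closed S"
    by (rule discrete_imp_closed[of 1]) (use assms dist_int_lattice dist_commute in \<open>force+\<close>)
  then show ?thesis using infdist_attains_inf[of S x] assms that by blast
qed

lemma int_lattice_reduce:
  obtains \<xi> :: "real^'n" where "\<xi> \<in> int_lattice" "x - \<xi> \<in> cbox 0 (\<chi> i. 1)"
proof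
  show "(\<chi> i. of_int \<lfloor>x $ i\<rfloor>) \<in> int_lattice" by (simp add: int_lattice_def)
  show "x - (\<chi> i. of_int \<lfloor>x $ i\<rfloor>) \<in> cbox 0 (\<chi> i. 1)"
    by (simp add: mem_box_cart) (metis add.commute diff_le_eq real_of_int_floor_add_one_ge)
qed

text \<open>One point is translated into the unit cube; points within distance 1 of it lie in the
  larger box \<open>?Q\<close>. Compactness gives a modulus on that box, and periodicity spreads it
  over all of space.\<close>

lemma periodic_uniformly_continuous:
  fixes f :: "real^'n \<Rightarrow> real"
  assumes per: "\<And>x \<xi>. \<xi> \<in> int_lattice \<Longrightarrow> f (x + \<xi>) = f x" and cont: "continuous_on UNIV f"
  shows "uniformly_continuous_on UNIV f"
  unfolding uniformly_continuous_on_def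
proof (intro allI impI)
  fix e :: real assume "e > 0"
  let ?Q = "cbox (- (\<chi> i. 1)) (\<chi> i. 2) :: (real^'n) set"
  have "uniformly_continuous_on ?Q f"
    by (intro compact_uniformly_continuous continuous_on_subset[OF cont]) auto
  then obtain d where d: "d > 0" "\<And>x y. x \<in> ?Q \<Longrightarrow> y \<in> ?Q \<Longrightarrow> dist y x < d \<Longrightarrow> dist (f y) (f x) < e"
    using \<open>e > 0\<close> unfolding uniformly_continuous_on_def by meson
  have "dist (f y) (f x) < e" if "dist y x < min d 1" for x y
  proof -
    obtain \<xi> :: "real^'n" where \<xi>: "\<xi> \<in> int_lattice" "x - \<xi> \<in> cbox 0 (\<chi> i. 1)" by (rule int_lattice_reduce)
    have nn: "\<bar>y $ i - x $ i\<bar> < 1" for i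
      using component_le_norm_cart[of "y - x" i] that by (simp add: dist_norm)
    have x: "0 \<le> x $ i - \<xi> $ i \<and> x $ i - \<xi> $ i \<le> 1" for i using \<xi>(2) by (simp add: mem_box_cart)
    have a: "- 1 \<le> x $ i - \<xi> $ i" "x $ i - \<xi> $ i \<le> 2" "- 1 \<le> y $ i - \<xi> $ i" "y $ i - \<xi> $ i \<le> 2" for i
      using nn[of i] x[of i] by linarith+
    have "x - \<xi> \<in> ?Q" "y - \<xi> \<in> ?Q" using a by (simp_all add: mem_box_cart)
    moreover have "dist (y - \<xi>) (x - \<xi>) < d" using that by (simp add: dist_norm)
    ultimately have "dist (f (y - \<xi>)) (f (x - \<xi>)) < e" by (rule d(2))
    then show ?thesis using per[OF \<xi>(1), of "x - \<xi>"] per[OF \<xi>(1), of "y - \<xi>"] by simp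
  qed
  then show "\<exists>d>0. \<forall>x\<in>UNIV. \<forall>x'\<in>UNIV. dist x' x < d \<longrightarrow> dist (f x') (f x) < e"
    using \<open>d > 0\<close> by (intro exI[of _ "min d 1"]) auto
qed

locale periodic_well = young \<phi> l for \<phi> :: "real \<Rightarrow> real" and l :: real +
  fixes V :: "real^'n \<Rightarrow> real" and c \<delta> :: real
  assumes V_C1: "C1_scalar V"
    and V_per: "\<And>x \<xi>. \<xi> \<in> int_lattice \<Longrightarrow> V (x + \<xi>) = V x"
    and V_nonneg: "\<And>x. V x \<ge> 0"
    and V_zero: "\<And>x. V x = 0 \<longleftrightarrow> x \<in> int_lattice"
    and c_nonneg: "0 \<le> c" and c_less: "c < cstar V"
    and delta: "admissible_delta V c \<delta>"
begin

text \<open>\<open>grad\<close> is a definite description, so uniqueness of the gradient has to be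
  shown before its value is available.\<close>

lemma V_GDERIV: "GDERIV V x :> grad V x"
proof -
  obtain D where "GDERIV V x :> D" using V_C1 unfolding C1_scalar_def by blast
  moreover have "D' = D" if "GDERIV V x :> D'" "GDERIV V x :> D" for D' D
  proof -
    have "(\<lambda>h. inner h D') = (\<lambda>h. inner h D)"
      using that has_derivative_unique unfolding gderiv_def by blast
    then have "inner (D' - D) (D' - D) = 0" by (simp add: inner_diff_right fun_eq_iff)
    then show ?thesis by simp
  qed
  ultimately have "grad V x = D" unfolding grad_def by (intro the_equality) blast+
  then show ?thesis using \<open>GDERIV V x :> D\<close> by simp
qed

lemma grad_cont: "continuous_on UNIV (grad V)" using V_C1 unfolding C1_scalar_def by blast

lemma V_has_derivative: "(V has_derivative (\<lambda>h. inner h (grad V x))) (at x)"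
  using V_GDERIV unfolding gderiv_def .

lemma V_cont: "continuous_on UNIV V"
  by (intro continuous_at_imp_continuous_on ballI has_derivative_continuous[OF V_has_derivative])

text \<open>Truncation makes the integrand nonnegative everywhere, so competitors may enter
  \<open>V < c\<close> without a reward. Along curves of \<open>Gamma_class\<close> it changes
  nothing.\<close>

definition W :: "real^'n \<Rightarrow> real" where "W x = max (V x - c) 0"

lemma W_nonneg: "W x \<ge> 0" by (simp add: W_def)

lemma W_eq_0: "W x = 0 \<longleftrightarrow> V x \<le> c" by (simp add: W_def max_def)

lemma W_cont: "continuous_on UNIV W"
  unfolding W_def[abs_def] by (intro continuous_intros V_cont)

lemma W_per: "\<xi> \<in> int_lattice \<Longrightarrow> W (x + \<xi>) = W x" by (simp add: W_def V_per)

lemma W_uniform: "uniformly_continuous_on UNIV W"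
  by (rule periodic_uniformly_continuous[OF W_per W_cont])

lemma periodic_reduce:
  obtains \<xi> where "\<xi> \<in> int_lattice" "x - \<xi> \<in> cbox 0 (\<chi> i. 1)" "V (x - \<xi>) = V x" "W (x - \<xi>) = W x"
proof -
  obtain \<xi> :: "real^'n" where \<xi>: "\<xi> \<in> int_lattice" "x - \<xi> \<in> cbox 0 (\<chi> i. 1)" by (rule int_lattice_reduce)
  then show ?thesis using that V_per[OF \<xi>(1), of "x - \<xi>"] W_per[OF \<xi>(1), of "x - \<xi>"] by simp
qed

lemma W_bounded: "\<exists>K\<ge>0. \<forall>x. W x \<le> K"
proof -
  have "compact (W ` cbox 0 (\<chi> i. 1))"
    by (intro compact_continuous_image continuous_on_subset[OF W_cont]) auto
  then obtain K where K: "\<And>x. x \<in> cbox 0 (\<chi> i. 1) \<Longrightarrow> \<bar>W x\<bar> \<le> K"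
    by (force dest!: compact_imp_bounded simp: bounded_iff)
  have "W x \<le> K" for x
    using periodic_reduce[of x] K by (metis abs_ge_self order_trans)
  then show ?thesis using W_nonneg order_trans by blast
qed

text \<open>Modulo the lattice, the points at distance at least \<open>e\<close> from the sublevel
  set form a compact set on which \<open>W\<close> is positive, hence bounded away from 0.\<close>

lemma W_small: assumes "e > 0" shows "\<exists>\<mu>>0. \<forall>x. W x < \<mu> \<longrightarrow> (\<exists>y. V y \<le> c \<and> dist x y < e)"
proof -
  define S where "S = {x \<in> cbox 0 (\<chi> i. 1). \<forall>y. V y \<le> c \<longrightarrow> dist x y \<ge> e}"
  have S: "S = cbox 0 (\<chi> i. 1) \<inter> (\<Inter>y\<in>{y. V y \<le> c}. {x. dist x y \<ge> e})" by (auto simp: S_def)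
  have "compact S"
    unfolding S by (intro compact_Int_closed closed_INT ballI closed_Collect_le continuous_intros) auto
  have *: "\<exists>\<mu>>0. \<forall>x\<in>S. W x \<ge> \<mu>"
  proof (cases "S = {}")
    case False
    then obtain x where x: "x \<in> S" "\<And>y. y \<in> S \<Longrightarrow> W x \<le> W y"
      using continuous_attains_inf[OF \<open>compact S\<close> False continuous_on_subset[OF W_cont]] by auto
    have "V x > c"
    proof (rule ccontr)
      assume "\<not> ?thesis"
      then have "dist x x \<ge> e" using x(1) unfolding S_def by (metis (lifting) mem_Collect_eq not_less)
      then show False using assms by simp
    qed
    then show ?thesis using x(2) by (intro exI[of _ "W x"]) (auto simp: W_def)
  qed (auto intro: exI[of _ 1])
  then obtain \<mu> where \<mu>: "\<mu> > 0" "\<And>x. x \<in> S \<Longrightarrow> W x \<ge> \<mu>" by blast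
  have "\<exists>y. V y \<le> c \<and> dist x y < e" if "W x < \<mu>" for x
  proof -
    obtain \<xi> where \<xi>: "\<xi> \<in> int_lattice" "x - \<xi> \<in> cbox 0 (\<chi> i. 1)" "W (x - \<xi>) = W x"
      using periodic_reduce by metis
    then have "x - \<xi> \<notin> S" using \<mu>(2)[of "x - \<xi>"] that by auto
    then obtain y where y: "V y \<le> c" "dist (x - \<xi>) y < e" using \<xi>(2) unfolding S_def by force
    then show ?thesis using V_per[OF \<xi>(1), of y]
      by (intro exI[of _ "y + \<xi>"]) (simp add: dist_norm algebra_simps)
  qed
  then show ?thesis using \<open>\<mu> > 0\<close> by blast
qed

lemma delta_bounds: "0 < \<delta>" "\<delta> < 1/2" using delta by (auto simp: admissible_delta_def)

lemma sublevel_near_lattice: assumes "V x \<le> c" shows "\<exists>\<xi>\<in>int_lattice. dist x \<xi> \<le> 1/2 - \<delta>"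
proof -
  obtain \<xi> :: "real^'n" where \<xi>: "\<xi> \<in> int_lattice" "infdist x int_lattice = dist x \<xi>"
    by (rule infdist_int_lattice_attained[of int_lattice x]) (use int_lattice_0 in \<open>blast+\<close>)
  have "\<not> infdist x int_lattice > 1/2 - \<delta>"
  proof
    assume "infdist x int_lattice > 1/2 - \<delta>"
    then have "V x \<ge> c + (cstar V - c) / 2" using delta unfolding admissible_delta_def by blast
    then show False using assms c_less by (simp add: field_simps)
  qed
  then show ?thesis using \<xi> by force
qed

text \<open>The infimum defining \<open>cstar\<close> includes distance exactly 1/2. This matters
  because only non-strict inequalities survive in limits of discrete paths.\<close>

lemma far_from_lattice: assumes "\<And>\<xi>. \<xi> \<in> int_lattice \<Longrightarrow> dist x \<xi> \<ge> 1/2" shows "V x > c"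
proof -
  have "infdist x int_lattice \<ge> 1/2"
    by (metis assms empty_iff infdist_int_lattice_attained int_lattice_0 subset_refl)
  then have "cstar V \<le> V x" unfolding cstar_def
    by (intro cINF_lower) (auto intro!: bdd_belowI2[of _ 0] V_nonneg)
  then show ?thesis using c_less by simp
qed

lemma V_lattice_le: "\<xi> \<in> int_lattice \<Longrightarrow> V \<xi> \<le> c" using V_zero[of \<xi>] c_nonneg by simp

lemma sublevel_at_shift: "\<xi> \<in> int_lattice \<Longrightarrow> x + \<xi> \<in> sublevel_at V c \<delta> (\<eta> + \<xi>) \<longleftrightarrow> x \<in> sublevel_at V c \<delta> \<eta>"
  by (simp add: sublevel_at_def V_per dist_norm)

section \<open>Discrete minimizers\<close>

text \<open>The potential is sampled at the left node only. Thus an interior node of a path occurs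
  in exactly two summands of \<open>cost\<close>, and a step that stays at a point of the sublevel
  set is free.\<close>

definition stepcost :: "real \<Rightarrow> real^'n \<Rightarrow> real^'n \<Rightarrow> real" where
  "stepcost h x y = h * (\<Phi> (norm ((y - x) /\<^sub>R h)) + W x)"

definition cost :: "real \<Rightarrow> (nat \<Rightarrow> real^'n) \<Rightarrow> nat \<Rightarrow> real" where
  "cost h x n = (\<Sum>i<n. stepcost h (x i) (x (Suc i)))"

lemma stepcost_nonneg: "h > 0 \<Longrightarrow> stepcost h x y \<ge> 0"
  by (simp add: stepcost_def Phi_nonneg W_nonneg)

lemma cost_nonneg: "h > 0 \<Longrightarrow> cost h x n \<ge> 0"
  unfolding cost_def by (intro sum_nonneg stepcost_nonneg)

lemma stepcost_superlinear:
  assumes "\<And>s. s \<ge> 0 \<Longrightarrow> K * s \<le> \<Phi> s + C" "h > 0"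
  shows "K * norm (y - x) \<le> stepcost h x y + C * h"
proof -
  have "K * (norm (y - x) / h) \<le> \<Phi> (norm ((y - x) /\<^sub>R h)) + C"
    using assms(1)[of "norm ((y - x) /\<^sub>R h)"] assms(2) by (simp add: divide_inverse_commute)
  then have "h * (K * (norm (y - x) / h)) \<le> h * (\<Phi> (norm ((y - x) /\<^sub>R h)) + C)"
    using assms(2) by (intro mult_left_mono) auto
  moreover have "h * (\<Phi> (norm ((y - x) /\<^sub>R h)) + C) \<le> stepcost h x y + C * h"
    using assms(2) W_nonneg[of x] unfolding stepcost_def by (simp add: algebra_simps)
  ultimately show ?thesis using assms(2) by simp
qed

text \<open>A bound for the Lagrangian at speeds up to 1, so a price per unit of time for travelling
  along a segment. \<open>SOME\<close> merely fixes one such bound to be shared by all later error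
  terms.\<close>

definition speed_const :: real where
  "speed_const = (SOME K. K > 0 \<and> (\<forall>x v. norm v \<le> 1 \<longrightarrow> \<Phi> (norm (v :: real^'n)) + W x \<le> K))"

lemma speed_const: "speed_const > 0" "norm (v :: real^'n) \<le> 1 \<Longrightarrow> \<Phi> (norm v) + W x \<le> speed_const"
proof -
  obtain K where K: "K \<ge> 0" "\<And>x. W x \<le> K" using W_bounded by blast
  have "\<exists>K. K > 0 \<and> (\<forall>x v. norm v \<le> 1 \<longrightarrow> \<Phi> (norm (v :: real^'n)) + W x \<le> K)"
  proof (intro exI[of _ "\<Phi> 1 + K + 1"] conjI allI impI)
    show "\<Phi> 1 + K + 1 > 0" using K Phi_nonneg[of 1] by simp
    show "\<Phi> (norm v) + W x \<le> \<Phi> 1 + K + 1" if "norm v \<le> 1" for x v :: "real^'n"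
      using Phi_mono[of "norm v" 1] that K(2)[of x] by simp
  qed
  from someI_ex[OF this] show "speed_const > 0" "norm v \<le> 1 \<Longrightarrow> \<Phi> (norm v) + W x \<le> speed_const"
    unfolding speed_const_def by blast+
qed

lemma straight_path:
  assumes "h > 0" "dist a b \<le> of_nat k * h"
  obtains z where "z 0 = a" "z k = b" "cost h z k \<le> of_nat k * h * speed_const"
proof (cases "k = 0")
  case True
  then show ?thesis using assms that[of "\<lambda>_. a"] by (simp add: cost_def)
next
  case False
  define z where "z i = a + (of_nat i / of_nat k) *\<^sub>R (b - a)" for i
  have "stepcost h (z i) (z (Suc i)) \<le> h * speed_const" for i
  proof -
    have "z (Suc i) - z i = (1 / of_nat k) *\<^sub>R (b - a)"
      by (simp add: z_def scaleR_left_diff_distrib[symmetric] diff_divide_distrib[symmetric])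
    then have "norm ((z (Suc i) - z i) /\<^sub>R h) = dist a b / (of_nat k * h)"
      using assms(1) by (simp only: norm_scaleR) (simp add: dist_norm norm_minus_commute divide_inverse)
    also have "\<dots> \<le> 1" using assms False by (simp add: divide_le_eq_1)
    finally have "norm ((z (Suc i) - z i) /\<^sub>R h) \<le> 1" .
    then show ?thesis unfolding stepcost_def using assms(1) by (intro mult_left_mono speed_const(2)) auto
  qed
  then have "cost h z k \<le> (\<Sum>i<k. h * speed_const)" unfolding cost_def by (intro sum_mono)
  then show ?thesis using that[of z] False by (simp add: z_def)
qed

lemma concat_paths:
  assumes "y M = z 0"
  obtains w where "w 0 = y 0" "w (M + k) = z k" "cost h w (M + k) = cost h y M + cost h z k"
proof -
  define w where "w i = (if i \<le> M then y i else z (i - M))" for i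
  have wz: "w (M + i) = z i" for i using assms by (cases "i = 0") (auto simp: w_def)
  have "cost h w (M + k) = (\<Sum>i<M. stepcost h (w i) (w (Suc i))) + (\<Sum>i<k. stepcost h (w (M + i)) (w (Suc (M + i))))"
    using sum.shift_bounds_nat_ivl[of "\<lambda>i. stepcost h (w i) (w (Suc i))" 0 M k]
    by (simp add: cost_def lessThan_atLeast0 sum.atLeastLessThan_concat[of 0 M "M + k", symmetric] add.commute)
  also have "(\<Sum>i<M. stepcost h (w i) (w (Suc i))) = cost h y M"
    unfolding cost_def by (rule sum.cong) (auto simp: w_def)
  also have "(\<Sum>i<k. stepcost h (w (M + i)) (w (Suc (M + i)))) = cost h z k"
    unfolding cost_def using wz by (simp flip: add_Suc_right)
  finally have "cost h w (M + k) = cost h y M + cost h z k" .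
  then show ?thesis using wz by (intro that[of w]) (simp_all add: w_def)
qed

end

locale subgroup_step = periodic_well \<phi> l V c \<delta>
  for \<phi> l and V :: "real^'n \<Rightarrow> real" and c \<delta> +
  fixes Z :: "(real^'n) set"
  assumes Z_sub: "Z \<subseteq> int_lattice" and Z_0: "0 \<in> Z"
    and Z_diff: "\<And>x y. x \<in> Z \<Longrightarrow> y \<in> Z \<Longrightarrow> x - y \<in> Z"
    and Z_proper: "Z \<noteq> int_lattice"
begin

abbreviation "A \<equiv> sublevel_part V c \<delta> Z"
abbreviation "B \<equiv> sublevel_part V c \<delta> (int_lattice - Z)"

lemma Z_minus: "x \<in> Z \<Longrightarrow> - x \<in> Z" using Z_diff[OF Z_0, of x] by simp

lemma Z_add: "x \<in> Z \<Longrightarrow> y \<in> Z \<Longrightarrow> x + y \<in> Z" using Z_diff[of x "- y"] Z_minus[of y] by simp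

text \<open>\<open>x + y \<in> Z\<close> would put \<open>x = (x + y) - y\<close> into
  \<open>Z\<close>. Here the subgroup property makes \<open>B\<close>, and not only
  \<open>A\<close>, invariant under translation by \<open>Z\<close>.\<close>

lemma Z_compl_add: "x \<in> int_lattice - Z \<Longrightarrow> y \<in> Z \<Longrightarrow> x + y \<in> int_lattice - Z"
  using Z_diff[of "x + y" y] Z_sub int_lattice_add by auto

lemma mem_A: "x \<in> A \<longleftrightarrow> V x \<le> c \<and> (\<exists>\<xi>\<in>Z. dist x \<xi> \<le> 1/2 - \<delta>)"
  by (auto simp: sublevel_part_def sublevel_at_def dist_commute)

lemma mem_B: "x \<in> B \<longleftrightarrow> V x \<le> c \<and> (\<exists>\<xi>\<in>int_lattice - Z. dist x \<xi> \<le> 1/2 - \<delta>)"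
  by (auto simp: sublevel_part_def sublevel_at_def dist_commute)

lemma A_shift: assumes "\<zeta> \<in> Z" "x \<in> A" shows "x + \<zeta> \<in> A"
proof -
  obtain \<xi> where "\<xi> \<in> Z" "dist x \<xi> \<le> 1/2 - \<delta>" "V x \<le> c" using assms mem_A by auto
  then show ?thesis using V_per[of \<zeta> x] assms Z_sub Z_add
    by (auto simp: mem_A dist_norm intro!: bexI[of _ "\<xi> + \<zeta>"])
qed

lemma B_shift: assumes "\<zeta> \<in> Z" "x \<in> B" shows "x + \<zeta> \<in> B"
proof -
  obtain \<xi> where "\<xi> \<in> int_lattice - Z" "dist x \<xi> \<le> 1/2 - \<delta>" "V x \<le> c" using assms mem_B by auto
  then show ?thesis using V_per[of \<zeta> x] assms Z_sub Z_compl_add[of \<xi> \<zeta>]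
    unfolding mem_B by (intro conjI bexI[of _ "\<xi> + \<zeta>"]) (auto simp: dist_norm)
qed

lemma B_nonempty: "\<exists>\<eta>. \<eta> \<in> int_lattice - Z" using Z_proper Z_sub by blast

text \<open>The union may be infinite. Subsets of the lattice are discrete, so a nearest point is
  attained and the union is cut out by a closed condition on \<open>infdist\<close>.\<close>

lemma closed_part: assumes "S \<subseteq> int_lattice" shows "closed (sublevel_part V c \<delta> S)"
proof (cases "S = {}")
  case False
  have "sublevel_part V c \<delta> S = {x. V x \<le> c} \<inter> {x. infdist x S \<le> 1/2 - \<delta>}" (is "?L = ?R")
  proof (intro equalityI subsetI)
    fix x assume "x \<in> ?L"
    then obtain \<xi> where "\<xi> \<in> S" "dist x \<xi> \<le> 1/2 - \<delta>" "V x \<le> c"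
      by (auto simp: sublevel_part_def sublevel_at_def dist_commute)
    then show "x \<in> ?R" using infdist_le[of \<xi> S x] by auto
  next
    fix x assume x: "x \<in> ?R"
    obtain \<xi> where "\<xi> \<in> S" "infdist x S = dist x \<xi>"
      by (rule infdist_int_lattice_attained[OF assms False])
    then show "x \<in> ?L" using x by (auto simp: sublevel_part_def sublevel_at_def dist_commute)
  qed
  moreover have "closed \<dots>"
    by (intro closed_Int closed_Collect_le continuous_intros V_cont)
  ultimately show ?thesis by simp
qed (simp add: sublevel_part_def)

lemma closed_A: "closed A" and closed_B: "closed B" using closed_part Z_sub by auto

definition minimal :: "real \<Rightarrow> nat \<Rightarrow> (nat \<Rightarrow> real^'n) \<Rightarrow> bool" where
  "minimal h n x \<longleftrightarrow> x 0 \<in> A \<and> x n \<in> B \<and> (\<forall>y. y 0 \<in> A \<longrightarrow> y n \<in> B \<longrightarrow> cost h x n \<le> cost h y n)"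

lemma stepcost_shift: "\<zeta> \<in> int_lattice \<Longrightarrow> stepcost h (x + \<zeta>) (y + \<zeta>) = stepcost h x y"
  by (simp add: stepcost_def W_per)

lemma cost_shift: "\<zeta> \<in> int_lattice \<Longrightarrow> cost h (\<lambda>i. x i + \<zeta>) n = cost h x n"
  by (simp add: cost_def stepcost_shift)

lemma minimal_shift: assumes "\<zeta> \<in> Z" "minimal h n x" shows "minimal h n (\<lambda>i. x i + \<zeta>)"
  using assms A_shift B_shift cost_shift[of \<zeta> h x n] Z_sub unfolding minimal_def by (auto 4 3)

text \<open>Direct method in finitely many variables. Translation by \<open>Z\<close> brings the
  first node near the origin, bounded cost bounds every step, and a subsequence converges at all
  \<open>n + 1\<close> nodes; the cost is continuous and both end sets are closed.\<close>

lemma minimal_exists: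
  assumes "h > 0" "n > 0" shows "\<exists>x. minimal h n x"
proof -
  define T where "T = {x. x 0 \<in> A \<and> x n \<in> B}"
  define I where "I = (INF x\<in>T. cost h x n)"
  obtain \<eta> where \<eta>: "\<eta> \<in> int_lattice - Z" using B_nonempty by blast
  \<comment> \<open>A single jump from the origin to \<open>\<eta>\<close> shows that the admissible
    class is nonempty; \<open>n > 0\<close> separates the two end nodes.\<close>
  have "(\<lambda>i. if i = 0 then 0 else \<eta>) \<in> T"
    using assms \<eta> Z_0 delta_bounds V_lattice_le unfolding T_def mem_A mem_B
    by (auto intro: bexI[of _ "0::real^'n"] bexI[of _ \<eta>])
  then have Tne: "T \<noteq> {}" by blast
  have bdd: "bdd_below ((\<lambda>x. cost h x n) ` T)" by (rule bdd_belowI2[of _ 0]) (simp add: cost_nonneg assms)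
  have I_le: "I \<le> cost h y n" if "y \<in> T" for y unfolding I_def using bdd that by (rule cINF_lower)
  have "\<exists>x\<in>T. dist (x 0) 0 \<le> 1/2 - \<delta> \<and> cost h x n < I + 1 / real (Suc k)" for k
  proof -
    obtain x where x: "x \<in> T" "cost h x n < I + 1 / real (Suc k)"
      using cINF_less_iff[OF Tne bdd, of "I + 1 / real (Suc k)"] by (auto simp: I_def)
    obtain \<xi> where \<xi>: "\<xi> \<in> Z" "dist (x 0) \<xi> \<le> 1/2 - \<delta>" using x by (auto simp: T_def mem_A)
    have "(\<lambda>i. x i + - \<xi>) \<in> T"
      using x A_shift[OF Z_minus[OF \<xi>(1)], of "x 0"] B_shift[OF Z_minus[OF \<xi>(1)], of "x n"] by (simp add: T_def)
    moreover have "cost h (\<lambda>i. x i + - \<xi>) n < I + 1 / real (Suc k)"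
      using x(2) cost_shift[of "- \<xi>" h x n] Z_minus[OF \<xi>(1)] Z_sub by auto
    ultimately show ?thesis using \<xi>(2) by (intro bexI[of _ "\<lambda>i. x i + - \<xi>"]) (auto simp: dist_norm)
  qed
  then obtain X where X: "\<And>k. X k \<in> T" "\<And>k. norm (X k 0) \<le> 1/2 - \<delta>"
    "\<And>k. cost h (X k) n < I + 1 / real (Suc k)" unfolding dist_norm diff_zero by metis
  obtain C where C: "C \<ge> 0" "\<And>s. s \<ge> 0 \<Longrightarrow> 1 * s \<le> \<Phi> s + C" using Phi_superlinear[of 1] by blast
  \<comment> \<open>Each step of the paths \<open>X k\<close> costs less than \<open>I + 1\<close>;
    superlinearity with slope 1 turns this into a bound on its length.\<close>
  define R where "R = I + 1 + C * h"
  have step: "norm (X k (Suc i) - X k i) \<le> R" if "i < n" for k i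
  proof -
    have "stepcost h (X k i) (X k (Suc i)) \<le> cost h (X k) n"
      unfolding cost_def
      using member_le_sum[of i "{..<n}" "\<lambda>j. stepcost h (X k j) (X k (Suc j))"] that assms
      by (simp add: stepcost_nonneg)
    also have "\<dots> < I + 1 / real (Suc k)" by (rule X(3))
    also have "\<dots> \<le> I + 1" by simp
    finally show ?thesis
      using stepcost_superlinear[OF C(2) assms(1), of "X k (Suc i)" "X k i"] by (simp add: R_def)
  qed
  have "norm (X k i) \<le> 1/2 + real i * R" if "i \<le> n" for k i
    using that
  proof (induction i)
    case 0
    then show ?case using X(2)[of k] delta_bounds by simp
  next
    case (Suc i)
    have "norm (X k (Suc i)) \<le> norm (X k i) + norm (X k (Suc i) - X k i)"
      using norm_triangle_ineq[of "X k i" "X k (Suc i) - X k i"] by simp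
    then show ?case using Suc step[of i k] by (simp add: algebra_simps)
  qed
  moreover have "R \<ge> 0" using step[of 0 0] assms(2) norm_ge_zero order_trans by blast
  ultimately have bound: "norm (X k i) \<le> 1/2 + real n * R" if "i \<in> {..n}" for k i
    using that by (smt (verit) atMost_iff mult_right_mono of_nat_le_iff)
  obtain r where r: "strict_mono r" "\<And>i. i \<in> {..n} \<Longrightarrow> \<exists>l. (\<lambda>k. X (r k) i) \<longlonglongrightarrow> l"
    using function_convergent_subsequence[of "{..n}" X, OF _ bound] by auto
  then obtain x where x: "\<And>i. i \<le> n \<Longrightarrow> (\<lambda>k. X (r k) i) \<longlonglongrightarrow> x i" by (metis atMost_iff)
  have "x 0 \<in> A"
    by (rule closed_sequentially[OF closed_A _ x]) (use X(1) in \<open>auto simp: T_def\<close>)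
  moreover have "x n \<in> B"
    by (rule closed_sequentially[OF closed_B _ x]) (use X(1) in \<open>auto simp: T_def\<close>)
  moreover have lim: "(\<lambda>k. cost h (X (r k)) n) \<longlonglongrightarrow> cost h x n"
    unfolding cost_def stepcost_def
  proof (intro tendsto_sum tendsto_mult tendsto_add tendsto_const)
    fix i assume "i \<in> {..<n}"
    then have i: "i \<le> n" "Suc i \<le> n" by auto
    show "(\<lambda>k. \<Phi> (norm ((X (r k) (Suc i) - X (r k) i) /\<^sub>R h))) \<longlonglongrightarrow> \<Phi> (norm ((x (Suc i) - x i) /\<^sub>R h))"
      by (rule continuous_on_tendsto_compose[OF Phi_norm_continuous])
        (use i x in \<open>auto intro!: tendsto_intros\<close>)
    show "(\<lambda>k. W (X (r k) i)) \<longlonglongrightarrow> W (x i)"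
      by (rule continuous_on_tendsto_compose[OF W_cont]) (use i x in auto)
  qed
  moreover have "(\<lambda>k. I + 1 / real (Suc (r k))) \<longlonglongrightarrow> I + 0"
    by (intro tendsto_intros LIMSEQ_subseq_LIMSEQ[OF lim_1_over_n[THEN LIMSEQ_Suc] r(1), unfolded o_def])
  ultimately have "cost h x n \<le> I"
    using LIMSEQ_le[of "\<lambda>k. cost h (X (r k)) n" "cost h x n" "\<lambda>k. I + 1 / real (Suc (r k))" "I + 0"] X(3)
    by (auto intro: less_imp_le)
  then show ?thesis unfolding minimal_def
    using I_le \<open>x 0 \<in> A\<close> \<open>x n \<in> B\<close> order_trans by (intro exI[of _ x]) (auto simp: T_def)
qed

text \<open>A single interior node is varied; it is unconstrained, so the derivative of the cost
  with respect to it vanishes. The condition \<open>V > c\<close> provides an open neighbourhood on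
  which \<open>W\<close> is the differentiable function \<open>V - c\<close>.\<close>

lemma discrete_Euler_Lagrange:
  assumes h: "h > 0" and min: "minimal h n x" and i: "Suc i < n" and Vx: "V (x (Suc i)) > c"
  shows "Pv ((x (Suc (Suc i)) - x (Suc i)) /\<^sub>R h) - Pv ((x (Suc i) - x i) /\<^sub>R h) = h *\<^sub>R grad V (x (Suc i))"
proof -
  let ?x = "x (Suc i)"
  define f where "f y = stepcost h (x i) y + stepcost h y (x (Suc (Suc i)))" for y
  \<comment> \<open>Only the summands with index \<open>i\<close> and \<open>Suc i\<close> see the
    varied node.\<close>
  have split: "cost h (x(Suc i := y)) n = f y + (\<Sum>j\<in>{..<n} - {i, Suc i}. stepcost h (x j) (x (Suc j)))" for y
  proof -
    let ?g = "\<lambda>j. stepcost h ((x(Suc i := y)) j) ((x(Suc i := y)) (Suc j))"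
    have "cost h (x(Suc i := y)) n = sum ?g ({..<n} - {i, Suc i}) + sum ?g {i, Suc i}"
      unfolding cost_def using i by (intro sum.subset_diff) auto
    moreover have "sum ?g {i, Suc i} = f y" by (simp add: f_def)
    moreover have "sum ?g ({..<n} - {i, Suc i}) = (\<Sum>j\<in>{..<n} - {i, Suc i}. stepcost h (x j) (x (Suc j)))"
      by (rule sum.cong) auto
    ultimately show ?thesis by simp
  qed
  have fmin: "f ?x \<le> f y" for y
  proof -
    have "cost h (x(Suc i := ?x)) n \<le> cost h (x(Suc i := y)) n"
      using min i unfolding minimal_def by auto
    then show ?thesis unfolding split by simp
  qed
  let ?S = "{y. V y > c}"
  have S: "open ?S" "?x \<in> ?S" using Vx by (auto intro!: open_Collect_less V_cont continuous_intros)
  let ?f = "\<lambda>y. h * (\<Phi> (norm ((y - x i) /\<^sub>R h)) + W (x i)) + h * (\<Phi> (norm ((x (Suc (Suc i)) - y) /\<^sub>R h)) + (V y + - c))"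
  let ?v = "(?x - x i) /\<^sub>R h" and ?w = "(x (Suc (Suc i)) - ?x) /\<^sub>R h"
  have feq: "f y = ?f y" if "y \<in> ?S" for y using that by (auto simp: f_def stepcost_def W_def)
  have d1: "((\<lambda>y. \<Phi> (norm ((y - x i) /\<^sub>R h))) has_derivative (\<lambda>k. inner (k /\<^sub>R h) (Pv ?v))) (at ?x)"
    by (rule has_derivative_compose[of "\<lambda>y. (y - x i) /\<^sub>R h", OF _ Phi_norm_GDERIV[unfolded gderiv_def]])
      (auto intro!: derivative_eq_intros)
  have d2: "((\<lambda>y. \<Phi> (norm ((x (Suc (Suc i)) - y) /\<^sub>R h))) has_derivative (\<lambda>k. inner ((- k) /\<^sub>R h) (Pv ?w))) (at ?x)"
    by (rule has_derivative_compose[of "\<lambda>y. (x (Suc (Suc i)) - y) /\<^sub>R h", OF _ Phi_norm_GDERIV[unfolded gderiv_def]])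
      (auto intro!: derivative_eq_intros)
  have "(?f has_derivative (\<lambda>k. h * (inner (k /\<^sub>R h) (Pv ?v)) + h * (inner ((- k) /\<^sub>R h) (Pv ?w) + inner k (grad V ?x)))) (at ?x)"
    by (intro has_derivative_add has_derivative_mult_right d1 d2 V_has_derivative has_derivative_add_const)
  then have "(f has_derivative (\<lambda>k. h * (inner (k /\<^sub>R h) (Pv ?v)) + h * (inner ((- k) /\<^sub>R h) (Pv ?w) + inner k (grad V ?x)))) (at ?x)"
    by (rule has_derivative_transform_within_open[OF _ S]) (use feq in auto)
  then have "(\<lambda>k. h * (inner (k /\<^sub>R h) (Pv ?v)) + h * (inner ((- k) /\<^sub>R h) (Pv ?w) + inner k (grad V ?x))) = (\<lambda>k. 0)"
    by (rule differential_zero_maxmin[OF S(2,1)]) (use fmin in auto)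
  note zero = fun_cong[OF this]
  have "inner k (Pv ?v) - inner k (Pv ?w) + h * inner k (grad V ?x) = 0" for k
  proof -
    have e: "h * inner (k /\<^sub>R h) p = inner k p" "h * inner ((- k) /\<^sub>R h) p = - inner k p" for p
      using h by simp_all
    show ?thesis using zero[of k] unfolding distrib_left e by simp
  qed
  then have "inner k (Pv ?v - Pv ?w + h *\<^sub>R grad V ?x) = 0" for k
    by (simp add: inner_diff_right inner_add_right)
  then have "Pv ?v - Pv ?w + h *\<^sub>R grad V ?x = 0" using inner_eq_zero_iff by blast
  then show ?thesis by (simp add: algebra_simps)
qed

text \<open>Waiting at the last node is free because it lies in \<open>B\<close>, where
  \<open>W = 0\<close>; a path with fewer steps can thus be padded to \<open>n\<close>
  steps.\<close>

lemma minimal_le_shorter: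
  assumes "minimal h n x" "y 0 \<in> A" "y M \<in> B" "M \<le> n"
  shows "cost h x n \<le> cost h y M"
proof -
  obtain w where w: "w 0 = y 0" "w (M + (n - M)) = y M" "cost h w (M + (n - M)) = cost h y M + cost h (\<lambda>_. y M) (n - M)"
    by (rule concat_paths[of y M "\<lambda>_. y M" "n - M" h]) auto
  have "W (y M) = 0" using assms by (simp add: W_eq_0 mem_B)
  then have "cost h (\<lambda>_. y M) (n - M) = 0" by (simp add: cost_def stepcost_def)
  then show ?thesis using w assms unfolding minimal_def by (metis add.right_neutral le_add_diff_inverse)
qed

text \<open>Two segments of \<open>k\<close> steps, at speed at most 1, attach the ends to
  \<open>a\<close> and \<open>b\<close>, each adding at most
  \<open>k * h * speed_const\<close>.\<close>

lemma minimal_le_near: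
  assumes h: "h > 0" and min: "minimal h n x"
    and ab: "a \<in> A" "b \<in> B" "dist a (y 0) \<le> of_nat k * h" "dist (y M) b \<le> of_nat k * h" and n: "M + 2 * k \<le> n"
  shows "cost h x n \<le> cost h y M + 2 * (of_nat k * h * speed_const)"
proof -
  obtain z where z: "z 0 = a" "z k = y 0" "cost h z k \<le> of_nat k * h * speed_const"
    by (rule straight_path[OF h ab(3)])
  obtain z' where z': "z' 0 = y M" "z' k = b" "cost h z' k \<le> of_nat k * h * speed_const"
    by (rule straight_path[OF h ab(4)])
  obtain w where w: "w 0 = z 0" "w (k + M) = y M" "cost h w (k + M) = cost h z k + cost h y M"
    by (rule concat_paths[of z k y M h]) (simp add: z(2))
  obtain w' where w': "w' 0 = w 0" "w' (k + M + k) = z' k" "cost h w' (k + M + k) = cost h w (k + M) + cost h z' k"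
    by (rule concat_paths[of w "k + M" z' k h]) (simp add: w(2) z'(1))
  have "cost h x n \<le> cost h w' (k + M + k)"
    by (rule minimal_le_shorter[OF min]) (use w w' z z' ab n in auto)
  then show ?thesis using w'(3) w(3) z(3) z'(3) by simp
qed

end

section \<open>Recentred two-sided paths\<close>

context subgroup_step begin

definition icost :: "real \<Rightarrow> (int \<Rightarrow> real^'n) \<Rightarrow> int \<Rightarrow> int \<Rightarrow> real" where
  "icost h X a b = (\<Sum>j\<in>{a..<b}. stepcost h (X j) (X (j + 1)))"

lemma not_near_both:
  assumes "x \<in> B" "\<xi> \<in> Z" shows "dist x \<xi> > 1/2"
proof -
  obtain \<eta> where \<eta>: "\<eta> \<in> int_lattice - Z" "dist x \<eta> \<le> 1/2 - \<delta>" using assms mem_B by auto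
  then have "dist \<xi> \<eta> \<ge> 1" using assms Z_sub by (intro dist_int_lattice) auto
  then show ?thesis using dist_triangle3[of \<xi> \<eta> x] \<eta>(2) delta_bounds by simp
qed

text \<open>Time is recentred at the last visit near \<open>Z\<close>, which is translated to the origin. The last
  conclusion holds because a path that visits \<open>B\<close> at an earlier time could have stopped there.\<close>

lemma two_sided_path:
  assumes h: "h > 0" and min0: "minimal h n x"
  obtains X where
    "\<And>j. V (X j) > c \<Longrightarrow> Pv ((X (j + 1) - X j) /\<^sub>R h) - Pv ((X j - X (j - 1)) /\<^sub>R h) = h *\<^sub>R grad V (X j)"
    "\<And>a b. icost h X a b \<le> cost h x n"
    "norm (X 0) \<le> 1/2" "\<And>j \<xi>. j > 0 \<Longrightarrow> \<xi> \<in> Z \<Longrightarrow> dist (X j) \<xi> > 1/2"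
    "\<And>k j b. b \<in> B \<Longrightarrow> dist (X j) b \<le> of_nat k * h \<Longrightarrow> j \<le> - 2 * int k \<Longrightarrow> 2 * k \<le> n \<Longrightarrow>
        icost h X j 0 \<le> 2 * (of_nat k * h * speed_const)"
proof -
  define near where "near i \<longleftrightarrow> (\<exists>\<xi>\<in>Z. dist (x i) \<xi> \<le> 1/2)" for i
  \<comment> \<open>The maximum exists because \<open>x 0\<close> is near \<open>Z\<close>, and it
    is smaller than \<open>n\<close> because no point of \<open>B\<close> is. The radius 1/2 in
    \<open>near\<close> exceeds the radius of a cell.\<close>
  define i0 where "i0 = Max {i. i \<le> n \<and> near i}"
  have "near 0" using min0 delta_bounds unfolding minimal_def near_def mem_A by force
  then have "i0 \<in> {i. i \<le> n \<and> near i}" unfolding i0_def by (intro Max_in) auto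
  moreover have "\<not> near n" using min0 not_near_both unfolding minimal_def near_def by force
  ultimately have i0: "i0 < n" "near i0" by (auto simp: le_less)
  have far: "\<not> near i" if "i0 < i" "i \<le> n" for i
    using Max_ge[of "{i. i \<le> n \<and> near i}" i] that unfolding i0_def by fastforce
  obtain \<zeta> where \<zeta>: "\<zeta> \<in> Z" "dist (x i0) \<zeta> \<le> 1/2" using i0 near_def by blast
  define y where "y i = x i + - \<zeta>" for i
  have min: "minimal h n y" unfolding y_def by (rule minimal_shift[OF Z_minus[OF \<zeta>(1)] min0])
  have cy: "cost h y n = cost h x n" unfolding y_def using Z_minus[OF \<zeta>(1)] Z_sub by (intro cost_shift) auto
  have y0: "y 0 \<in> A" and yn: "y n \<in> B" using min by (auto simp: minimal_def)
  \<comment> \<open>Clamping the index continues the path constantly on both sides. The end values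
    lie in the sublevel set, so the continuation is free and creates no node with
    \<open>V > c\<close>.\<close>
  define idx where "idx j = nat (max 0 (min (int n) (int i0 + j)))" for j
  define X where "X j = y (idx j)" for j
  have idx_le: "idx j \<le> n" for j by (auto simp: idx_def)
  have inner: "0 < int i0 + j \<and> int i0 + j < int n" if "V (X j) > c" for j
    using that y0 yn unfolding X_def idx_def mem_A mem_B
    by (cases "int i0 + j \<le> 0"; cases "int i0 + j \<ge> int n") (auto simp: max_def min_def)
  have Xy: "X j = y i" if "int i = int i0 + j" "i \<le> n" for i j
    using that by (simp add: X_def idx_def flip: that(1))
  have outer: "stepcost h (X j) (X (j + 1)) = 0" if "int i0 + j < 0 \<or> int n \<le> int i0 + j" for j
  proof -
    have "X (j + 1) = X j" "X j = y 0 \<or> X j = y n"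
      using that by (auto simp: X_def idx_def)
    moreover have "W (y 0) = 0" "W (y n) = 0" using y0 yn by (auto simp: W_eq_0 mem_A mem_B)
    ultimately show ?thesis by (auto simp: stepcost_def)
  qed
  \<comment> \<open>Windows may overhang the finite path; by \<open>outer\<close> only its genuine
    steps contribute, so each window sum is a partial sum of \<open>cost h y n\<close>.\<close>
  have icost_eq: "icost h X a b = (\<Sum>i\<in>{i. i < n \<and> a \<le> int i - int i0 \<and> int i - int i0 < b}. stepcost h (y i) (y (Suc i)))"
    (is "_ = sum ?f ?S") for a b
  proof -
    have "icost h X a b = (\<Sum>j\<in>(\<lambda>i. int i - int i0) ` ?S. stepcost h (X j) (X (j + 1)))"
      unfolding icost_def
    proof (rule sum.mono_neutral_right)
      show "\<forall>i\<in>{a..<b} - (\<lambda>i. int i - int i0) ` ?S. stepcost h (X i) (X (i + 1)) = 0"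
      proof
        fix j assume j: "j \<in> {a..<b} - (\<lambda>i. int i - int i0) ` ?S"
        show "stepcost h (X j) (X (j + 1)) = 0"
        proof (rule outer, rule ccontr)
          assume "\<not> (int i0 + j < 0 \<or> int n \<le> int i0 + j)"
          then have "nat (int i0 + j) \<in> ?S" "j = int (nat (int i0 + j)) - int i0" using j by auto
          then show False using j by blast
        qed
      qed
    qed auto
    also have "\<dots> = sum ?f ?S"
    proof (subst sum.reindex)
      show "inj_on (\<lambda>i. int i - int i0) ?S" by (auto simp: inj_on_def)
      show "sum ((\<lambda>j. stepcost h (X j) (X (j + 1))) \<circ> (\<lambda>i. int i - int i0)) ?S = sum ?f ?S"
      proof (rule sum.cong)
        fix i assume "i \<in> ?S"
        then have "X (int i - int i0) = y i" "X (int i - int i0 + 1) = y (Suc i)"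
          by (auto intro: Xy)
        then show "((\<lambda>j. stepcost h (X j) (X (j + 1))) \<circ> (\<lambda>i. int i - int i0)) i = ?f i" by simp
      qed simp
    qed
    finally show ?thesis .
  qed
  show thesis
  proof (rule that[of X])
    fix j assume Vj: "V (X j) > c"
    define i where "i = nat (int i0 + j) - 1"
    have i: "Suc i < n" "int (Suc i) = int i0 + j" using inner[OF Vj] by (auto simp: i_def)
    have X3: "X j = y (Suc i)" "X (j + 1) = y (Suc (Suc i))" "X (j - 1) = y i"
      using i by (auto intro!: Xy)
    show "Pv ((X (j + 1) - X j) /\<^sub>R h) - Pv ((X j - X (j - 1)) /\<^sub>R h) = h *\<^sub>R grad V (X j)"
      using discrete_Euler_Lagrange[OF h min i(1)] Vj unfolding X3 by blast
  next
    fix a b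
    have "icost h X a b \<le> cost h y n" unfolding icost_eq cost_def
      by (intro sum_mono2) (auto simp: stepcost_nonneg h)
    then show "icost h X a b \<le> cost h x n" by (simp add: cy)
  next
    have "X 0 = y i0" using i0 by (intro Xy) auto
    then show "norm (X 0) \<le> 1/2" using \<zeta>(2) by (simp add: y_def dist_norm)
  next
    fix j \<xi> assume j: "j > (0::int)" "\<xi> \<in> Z"
    have "i0 < idx j" using j(1) i0(1) by (auto simp: idx_def)
    then have "\<not> near (idx j)" using far idx_le by blast
    then have "dist (x (idx j)) (\<xi> + \<zeta>) > 1/2" using Z_add[OF j(2) \<zeta>(1)] unfolding near_def by force
    then show "dist (X j) \<xi> > 1/2" by (simp add: X_def y_def dist_norm algebra_simps)
  next
    fix k j b assume b: "b \<in> B" "dist (X j) b \<le> of_nat k * h" "j \<le> - 2 * int k" "2 * k \<le> n"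
    define p where "p = idx j"
    \<comment> \<open>If the index is clamped, then \<open>p = 0\<close> and
      \<open>2 * k \<le> n\<close> is used; otherwise \<open>p = i0 + j\<close> with
      \<open>j \<le> - 2 * k\<close> and \<open>i0 < n\<close>.\<close>
    have "p + 2 * k \<le> n" using b(3,4) i0(1) by (auto simp: p_def idx_def)
    then have le: "cost h y n \<le> cost h y p + 2 * (of_nat k * h * speed_const)"
      using minimal_le_near[OF h min y0 b(1), of y k p] b(2) h by (simp add: X_def p_def)
    \<comment> \<open>The steps before \<open>p\<close> and those between \<open>j\<close> and 0 are
      disjoint. As stopping at \<open>p\<close> and turning to \<open>b\<close> is a competitor, the
      latter cost no more than the detour.\<close>
    have "icost h X j 0 + cost h y p \<le> cost h y n"
    proof -
      let ?S = "{i. i < n \<and> j \<le> int i - int i0 \<and> int i - int i0 < 0}"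
      have "icost h X j 0 + cost h y p = (\<Sum>i\<in>?S \<union> {..<p}. stepcost h (y i) (y (Suc i)))"
        unfolding icost_eq cost_def by (intro sum.union_disjoint[symmetric]) (auto simp: p_def idx_def)
      also have "\<dots> \<le> cost h y n" unfolding cost_def
        by (intro sum_mono2) (use idx_le[of j] in \<open>auto simp: stepcost_nonneg h p_def\<close>)
      finally show ?thesis .
    qed
    then show "icost h X j 0 \<le> 2 * (of_nat k * h * speed_const)" using le by simp
  qed
qed

lemma icost_superlinear:
  assumes "\<And>s. s \<ge> 0 \<Longrightarrow> K * s \<le> \<Phi> s + C" "h > 0" "K \<ge> 0" "a \<le> b"
  shows "K * dist (X a) (X b) \<le> icost h X a b + C * (h * of_int (b - a))"
proof -
  have "norm (X b - X a) \<le> (\<Sum>j\<in>{a..<b}. norm (X (j + 1) - X j))"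
    using assms(4)
  proof (induction b rule: int_ge_induct)
    case (step i)
    have "{a..<i + 1} = insert i {a..<i}" using step by auto
    moreover have "norm (X (i + 1) - X a) \<le> norm (X i - X a) + norm (X (i + 1) - X i)"
      using norm_triangle_ineq[of "X i - X a" "X (i + 1) - X i"] by simp
    ultimately show ?case using step by simp
  qed simp
  then have "K * norm (X b - X a) \<le> (\<Sum>j\<in>{a..<b}. K * norm (X (j + 1) - X j))"
    using mult_left_mono[OF _ assms(3)] by (simp add: sum_distrib_left[symmetric])
  also have "\<dots> \<le> (\<Sum>j\<in>{a..<b}. stepcost h (X j) (X (j + 1)) + C * h)"
    by (intro sum_mono stepcost_superlinear assms)
  also have "\<dots> = icost h X a b + C * (h * of_int (b - a))"
    using assms(4) by (simp add: icost_def sum.distrib)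
  finally show ?thesis by (simp add: dist_norm norm_minus_commute)
qed

end

section \<open>Passage to the limit\<close>

text \<open>Collects all that later arguments use about the discrete problems, for a sequence of
  meshes; as a locale it can be instantiated again with a subsequence. \<open>X\<close> is the
  recentred form of \<open>x\<close>, and \<open>q_lim\<close> is locally uniform convergence of the
  associated step functions.\<close>

locale limit_curve = subgroup_step \<phi> l V c \<delta> Z
  for \<phi> l and V :: "real^'n \<Rightarrow> real" and c \<delta> Z +
  fixes h :: "nat \<Rightarrow> real" and N :: "nat \<Rightarrow> nat" and x :: "nat \<Rightarrow> nat \<Rightarrow> real^'n"
    and X :: "nat \<Rightarrow> int \<Rightarrow> real^'n" and L :: real and q :: "real \<Rightarrow> real^'n"
  assumes h_pos: "\<And>k. h k > 0" and h_lim: "h \<longlonglongrightarrow> 0"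
    and Nh_lim: "filterlim (\<lambda>k. of_nat (N k) * h k) at_top sequentially"
    and min: "\<And>k. minimal (h k) (N k) (x k)"
    and L_lim: "(\<lambda>k. cost (h k) (x k) (N k)) \<longlonglongrightarrow> L"
    and EL: "\<And>k j. V (X k j) > c \<Longrightarrow>
      Pv ((X k (j + 1) - X k j) /\<^sub>R h k) - Pv ((X k j - X k (j - 1)) /\<^sub>R h k) = h k *\<^sub>R grad V (X k j)"
    and icost_le: "\<And>k a b. icost (h k) (X k) a b \<le> cost (h k) (x k) (N k)"
    and X_0: "\<And>k. norm (X k 0) \<le> 1/2"
    and X_far: "\<And>k j \<xi>. j > 0 \<Longrightarrow> \<xi> \<in> Z \<Longrightarrow> dist (X k j) \<xi> > 1/2"
    and icost_cut: "\<And>k i j b. b \<in> B \<Longrightarrow> dist (X k j) b \<le> of_nat i * h k \<Longrightarrow> j \<le> - 2 * int i \<Longrightarrow>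
      2 * i \<le> N k \<Longrightarrow> icost (h k) (X k) j 0 \<le> 2 * (of_nat i * h k * speed_const)"
    and q_lim: "\<And>R e. e > 0 \<Longrightarrow> \<forall>\<^sub>F k in sequentially. \<forall>t. \<bar>t\<bar> \<le> R \<longrightarrow> dist (X k \<lfloor>t / h k\<rfloor>) (q t) < e"
    and q_uniform: "uniformly_continuous_on UNIV q"

context subgroup_step begin

text \<open>Arzela-Ascoli for step functions. These are discontinuous, so they are equicontinuous
  only up to the mesh, which tends to 0.\<close>

lemma limit_curve_exists: "\<exists>h N x X L q. limit_curve \<phi> l V c \<delta> Z h N x X L q"
proof -
  obtain \<eta> where \<eta>: "\<eta> \<in> int_lattice - Z" using B_nonempty by blast
  \<comment> \<open>A time that suffices for travelling from the origin to \<open>\<eta>\<close> at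
    unit speed, whatever the mesh; it bounds all minimal costs by \<open>M\<close>.\<close>
  define R where "R = nat \<lceil>norm \<eta>\<rceil>"
  define h where "h k = 1 / real (Suc k)" for k
  \<comment> \<open>The total time \<open>N k * h k\<close> equals \<open>Suc k + R\<close>: it
    tends to infinity and leaves room for the straight competitor with \<open>Suc k * R\<close>
    steps.\<close>
  define N where "N k = Suc k * (Suc k + R)" for k
  have h: "h k > 0" "h k \<le> 1" for k by (auto simp: h_def)
  have h_lim: "h \<longlonglongrightarrow> 0" unfolding h_def using LIMSEQ_Suc[OF lim_1_over_n] by simp
  have Nh: "of_nat (N k) * h k = real (Suc k + R)" for k unfolding h_def N_def of_nat_mult by simp
  have Npos: "N k > 0" for k by (simp add: N_def)
  obtain x where min: "\<And>k. minimal (h k) (N k) (x k)"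
  proof -
    have "\<forall>k. \<exists>x. minimal (h k) (N k) x" using minimal_exists h(1) Npos by blast
    then show thesis using that by metis
  qed
  define Lk where "Lk k = cost (h k) (x k) (N k)" for k
  define M where "M = real R * speed_const"
  have Lk: "Lk k \<le> M" for k
  proof -
    have SR: "of_nat (Suc k * R) * h k = real R" unfolding h_def of_nat_mult by simp
    then have "dist 0 \<eta> \<le> of_nat (Suc k * R) * h k"
      using real_nat_ceiling_ge[of "norm \<eta>"] unfolding R_def by simp
    then obtain z where z: "z 0 = 0" "z (Suc k * R) = \<eta>" "cost (h k) z (Suc k * R) \<le> of_nat (Suc k * R) * h k * speed_const"
      using straight_path[OF h(1)] by metis
    have "0 \<in> A" "\<eta> \<in> B" using \<eta> Z_0 delta_bounds V_lattice_le unfolding mem_A mem_B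
      by (auto intro: bexI[of _ "0::real^'n"] bexI[of _ \<eta>])
    moreover have "Suc k * R \<le> N k" unfolding N_def by (intro mult_le_mono) auto
    ultimately have "Lk k \<le> cost (h k) z (Suc k * R)" unfolding Lk_def
      by (intro minimal_le_shorter[OF min]) (simp_all only: z)
    also have "\<dots> \<le> M" using z(3) unfolding SR M_def .
    finally show ?thesis .
  qed
  have "\<exists>X. (\<forall>j. V (X j) > c \<longrightarrow> Pv ((X (j + 1) - X j) /\<^sub>R h k) - Pv ((X j - X (j - 1)) /\<^sub>R h k) = h k *\<^sub>R grad V (X j))
     \<and> (\<forall>a b. icost (h k) X a b \<le> Lk k) \<and> norm (X 0) \<le> 1/2 \<and> (\<forall>j \<xi>. j > 0 \<longrightarrow> \<xi> \<in> Z \<longrightarrow> dist (X j) \<xi> > 1/2)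
     \<and> (\<forall>i j b. b \<in> B \<longrightarrow> dist (X j) b \<le> of_nat i * h k \<longrightarrow> j \<le> - 2 * int i \<longrightarrow> 2 * i \<le> N k \<longrightarrow>
        icost (h k) X j 0 \<le> 2 * (of_nat i * h k * speed_const))" for k
    unfolding Lk_def by (rule two_sided_path[OF h(1) min]) blast
  then obtain X where X:
    "\<And>k j. V (X k j) > c \<Longrightarrow> Pv ((X k (j + 1) - X k j) /\<^sub>R h k) - Pv ((X k j - X k (j - 1)) /\<^sub>R h k) = h k *\<^sub>R grad V (X k j)"
    "\<And>k a b. icost (h k) (X k) a b \<le> Lk k" "\<And>k. norm (X k 0) \<le> 1/2"
    "\<And>k j \<xi>. j > 0 \<Longrightarrow> \<xi> \<in> Z \<Longrightarrow> dist (X k j) \<xi> > 1/2"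
    "\<And>k i j b. b \<in> B \<Longrightarrow> dist (X k j) b \<le> of_nat i * h k \<Longrightarrow> j \<le> - 2 * int i \<Longrightarrow> 2 * i \<le> N k \<Longrightarrow>
        icost (h k) (X k) j 0 \<le> 2 * (of_nat i * h k * speed_const)"
    by metis
  define Q where "Q k t = X k \<lfloor>t / h k\<rfloor>" for k t
  \<comment> \<open>Rounding both times to the grid lengthens the time between them by at most one
    mesh, whence the term \<open>h k\<close>.\<close>
  have Q_super: "K * dist (Q k s) (Q k t) \<le> M + C * (\<bar>s - t\<bar> + h k)"
    if KC: "K \<ge> 0" "C \<ge> 0" "\<And>s. s \<ge> 0 \<Longrightarrow> K * s \<le> \<Phi> s + C" for K C k s t
  proof -
    have *: "K * dist (Q k s) (Q k t) \<le> M + C * (\<bar>s - t\<bar> + h k)" if st: "s \<le> t" for s t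
    proof -
      have fl: "\<lfloor>s / h k\<rfloor> \<le> \<lfloor>t / h k\<rfloor>" using st h(1)[of k] by (intro floor_mono divide_right_mono) auto
      have "real_of_int \<lfloor>t / h k\<rfloor> \<le> t / h k" "s / h k < real_of_int \<lfloor>s / h k\<rfloor> + 1" by linarith+
      then have "of_int (\<lfloor>t / h k\<rfloor> - \<lfloor>s / h k\<rfloor>) \<le> t / h k - s / h k + 1" unfolding of_int_diff by linarith
      then have "h k * of_int (\<lfloor>t / h k\<rfloor> - \<lfloor>s / h k\<rfloor>) \<le> h k * (t / h k - s / h k + 1)"
        using h(1)[of k] by (intro mult_left_mono) auto
      also have "\<dots> = \<bar>s - t\<bar> + h k" using st h(1)[of k] by (simp add: algebra_simps)
      finally have "C * (h k * of_int (\<lfloor>t / h k\<rfloor> - \<lfloor>s / h k\<rfloor>)) \<le> C * (\<bar>s - t\<bar> + h k)"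
        by (intro mult_left_mono KC(2))
      then show ?thesis
        using icost_superlinear[OF KC(3) h(1)[of k] KC(1) fl, of "X k"] X(2)[of k "\<lfloor>s / h k\<rfloor>" "\<lfloor>t / h k\<rfloor>"] Lk[of k]
        unfolding Q_def by linarith
    qed
    show ?thesis using *[of s t] *[of t s] by (cases "s \<le> t") (auto simp: dist_commute abs_minus_commute)
  qed
  have "M \<ge> 0" using speed_const(1) by (simp add: M_def)
  have modulus: "\<exists>d>0. \<forall>k s t. \<bar>s - t\<bar> + h k < d \<longrightarrow> dist (Q k s) (Q k t) \<le> e" if "e > 0" for e
  proof -
    \<comment> \<open>With this slope \<open>(M + 1) / K = e / 2\<close>, and the threshold
      \<open>1 / (C + 1)\<close> makes the error term at most 1.\<close>
    define K where "K = 2 * (M + 1) / e"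
    have "K > 0" using that \<open>M \<ge> 0\<close> by (simp add: K_def)
    obtain C where C: "C \<ge> 0" "\<And>s. s \<ge> 0 \<Longrightarrow> K * s \<le> \<Phi> s + C" using Phi_superlinear[of K] by blast
    show ?thesis
    proof (intro exI[of _ "1 / (C + 1)"] conjI allI impI)
      fix k s t assume "\<bar>s - t\<bar> + h k < 1 / (C + 1)"
      then have "C * (\<bar>s - t\<bar> + h k) \<le> C * (1 / (C + 1))" using C(1) by (intro mult_left_mono) auto
      also have "\<dots> \<le> 1" using C(1) by (simp add: field_simps)
      finally have "K * dist (Q k s) (Q k t) \<le> M + 1"
        using Q_super[OF less_imp_le[OF \<open>K > 0\<close>] C, of k s t] by simp
      also have "\<dots> = K * (e / 2)" using that \<open>M \<ge> 0\<close> by (simp add: K_def)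
      finally have "dist (Q k s) (Q k t) \<le> e / 2" using \<open>K > 0\<close> by simp
      then show "dist (Q k s) (Q k t) \<le> e" using that by simp
    qed (use C in simp)
  qed
  obtain C where C: "C \<ge> 0" "\<And>s. s \<ge> 0 \<Longrightarrow> 1 * s \<le> \<Phi> s + C" using Phi_superlinear[of 1] by blast
  \<comment> \<open>Division by \<open>1 + \<bar>t\<bar>\<close> gives a bound uniform in
    \<open>t\<close>, as the diagonal argument over the rationals asks for; \<open>rat\<close>
    undoes the scaling.\<close>
  have Q_bound: "norm (Q k t /\<^sub>R (1 + \<bar>t\<bar>)) \<le> 1/2 + M + C" for k t
  proof -
    have "dist (Q k t) (Q k 0) \<le> M + C * (\<bar>t\<bar> + h k)" using Q_super[of 1 C k t 0] C by simp
    also have "\<dots> \<le> M + C * (\<bar>t\<bar> + 1)" using h(2)[of k] C(1) by (simp add: mult_left_mono)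
    finally have "norm (Q k t) \<le> 1/2 + (M + C * (\<bar>t\<bar> + 1))"
      using X(3)[of k] norm_triangle_ineq2[of "Q k t" "Q k 0"] by (simp add: Q_def dist_norm)
    also have "\<dots> \<le> (1/2 + M + C) * (1 + \<bar>t\<bar>)"
    proof -
      have "(1/2 + M + C) * (1 + \<bar>t\<bar>) = 1/2 + (M + C * (\<bar>t\<bar> + 1)) + (\<bar>t\<bar> / 2 + M * \<bar>t\<bar>)"
        by (simp add: algebra_simps)
      moreover have "0 \<le> \<bar>t\<bar> / 2 + M * \<bar>t\<bar>" using \<open>M \<ge> 0\<close> by simp
      ultimately show ?thesis by linarith
    qed
    finally show ?thesis by (simp add: divide_inverse_commute[symmetric] pos_divide_le_eq)
  qed
  have "bounded (range Lk)"
    using Lk cost_nonneg[OF h(1)] unfolding bounded_iff Lk_def by (intro exI[of _ M]) auto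
  then obtain L r1 where r1: "strict_mono r1" "(Lk \<circ> r1) \<longlonglongrightarrow> L"
    using bounded_imp_convergent_subsequence by blast
  obtain r2 where r2: "strict_mono r2" "\<And>t. t \<in> \<rat> \<Longrightarrow> \<exists>l. (\<lambda>k. Q (r1 (r2 k)) t /\<^sub>R (1 + \<bar>t\<bar>)) \<longlonglongrightarrow> l"
    by (rule function_convergent_subsequence[OF countable_rat, of "\<lambda>k t. Q (r1 k) t /\<^sub>R (1 + \<bar>t\<bar>)"])
      (use Q_bound in blast)+
  define r where "r k = r1 (r2 k)" for k
  have r: "strict_mono r" using r1(1) r2(1) by (auto simp: r_def strict_mono_def)
  have hr: "(\<lambda>k. h (r k)) \<longlonglongrightarrow> 0" using LIMSEQ_subseq_LIMSEQ[OF h_lim r] by (simp add: o_def)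
  have near: "\<exists>d>0. \<forall>\<^sub>F k in sequentially. \<forall>s t. \<bar>s - t\<bar> < d \<longrightarrow> dist (Q (r k) s) (Q (r k) t) \<le> e" if "e > 0" for e
  proof -
    obtain d where d: "d > 0" "\<And>k s t. \<bar>s - t\<bar> + h k < d \<Longrightarrow> dist (Q k s) (Q k t) \<le> e" using modulus[OF \<open>e > 0\<close>] by blast
    have "\<forall>\<^sub>F k in sequentially. h (r k) < d / 2" using order_tendstoD(2)[OF hr, of "d/2"] d by simp
    then have "\<forall>\<^sub>F k in sequentially. \<forall>s t. \<bar>s - t\<bar> < d / 2 \<longrightarrow> dist (Q (r k) s) (Q (r k) t) \<le> e"
    proof eventually_elim
      case (elim k)
      then show ?case using d(2)[of _ _ "r k"] by (smt (verit) field_sum_of_halves)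
    qed
    then show ?thesis using d(1) by (intro exI[of _ "d/2"]) auto
  qed
  have rat: "convergent (\<lambda>k. Q (r k) s)" if s: "s \<in> \<rat>" for s
  proof -
    obtain l where "(\<lambda>k. Q (r k) s /\<^sub>R (1 + \<bar>s\<bar>)) \<longlonglongrightarrow> l" using r2(2)[OF s] unfolding r_def by blast
    then have "(\<lambda>k. (1 + \<bar>s\<bar>) *\<^sub>R (Q (r k) s /\<^sub>R (1 + \<bar>s\<bar>))) \<longlonglongrightarrow> (1 + \<bar>s\<bar>) *\<^sub>R l" by (intro tendsto_intros)
    then show ?thesis by (auto simp: convergent_def add_nonneg_eq_0_iff)
  qed
  \<comment> \<open>Convergence at a nearby rational time controls time \<open>t\<close>, since the
    oscillation between them is small for all large \<open>k\<close>.\<close>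
  have "Cauchy (\<lambda>k. Q (r k) t)" for t
  proof (rule metric_CauchyI)
    fix e :: real assume "e > 0"
    then obtain d where d: "d > 0" "\<forall>\<^sub>F k in sequentially. \<forall>s t. \<bar>s - t\<bar> < d \<longrightarrow> dist (Q (r k) s) (Q (r k) t) \<le> e / 4"
      using near[of "e/4"] by auto
    obtain s where s: "s \<in> \<rat>" "t < s" "s < t + d" using Rats_dense_in_real[of t "t + d"] d by auto
    have "Cauchy (\<lambda>k. Q (r k) s)" using rat[OF s(1)] by (rule convergent_Cauchy)
    then obtain n1 where n1: "\<And>m n. m \<ge> n1 \<Longrightarrow> n \<ge> n1 \<Longrightarrow> dist (Q (r m) s) (Q (r n) s) < e / 4"
      using \<open>e > 0\<close> metric_CauchyD[of "\<lambda>k. Q (r k) s" "e / 4"] by auto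
    obtain n2 where n2: "\<And>k. k \<ge> n2 \<Longrightarrow> dist (Q (r k) s) (Q (r k) t) \<le> e / 4"
    proof -
      have "\<bar>s - t\<bar> < d" using s by simp
      then have "\<forall>\<^sub>F k in sequentially. dist (Q (r k) s) (Q (r k) t) \<le> e / 4"
        using d(2) by (auto elim: eventually_mono)
      then show thesis using that unfolding eventually_sequentially by blast
    qed
    show "\<exists>n0. \<forall>m\<ge>n0. \<forall>n\<ge>n0. dist (Q (r m) t) (Q (r n) t) < e"
    proof (intro exI[of _ "max n1 n2"] allI impI)
      fix m n assume "max n1 n2 \<le> m" "max n1 n2 \<le> n"
      then have "dist (Q (r m) s) (Q (r n) s) < e / 4" "dist (Q (r m) s) (Q (r m) t) \<le> e / 4" "dist (Q (r n) s) (Q (r n) t) \<le> e / 4"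
        using n1 n2 by auto
      then show "dist (Q (r m) t) (Q (r n) t) < e"
        using dist_triangle3[of "Q (r m) t" "Q (r n) t" "Q (r m) s"] dist_triangle[of "Q (r m) s" "Q (r n) t" "Q (r n) s"] \<open>e > 0\<close> by linarith
    qed
  qed
  then have conv: "convergent (\<lambda>k. Q (r k) t)" for t by (rule Cauchy_convergent)
  define q where "q t = lim (\<lambda>k. Q (r k) t)" for t
  have q: "(\<lambda>k. Q (r k) t) \<longlonglongrightarrow> q t" for t
    using conv[of t] unfolding q_def convergent_LIMSEQ_iff .
  have q_uni: "uniformly_continuous_on UNIV q" unfolding uniformly_continuous_on_def
  proof (intro allI impI)
    fix e :: real assume "e > 0"
    then obtain d where d: "d > 0" "\<forall>\<^sub>F k in sequentially. \<forall>s t. \<bar>s - t\<bar> < d \<longrightarrow> dist (Q (r k) s) (Q (r k) t) \<le> e / 2"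
      using near[of "e/2"] by auto
    have "dist (q s) (q t) < e" if "dist s t < d" for s t
    proof -
      have "dist (q s) (q t) \<le> e / 2"
      proof (rule tendsto_upperbound[OF tendsto_dist[OF q q]])
        show "\<forall>\<^sub>F k in sequentially. dist (Q (r k) s) (Q (r k) t) \<le> e / 2"
          using d(2) by eventually_elim (use that in \<open>auto simp: dist_real_def\<close>)
      qed simp
      then show ?thesis using \<open>e > 0\<close> by simp
    qed
    then show "\<exists>d>0. \<forall>x\<in>UNIV. \<forall>x'\<in>UNIV. dist x' x < d \<longrightarrow> dist (q x') (q x) < e" using d(1) by blast
  qed
  have q_lim: "\<forall>\<^sub>F k in sequentially. \<forall>t. \<bar>t\<bar> \<le> R \<longrightarrow> dist (X (r k) \<lfloor>t / h (r k)\<rfloor>) (q t) < e"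
    if "e > 0" for R e :: real
  proof -
    obtain d where d: "d > 0" "\<forall>\<^sub>F k in sequentially. \<forall>s t. \<bar>s - t\<bar> < d \<longrightarrow> dist (Q (r k) s) (Q (r k) t) \<le> e / 3"
      using near[of "e/3"] \<open>e > 0\<close> by auto
    obtain d' where d': "d' > 0" "\<And>s t. dist s t < d' \<Longrightarrow> dist (q s) (q t) < e / 3"
      using q_uni \<open>e > 0\<close> unfolding uniformly_continuous_on_def by (metis UNIV_I zero_less_divide_iff zero_less_numeral)
    \<comment> \<open>A finite net reduces uniformity on the compact interval to convergence at
      finitely many times.\<close>
    obtain F where F: "finite F" "{- R..R} \<subseteq> (\<Union>s\<in>F. ball s (min d d'))"
      using seq_compact_imp_totally_bounded[of "{- R..R}"] d(1) d'(1) compact_imp_seq_compact[OF compact_Icc]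
      by (metis min_less_iff_conj)
    have "\<forall>\<^sub>F k in sequentially. \<forall>s\<in>F. dist (Q (r k) s) (q s) < e / 3"
      using \<open>e > 0\<close> by (intro eventually_ball_finite F(1) ballI tendstoD[OF q]) auto
    then show ?thesis using d(2)
    proof eventually_elim
      case (elim k)
      show ?case
      proof (intro allI impI)
        fix t assume "\<bar>t\<bar> \<le> R"
        then have "t \<in> {- R..R}" by auto
        then have "t \<in> (\<Union>s\<in>F. ball s (min d d'))" using F(2) by blast
        then obtain s where s: "s \<in> F" "dist s t < d" "dist s t < d'" by auto
        have "dist (Q (r k) s) (Q (r k) t) \<le> e / 3" using elim(2) s(2) by (simp add: dist_real_def)
        moreover have "dist (Q (r k) s) (q s) < e / 3" using elim(1) s(1) by blast
        moreover have "dist (q s) (q t) < e / 3" using d'(2) s(3) by blast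
        ultimately have "dist (Q (r k) t) (q t) < e"
          using dist_triangle3[of "Q (r k) t" "q t" "Q (r k) s"] dist_triangle[of "Q (r k) s" "q t" "q s"] by linarith
        then show "dist (X (r k) \<lfloor>t / h (r k)\<rfloor>) (q t) < e" by (simp add: Q_def)
      qed
    qed
  qed
  have "limit_curve \<phi> l V c \<delta> Z (\<lambda>k. h (r k)) (\<lambda>k. N (r k)) (\<lambda>k. x (r k)) (\<lambda>k. X (r k)) L q"
  proof unfold_locales
    show "filterlim (\<lambda>k. of_nat (N (r k)) * h (r k)) at_top sequentially"
      unfolding Nh
    proof (rule filterlim_at_top_mono[OF filterlim_real_sequentially])
      show "\<forall>\<^sub>F k in sequentially. real k \<le> real (Suc (r k) + R)"
        using seq_suble[OF r] by (intro always_eventually) (auto simp: le_SucI trans_le_add1 simp del: of_nat_Suc of_nat_add)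
    qed
    show "(\<lambda>k. cost (h (r k)) (x (r k)) (N (r k))) \<longlonglongrightarrow> L"
      using LIMSEQ_subseq_LIMSEQ[OF r1(2) r2(1)] by (simp add: o_def r_def Lk_def)
  qed (use h hr min X q_uni q_lim in \<open>auto simp: Lk_def[symmetric]\<close>)
  then show ?thesis by blast
qed

end

section \<open>Regularity of the limit curve\<close>

text \<open>A continuous \<open>f\<close> is uniformly continuous on bounded sets only, so the limit
  family must be bounded; the approximating one then stays in the ball of radius
  \<open>R + 1\<close>. The index sets depend on \<open>k\<close> because the grids do.\<close>

lemma uniform_limit_compose:
  fixes f :: "'a::euclidean_space \<Rightarrow> 'b::metric_space"
  assumes f: "continuous_on UNIV f"
    and u: "\<And>e. e > 0 \<Longrightarrow> \<forall>\<^sub>F k in sequentially. \<forall>j\<in>S k. dist (u k j) (U k j) \<le> e"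
    and U: "bounded (\<Union>k. U k ` S k)" and e: "e > 0"
  shows "\<forall>\<^sub>F k in sequentially. \<forall>j\<in>S k. dist (f (u k j)) (f (U k j)) \<le> e"
proof -
  obtain R where R: "\<And>k j. j \<in> S k \<Longrightarrow> norm (U k j) \<le> R" using U unfolding bounded_iff by auto
  have "uniformly_continuous_on (cball 0 (R + 1)) f"
    by (intro compact_uniformly_continuous continuous_on_subset[OF f]) auto
  then obtain d where d: "d > 0" "\<And>x y. x \<in> cball 0 (R + 1) \<Longrightarrow> y \<in> cball 0 (R + 1) \<Longrightarrow> dist y x < d \<Longrightarrow> dist (f y) (f x) < e"
    using e unfolding uniformly_continuous_on_def by meson
  have "\<forall>\<^sub>F k in sequentially. \<forall>j\<in>S k. dist (u k j) (U k j) \<le> min 1 (d / 2)"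
    using d(1) by (intro u) auto
  then show ?thesis
  proof eventually_elim
    case (elim k)
    show ?case
    proof
      fix j assume j: "j \<in> S k"
      then have *: "dist (u k j) (U k j) \<le> min 1 (d / 2)" using elim by blast
      have "norm (u k j) \<le> norm (U k j) + dist (u k j) (U k j)"
        by (simp add: dist_norm norm_triangle_sub)
      then have "norm (u k j) \<le> R + 1" using R[OF j] * by simp
      then have "u k j \<in> cball 0 (R + 1)" "U k j \<in> cball 0 (R + 1)" using R[OF j] by (auto simp: dist_norm)
      then show "dist (f (u k j)) (f (U k j)) \<le> e" using d(2)[of "U k j" "u k j"] * d(1) by force
    qed
  qed
qed

text \<open>On each grid cell the summand differs from the increment of the antiderivative by at
  most \<open>2 * e1 * h k\<close>, half of it from \<open>f\<close> and half from the oscillation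
  of \<open>F\<close>; the increments telescope. One estimate covers all upper limits
  \<open>j\<close>.\<close>

lemma uniform_Riemann_sums:
  fixes F :: "real \<Rightarrow> 'a::euclidean_space"
  assumes der: "\<And>u. (Fa has_vector_derivative F u) (at u)" and cont: "continuous_on UNIV F"
    and h: "\<And>k. h k > 0" "h \<longlonglongrightarrow> 0"
    and ab: "\<And>k j. a k \<le> j \<Longrightarrow> j \<le> b k \<Longrightarrow> s \<le> h k * of_int j \<and> h k * of_int j \<le> t"
    and a: "(\<lambda>k. h k * of_int (a k)) \<longlonglongrightarrow> s" and st: "s \<le> t"
    and f: "\<And>e. e > 0 \<Longrightarrow> \<forall>\<^sub>F k in sequentially. \<forall>j\<in>{a k..<b k}. dist (f k j) (F (h k * of_int j)) \<le> e"
    and e: "e > 0"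
  shows "\<forall>\<^sub>F k in sequentially. \<forall>j\<in>{a k..b k}.
     dist (\<Sum>i\<in>{a k..<j}. h k *\<^sub>R f k i) (Fa (h k * of_int j) - Fa s) \<le> e"
proof -
  \<comment> \<open>The cell errors add up to at most \<open>2 * e1 * (t - s + 1) = e / 2\<close>;
    the other half of \<open>e\<close> pays for the first grid point not being \<open>s\<close>. The
    1 avoids a zero denominator.\<close>
  define e1 where "e1 = e / (4 * (t - s + 1))"
  have e1: "e1 > 0" using e st by (simp add: e1_def)
  have "uniformly_continuous_on {s..t} F"
    by (intro compact_uniformly_continuous continuous_on_subset[OF cont]) auto
  then obtain d where d: "d > 0" "\<And>x y. x \<in> {s..t} \<Longrightarrow> y \<in> {s..t} \<Longrightarrow> dist y x < d \<Longrightarrow> dist (F y) (F x) < e1"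
    using e1 unfolding uniformly_continuous_on_def by meson
  have "isCont Fa s" using der has_vector_derivative_continuous by blast
  then have "(\<lambda>k. Fa (h k * of_int (a k))) \<longlonglongrightarrow> Fa s" using a by (rule isCont_tendsto_compose)
  then have "\<forall>\<^sub>F k in sequentially. dist (Fa (h k * of_int (a k))) (Fa s) < e / 2"
    using e by (intro tendstoD) auto
  moreover have "\<forall>\<^sub>F k in sequentially. h k < d" using order_tendstoD(2)[OF h(2) d(1)] .
  ultimately show ?thesis using f[OF e1]
  proof eventually_elim
    case (elim k)
    define g where "g j = Fa (h k * of_int j)" for j :: int
    have piece: "norm (h k *\<^sub>R f k i - (g (i + 1) - g i)) \<le> 2 * e1 * h k" if i: "i \<in> {a k..<b k}" for i
    proof -
      let ?x = "h k * of_int i" and ?y = "h k * of_int (i + 1)"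
      have xy: "s \<le> ?x" "?x \<le> ?y" "?y \<le> t" "?y - ?x = h k" using ab[of k i] ab[of k "i + 1"] i h(1)[of k]
        by (auto simp: algebra_simps)
      have "norm (Fa ?y - Fa ?x - (?y - ?x) *\<^sub>R F ?x) \<le> norm (?y - ?x) * e1"
      proof (rule vector_differentiable_bound_linearization)
        show "(Fa has_vector_derivative F u) (at u within {?x..?y})" for u
          using der has_vector_derivative_at_within by blast
        show "closed_segment ?x ?y \<subseteq> {?x..?y}" using xy by (simp add: closed_segment_eq_real_ivl)
        show "norm (F u - F ?x) \<le> e1" if "u \<in> {?x..?y}" for u
        proof -
          have "dist u ?x < d" using that xy(4) elim(2) by (auto simp: dist_real_def)
          then show ?thesis using d(2)[of ?x u] that xy by (auto simp: dist_norm)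
        qed
        show "?x \<in> {?x..?y}" using xy by simp
      qed
      then have 1: "norm (g (i + 1) - g i - h k *\<^sub>R F ?x) \<le> h k * e1"
        unfolding xy(4) g_def using h(1)[of k] by simp
      have "norm (h k *\<^sub>R (f k i - F ?x)) \<le> h k * e1"
        using elim(3) i h(1)[of k] by (simp add: dist_norm)
      moreover have "h k *\<^sub>R f k i - (g (i + 1) - g i) = h k *\<^sub>R (f k i - F ?x) - (g (i + 1) - g i - h k *\<^sub>R F ?x)"
        by (simp add: algebra_simps)
      ultimately have "norm (h k *\<^sub>R f k i - (g (i + 1) - g i)) \<le> h k * e1 + h k * e1"
        using 1 norm_triangle_le_diff by (metis (no_types, lifting) add_mono)
      then show ?thesis by simp
    qed
    show ?case
    proof
      fix j assume j: "j \<in> {a k..b k}"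
      have tele: "(\<Sum>i\<in>{a k..<j}. g (i + 1) - g i) = g j - g (a k)"
      proof -
        have "a k \<le> j" using j by simp
        then show ?thesis
        proof (induction j rule: int_ge_induct)
          case (step i)
          have "{a k..<i + 1} = insert i {a k..<i}" using step by auto
          then show ?case using step by simp
        qed simp
      qed
      have "norm ((\<Sum>i\<in>{a k..<j}. h k *\<^sub>R f k i) - (g j - g (a k))) = norm (\<Sum>i\<in>{a k..<j}. h k *\<^sub>R f k i - (g (i + 1) - g i))"
        by (simp only: tele[symmetric] sum_subtractf)
      also have "\<dots> \<le> (\<Sum>i\<in>{a k..<j}. 2 * e1 * h k)" using j by (intro sum_norm_le piece) auto
      also have "\<dots> = 2 * e1 * (h k * of_int j - h k * of_int (a k))" using j by (simp add: algebra_simps)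
      also have "\<dots> \<le> 2 * e1 * (t - s + 1)"
        using ab[of k j] ab[of k "a k"] j e1 by (intro mult_left_mono) auto
      also have "\<dots> = e / 2"
      proof -
        have "t - s + 1 \<noteq> 0" using st by simp
        then show ?thesis unfolding e1_def by (simp add: divide_simps del: diff_add_eq)
      qed
      finally have "dist (\<Sum>i\<in>{a k..<j}. h k *\<^sub>R f k i) (g j - g (a k)) \<le> e / 2" by (simp add: dist_norm)
      moreover have "dist (g j - g (a k)) (g j - Fa s) < e / 2" using elim(1) by (simp add: g_def dist_norm norm_minus_commute)
      ultimately show "dist (\<Sum>i\<in>{a k..<j}. h k *\<^sub>R f k i) (Fa (h k * of_int j) - Fa s) \<le> e"
        using dist_triangle[of "\<Sum>i\<in>{a k..<j}. h k *\<^sub>R f k i" "g j - Fa s" "g j - g (a k)"] by (simp add: g_def)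
    qed
  qed
qed

lemma antiderivative_UNIV:
  fixes f :: "real \<Rightarrow> 'a::euclidean_space"
  assumes "continuous_on UNIV f"
  obtains F where "\<And>t. (F has_vector_derivative f t) (at t)"
  using einterval_antiderivative[of "-\<infinity>" \<infinity> f] assms by (auto simp: continuous_on_eq_continuous_at)

context limit_curve begin

lemma q_cont: "continuous_on UNIV q" using q_uniform by (rule uniformly_continuous_imp_continuous)

lemma X_node: "X k \<lfloor>(h k * of_int j) / h k\<rfloor> = X k j"
  using h_pos[of k] by simp

text \<open>Rounding is inwards, so that the indices from \<open>lo s k\<close> to
  \<open>hi t k\<close> are exactly those of the nodes with time in \<open>{s..t}\<close>.\<close>

definition lo :: "real \<Rightarrow> nat \<Rightarrow> int" where "lo s k = \<lceil>s / h k\<rceil>"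
definition hi :: "real \<Rightarrow> nat \<Rightarrow> int" where "hi t k = \<lfloor>t / h k\<rfloor>"
definition velo :: "nat \<Rightarrow> int \<Rightarrow> real^'n" where "velo k j = (X k (j + 1) - X k j) /\<^sub>R h k"

lemma lo_hi: assumes "lo s k \<le> j" "j \<le> hi t k" shows "s \<le> h k * of_int j" "h k * of_int j \<le> t"
proof -
  have "s / h k \<le> of_int j" using assms(1) by (simp add: lo_def ceiling_le_iff)
  then show "s \<le> h k * of_int j" using h_pos[of k] by (simp add: field_simps)
  have "of_int j \<le> t / h k" using assms(2) by (simp add: hi_def le_floor_iff)
  then show "h k * of_int j \<le> t" using h_pos[of k] by (simp add: field_simps)
qed

lemma lo_bounds: "s \<le> h k * of_int (lo s k)" "h k * of_int (lo s k) \<le> s + h k"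
proof -
  have "s / h k \<le> of_int (lo s k)" "of_int (lo s k) \<le> s / h k + 1" unfolding lo_def by linarith+
  then have "h k * (s / h k) \<le> h k * of_int (lo s k)" "h k * of_int (lo s k) \<le> h k * (s / h k + 1)"
    using h_pos[of k] by (simp_all only: mult_le_cancel_left_pos)
  then show "s \<le> h k * of_int (lo s k)" "h k * of_int (lo s k) \<le> s + h k"
    using h_pos[of k] by (simp_all add: distrib_left)
qed

lemma hi_bounds: "h k * of_int (hi s k) \<le> s" "s - h k \<le> h k * of_int (hi s k)"
proof -
  have "of_int (hi s k) \<le> s / h k" "s / h k - 1 \<le> of_int (hi s k)" unfolding hi_def by linarith+
  then have "h k * of_int (hi s k) \<le> h k * (s / h k)" "h k * (s / h k - 1) \<le> h k * of_int (hi s k)"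
    using h_pos[of k] by (simp_all only: mult_le_cancel_left_pos)
  then show "h k * of_int (hi s k) \<le> s" "s - h k \<le> h k * of_int (hi s k)"
    using h_pos[of k] by (simp_all add: right_diff_distrib)
qed

lemma lo_lim: "(\<lambda>k. h k * of_int (lo s k)) \<longlonglongrightarrow> s"
  by (rule tendsto_sandwich[of "\<lambda>_. s" _ _ "\<lambda>k. s + h k"])
    (use lo_bounds tendsto_add[OF tendsto_const h_lim, of s] in auto)

lemma hi_lim: "(\<lambda>k. h k * of_int (hi s k)) \<longlonglongrightarrow> s"
  by (rule tendsto_sandwich[of "\<lambda>k. s - h k" _ _ "\<lambda>k. s"])
    (use hi_bounds tendsto_diff[OF tendsto_const h_lim, of s] in auto)

lemma lo_le_hi: assumes "s < t" shows "\<forall>\<^sub>F k in sequentially. lo s k \<le> hi t k"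
proof -
  have "\<forall>\<^sub>F k in sequentially. h k < (t - s) / 2" using assms by (intro order_tendstoD(2)[OF h_lim]) auto
  then show ?thesis
  proof eventually_elim
    case (elim k)
    have "h k * of_int (lo s k) \<le> h k * of_int (hi t k)"
      using elim lo_bounds(2)[of k s] hi_bounds(2)[of t k] by (simp add: field_simps)
    then show ?case using h_pos[of k] by simp
  qed
qed

lemma X_uniform:
  assumes "e > 0"
  shows "\<forall>\<^sub>F k in sequentially. \<forall>j\<in>{lo s k..hi t k}. dist (X k j) (q (h k * of_int j)) \<le> e"
  using q_lim[OF assms, of "max \<bar>s\<bar> \<bar>t\<bar>"]
proof eventually_elim
  case (elim k)
  show ?case
  proof
    fix j assume "j \<in> {lo s k..hi t k}"
    then have "\<bar>h k * of_int j\<bar> \<le> max \<bar>s\<bar> \<bar>t\<bar>" using lo_hi[of s k j t] by auto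
    then show "dist (X k j) (q (h k * of_int j)) \<le> e" using elim X_node by fastforce
  qed
qed

lemma q_bounded_range: "bounded (\<Union>k. (\<lambda>j. q (h k * of_int j)) ` {lo s k..hi t k})"
proof (rule bounded_subset)
  show "bounded (q ` {s..t})"
    by (intro compact_imp_bounded compact_continuous_image continuous_on_subset[OF q_cont]) auto
  show "(\<Union>k. (\<lambda>j. q (h k * of_int j)) ` {lo s k..hi t k}) \<subseteq> q ` {s..t}" using lo_hi by force
qed

lemma X_compose_uniform:
  fixes f :: "real^'n \<Rightarrow> 'b::metric_space"
  assumes "continuous_on UNIV f" "e > 0"
  shows "\<forall>\<^sub>F k in sequentially. \<forall>j\<in>{lo s k..hi t k}. dist (f (X k j)) (f (q (h k * of_int j))) \<le> e"
  by (rule uniform_limit_compose[OF assms(1) X_uniform q_bounded_range assms(2)])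

lemma X_hi_lim: "(\<lambda>k. X k (hi t k)) \<longlonglongrightarrow> q t"
proof (rule tendstoI)
  fix e :: real assume "e > 0"
  from q_lim[OF this, of "\<bar>t\<bar>"] show "\<forall>\<^sub>F k in sequentially. dist (X k (hi t k)) (q t) < e"
    by eventually_elim (simp add: hi_def)
qed

lemma X_lo_lim: "(\<lambda>k. X k (lo s k)) \<longlonglongrightarrow> q s"
proof (rule tendstoI)
  fix e :: real assume e: "e > 0"
  have "isCont q s" using q_cont by (simp add: continuous_on_eq_continuous_at)
  then have "(\<lambda>k. q (h k * of_int (lo s k))) \<longlonglongrightarrow> q s" using lo_lim by (rule isCont_tendsto_compose)
  then have "\<forall>\<^sub>F k in sequentially. dist (q (h k * of_int (lo s k))) (q s) < e / 2" using e by (intro tendstoD) auto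
  moreover have "\<forall>\<^sub>F k in sequentially. \<forall>j\<in>{lo s k..hi (s + 1) k}. dist (X k j) (q (h k * of_int j)) \<le> e / 2"
    by (rule X_uniform) (use e in simp)
  ultimately show "\<forall>\<^sub>F k in sequentially. dist (X k (lo s k)) (q s) < e"
    using lo_le_hi[of s "s + 1", simplified]
  proof eventually_elim
    case (elim k)
    then have "dist (X k (lo s k)) (q (h k * of_int (lo s k))) \<le> e / 2" by auto
    then show ?case using elim(1) dist_triangle[of "X k (lo s k)" "q s" "q (h k * of_int (lo s k))"] by linarith
  qed
qed

text \<open>The minimum of \<open>V\<close> along the compact arc exceeds \<open>c\<close>; half of
  the excess absorbs the approximation error.\<close>

lemma V_above_eventually:
  assumes "\<And>u. u \<in> {s..t} \<Longrightarrow> V (q u) > c"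
  shows "\<forall>\<^sub>F k in sequentially. \<forall>j\<in>{lo s k..hi t k}. V (X k j) > c"
proof (cases "s \<le> t")
  case False
  have "\<And>k j. j \<notin> {lo s k..hi t k}" using lo_hi[of s _ _ t] False by fastforce
  then show ?thesis by auto
next
  case True
  have "continuous_on {s..t} (\<lambda>u. V (q u))"
    by (intro continuous_on_compose2[OF V_cont] continuous_on_subset[OF q_cont]) auto
  then obtain u where u: "u \<in> {s..t}" "\<And>v. v \<in> {s..t} \<Longrightarrow> V (q u) \<le> V (q v)"
    using continuous_attains_inf[of "{s..t}" "\<lambda>u. V (q u)"] True by auto
  have "\<forall>\<^sub>F k in sequentially. \<forall>j\<in>{lo s k..hi t k}. dist (V (X k j)) (V (q (h k * of_int j))) \<le> (V (q u) - c) / 2"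
    using assms[OF u(1)] by (intro X_compose_uniform V_cont) auto
  then show ?thesis
  proof eventually_elim
    case (elim k)
    show ?case
    proof
      fix j assume j: "j \<in> {lo s k..hi t k}"
      then have "h k * of_int j \<in> {s..t}" using lo_hi[of s k j t] by auto
      then have "V (q (h k * of_int j)) \<ge> V (q u)" by (rule u(2))
      moreover have "dist (V (X k j)) (V (q (h k * of_int j))) \<le> (V (q u) - c) / 2" using elim j by blast
      ultimately show "V (X k j) > c" using assms[OF u(1)] unfolding dist_real_def abs_le_iff by argo
    qed
  qed
qed

lemma momentum_sum:
  assumes above: "\<forall>j\<in>{lo s k..hi t k}. V (X k j) > c" and j: "j \<in> {lo s k..hi t k}"
  shows "Pv (velo k j) = Pv (velo k (lo s k)) + (\<Sum>i\<in>{lo s k..<j}. h k *\<^sub>R grad V (X k (i + 1)))"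
proof -
  have "lo s k \<le> j" using j by simp
  then show ?thesis using j
  proof (induction j rule: int_ge_induct)
    case (step i)
    have "{lo s k..<i + 1} = insert i {lo s k..<i}" using step by auto
    moreover have "Pv (velo k (i + 1)) - Pv (velo k i) = h k *\<^sub>R grad V (X k (i + 1))"
      using EL[of k "i + 1"] above step by (auto simp: velo_def)
    ultimately show ?case using step by (simp add: algebra_simps)
  qed simp
qed

lemma position_sum:
  assumes "lo s k \<le> j"
  shows "X k j = X k (lo s k) + (\<Sum>i\<in>{lo s k..<j}. h k *\<^sub>R velo k i)"
  using assms
proof (induction j rule: int_ge_induct)
  case (step i)
  have "{lo s k..<i + 1} = insert i {lo s k..<i}" using step by auto
  then show ?case using step h_pos[of k] by (simp add: velo_def)
qed simp

text \<open>The discrete equations are summed twice. Momenta are the initial momentum plus a Riemann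
  sum of forces, hence converge uniformly; the continuous map \<open>Psi\<close> passes this on to
  velocities, whose Riemann sums give positions. The costs are Riemann sums as well, so an eventual
  bound on them passes to the action, expressed through an antiderivative \<open>Ja\<close>.\<close>

lemma regularity_if_momentum_converges:
  assumes st: "s < t" and above: "\<And>u. u \<in> {s..t} \<Longrightarrow> V (q u) > c"
    and p0: "(\<lambda>k. Pv (velo k (lo s k))) \<longlonglongrightarrow> p0"
  obtains p where "\<And>u. (p has_vector_derivative grad V (q u)) (at u)"
    "\<And>u. u \<in> {s<..<t} \<Longrightarrow> (q has_vector_derivative Psi (p u)) (at u)"
    "\<And>Ja B. (\<And>u. (Ja has_vector_derivative (\<Phi> (norm (Psi (p u))) + W (q u))) (at u)) \<Longrightarrow>
      (\<forall>\<^sub>F k in sequentially. icost (h k) (X k) (lo s k) (hi t k) \<le> B) \<Longrightarrow> Ja t - Ja s \<le> B"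
proof -
  have gq: "continuous_on UNIV (\<lambda>u. grad V (q u))"
    by (rule continuous_on_compose2[OF grad_cont q_cont]) auto
  obtain Ga where Ga: "\<And>u. (Ga has_vector_derivative grad V (q u)) (at u)" by (rule antiderivative_UNIV[OF gq]) blast
  define p where "p u = p0 + (Ga u - Ga s)" for u
  have dp: "(p has_vector_derivative grad V (q u)) (at u)" for u
    unfolding p_def[abs_def] using Ga by (auto intro!: derivative_eq_intros)
  have p_cont: "continuous_on UNIV p"
    using dp by (intro continuous_at_imp_continuous_on ballI has_vector_derivative_continuous)
  have Pp: "continuous_on UNIV (\<lambda>u. Psi (p u))" by (rule continuous_on_compose2[OF Psi_continuous p_cont]) auto
  obtain Fa where Fa: "\<And>u. (Fa has_vector_derivative Psi (p u)) (at u)" by (rule antiderivative_UNIV[OF Pp]) blast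
  note bnd = lo_hi[of s _ _ t]
  have lh: "lo s k \<le> j \<Longrightarrow> j \<le> hi t k \<Longrightarrow> s \<le> h k * of_int j \<and> h k * of_int j \<le> t" for k j
    using bnd by blast
  have Vab: "\<forall>\<^sub>F k in sequentially. \<forall>j\<in>{lo s k..hi t k}. V (X k j) > c"
    by (rule V_above_eventually) (rule above)
  \<comment> \<open>The momentum gains the force at node \<open>j + 1\<close>, whereas the Riemann
    sums take values at the left node; uniform continuity absorbs one mesh width.\<close>
  have shift: "\<forall>\<^sub>F k in sequentially. \<forall>j\<in>{lo s k..<hi t k}. dist (grad V (X k (j + 1))) (grad V (q (h k * of_int j))) \<le> e"
    if "e > 0" for e
  proof -
    have "uniformly_continuous_on {s..t} (\<lambda>u. grad V (q u))"
      by (intro compact_uniformly_continuous continuous_on_subset[OF gq]) auto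
    then obtain d where d: "d > 0" "\<And>x y. x \<in> {s..t} \<Longrightarrow> y \<in> {s..t} \<Longrightarrow> dist y x < d \<Longrightarrow> dist (grad V (q y)) (grad V (q x)) < e / 2"
      using \<open>e > 0\<close> half_gt_zero unfolding uniformly_continuous_on_def by meson
    have "\<forall>\<^sub>F k in sequentially. h k < d" using order_tendstoD(2)[OF h_lim d(1)] .
    then show ?thesis using X_compose_uniform[OF grad_cont half_gt_zero[OF \<open>e > 0\<close>], of s t]
    proof eventually_elim
      case (elim k)
      show ?case
      proof
        fix j assume j: "j \<in> {lo s k..<hi t k}"
        have "dist (grad V (X k (j + 1))) (grad V (q (h k * of_int (j + 1)))) \<le> e / 2" using bspec[OF elim(2), of "j + 1"] j by simp
        moreover have "dist (grad V (q (h k * of_int (j + 1)))) (grad V (q (h k * of_int j))) < e / 2"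
        proof (rule d(2))
          show "h k * of_int j \<in> {s..t}" "h k * of_int (j + 1) \<in> {s..t}" using lh[of k j] lh[of k "j + 1"] j by auto
          show "dist (h k * of_int (j + 1)) (h k * of_int j) < d" using elim(1) h_pos[of k] by (simp add: dist_real_def algebra_simps)
        qed
        ultimately show "dist (grad V (X k (j + 1))) (grad V (q (h k * of_int j))) \<le> e"
          using dist_triangle[of "grad V (X k (j + 1))" "grad V (q (h k * of_int j))" "grad V (q (h k * of_int (j + 1)))"] by linarith
      qed
    qed
  qed
  have P_unif: "\<forall>\<^sub>F k in sequentially. \<forall>j\<in>{lo s k..hi t k}. dist (Pv (velo k j)) (p (h k * of_int j)) \<le> e" if "e > 0" for e
  proof -
    have "\<forall>\<^sub>F k in sequentially. \<forall>j\<in>{lo s k..hi t k}.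
      dist (\<Sum>i\<in>{lo s k..<j}. h k *\<^sub>R grad V (X k (i + 1))) (Ga (h k * of_int j) - Ga s) \<le> e / 2"
      by (rule uniform_Riemann_sums[OF Ga gq h_pos h_lim lh lo_lim less_imp_le[OF st] shift half_gt_zero[OF that]])
    moreover have "\<forall>\<^sub>F k in sequentially. dist (Pv (velo k (lo s k))) p0 < e / 2"
      using tendstoD[OF p0 half_gt_zero[OF that]] .
    ultimately show ?thesis using Vab
    proof eventually_elim
      case (elim k)
      show ?case
      proof
        fix j assume j: "j \<in> {lo s k..hi t k}"
        have "dist (Pv (velo k j)) (p (h k * of_int j)) \<le>
          dist (Pv (velo k (lo s k))) p0 + dist (\<Sum>i\<in>{lo s k..<j}. h k *\<^sub>R grad V (X k (i + 1))) (Ga (h k * of_int j) - Ga s)"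
          unfolding momentum_sum[OF elim(3) j] p_def by (rule dist_triangle_add)
        then show "dist (Pv (velo k j)) (p (h k * of_int j)) \<le> e" using elim(1,2) j by fastforce
      qed
    qed
  qed
  have v_bdd: "bounded (\<Union>k. (\<lambda>j. f (h k * of_int j)) ` {lo s k..hi t k})" if "continuous_on UNIV f" for f :: "real \<Rightarrow> real^'n"
  proof (rule bounded_subset)
    show "bounded (f ` {s..t})"
      by (intro compact_imp_bounded compact_continuous_image continuous_on_subset[OF that]) auto
    show "(\<Union>k. (\<lambda>j. f (h k * of_int j)) ` {lo s k..hi t k}) \<subseteq> f ` {s..t}" using lh by force
  qed
  have v_unif: "\<forall>\<^sub>F k in sequentially. \<forall>j\<in>{lo s k..hi t k}. dist (velo k j) (Psi (p (h k * of_int j))) \<le> e" if "e > 0" for e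
    using uniform_limit_compose[OF Psi_continuous P_unif v_bdd[OF p_cont] that] by simp
  have Phi_unif: "\<forall>\<^sub>F k in sequentially. \<forall>j\<in>{lo s k..hi t k}.
      dist (\<Phi> (norm (velo k j))) (\<Phi> (norm (Psi (p (h k * of_int j))))) \<le> e" if "e > 0" for e
    by (rule uniform_limit_compose[OF Phi_norm_continuous v_unif v_bdd[OF Pp] that])
  \<comment> \<open>The time \<open>u\<close> need not be a grid point: the sum runs up to
    \<open>hi u k\<close>, and continuity of \<open>Fa\<close> closes the remaining gap.\<close>
  have q_eq: "q u = q s + (Fa u - Fa s)" if u: "u \<in> {s<..t}" for u
  proof -
    have "(\<lambda>k. \<Sum>i\<in>{lo s k..<hi u k}. h k *\<^sub>R velo k i) \<longlonglongrightarrow> Fa u - Fa s"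
    proof (rule tendstoI)
      fix e :: real assume e: "e > 0"
      have "isCont Fa u" using Fa has_vector_derivative_continuous by blast
      then have "(\<lambda>k. Fa (h k * of_int (hi u k))) \<longlonglongrightarrow> Fa u" using hi_lim by (rule isCont_tendsto_compose)
      then have "\<forall>\<^sub>F k in sequentially. dist (Fa (h k * of_int (hi u k))) (Fa u) < e / 2" using e by (intro tendstoD) auto
      moreover have "\<forall>\<^sub>F k in sequentially. \<forall>j\<in>{lo s k..hi t k}.
        dist (\<Sum>i\<in>{lo s k..<j}. h k *\<^sub>R velo k i) (Fa (h k * of_int j) - Fa s) \<le> e / 2"
      proof (rule uniform_Riemann_sums[OF Fa Pp h_pos h_lim lh lo_lim less_imp_le[OF st] _ half_gt_zero[OF e]])
        show "\<forall>\<^sub>F k in sequentially. \<forall>j\<in>{lo s k..<hi t k}. dist (velo k j) (Psi (p (h k * of_int j))) \<le> e'" if "e' > 0" for e'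
          using v_unif[OF that] by eventually_elim auto
      qed
      moreover have "\<forall>\<^sub>F k in sequentially. lo s k \<le> hi u k" using lo_le_hi u by auto
      ultimately show "\<forall>\<^sub>F k in sequentially. dist (\<Sum>i\<in>{lo s k..<hi u k}. h k *\<^sub>R velo k i) (Fa u - Fa s) < e"
      proof eventually_elim
        case (elim k)
        have "hi u k \<le> hi t k" using u h_pos[of k] by (auto simp: hi_def intro!: floor_mono divide_right_mono)
        then have "dist (\<Sum>i\<in>{lo s k..<hi u k}. h k *\<^sub>R velo k i) (Fa (h k * of_int (hi u k)) - Fa s) \<le> e / 2"
          using elim by auto
        moreover have "dist (Fa (h k * of_int (hi u k)) - Fa s) (Fa u - Fa s) < e / 2" using elim(1) by (simp add: dist_norm)
        ultimately show ?case using dist_triangle by (smt (verit) field_sum_of_halves)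
      qed
    qed
    then have "(\<lambda>k. X k (lo s k) + (\<Sum>i\<in>{lo s k..<hi u k}. h k *\<^sub>R velo k i)) \<longlonglongrightarrow> q s + (Fa u - Fa s)"
      by (intro tendsto_add X_lo_lim)
    moreover have "\<forall>\<^sub>F k in sequentially. X k (lo s k) + (\<Sum>i\<in>{lo s k..<hi u k}. h k *\<^sub>R velo k i) = X k (hi u k)"
    proof -
      have "\<forall>\<^sub>F k in sequentially. lo s k \<le> hi u k" using lo_le_hi u by auto
      then show ?thesis by eventually_elim (rule position_sum[symmetric])
    qed
    ultimately have "(\<lambda>k. X k (hi u k)) \<longlonglongrightarrow> q s + (Fa u - Fa s)" by (rule Lim_transform_eventually)
    then show ?thesis using X_hi_lim LIMSEQ_unique by blast
  qed
  have dq: "(q has_vector_derivative Psi (p u)) (at u)" if u: "u \<in> {s<..<t}" for u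
  proof (rule has_vector_derivative_transform_within_open)
    show "((\<lambda>u. q s + (Fa u - Fa s)) has_vector_derivative Psi (p u)) (at u)"
      using Fa by (auto intro!: derivative_eq_intros)
    show "open {s<..<t}" "u \<in> {s<..<t}" using u by auto
    show "q s + (Fa u - Fa s) = q u" if "u \<in> {s<..<t}" for u using q_eq[of u] that by auto
  qed
  have act: "Ja t - Ja s \<le> B"
    if Ja: "\<And>u. (Ja has_vector_derivative (\<Phi> (norm (Psi (p u))) + W (q u))) (at u)"
      and B: "\<forall>\<^sub>F k in sequentially. icost (h k) (X k) (lo s k) (hi t k) \<le> B" for Ja :: "real \<Rightarrow> real" and B
  proof (rule field_le_epsilon)
    fix e :: real assume e: "e > 0"
    have contJ: "continuous_on UNIV (\<lambda>u. \<Phi> (norm (Psi (p u))) + W (q u))"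
      by (intro continuous_on_add continuous_on_compose2[OF Phi_norm_continuous Pp] continuous_on_compose2[OF W_cont q_cont]) auto
    have fu: "\<forall>\<^sub>F k in sequentially. \<forall>j\<in>{lo s k..<hi t k}.
      dist (\<Phi> (norm (velo k j)) + W (X k j)) (\<Phi> (norm (Psi (p (h k * of_int j)))) + W (q (h k * of_int j))) \<le> e'"
      if "e' > 0" for e'
      using Phi_unif[OF half_gt_zero[OF that]] X_compose_uniform[OF W_cont half_gt_zero[OF that], of s t]
    proof eventually_elim
      case (elim k)
      show ?case
      proof
        fix j assume j: "j \<in> {lo s k..<hi t k}"
        then have "j \<in> {lo s k..hi t k}" by simp
        then show "dist (\<Phi> (norm (velo k j)) + W (X k j)) (\<Phi> (norm (Psi (p (h k * of_int j)))) + W (q (h k * of_int j))) \<le> e'"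
          using bspec[OF elim(1)] bspec[OF elim(2)]
            dist_triangle_add[of "\<Phi> (norm (velo k j))" "W (X k j)" "\<Phi> (norm (Psi (p (h k * of_int j))))" "W (q (h k * of_int j))"]
          by fastforce
      qed
    qed
    have "isCont Ja t" using Ja has_vector_derivative_continuous by blast
    then have "(\<lambda>k. Ja (h k * of_int (hi t k))) \<longlonglongrightarrow> Ja t" using hi_lim by (rule isCont_tendsto_compose)
    then have 1: "\<forall>\<^sub>F k in sequentially. dist (Ja (h k * of_int (hi t k))) (Ja t) < e / 2" using e by (intro tendstoD) auto
    have 2: "\<forall>\<^sub>F k in sequentially. \<forall>j\<in>{lo s k..hi t k}.
        dist (\<Sum>i\<in>{lo s k..<j}. h k *\<^sub>R (\<Phi> (norm (velo k i)) + W (X k i))) (Ja (h k * of_int j) - Ja s) \<le> e / 2"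
      by (rule uniform_Riemann_sums[OF Ja contJ h_pos h_lim lh lo_lim less_imp_le[OF st] fu half_gt_zero[OF e]])
    have "\<forall>\<^sub>F k in sequentially. Ja t - Ja s \<le> B + e" using 1 2 B lo_le_hi[OF st]
    proof eventually_elim
      case (elim k)
      have "icost (h k) (X k) (lo s k) (hi t k) = (\<Sum>i\<in>{lo s k..<hi t k}. h k *\<^sub>R (\<Phi> (norm (velo k i)) + W (X k i)))"
        by (simp add: icost_def stepcost_def velo_def)
      then have "dist (icost (h k) (X k) (lo s k) (hi t k)) (Ja (h k * of_int (hi t k)) - Ja s) \<le> e / 2"
        using elim by auto
      then show ?case using elim(1,3) unfolding dist_real_def abs_le_iff abs_less_iff by linarith
    qed
    then show "Ja t - Ja s \<le> B + e" by simp
  qed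
  show thesis by (rule that[OF dp dq act])
qed

text \<open>If all discrete speeds in the window exceeded \<open>R0\<close>, superlinearity would
  push its cost above \<open>L + 1\<close>. So one momentum is bounded, and the forces, bounded
  along the compact arc, change it by a bounded amount on the way back to the left end.\<close>

lemma momentum_bounded:
  assumes st: "s < t" and above: "\<And>u. u \<in> {s..t} \<Longrightarrow> V (q u) > c"
  shows "\<exists>R. \<forall>\<^sub>F k in sequentially. norm (Pv (velo k (lo s k))) \<le> R"
proof -
  obtain C where C: "C \<ge> 0" "\<And>r. r \<ge> 0 \<Longrightarrow> 1 * r \<le> \<Phi> r + C" using Phi_superlinear[of 1] by blast
  \<comment> \<open>Once \<open>h k < (t - s) / 4\<close> the window lasts longer than
    \<open>(t - s) / 2\<close>, so speeds of at least \<open>R0\<close> would produce a length of at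
    least \<open>L + 1 + C * (t - s)\<close>.\<close>
  define R0 where "R0 = max 0 (2 * (L + 1 + C * (t - s)) / (t - s))"
  have "bounded ((\<lambda>u. grad V (q u)) ` {s..t})"
    by (intro compact_imp_bounded compact_continuous_image continuous_on_compose2[OF grad_cont] continuous_on_subset[OF q_cont]) auto
  then obtain D where "\<forall>y\<in>(\<lambda>u. grad V (q u)) ` {s..t}. norm y \<le> D" unfolding bounded_iff by blast
  then have D: "norm (grad V (q u)) \<le> D" if "u \<in> {s..t}" for u using that by blast
  have "norm (grad V (q s)) \<le> D" using D st by simp
  then have "D \<ge> 0" using norm_ge_zero[of "grad V (q s)"] by linarith
  have Vab: "\<forall>\<^sub>F k in sequentially. \<forall>j\<in>{lo s k..hi t k}. V (X k j) > c"
    by (rule V_above_eventually) (rule above)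
  have "\<forall>\<^sub>F k in sequentially. h k < (t - s) / 4" using st by (intro order_tendstoD(2)[OF h_lim]) auto
  moreover have "\<forall>\<^sub>F k in sequentially. cost (h k) (x k) (N k) < L + 1" by (intro order_tendstoD(2)[OF L_lim]) auto
  moreover have "\<forall>\<^sub>F k in sequentially. \<forall>j\<in>{lo s k..hi t k}. dist (grad V (X k j)) (grad V (q (h k * of_int j))) \<le> 1"
    by (intro X_compose_uniform grad_cont) auto
  ultimately have "\<forall>\<^sub>F k in sequentially. norm (Pv (velo k (lo s k))) \<le> P R0 + (t - s) * (D + 1)"
    using Vab lo_le_hi[OF st]
  proof eventually_elim
    case (elim k)
    have len: "h k * of_int (hi t k - lo s k) \<le> t - s" "(t - s) / 2 < h k * of_int (hi t k - lo s k)"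
      using elim(1) lo_bounds[where s=s and k=k] hi_bounds[where s=t and k=k] by (auto simp: right_diff_distrib field_simps)
    have "\<exists>j\<in>{lo s k..<hi t k}. norm (velo k j) \<le> R0"
    proof (rule ccontr)
      assume "\<not> ?thesis"
      then have big: "\<And>j. j \<in> {lo s k..<hi t k} \<Longrightarrow> R0 \<le> norm (velo k j)" by force
      have "R0 * (h k * of_int (hi t k - lo s k)) = (\<Sum>j\<in>{lo s k..<hi t k}. h k * R0)" using elim(5) by simp
      also have "\<dots> \<le> (\<Sum>j\<in>{lo s k..<hi t k}. 1 * norm (X k (j + 1) - X k j))"
      proof (rule sum_mono)
        fix j assume "j \<in> {lo s k..<hi t k}"
        then have "h k * R0 \<le> h k * norm (velo k j)" using big h_pos[of k] by (intro mult_left_mono) auto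
        moreover have "h k * norm (velo k j) = norm (X k (j + 1) - X k j)"
          using h_pos[of k] by (simp add: velo_def)
        ultimately show "h k * R0 \<le> 1 * norm (X k (j + 1) - X k j)" by linarith
      qed
      also have "\<dots> \<le> (\<Sum>j\<in>{lo s k..<hi t k}. stepcost (h k) (X k j) (X k (j + 1)) + C * h k)"
        by (intro sum_mono stepcost_superlinear C h_pos)
      also have "\<dots> = icost (h k) (X k) (lo s k) (hi t k) + C * (h k * of_int (hi t k - lo s k))"
        using elim(5) by (simp add: icost_def sum.distrib)
      also have "\<dots> < L + 1 + C * (t - s)"
        using icost_le[of k "lo s k" "hi t k"] elim(2) mult_left_mono[OF len(1) C(1)] by linarith
      finally have 1: "R0 * (h k * of_int (hi t k - lo s k)) < L + 1 + C * (t - s)" .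
      have "L + 1 + C * (t - s) \<le> R0 * ((t - s) / 2)"
        using st by (simp add: R0_def max_def field_simps)
      also have "\<dots> \<le> R0 * (h k * of_int (hi t k - lo s k))"
        using len(2) by (intro mult_left_mono) (auto simp: R0_def)
      finally show False using 1 by simp
    qed
    then obtain j where j: "j \<in> {lo s k..<hi t k}" "norm (velo k j) \<le> R0" by blast
    let ?S = "\<Sum>i\<in>{lo s k..<j}. h k *\<^sub>R grad V (X k (i + 1))"
    have "norm ?S \<le> (\<Sum>i\<in>{lo s k..<j}. h k * (D + 1))"
    proof (rule sum_norm_le)
      fix i assume "i \<in> {lo s k..<j}"
      then have i: "i + 1 \<in> {lo s k..hi t k}" using j by auto
      have "norm (grad V (X k (i + 1))) \<le> norm (grad V (q (h k * of_int (i + 1)))) + dist (grad V (X k (i + 1))) (grad V (q (h k * of_int (i + 1))))"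
        by (simp add: dist_norm norm_triangle_sub)
      also have "\<dots> \<le> D + 1"
      proof (rule add_mono)
        show "norm (grad V (q (h k * of_int (i + 1)))) \<le> D" using i lo_hi[of s k "i + 1" t] by (intro D) auto
        show "dist (grad V (X k (i + 1))) (grad V (q (h k * of_int (i + 1)))) \<le> 1" by (rule bspec[OF elim(3) i])
      qed
      finally show "norm (h k *\<^sub>R grad V (X k (i + 1))) \<le> h k * (D + 1)" using h_pos[of k] by simp
    qed
    also have "\<dots> = h k * of_int (j - lo s k) * (D + 1)" using j by simp
    also have "\<dots> \<le> (t - s) * (D + 1)"
    proof (rule mult_right_mono)
      have "h k * of_int (j - lo s k) \<le> h k * of_int (hi t k - lo s k)" using j h_pos[of k] by simp
      then show "h k * of_int (j - lo s k) \<le> t - s" using len(1) by linarith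
    qed (use \<open>D \<ge> 0\<close> in simp)
    finally have S: "norm ?S \<le> (t - s) * (D + 1)" .
    have "Pv (velo k (lo s k)) = Pv (velo k j) - ?S" using momentum_sum[OF elim(4), of j] j by simp
    then have "norm (Pv (velo k (lo s k))) \<le> norm (Pv (velo k j)) + norm ?S" by (metis norm_triangle_ineq4)
    also have "norm (Pv (velo k j)) \<le> P R0" unfolding norm_Pv using j by (intro P_mono) auto
    finally show ?case using S by simp
  qed
  then show ?thesis by blast
qed

lemma limit_curve_subseq:
  assumes "strict_mono r"
  shows "limit_curve \<phi> l V c \<delta> Z (\<lambda>k. h (r k)) (\<lambda>k. N (r k)) (\<lambda>k. x (r k)) (\<lambda>k. X (r k)) L q"
proof unfold_locales
  note sub = filterlim_compose[OF _ filterlim_subseq[OF assms]]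
  show "(\<lambda>k. h (r k)) \<longlonglongrightarrow> 0" "(\<lambda>k. cost (h (r k)) (x (r k)) (N (r k))) \<longlonglongrightarrow> L"
    using sub[OF h_lim] sub[OF L_lim] by simp_all
  show "filterlim (\<lambda>k. real (N (r k)) * h (r k)) at_top sequentially" using sub[OF Nh_lim] by simp
  show "\<forall>\<^sub>F k in sequentially. \<forall>t. \<bar>t\<bar> \<le> R \<longrightarrow> dist (X (r k) \<lfloor>t / h (r k)\<rfloor>) (q t) < e" if "e > 0" for R e
    using eventually_subseq[OF assms q_lim[OF that]] .
qed (use h_pos min EL icost_le X_0 X_far icost_cut q_uniform in auto)

text \<open>Bounded initial momenta converge along a subsequence, and this is again an instance of
  the locale with the same \<open>q\<close> and \<open>L\<close>. An eventual bound on the costs is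
  inherited by it.\<close>

lemma regularity:
  assumes st: "s < t" and above: "\<And>u. u \<in> {s..t} \<Longrightarrow> V (q u) > c"
  obtains p where "\<And>u. (p has_vector_derivative grad V (q u)) (at u)"
    "\<And>u. u \<in> {s<..<t} \<Longrightarrow> (q has_vector_derivative Psi (p u)) (at u)"
    "\<And>Ja B. (\<And>u. (Ja has_vector_derivative (\<Phi> (norm (Psi (p u))) + W (q u))) (at u)) \<Longrightarrow>
      (\<forall>\<^sub>F k in sequentially. icost (h k) (X k) (lo s k) (hi t k) \<le> B) \<Longrightarrow> Ja t - Ja s \<le> B"
proof -
  obtain R n0 where R: "\<And>k. k \<ge> n0 \<Longrightarrow> norm (Pv (velo k (lo s k))) \<le> R"
    using momentum_bounded[OF assms] unfolding eventually_sequentially by blast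
  have "bounded (range (\<lambda>k. Pv (velo (k + n0) (lo s (k + n0)))))"
    by (rule boundedI[where B = R]) (use R in auto)
  then obtain p0 r1 where r1: "strict_mono r1" "((\<lambda>k. Pv (velo (k + n0) (lo s (k + n0)))) \<circ> r1) \<longlonglongrightarrow> p0"
    using bounded_imp_convergent_subsequence by blast
  define r where "r k = r1 k + n0" for k
  have r: "strict_mono r" using r1(1) by (auto simp: r_def strict_mono_def)
  interpret sub: limit_curve \<phi> l V c \<delta> Z "\<lambda>k. h (r k)" "\<lambda>k. N (r k)" "\<lambda>k. x (r k)" "\<lambda>k. X (r k)" L q
    by (rule limit_curve_subseq[OF r])
  have eqs: "sub.lo s k = lo s (r k)" "sub.hi t k = hi t (r k)" "sub.velo k j = velo (r k) j" for k j
    by (simp_all add: sub.lo_def lo_def sub.hi_def hi_def sub.velo_def velo_def)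
  have "(\<lambda>k. Pv (sub.velo k (sub.lo s k))) \<longlonglongrightarrow> p0"
    using r1(2) unfolding eqs o_def r_def[symmetric] .
  note P0 = this
  show thesis
  proof (rule sub.regularity_if_momentum_converges[OF st above P0])
    fix p assume p: "\<And>u. (p has_vector_derivative grad V (q u)) (at u)"
      "\<And>u. u \<in> {s<..<t} \<Longrightarrow> (q has_vector_derivative Psi (p u)) (at u)"
      "\<And>Ja B. (\<And>u. (Ja has_vector_derivative (\<Phi> (norm (Psi (p u))) + W (q u))) (at u)) \<Longrightarrow>
        (\<forall>\<^sub>F k in sequentially. icost (h (r k)) (X (r k)) (sub.lo s k) (sub.hi t k) \<le> B) \<Longrightarrow> Ja t - Ja s \<le> B"
    show thesis
    proof (rule that[OF p(1,2)])
      fix Ja B assume J: "\<And>u. (Ja has_vector_derivative (\<Phi> (norm (Psi (p u))) + W (q u))) (at u)"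
        and "\<forall>\<^sub>F k in sequentially. icost (h k) (X k) (lo s k) (hi t k) \<le> B"
      then have "\<forall>\<^sub>F k in sequentially. icost (h (r k)) (X (r k)) (sub.lo s k) (sub.hi t k) \<le> B"
        unfolding eqs by (intro eventually_subseq[OF r])
      then show "Ja t - Ja s \<le> B" by (rule p(3)[OF J])
    qed
  qed
qed

end

section \<open>The lower bound for the action\<close>

lemma integral_ge_rectangle:
  fixes f :: "real \<Rightarrow> real"
  assumes "f integrable_on {s..t}" "s \<le> t" "\<And>u. u \<in> {s..t} \<Longrightarrow> m \<le> f u"
  shows "(t - s) * m \<le> integral {s..t} f"
  using integral_le[of "\<lambda>_. m" "{s..t}" f] assms by (simp add: integrable_const_ivl)

context young begin

text \<open>The tangent inequality at the mean velocity \<open>v\<close> is integrated; its linear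
  term contributes nothing. Only the integral of \<open>p\<close> enters, so a weak derivative will
  do.\<close>

lemma Jensen_Phi:
  fixes p :: "real \<Rightarrow> 'a::euclidean_space"
  assumes st: "s < t" and p: "(p has_integral w) {s..t}" and int: "(\<lambda>u. \<Phi> (norm (p u))) integrable_on {s..t}"
  shows "(t - s) * \<Phi> (norm (w /\<^sub>R (t - s))) \<le> integral {s..t} (\<lambda>u. \<Phi> (norm (p u)))"
proof -
  define v where "v = w /\<^sub>R (t - s)"
  have "((\<lambda>u. inner (Pv v) (p u)) has_integral inner (Pv v) w) {s..t}"
    using has_integral_linear[OF p bounded_linear_inner_right[of "Pv v"]] by (simp add: o_def)
  then have "((\<lambda>u. \<Phi> (norm v) + (inner (Pv v) (p u) - inner (Pv v) v)) has_integral
      (t - s) * \<Phi> (norm v) + (inner (Pv v) w - (t - s) * inner (Pv v) v)) {s..t}"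
    using st by (intro has_integral_add has_integral_diff has_integral_const_real[of _ s t, simplified, THEN has_integral_eq_rhs]) auto
  moreover have "(t - s) * inner (Pv v) v = inner (Pv v) w" using st by (simp add: v_def)
  ultimately have "((\<lambda>u. \<Phi> (norm v) + inner (Pv v) (p u - v)) has_integral (t - s) * \<Phi> (norm v)) {s..t}"
    by (simp add: inner_diff_right)
  then show ?thesis unfolding v_def[symmetric]
  proof (rule has_integral_le[OF _ integrable_integral[OF int]])
    show "\<Phi> (norm v) + inner (Pv v) (p u - v) \<le> \<Phi> (norm (p u))" for u
      using Phi_tangent_norm[of v "p u"] by simp
  qed
qed

end

lemma uniformly_continuous_on_UNIV_D:
  assumes "uniformly_continuous_on UNIV f" "e > 0"
  shows "\<exists>d>0. \<forall>s t. dist s t < d \<longrightarrow> dist (f s) (f t) < e"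
proof -
  obtain d where "d > 0" "\<forall>x\<in>UNIV. \<forall>x'\<in>UNIV. dist x' x < d \<longrightarrow> dist (f x') (f x) < e"
    using assms unfolding uniformly_continuous_on_def by metis
  then show ?thesis by (intro exI[of _ d]) auto
qed

text \<open>If \<open>f t \<ge> e\<close>, uniform continuity keeps \<open>f\<close> above
  \<open>e / 2\<close> for a time \<open>d / 2\<close>, so \<open>F\<close> gains more than
  \<open>e * d / 4\<close>. This is impossible beyond a time at which \<open>F\<close> is within
  \<open>e * d / 8\<close> of its supremum.\<close>

lemma Barbalat:
  fixes f :: "real \<Rightarrow> real"
  assumes uni: "uniformly_continuous_on UNIV f" and nn: "\<And>t. f t \<ge> 0"
    and F: "\<And>t. (F has_vector_derivative f t) (at t)" and bdd: "\<And>t. t \<ge> 0 \<Longrightarrow> F t \<le> M" and e: "e > 0"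
  shows "\<exists>s\<ge>0. \<forall>t\<ge>s. f t < e"
proof -
  obtain d where d: "d > 0" "\<forall>s t. dist s t < d \<longrightarrow> dist (f s) (f t) < e / 2"
    using uniformly_continuous_on_UNIV_D[OF uni half_gt_zero[OF e]] by blast
  have F': "(F has_real_derivative f t) (at t)" for t
    using F by (simp add: has_real_derivative_iff_has_vector_derivative)
  have inc: "F s \<le> F t" if "s \<le> t" for s t
    by (rule DERIV_nonneg_imp_nondecreasing[OF that]) (use F' nn in blast)
  define m where "m = (SUP t\<in>{0..}. F t)"
  have bdd': "bdd_above (F ` {0..})" using bdd by (auto intro!: bdd_aboveI2)
  have "m - e * d / 8 < m" using e d by simp
  then obtain s where s: "s \<ge> 0" "m - e * d / 8 < F s"
    unfolding m_def using less_cSUP_iff[OF _ bdd'] by auto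
  have "f t < e" if "t \<ge> s" for t
  proof (rule ccontr)
    assume "\<not> f t < e"
    have "\<exists>z>t. z < t + d / 2 \<and> F (t + d / 2) - F t = (t + d / 2 - t) * f z"
      using d(1) F' by (intro MVT2) simp_all
    then obtain z where z: "t < z" "z < t + d / 2" "F (t + d / 2) - F t = d / 2 * f z" by auto
    have "dist (f z) (f t) < e / 2" using z d(1) by (intro d(2)[rule_format]) (auto simp: dist_real_def)
    then have "f z > e / 2" using \<open>\<not> f t < e\<close> unfolding dist_real_def by linarith
    then have "d / 2 * (e / 2) < d / 2 * f z" using d(1) by simp
    moreover have "d / 2 * (e / 2) = e * d / 4" by simp
    ultimately have "F (t + d / 2) > F t + e * d / 4" using z(3) by linarith
    moreover have "F (t + d / 2) \<le> m" unfolding m_def by (intro cSUP_upper bdd') (use s that d in auto)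
    moreover have "F s \<le> F t" by (rule inc[OF that])
    moreover have "e * d > 0" using e d by simp
    ultimately show False using s(2) by linarith
  qed
  then show ?thesis using s(1) by blast
qed

context limit_curve begin

text \<open>Sampling at spacing \<open>h k\<close> gives a discrete competitor: Jensen's inequality
  handles the kinetic part of each step, uniform continuity the potential, and short segments join
  the ends to \<open>A0\<close> and \<open>B0\<close>. Minimality of \<open>x k\<close> gives the
  bound for each fine mesh, and \<open>L\<close> is the limit of the minima.\<close>

lemma lower_bound:
  fixes a b \<epsilon> :: real
  assumes ab: "a < b" and cont: "continuous_on {a..b} q1"
    and p: "\<And>s t. a \<le> s \<Longrightarrow> s \<le> t \<Longrightarrow> t \<le> b \<Longrightarrow> (p has_integral (q1 t - q1 s)) {s..t}"
    and int: "(\<lambda>u. \<Phi> (norm (p u))) integrable_on {a..b}"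
    and ends: "A0 \<in> A" "dist A0 (q1 a) \<le> \<epsilon>" "B0 \<in> B" "dist (q1 b) B0 \<le> \<epsilon>"
  shows "L \<le> integral {a..b} (\<lambda>u. \<Phi> (norm (p u)) + W (q1 u)) + 2 * \<epsilon> * speed_const"
proof (rule field_le_epsilon)
  fix e :: real assume e: "e > 0"
  \<comment> \<open>The errors are \<open>e1 * (b - a)\<close> from the potential and
    \<open>4 * e1 * speed_const\<close> from the joining segments, in total
    \<open>e\<close>.\<close>
  define e1 where "e1 = e / (b - a + 4 * speed_const)"
  have pos: "b - a + 4 * speed_const > 0" using ab speed_const(1) by simp
  have e1: "e1 > 0" using e pos by (simp add: e1_def)
  have "\<epsilon> \<ge> 0" using ends(2) zero_le_dist order_trans by blast
  have contW: "continuous_on {a..b} (\<lambda>u. W (q1 u))" by (rule continuous_on_compose2[OF W_cont cont]) auto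
  define f where "f u = \<Phi> (norm (p u)) + W (q1 u)" for u
  have f_int: "f integrable_on {a..b}" unfolding f_def
    by (intro integrable_add int integrable_continuous_real contW)
  have f_nn: "f u \<ge> 0" for u by (simp add: f_def Phi_nonneg W_nonneg)
  have ucW: "uniformly_continuous_on {a..b} (\<lambda>u. W (q1 u))" "uniformly_continuous_on {a..b} q1"
    using contW cont by (auto intro: compact_uniformly_continuous)
  obtain d where d: "d > 0" "\<And>s t. s \<in> {a..b} \<Longrightarrow> t \<in> {a..b} \<Longrightarrow> dist t s < d \<Longrightarrow> dist (W (q1 t)) (W (q1 s)) < e1"
    using ucW(1) e1 unfolding uniformly_continuous_on_def by meson
  obtain d' where d': "d' > 0" "\<And>s t. s \<in> {a..b} \<Longrightarrow> t \<in> {a..b} \<Longrightarrow> dist t s < d' \<Longrightarrow> dist (q1 t) (q1 s) < e1"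
    using ucW(2) e1 unfolding uniformly_continuous_on_def by meson
  have "\<forall>\<^sub>F k in sequentially. h k < min (min d d') e1" using d d' e1 by (intro order_tendstoD(2)[OF h_lim]) auto
  \<comment> \<open>This leaves enough steps for the sampled path and both joining segments.\<close>
  moreover have "\<forall>\<^sub>F k in sequentially. b - a + 2 * (\<epsilon> + e1 + e1) \<le> of_nat (N k) * h k"
    using Nh_lim unfolding filterlim_at_top by blast
  ultimately have "\<forall>\<^sub>F k in sequentially. cost (h k) (x k) (N k) \<le>
    integral {a..b} f + e1 * (b - a) + 2 * ((\<epsilon> + e1 + e1) * speed_const)"
  proof eventually_elim
    case (elim k)
    have hk: "h k > 0" "h k < d" "h k < d'" "h k < e1" using elim h_pos[of k] by auto
    \<comment> \<open>The last node precedes \<open>b\<close> by less than one mesh, which displaces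
      the end point by less than \<open>e1\<close>.\<close>
    define M where "M = nat \<lfloor>(b - a) / h k\<rfloor>"
    define y where "y i = q1 (a + of_nat i * h k)" for i
    have M: "of_nat M * h k \<le> b - a" "b - a < of_nat M * h k + h k"
    proof -
      have "(b - a) / h k \<ge> 0" using ab hk by simp
      then have "real M = of_int \<lfloor>(b - a) / h k\<rfloor>" by (simp add: M_def)
      then have "real M \<le> (b - a) / h k" "(b - a) / h k < real M + 1" by linarith+
      then show "of_nat M * h k \<le> b - a" "b - a < of_nat M * h k + h k" using hk(1) by (simp_all add: field_simps)
    qed
    have node: "a \<le> a + of_nat i * h k" "a + of_nat i * h k \<le> b" if "i \<le> M" for i
    proof -
      have "real i * h k \<le> real M * h k" "0 \<le> real i * h k" using that hk(1) by (auto intro: mult_right_mono)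
      then show "a \<le> a + of_nat i * h k" "a + of_nat i * h k \<le> b" using M(1) by linarith+
    qed
    have "cost (h k) y i \<le> integral {a..a + of_nat i * h k} f + e1 * (of_nat i * h k)" if "i \<le> M" for i
      using that
    proof (induction i)
      case (Suc i)
      let ?s = "a + of_nat i * h k" and ?t = "a + of_nat (Suc i) * h k"
      have st: "a \<le> ?s" "?s < ?t" "?t \<le> b" "?t - ?s = h k" using node[of i] node[of "Suc i"] Suc hk(1)
        by (auto simp: algebra_simps)
      have fi: "f integrable_on {u..v}" "(\<lambda>u. \<Phi> (norm (p u))) integrable_on {u..v}"
        "(\<lambda>u. W (q1 u)) integrable_on {u..v}" if "a \<le> u" "v \<le> b" for u v
        using that integrable_subinterval_real[OF f_int] integrable_subinterval_real[OF int]
          integrable_subinterval_real[OF integrable_continuous_real[OF contW]] by auto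
      have "h k * \<Phi> (norm ((y (Suc i) - y i) /\<^sub>R h k)) \<le> integral {?s..?t} (\<lambda>u. \<Phi> (norm (p u)))"
        using Jensen_Phi[OF st(2) p fi(2)] st(1,2,3) unfolding st(4) y_def by simp
      moreover have "h k * (W (y i) - e1) \<le> integral {?s..?t} (\<lambda>u. W (q1 u))"
      proof -
        have "W (y i) - e1 \<le> W (q1 u)" if "u \<in> {?s..?t}" for u
        proof -
          have "dist ?s u < d" using that st(4) hk(2) unfolding dist_real_def by auto
          moreover have "u \<in> {a..b}" "?s \<in> {a..b}" using that st(1-3) unfolding atLeastAtMost_iff by linarith+
          ultimately have "dist (W (q1 ?s)) (W (q1 u)) < e1" by (intro d(2))
          then show ?thesis unfolding y_def dist_real_def by linarith
        qed
        then show ?thesis using integral_ge_rectangle[OF fi(3)[OF st(1,3)]] st(2,4) by simp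
      qed
      ultimately have "stepcost (h k) (y i) (y (Suc i)) \<le> integral {?s..?t} f + e1 * h k"
        unfolding f_def stepcost_def
        by (subst integral_add[OF fi(2)[OF st(1,3)] fi(3)[OF st(1,3)]]) (simp add: algebra_simps)
      moreover have "integral {a..?t} f = integral {a..?s} f + integral {?s..?t} f"
        using st fi(1) by (intro Henstock_Kurzweil_Integration.integral_combine[symmetric]) auto
      moreover have "cost (h k) y (Suc i) = cost (h k) y i + stepcost (h k) (y i) (y (Suc i))"
        by (simp add: cost_def)
      moreover have "e1 * (of_nat (Suc i) * h k) = e1 * (of_nat i * h k) + e1 * h k" by (simp add: algebra_simps)
      ultimately show ?case using Suc by linarith
    qed (simp add: cost_def)
    then have "cost (h k) y M \<le> integral {a..a + of_nat M * h k} f + e1 * (of_nat M * h k)" by simp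
    also have "integral {a..a + of_nat M * h k} f \<le> integral {a..b} f"
      using node[of M] f_int f_nn by (intro integral_subset_le integrable_subinterval_real[OF f_int]) auto
    also have "e1 * (of_nat M * h k) \<le> e1 * (b - a)" using M(1) e1 by (intro mult_left_mono) auto
    finally have cy: "cost (h k) y M \<le> integral {a..b} f + e1 * (b - a)" by simp
    define i where "i = nat \<lceil>(\<epsilon> + e1) / h k\<rceil>"
    have i: "\<epsilon> + e1 \<le> of_nat i * h k" "of_nat i * h k \<le> \<epsilon> + e1 + h k"
    proof -
      have "(\<epsilon> + e1) / h k \<ge> 0" using \<open>\<epsilon> \<ge> 0\<close> e1 hk by simp
      then have "0 \<le> \<lceil>(\<epsilon> + e1) / h k\<rceil>" by linarith
      then have "real i = of_int \<lceil>(\<epsilon> + e1) / h k\<rceil>" by (simp add: i_def)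
      then have "(\<epsilon> + e1) / h k \<le> real i" "real i \<le> (\<epsilon> + e1) / h k + 1" by linarith+
      then show "\<epsilon> + e1 \<le> of_nat i * h k" "of_nat i * h k \<le> \<epsilon> + e1 + h k" using hk(1) by (simp_all add: field_simps)
    qed
    have "dist A0 (y 0) \<le> of_nat i * h k" using ends(2) i(1) e1 by (simp add: y_def)
    moreover have "dist (y M) B0 \<le> of_nat i * h k"
    proof -
      have "dist b (a + of_nat M * h k) < d'" using M hk(3) by (simp add: dist_real_def)
      then have "dist (q1 b) (y M) < e1" unfolding y_def using node[of M] ab by (intro d'(2)) auto
      then show ?thesis using dist_triangle3[of "y M" B0 "q1 b"] ends(4) i(1) by linarith
    qed
    moreover have "M + 2 * i \<le> N k"
    proof -
      have "of_nat (M + 2 * i) * h k \<le> of_nat (N k) * h k"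
        using M(1) i(2) elim(2) hk(4) by (simp add: algebra_simps)
      then show ?thesis using hk(1) by simp
    qed
    ultimately have "cost (h k) (x k) (N k) \<le> cost (h k) y M + 2 * (of_nat i * h k * speed_const)"
      by (intro minimal_le_near[OF hk(1) min ends(1,3)])
    moreover have "of_nat i * h k * speed_const \<le> (\<epsilon> + e1 + e1) * speed_const"
      using i(2) hk(4) speed_const(1) by (intro mult_right_mono) auto
    ultimately show ?case using cy by linarith
  qed
  then have "L \<le> integral {a..b} f + e1 * (b - a) + 2 * ((\<epsilon> + e1 + e1) * speed_const)"
    by (rule tendsto_upperbound[OF L_lim]) simp
  also have "\<dots> = integral {a..b} f + 2 * \<epsilon> * speed_const + e1 * (b - a + 4 * speed_const)"
    by (simp add: algebra_simps)
  also have "e1 * (b - a + 4 * speed_const) = e" using pos by (simp add: e1_def)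
  finally show "L \<le> integral {a..b} (\<lambda>u. \<Phi> (norm (p u)) + W (q1 u)) + 2 * \<epsilon> * speed_const + e"
    by (simp add: f_def[abs_def])
qed

text \<open>For \<open>t > 0\<close> the index \<open>hi t k\<close> is eventually positive, as
  \<open>X_far\<close> requires; time 0 follows by continuity.\<close>

lemma q_far: assumes "t \<ge> 0" "\<xi> \<in> Z" shows "dist (q t) \<xi> \<ge> 1/2"
proof -
  have pos: "dist (q t) \<xi> \<ge> 1/2" if t: "t > 0" for t
  proof (rule tendsto_lowerbound[OF tendsto_dist[OF X_hi_lim tendsto_const]])
    have "\<forall>\<^sub>F k in sequentially. h k < t" using t by (intro order_tendstoD(2)[OF h_lim])
    then show "\<forall>\<^sub>F k in sequentially. 1/2 \<le> dist (X k (hi t k)) \<xi>"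
    proof eventually_elim
      case (elim k)
      have "hi t k \<ge> 1" using elim h_pos[of k] by (simp add: hi_def le_floor_iff)
      then show ?case using X_far[of "hi t k" \<xi> k] assms(2) by simp
    qed
  qed simp
  have "((\<lambda>t. dist (q t) \<xi>) \<longlongrightarrow> dist (q 0) \<xi>) (at_right 0)"
  proof (intro tendsto_dist tendsto_const tendsto_mono[OF at_le[of "{0<..}" UNIV]])
    show "q \<midarrow>0\<rightarrow> q 0" using q_cont by (simp add: continuous_on_def)
  qed simp
  then have "dist (q 0) \<xi> \<ge> 1/2"
    by (rule tendsto_lowerbound) (use pos in \<open>auto intro!: eventually_at_rightI[of 0 1]\<close>)
  then show ?thesis using pos assms(1) by (cases "t = 0") auto
qed

text \<open>Within 1/2 of the origin the curve is at least 1/2 away from every other lattice point,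
  and \<open>q_far\<close> keeps it away from \<open>Z\<close>, which contains the origin.\<close>

lemma V_q_0: "V (q 0) > c"
proof (rule far_from_lattice)
  have q0: "norm (q 0) \<le> 1/2"
  proof (rule tendsto_upperbound[OF tendsto_norm[OF X_hi_lim]])
    show "\<forall>\<^sub>F k in sequentially. norm (X k (hi 0 k)) \<le> 1/2" using X_0 by (simp add: hi_def)
  qed simp
  fix \<xi> :: "real^'n" assume \<xi>: "\<xi> \<in> int_lattice"
  show "dist (q 0) \<xi> \<ge> 1/2"
  proof (cases "\<xi> \<in> Z")
    case True then show ?thesis using q_far by simp
  next
    case False
    then have "dist 0 \<xi> \<ge> 1" using \<xi> Z_0 by (intro dist_int_lattice) auto
    then show ?thesis using dist_triangle[of 0 \<xi> "q 0"] q0 by simp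
  qed
qed

text \<open>The maximal interval around 0 on which the limit curve stays above the level
  \<open>c\<close>; it becomes the domain of the connection. Its ends may be finite, since
  \<open>q\<close> may reach the sublevel set in finite time.\<close>

definition S :: "real set" where "S = connected_component_set {t. V (q t) > c} 0"
definition \<alpha> :: ereal where "\<alpha> = Inf (ereal ` S)"
definition \<omega> :: ereal where "\<omega> = Sup (ereal ` S)"

lemma open_U: "open {t. V (q t) > c}"
  by (intro open_Collect_less continuous_on_const continuous_on_compose2[OF V_cont q_cont]) auto

lemma S_0: "0 \<in> S" using V_q_0 by (simp add: S_def)
lemma S_open: "open S" unfolding S_def by (intro open_connected_component open_U)
lemma S_connected: "connected S" unfolding S_def by simp
lemma S_above: "t \<in> S \<Longrightarrow> V (q t) > c" unfolding S_def using connected_component_subset by blast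
lemma S_convex: "\<lbrakk>s \<in> S; t \<in> S; s \<le> u; u \<le> t\<rbrakk> \<Longrightarrow> u \<in> S"
  using S_connected unfolding is_interval_connected_1[symmetric] is_interval_1 by blast
lemma S_max: "\<lbrakk>0 \<in> T; connected T; \<And>t. t \<in> T \<Longrightarrow> V (q t) > c\<rbrakk> \<Longrightarrow> T \<subseteq> S"
  unfolding S_def by (intro connected_component_maximal) auto

lemma S_expand: assumes "t \<in> S" obtains s u where "s \<in> S" "u \<in> S" "s < t" "t < u"
proof -
  obtain e where e: "e > 0" "ball t e \<subseteq> S" using S_open assms open_contains_ball by blast
  then have "t - e/2 \<in> S" "t + e/2 \<in> S" by (auto simp: dist_real_def subset_iff)
  then show ?thesis using that[of "t - e/2" "t + e/2"] e(1) by simp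
qed

lemma S_eq: "einterval \<alpha> \<omega> = S"
proof (intro equalityI subsetI)
  fix t assume "t \<in> einterval \<alpha> \<omega>"
  then have "\<alpha> < ereal t" "ereal t < \<omega>" by (auto simp: einterval_def)
  then obtain s u where "s \<in> S" "s < t" "u \<in> S" "t < u"
    unfolding \<alpha>_def \<omega>_def Inf_less_iff less_Sup_iff by auto
  then show "t \<in> S" using S_convex[of s u t] by auto
next
  fix t assume "t \<in> S"
  then obtain s u where su: "s \<in> S" "u \<in> S" "s < t" "t < u" by (rule S_expand)
  then have "\<alpha> \<le> ereal s" "ereal u \<le> \<omega>" unfolding \<alpha>_def \<omega>_def by (auto intro: Inf_lower Sup_upper)
  moreover have "ereal s < ereal t" "ereal t < ereal u" using su by auto
  ultimately show "t \<in> einterval \<alpha> \<omega>"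
    unfolding einterval_def mem_Collect_eq by (meson le_less_trans less_le_trans)
qed

definition D :: "real \<Rightarrow> real^'n" where "D t = vector_derivative q (at t)"

text \<open>The momentum from \<open>regularity\<close> depends on the window, but velocity and
  action are now expressed independently of it. The derivative is known in the open window; the two
  end points do not affect the integral.\<close>

lemma regularity_D:
  assumes st: "s \<in> S" "t \<in> S" "s < t"
  obtains p where "\<And>u. (p has_vector_derivative grad V (q u)) (at u)"
    "\<And>u. u \<in> {s<..<t} \<Longrightarrow> (q has_vector_derivative D u) (at u)"
    "\<And>u. u \<in> {s<..<t} \<Longrightarrow> D u = Psi (p u)"
    "\<And>B. (\<forall>\<^sub>F k in sequentially. icost (h k) (X k) (lo s k) (hi t k) \<le> B) \<Longrightarrow>
       integral {s..t} (\<lambda>u. \<Phi> (norm (D u)) + W (q u)) \<le> B"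
proof -
  have above: "V (q u) > c" if "u \<in> {s..t}" for u using S_above S_convex[OF st(1,2)] that by auto
  show thesis
  proof (rule regularity[OF st(3) above])
    fix p assume p: "\<And>u. (p has_vector_derivative grad V (q u)) (at u)"
      "\<And>u. u \<in> {s<..<t} \<Longrightarrow> (q has_vector_derivative Psi (p u)) (at u)"
      "\<And>Ja B. (\<And>u. (Ja has_vector_derivative (\<Phi> (norm (Psi (p u))) + W (q u))) (at u)) \<Longrightarrow>
        (\<forall>\<^sub>F k in sequentially. icost (h k) (X k) (lo s k) (hi t k) \<le> B) \<Longrightarrow> Ja t - Ja s \<le> B"
    have D: "D u = Psi (p u)" if "u \<in> {s<..<t}" for u
      unfolding D_def by (rule vector_derivative_at[OF p(2)[OF that]])
    have pc: "continuous_on UNIV p"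
      using p(1) by (intro continuous_at_imp_continuous_on ballI has_vector_derivative_continuous)
    have cont: "continuous_on UNIV (\<lambda>u. \<Phi> (norm (Psi (p u))) + W (q u))"
      by (intro continuous_on_add continuous_on_compose2[OF Phi_norm_continuous continuous_on_compose2[OF Psi_continuous pc]]
          continuous_on_compose2[OF W_cont q_cont]) auto
    obtain Ja where Ja: "\<And>u. (Ja has_vector_derivative (\<Phi> (norm (Psi (p u))) + W (q u))) (at u)"
      by (rule antiderivative_UNIV[OF cont]) blast
    have "((\<lambda>u. \<Phi> (norm (Psi (p u))) + W (q u)) has_integral (Ja t - Ja s)) {s..t}"
      by (rule fundamental_theorem_of_calculus) (use st(3) Ja[THEN has_vector_derivative_at_within] in auto)
    then have "((\<lambda>u. \<Phi> (norm (D u)) + W (q u)) has_integral (Ja t - Ja s)) {s..t}"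
      by (rule has_integral_spike_finite[of "{s, t}", rotated 2]) (use D in auto)
    then have eq: "integral {s..t} (\<lambda>u. \<Phi> (norm (D u)) + W (q u)) = Ja t - Ja s" by (rule integral_unique)
    show thesis
      by (rule that[of p]) (use p(1,2) D p(3)[OF Ja] eq in auto)
  qed
qed

lemma D_derivative: assumes "t \<in> S"
  shows "(q has_vector_derivative D t) (at t)" "((\<lambda>u. Pv (D u)) has_vector_derivative grad V (q t)) (at t)"
proof -
  obtain s u where su: "s \<in> S" "u \<in> S" "s < t" "t < u" using assms by (rule S_expand)
  then have "s < u" by simp
  show "(q has_vector_derivative D t) (at t)" "((\<lambda>u. Pv (D u)) has_vector_derivative grad V (q t)) (at t)"
  proof (atomize (full), rule regularity_D[OF su(1,2) \<open>s < u\<close>])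
    fix p assume p: "\<And>u. (p has_vector_derivative grad V (q u)) (at u)"
      "\<And>t. t \<in> {s<..<u} \<Longrightarrow> (q has_vector_derivative D t) (at t)"
      "\<And>t. t \<in> {s<..<u} \<Longrightarrow> D t = Psi (p t)"
    have "((\<lambda>u. Pv (D u)) has_vector_derivative grad V (q t)) (at t)"
      by (rule has_vector_derivative_transform_within_open[OF p(1), of "{s<..<u}"]) (use su p(3) in auto)
    then show "(q has_vector_derivative D t) (at t) \<and> ((\<lambda>u. Pv (D u)) has_vector_derivative grad V (q t)) (at t)"
      using p(2) su by auto
  qed
qed

lemma D_continuous: "continuous_on S D"
proof -
  have "continuous_on S (\<lambda>u. Pv (D u))"
    using D_derivative(2) by (intro continuous_at_imp_continuous_on ballI has_vector_derivative_continuous) blast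
  then have "continuous_on S (\<lambda>u. Psi (Pv (D u)))" by (rule continuous_on_compose2[OF Psi_continuous]) auto
  then show ?thesis by simp
qed

lemma Icc_S: "s \<in> S \<Longrightarrow> t \<in> S \<Longrightarrow> {s..t} \<subseteq> S"
  by (meson S_convex atLeastAtMost_iff subsetI)

lemma Wq_cont: "continuous_on T (\<lambda>u. W (q u))"
  by (rule continuous_on_compose2[OF W_cont continuous_on_subset[OF q_cont]]) auto

lemma PhiD_cont: "continuous_on S (\<lambda>u. \<Phi> (norm (D u)))"
  by (rule continuous_on_compose2[OF Phi_norm_continuous D_continuous]) auto

lemma action_integrand_continuous: "continuous_on S (\<lambda>u. \<Phi> (norm (D u)) + W (q u))"
  by (rule continuous_on_add[OF PhiD_cont Wq_cont])

lemma action_le_bound: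
  assumes "s \<in> S" "t \<in> S" "s < t" "\<forall>\<^sub>F k in sequentially. icost (h k) (X k) (lo s k) (hi t k) \<le> K"
  shows "integral {s..t} (\<lambda>u. \<Phi> (norm (D u)) + W (q u)) \<le> K"
proof (rule regularity_D[OF assms(1-3)])
  fix p assume "\<And>K. (\<forall>\<^sub>F k in sequentially. icost (h k) (X k) (lo s k) (hi t k) \<le> K) \<Longrightarrow>
       integral {s..t} (\<lambda>u. \<Phi> (norm (D u)) + W (q u)) \<le> K"
  from this[OF assms(4)] show ?thesis .
qed

lemma action_le_L:
  assumes "s \<in> S" "t \<in> S" "s < t"
  shows "integral {s..t} (\<lambda>u. \<Phi> (norm (D u)) + W (q u)) \<le> L"
proof (rule field_le_epsilon)
  fix e :: real assume "e > 0"
  then have "\<forall>\<^sub>F k in sequentially. cost (h k) (x k) (N k) < L + e" by (intro order_tendstoD(2)[OF L_lim]) auto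
  then show "integral {s..t} (\<lambda>u. \<Phi> (norm (D u)) + W (q u)) \<le> L + e"
    by (intro action_le_bound[OF assms]) (auto elim!: eventually_mono intro: order_trans[OF icost_le less_imp_le])
qed

lemma W_eq_S: "t \<in> S \<Longrightarrow> W (q t) = V (q t) - c" using S_above[of t] by (simp add: W_def)

text \<open>The energy is written \<open>H (Pv (D t)) - V (q t)\<close>: differentiating through the
  conjugate uses only the derivative of the momentum, and both terms produce
  \<open>inner (D t) (grad V (q t))\<close>.\<close>

lemma energy_constant: obtains E where "\<And>t. t \<in> S \<Longrightarrow> G (norm (D t)) = W (q t) + E"
proof -
  let ?E = "\<lambda>t. H (Pv (D t)) - V (q t)"
  have "(?E has_real_derivative 0) (at t within S)" if t: "t \<in> S" for t
  proof -
    have "((\<lambda>u. H (Pv (D u))) has_derivative (\<lambda>k. inner (k *\<^sub>R grad V (q t)) (Psi (Pv (D t))))) (at t)"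
      by (rule has_derivative_compose[OF D_derivative(2)[OF t, unfolded has_vector_derivative_def] H_GDERIV[unfolded gderiv_def]])
    moreover have "((\<lambda>u. V (q u)) has_derivative (\<lambda>k. inner (k *\<^sub>R D t) (grad V (q t)))) (at t)"
      by (rule has_derivative_compose[OF D_derivative(1)[OF t, unfolded has_vector_derivative_def] V_has_derivative])
    ultimately have "(?E has_derivative (\<lambda>k. inner (k *\<^sub>R grad V (q t)) (Psi (Pv (D t))) - inner (k *\<^sub>R D t) (grad V (q t)))) (at t)"
      by (rule has_derivative_diff)
    then have "(?E has_real_derivative 0) (at t)" by (simp add: has_field_derivative_def inner_commute lambda_zero)
    then show ?thesis by (rule has_field_derivative_at_within)
  qed
  moreover have "convex S" using S_connected by (simp add: is_interval_connected_1[symmetric] is_interval_convex_1[symmetric])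
  ultimately have "\<exists>C. \<forall>t\<in>S. ?E t = C" by (intro has_field_derivative_zero_constant) auto
  then obtain C where C: "\<And>t. t \<in> S \<Longrightarrow> ?E t = C" by blast
  show thesis
  proof (rule that[of "C + c"])
    fix t assume "t \<in> S"
    then show "G (norm (D t)) = W (q t) + (C + c)" using C[of t] by (simp add: H_Pv W_eq_S)
  qed
qed

lemma Wq_uniform: "uniformly_continuous_on UNIV (\<lambda>t. W (q t))"
proof -
  have "uniformly_continuous_on (range q) W"
    unfolding uniformly_continuous_on_def
  proof (intro allI impI)
    fix e :: real assume "e > 0"
    then obtain d where "d > 0" "\<forall>s t. dist s t < d \<longrightarrow> dist (W s) (W t) < e"
      using uniformly_continuous_on_UNIV_D[OF W_uniform] by blast
    then show "\<exists>d>0. \<forall>x\<in>range q. \<forall>x'\<in>range q. dist x' x < d \<longrightarrow> dist (W x') (W x) < e"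
      by (intro exI[of _ d]) simp
  qed
  then show ?thesis by (rule uniformly_continuous_on_compose[OF q_uniform])
qed

lemma integral_W_le:
  assumes "s \<in> S" "t \<in> S" "s < t" shows "integral {s..t} (\<lambda>u. W (q u)) \<le> L"
proof -
  have "(\<lambda>u. W (q u)) integrable_on {s..t}"
    by (rule integrable_continuous_real[OF Wq_cont])
  moreover have "(\<lambda>u. \<Phi> (norm (D u)) + W (q u)) integrable_on {s..t}"
    by (rule integrable_continuous_real[OF continuous_on_subset[OF action_integrand_continuous Icc_S[OF assms(1,2)]]])
  ultimately have "integral {s..t} (\<lambda>u. W (q u)) \<le> integral {s..t} (\<lambda>u. \<Phi> (norm (D u)) + W (q u))"
    by (rule integral_le) (simp add: Phi_nonneg)
  then show ?thesis using action_le_L[OF assms] by simp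
qed

lemma W_antiderivative:
  obtains Wa where "\<And>t. (Wa has_vector_derivative W (q t)) (at t)"
    "\<And>s t. s \<in> S \<Longrightarrow> t \<in> S \<Longrightarrow> s < t \<Longrightarrow> Wa t - Wa s \<le> L"
proof -
  have "continuous_on UNIV (\<lambda>t. W (q t))" by (rule continuous_on_compose2[OF W_cont q_cont]) auto
  then obtain Wa where Wa: "\<And>t. (Wa has_vector_derivative W (q t)) (at t)" by (rule antiderivative_UNIV) blast
  have "Wa t - Wa s \<le> L" if "s \<in> S" "t \<in> S" "s < t" for s t
  proof -
    have "((\<lambda>u. W (q u)) has_integral (Wa t - Wa s)) {s..t}"
      by (rule fundamental_theorem_of_calculus) (use that Wa[THEN has_vector_derivative_at_within] in auto)
    then show ?thesis using integral_W_le[OF that] by (simp add: integral_unique)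
  qed
  then show thesis using that Wa by blast
qed

text \<open>If \<open>S\<close> contains the whole half-line, \<open>W (q t)\<close> is uniformly
  continuous with bounded integral and Barbalat's lemma applies. Otherwise \<open>S\<close> ends at
  the first time \<open>w\<close> with \<open>V (q w) \<le> c\<close>, and continuity at
  \<open>w\<close> suffices.\<close>

lemma W_end_right: assumes "e > 0" shows "\<exists>s\<in>S. \<forall>t\<in>S. s < t \<longrightarrow> W (q t) < e"
proof (cases "\<exists>b. b \<notin> S \<and> b > 0")
  case False
  obtain Wa where Wa: "\<And>t. (Wa has_vector_derivative W (q t)) (at t)"
    "\<And>s t. s \<in> S \<Longrightarrow> t \<in> S \<Longrightarrow> s < t \<Longrightarrow> Wa t - Wa s \<le> L" by (rule W_antiderivative) blast
  have "Wa t \<le> max (Wa 0) (L + Wa 0)" if "t \<ge> 0" for t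
  proof -
    have "t \<in> S" using False S_0 that by (metis less_eq_real_def)
    then show ?thesis using Wa(2)[of 0 t] S_0 that by (cases "t = 0") auto
  qed
  then obtain s where "s \<ge> 0" "\<And>t. t \<ge> s \<Longrightarrow> W (q t) < e"
    using Barbalat[OF Wq_uniform W_nonneg Wa(1) _ assms] by blast
  then show ?thesis using False S_0 by (intro bexI[of _ s]) (auto simp: le_less)
next
  case True
  then obtain b where b: "b \<notin> S" "b > 0" by blast
  define T where "T = {t. t \<ge> 0 \<and> V (q t) \<le> c}"
  have "\<exists>u\<in>{0..b}. V (q u) \<le> c"
  proof (rule ccontr)
    assume "\<not> ?thesis"
    then have "V (q u) > c" if "u \<in> {0..b}" for u using that by (meson not_le)
    then have "{0..b} \<subseteq> S" using b by (intro S_max) auto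
    moreover have "b \<in> {0..b}" using b by simp
    ultimately show False using b by blast
  qed
  then have "T \<noteq> {}" by (auto simp: T_def)
  moreover have "closed T" unfolding T_def
    by (intro closed_Collect_conj closed_Collect_le continuous_intros continuous_on_compose2[OF V_cont q_cont]) auto
  moreover have "bdd_below T" by (auto simp: T_def intro: bdd_belowI[of _ 0])
  ultimately have inf: "Inf T \<in> T" "\<And>t. t \<in> T \<Longrightarrow> Inf T \<le> t" by (auto intro: closed_contains_Inf cInf_lower)
  define w where "w = Inf T"
  have w: "w \<ge> 0" "W (q w) = 0" using inf(1) by (auto simp: T_def w_def W_eq_0)
  have "w \<noteq> 0" using V_q_0 w(2) by (auto simp: W_eq_0)
  have "w \<notin> S" using w(2) S_above[of w] by (auto simp: W_eq_0)
  then have S_less: "t < w" if "t \<in> S" for t using S_convex[OF S_0 that, of w] w(1) by force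
  have in_S: "t \<in> S" if "0 \<le> t" "t < w" for t
  proof -
    have "{0..t} \<subseteq> S"
    proof (rule S_max)
      show "V (q u) > c" if "u \<in> {0..t}" for u
        using inf(2)[of u] that \<open>t < w\<close> by (force simp: T_def w_def)
    qed (use that in auto)
    then show ?thesis using that by auto
  qed
  obtain d where d: "d > 0" "\<And>t. dist t w < d \<Longrightarrow> dist (W (q t)) (W (q w)) < e"
    using uniformly_continuous_on_UNIV_D[OF Wq_uniform assms] by blast
  show ?thesis
  proof (intro bexI[of _ "max 0 (w - d)"] ballI impI)
    show "max 0 (w - d) \<in> S" using w \<open>w \<noteq> 0\<close> d in_S by auto
    fix t assume "t \<in> S" "max 0 (w - d) < t"
    then have "dist t w < d" using S_less[of t] by (auto simp: dist_real_def)
    then show "W (q t) < e" using d(2)[of t] w(2) W_nonneg[of "q t"] by simp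
  qed
qed

text \<open>Mirror image: Barbalat's lemma is applied to the reversed curve, and the last
  nonpositive time with \<open>V \<le> c\<close> replaces the first nonnegative one.\<close>

lemma W_end_left: assumes "e > 0" shows "\<exists>s\<in>S. \<forall>t\<in>S. t < s \<longrightarrow> W (q t) < e"
proof (cases "\<exists>b. b \<notin> S \<and> b < 0")
  case False
  obtain Wa where Wa: "\<And>t. (Wa has_vector_derivative W (q t)) (at t)"
    "\<And>s t. s \<in> S \<Longrightarrow> t \<in> S \<Longrightarrow> s < t \<Longrightarrow> Wa t - Wa s \<le> L" by (rule W_antiderivative) blast
  have der: "((\<lambda>t. - Wa (- t)) has_vector_derivative W (q (- t))) (at t)" for t
  proof -
    have "(uminus has_vector_derivative (- 1)) (at t)" by (auto intro!: derivative_eq_intros)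
    then have "(Wa \<circ> uminus has_vector_derivative (- 1) *\<^sub>R W (q (- t))) (at t)"
      using Wa(1)[of "- t"] by (rule vector_diff_chain_at)
    then have "((\<lambda>t. Wa (- t)) has_vector_derivative - W (q (- t))) (at t)" by (simp add: o_def)
    from has_vector_derivative_minus[OF this] show ?thesis by simp
  qed
  have uni: "uniformly_continuous_on UNIV (\<lambda>t. W (q (- t)))"
    unfolding uniformly_continuous_on_def
  proof (intro allI impI)
    fix e :: real assume "e > 0"
    then obtain d where "d > 0" "\<And>s t. dist s t < d \<Longrightarrow> dist (W (q s)) (W (q t)) < e"
      using uniformly_continuous_on_UNIV_D[OF Wq_uniform] by blast
    then show "\<exists>d>0. \<forall>x\<in>UNIV. \<forall>x'\<in>UNIV. dist x' x < d \<longrightarrow> dist (W (q (- x'))) (W (q (- x))) < e"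
      by (intro exI[of _ d]) (auto simp: dist_minus)
  qed
  have "- Wa (- t) \<le> max (- Wa 0) (L - Wa 0)" if "t \<ge> 0" for t
  proof -
    have "- t \<in> S" using False S_0 that by (metis less_eq_real_def neg_less_0_iff_less neg_0_equal_iff_equal)
    then show ?thesis using Wa(2)[of "- t" 0] S_0 that by (cases "t = 0") auto
  qed
  then obtain s where s: "s \<ge> 0" "\<And>t. t \<ge> s \<Longrightarrow> W (q (- t)) < e"
    using Barbalat[OF uni W_nonneg der _ assms] by blast
  have "W (q t) < e" if "t < - s" for t using s(2)[of "- t"] that by simp
  then show ?thesis using False S_0 s(1) by (intro bexI[of _ "- s"]) (auto simp: le_less)
next
  case True
  then obtain b where b: "b \<notin> S" "b < 0" by blast
  define T where "T = {t. t \<le> 0 \<and> V (q t) \<le> c}"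
  have "\<exists>u\<in>{b..0}. V (q u) \<le> c"
  proof (rule ccontr)
    assume "\<not> ?thesis"
    then have "V (q u) > c" if "u \<in> {b..0}" for u using that by (meson not_le)
    then have "{b..0} \<subseteq> S" using b by (intro S_max) auto
    moreover have "b \<in> {b..0}" using b by simp
    ultimately show False using b by blast
  qed
  then have "T \<noteq> {}" by (auto simp: T_def)
  moreover have "closed T" unfolding T_def
    by (intro closed_Collect_conj closed_Collect_le continuous_intros continuous_on_compose2[OF V_cont q_cont]) auto
  moreover have "bdd_above T" by (auto simp: T_def intro: bdd_aboveI[of _ 0])
  ultimately have sup: "Sup T \<in> T" "\<And>t. t \<in> T \<Longrightarrow> t \<le> Sup T" by (auto intro: closed_contains_Sup cSup_upper)
  define w where "w = Sup T"
  have w: "w \<le> 0" "W (q w) = 0" using sup(1) by (auto simp: T_def w_def W_eq_0)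
  have "w \<noteq> 0" using V_q_0 w(2) by (auto simp: W_eq_0)
  have "w \<notin> S" using w(2) S_above[of w] by (auto simp: W_eq_0)
  then have S_gr: "t > w" if "t \<in> S" for t using S_convex[OF that S_0, of w] w(1) by force
  have in_S: "t \<in> S" if "t \<le> 0" "w < t" for t
  proof -
    have "{t..0} \<subseteq> S"
    proof (rule S_max)
      show "V (q u) > c" if "u \<in> {t..0}" for u
        using sup(2)[of u] that \<open>w < t\<close> by (force simp: T_def w_def)
    qed (use that in auto)
    then show ?thesis using that by auto
  qed
  obtain d where d: "d > 0" "\<And>t. dist t w < d \<Longrightarrow> dist (W (q t)) (W (q w)) < e"
    using uniformly_continuous_on_UNIV_D[OF Wq_uniform assms] by blast
  show ?thesis
  proof (intro bexI[of _ "min 0 (w + d)"] ballI impI)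
    show "min 0 (w + d) \<in> S" using w \<open>w \<noteq> 0\<close> d in_S by auto
    fix t assume "t \<in> S" "t < min 0 (w + d)"
    then have "dist t w < d" using S_gr[of t] by (auto simp: dist_real_def)
    then show "W (q t) < e" using d(2)[of t] w(2) W_nonneg[of "q t"] by simp
  qed
qed

end

section \<open>The ends and the energy of the limit curve\<close>

text \<open>From here on the discretization is forgotten. Two facts about \<open>L\<close> remain:
  it bounds the action of the curve on compact parts, and it bounds from below the action of every
  competitor up to the price of reaching \<open>A\<close> and \<open>B\<close>. The initial cell is
  normalized to the one at the origin.\<close>

locale connection = subgroup_step \<phi> l V c \<delta> Z
  for \<phi> l and V :: "real^'n \<Rightarrow> real" and c \<delta> Z +
  fixes \<alpha> \<omega> :: ereal and q D :: "real \<Rightarrow> real^'n" and L :: real and \<xi> :: "real^'n"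
  assumes \<alpha>_less_\<omega>: "\<alpha> < \<omega>"
    and q_cont: "continuous_on UNIV q"
    and q_D: "\<And>t. t \<in> einterval \<alpha> \<omega> \<Longrightarrow> (q has_vector_derivative D t) (at t)"
    and Euler_Lagrange: "\<And>t. t \<in> einterval \<alpha> \<omega> \<Longrightarrow> ((\<lambda>u. Pv (D u)) has_vector_derivative grad V (q t)) (at t)"
    and above: "\<And>t. t \<in> einterval \<alpha> \<omega> \<Longrightarrow> V (q t) > c"
    and energy: "\<And>t. t \<in> einterval \<alpha> \<omega> \<Longrightarrow> G (norm (D t)) = V (q t) - c"
    and left_cell: "\<And>e. e > 0 \<Longrightarrow> \<exists>s\<in>einterval \<alpha> \<omega>. \<forall>t\<in>einterval \<alpha> \<omega>. t < s \<longrightarrow> infdist (q t) (sublevel_at V c \<delta> 0) < e"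
    and right_cell: "\<And>e. e > 0 \<Longrightarrow> \<exists>s\<in>einterval \<alpha> \<omega>. \<forall>t\<in>einterval \<alpha> \<omega>. s < t \<longrightarrow> infdist (q t) (sublevel_at V c \<delta> \<xi>) < e"
    and \<xi>: "\<xi> \<in> int_lattice - Z"
    and action_le: "\<And>s t. s \<in> einterval \<alpha> \<omega> \<Longrightarrow> t \<in> einterval \<alpha> \<omega> \<Longrightarrow> s < t \<Longrightarrow>
      integral {s..t} (\<lambda>u. \<Phi> (norm (D u)) + (V (q u) - c)) \<le> L"
    and L_le: "\<And>(a::real) b q1 p \<epsilon> A0 B0. a < b \<Longrightarrow> continuous_on {a..b} q1 \<Longrightarrow>
      (\<And>s t. a \<le> s \<Longrightarrow> s \<le> t \<Longrightarrow> t \<le> b \<Longrightarrow> (p has_integral (q1 t - q1 s)) {s..t}) \<Longrightarrow>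
      (\<lambda>u. \<Phi> (norm (p u))) integrable_on {a..b} \<Longrightarrow>
      A0 \<in> A \<Longrightarrow> dist A0 (q1 a) \<le> \<epsilon> \<Longrightarrow> B0 \<in> B \<Longrightarrow> dist (q1 b) B0 \<le> \<epsilon> \<Longrightarrow>
      L \<le> integral {a..b} (\<lambda>u. \<Phi> (norm (p u)) + W (q1 u)) + 2 * \<epsilon> * speed_const"

context periodic_well begin

lemma sublevel_at_closed: "closed (sublevel_at V c \<delta> \<xi>)"
  unfolding sublevel_at_def by (intro closed_Int closed_Collect_le V_cont continuous_on_const closed_cball)

lemma lattice_in_sublevel_at: "\<xi> \<in> int_lattice \<Longrightarrow> \<xi> \<in> sublevel_at V c \<delta> \<xi>"
  using V_lattice_le delta_bounds by (simp add: sublevel_at_def)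

lemma sublevel_at_attained:
  assumes "\<xi> \<in> int_lattice" "infdist x (sublevel_at V c \<delta> \<xi>) < e"
  obtains y where "y \<in> sublevel_at V c \<delta> \<xi>" "dist x y < e"
proof -
  obtain y where "y \<in> sublevel_at V c \<delta> \<xi>" "infdist x (sublevel_at V c \<delta> \<xi>) = dist x y"
    using infdist_attains_inf[OF sublevel_at_closed] lattice_in_sublevel_at[OF assms(1)] by blast
  then show thesis using that assms(2) by simp
qed

text \<open>The open balls of radius 1/2 about lattice points are disjoint and cover the image, so
  connectedness selects one of them.\<close>

lemma connected_in_cell:
  assumes T: "connected T" "T \<noteq> {}" and f: "continuous_on T f" and small: "\<And>t. t \<in> T \<Longrightarrow> \<exists>y. V y \<le> c \<and> dist (f t) y < \<delta>"
  obtains \<xi> where "\<xi> \<in> int_lattice" "\<And>t. t \<in> T \<Longrightarrow> dist (f t) \<xi> < 1/2"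
proof -
  have near: "\<exists>\<xi>\<in>int_lattice. dist (f t) \<xi> < 1/2" if t: "t \<in> T" for t
  proof -
    obtain y where y: "V y \<le> c" "dist (f t) y < \<delta>" using small[OF t] by blast
    obtain \<xi> :: "real^'n" where "\<xi> \<in> int_lattice" "dist y \<xi> \<le> 1/2 - \<delta>" using sublevel_near_lattice[OF y(1)] by blast
    then show ?thesis using dist_triangle[of "f t" \<xi> y] y(2) by force
  qed
  obtain t0 where t0: "t0 \<in> T" using T(2) by blast
  then obtain \<xi> where \<xi>: "\<xi> \<in> int_lattice" "dist (f t0) \<xi> < 1/2" using near by blast
  have disj: "\<eta> = \<eta>'" if "\<eta> \<in> int_lattice" "\<eta>' \<in> int_lattice" "dist y \<eta> < 1/2" "dist y \<eta>' < 1/2" for y \<eta> \<eta>' :: "real^'n"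
    using dist_int_lattice[OF that(1,2)] dist_triangle3[of \<eta> \<eta>' y] that(3,4) by linarith
  have conn: "connected (f ` T)" using T(1) f by (rule connected_continuous_image[rotated])
  let ?O = "\<Union>\<eta>\<in>int_lattice - {\<xi>}. ball \<eta> (1/2)"
  have "ball \<xi> (1/2) \<inter> f ` T = {} \<or> ?O \<inter> f ` T = {}"
  proof (rule connectedD[OF conn])
    show "ball \<xi> (1/2) \<inter> ?O \<inter> f ` T = {}" using disj[OF \<xi>(1)] by (force simp: dist_commute)
    show "f ` T \<subseteq> ball \<xi> (1/2) \<union> ?O" using near by (force simp: dist_commute)
  qed auto
  then have "?O \<inter> f ` T = {}" using t0 \<xi>(2) by (auto simp: dist_commute)
  have "dist (f t) \<xi> < 1/2" if t: "t \<in> T" for t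
  proof -
    obtain \<eta> where \<eta>: "\<eta> \<in> int_lattice" "dist (f t) \<eta> < 1/2" using near[OF t] by blast
    have "\<eta> = \<xi>"
    proof (rule ccontr)
      assume "\<eta> \<noteq> \<xi>"
      then have "f t \<in> ?O \<inter> f ` T" using t \<eta> by (auto simp: dist_commute intro!: bexI[of _ \<eta>])
      then show False using \<open>?O \<inter> f ` T = {}\<close> by blast
    qed
    then show ?thesis using \<eta>(2) by simp
  qed
  then show thesis using that \<xi>(1) by blast
qed

text \<open>The lattice point whose cell contains \<open>y\<close> is at distance less than
  \<open>1/2 + \<delta> + (1/2 - \<delta>) = 1\<close> from \<open>\<xi>\<close>, hence equal to
  it.\<close>

lemma infdist_cell_small:
  assumes "\<xi> \<in> int_lattice" "dist x \<xi> < 1/2" "V y \<le> c" "dist x y < e" "e \<le> \<delta>"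
  shows "infdist x (sublevel_at V c \<delta> \<xi>) < e"
proof -
  obtain \<eta> :: "real^'n" where \<eta>: "\<eta> \<in> int_lattice" "dist y \<eta> \<le> 1/2 - \<delta>" using sublevel_near_lattice[OF assms(3)] by blast
  have "dist \<xi> \<eta> < 1"
    using dist_triangle3[of \<xi> \<eta> x] dist_triangle[of x \<eta> y] \<eta>(2) assms(2,4,5) by linarith
  then have "\<eta> = \<xi>" using dist_int_lattice[OF assms(1) \<eta>(1)] by fastforce
  then have "y \<in> sublevel_at V c \<delta> \<xi>" using \<eta> assms(3) by (simp add: sublevel_at_def dist_commute)
  then show ?thesis using infdist_le[of y _ x] assms(4) by fastforce
qed

end

context limit_curve begin

text \<open>\<open>R\<close> will be the order or its converse, so that one argument serves both
  ends. Near an end the curve is within \<open>\<delta>\<close> of the sublevel set, and being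
  connected this part stays in one ball.\<close>

lemma end_cell:
  assumes T: "\<And>e. e > 0 \<Longrightarrow> \<exists>s\<in>S. \<forall>t\<in>S. R s t \<longrightarrow> W (q t) < e"
    and conn: "\<And>s. s \<in> S \<Longrightarrow> connected {t \<in> S. R s t}" and ne: "\<And>s. s \<in> S \<Longrightarrow> {t \<in> S. R s t} \<noteq> {}"
    and dir: "\<And>s s'. s \<in> S \<Longrightarrow> s' \<in> S \<Longrightarrow> (\<forall>t. R s t \<longrightarrow> R s' t) \<or> (\<forall>t. R s' t \<longrightarrow> R s t)"
  obtains \<xi> s where "\<xi> \<in> int_lattice" "s \<in> S" "\<And>t. t \<in> S \<Longrightarrow> R s t \<Longrightarrow> dist (q t) \<xi> < 1/2"
    "\<And>e. e > 0 \<Longrightarrow> \<exists>s\<in>S. \<forall>t\<in>S. R s t \<longrightarrow> infdist (q t) (sublevel_at V c \<delta> \<xi>) < e"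
proof -
  have near: "\<exists>s\<in>S. \<forall>t\<in>S. R s t \<longrightarrow> (\<exists>y. V y \<le> c \<and> dist (q t) y < e)" if "e > 0" for e
  proof -
    obtain \<mu> where \<mu>: "\<mu> > 0" "\<And>x. W x < \<mu> \<Longrightarrow> \<exists>y. V y \<le> c \<and> dist x y < e" using W_small[OF \<open>e > 0\<close>] by blast
    obtain s where "s \<in> S" "\<forall>t\<in>S. R s t \<longrightarrow> W (q t) < \<mu>" using T[OF \<mu>(1)] by blast
    then show ?thesis using \<mu>(2) by blast
  qed
  obtain s where s: "s \<in> S" "\<And>t. t \<in> S \<Longrightarrow> R s t \<Longrightarrow> \<exists>y. V y \<le> c \<and> dist (q t) y < \<delta>"
    using near[OF delta_bounds(1)] by blast
  have "continuous_on {t \<in> S. R s t} q" using q_cont continuous_on_subset by blast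
  then obtain \<xi> where \<xi>: "\<xi> \<in> int_lattice" "\<And>t. t \<in> {t \<in> S. R s t} \<Longrightarrow> dist (q t) \<xi> < 1/2"
    using connected_in_cell[OF conn[OF s(1)] ne[OF s(1)]] s(2) by (metis (no_types, lifting) mem_Collect_eq)
  have "\<exists>s\<in>S. \<forall>t\<in>S. R s t \<longrightarrow> infdist (q t) (sublevel_at V c \<delta> \<xi>) < e" if "e > 0" for e
  proof -
    have "min e \<delta> > 0" using that delta_bounds by simp
    then obtain s' where s': "s' \<in> S" "\<forall>t\<in>S. R s' t \<longrightarrow> (\<exists>y. V y \<le> c \<and> dist (q t) y < min e \<delta>)" using near by blast
    have *: "infdist (q t) (sublevel_at V c \<delta> \<xi>) < e" if st: "t \<in> S" "R s t" "R s' t" for t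
    proof -
      obtain y where "V y \<le> c" "dist (q t) y < min e \<delta>" using s'(2) st by blast
      then have "infdist (q t) (sublevel_at V c \<delta> \<xi>) < min e \<delta>"
        using \<xi> that by (intro infdist_cell_small) auto
      then show ?thesis by simp
    qed
    from dir[OF s(1) s'(1)] show ?thesis using * s(1) s'(1) by blast
  qed
  then show thesis using that[OF \<xi>(1) s(1)] \<xi>(2) by blast
qed

lemma right_end:
  obtains \<xi> where "\<xi> \<in> int_lattice - Z"
    "\<And>e. e > 0 \<Longrightarrow> \<exists>s\<in>S. \<forall>t\<in>S. s < t \<longrightarrow> infdist (q t) (sublevel_at V c \<delta> \<xi>) < e"
proof (rule end_cell[of "\<lambda>s t. s < t"])
  show "connected {t \<in> S. s < t}" for s
    unfolding is_interval_connected_1[symmetric] is_interval_1 using S_convex by (auto intro: less_le_trans)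
  show "{t \<in> S. s < t} \<noteq> {}" if "s \<in> S" for s using S_expand[OF that] by blast
  show "(\<forall>t. s < t \<longrightarrow> s' < t) \<or> (\<forall>t. s' < t \<longrightarrow> s < t)" for s s' :: real by (meson le_less_trans linear)
  fix \<xi> :: "real^'n" and s assume \<xi>: "\<xi> \<in> int_lattice" "s \<in> S" "\<And>t. t \<in> S \<Longrightarrow> s < t \<Longrightarrow> dist (q t) \<xi> < 1/2"
    "\<And>e. e > 0 \<Longrightarrow> \<exists>s\<in>S. \<forall>t\<in>S. s < t \<longrightarrow> infdist (q t) (sublevel_at V c \<delta> \<xi>) < e"
  have "max s 0 \<in> S" using \<xi>(2) S_0 by (auto simp: max_def)
  then obtain t where "t \<in> S" "max s 0 < t" by (rule S_expand)
  \<comment> \<open>At positive times the curve is at least 1/2 away from \<open>Z\<close>, so the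
    ball that captures it is centred elsewhere.\<close>
  then have "\<xi> \<notin> Z" using \<xi>(3)[of t] q_far[of t \<xi>] by force
  then show thesis using that[of \<xi>] \<xi>(1,4) by blast
qed (use W_end_right in blast)

lemma integral_mono_left:
  assumes "s \<in> S" "s' \<in> S" "t \<in> S" "s \<le> s'" "s' \<le> t"
  shows "integral {s'..t} (\<lambda>u. \<Phi> (norm (D u)) + W (q u)) \<le> integral {s..t} (\<lambda>u. \<Phi> (norm (D u)) + W (q u))"
  using assms by (intro integral_subset_le integrable_continuous_real
      continuous_on_subset[OF action_integrand_continuous] Icc_S) (auto simp: Phi_nonneg W_nonneg)

text \<open>If the cell were centred outside \<open>Z\<close>, the curve would come close to
  \<open>B\<close> at an early time. Then \<open>icost_cut\<close> makes the cost from that time to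
  0 arbitrarily small, although the curve spends a fixed amount \<open>\<kappa>\<close> just before
  time 0, where \<open>V > c\<close>.\<close>

lemma left_end:
  obtains \<xi> where "\<xi> \<in> Z"
    "\<And>e. e > 0 \<Longrightarrow> \<exists>s\<in>S. \<forall>t\<in>S. t < s \<longrightarrow> infdist (q t) (sublevel_at V c \<delta> \<xi>) < e"
proof (rule end_cell[of "\<lambda>s t. t < s"])
  show "connected {t \<in> S. t < s}" for s
    unfolding is_interval_connected_1[symmetric] is_interval_1 using S_convex by (auto intro: le_less_trans)
  show "{t \<in> S. t < s} \<noteq> {}" if "s \<in> S" for s using S_expand[OF that] by blast
  show "(\<forall>t. t < s \<longrightarrow> t < s') \<or> (\<forall>t. t < s' \<longrightarrow> t < s)" for s s' :: real by (meson less_le_trans linear)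
  fix \<xi> :: "real^'n" and s1 assume \<xi>: "\<xi> \<in> int_lattice" "s1 \<in> S" "\<And>t. t \<in> S \<Longrightarrow> t < s1 \<Longrightarrow> dist (q t) \<xi> < 1/2"
    "\<And>e. e > 0 \<Longrightarrow> \<exists>s\<in>S. \<forall>t\<in>S. t < s \<longrightarrow> infdist (q t) (sublevel_at V c \<delta> \<xi>) < e"
  have "\<xi> \<in> Z"
  proof (rule ccontr)
    assume nZ: "\<xi> \<notin> Z"
    obtain s0 where s0: "s0 \<in> S" "s0 < 0" using S_expand[OF S_0] by blast
    define f where "f u = \<Phi> (norm (D u)) + W (q u)" for u
    have f_cont: "continuous_on {s0..0} f" unfolding f_def
      by (rule continuous_on_subset[OF action_integrand_continuous Icc_S[OF s0(1) S_0]])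
    define \<kappa> where "\<kappa> = integral {s0..0} f"
    have "\<kappa> > 0"
    proof -
      have "f u \<ge> 0" for u by (simp add: f_def Phi_nonneg W_nonneg)
      moreover have "f 0 > 0" using V_q_0 Phi_nonneg[of "norm (D 0)"] by (simp add: f_def W_def)
      ultimately have "\<kappa> \<noteq> 0" "\<kappa> \<ge> 0" unfolding \<kappa>_def
        using integral_eq_0_iff[OF f_cont, of] s0(2) integral_nonneg[OF integrable_continuous_real[OF f_cont]] by force+
      then show ?thesis by simp
    qed
    \<comment> \<open>The first bound keeps the detour so short that the node index is at most
      \<open>- 2 * i\<close>; the second makes the detour cheaper than
      \<open>\<kappa>\<close>.\<close>
    define \<epsilon> where "\<epsilon> = min (- s0 / 8) (\<kappa> / (8 * speed_const))"
    have \<epsilon>: "\<epsilon> > 0" "\<epsilon> \<le> - s0 / 8" "4 * \<epsilon> * speed_const < \<kappa>"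
    proof -
      show "\<epsilon> > 0" using s0 \<open>\<kappa> > 0\<close> speed_const(1) by (simp add: \<epsilon>_def)
      show "\<epsilon> \<le> - s0 / 8" by (simp add: \<epsilon>_def)
      have "\<epsilon> * speed_const \<le> \<kappa> / (8 * speed_const) * speed_const"
        using speed_const(1) by (intro mult_right_mono) (auto simp: \<epsilon>_def)
      also have "\<dots> = \<kappa> / 8" using speed_const(1) by simp
      finally show "4 * \<epsilon> * speed_const < \<kappa>" using \<open>\<kappa> > 0\<close> by simp
    qed
    obtain s2 where s2: "s2 \<in> S" "\<forall>t\<in>S. t < s2 \<longrightarrow> infdist (q t) (sublevel_at V c \<delta> \<xi>) < \<epsilon>" using \<xi>(4)[OF \<epsilon>(1)] by blast
    have "min s2 s0 \<in> S" using s0 s2(1) by (auto simp: min_def)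
    then obtain s where s: "s \<in> S" "s < min s2 s0" by (rule S_expand)
    then obtain b where b: "b \<in> sublevel_at V c \<delta> \<xi>" "dist (q s) b < \<epsilon>"
      using sublevel_at_attained[OF \<xi>(1), of "q s" \<epsilon>] s2(2) by auto
    have bB: "b \<in> B" using b(1) \<xi>(1) nZ unfolding sublevel_part_def by blast
    have "\<forall>\<^sub>F k in sequentially. dist (X k (lo s k)) b < \<epsilon>"
      using b(2) by (intro order_tendstoD(2)[OF tendsto_dist[OF X_lo_lim tendsto_const]])
    moreover have "\<forall>\<^sub>F k in sequentially. h k < \<epsilon>" using \<epsilon>(1) by (intro order_tendstoD(2)[OF h_lim])
    moreover have "\<forall>\<^sub>F k in sequentially. 4 * \<epsilon> \<le> of_nat (N k) * h k"
      using Nh_lim unfolding filterlim_at_top by blast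
    ultimately have "\<forall>\<^sub>F k in sequentially. icost (h k) (X k) (lo s k) (hi 0 k) \<le> 4 * \<epsilon> * speed_const"
    proof eventually_elim
      case (elim k)
      \<comment> \<open>The number of steps that cover \<epsilon> at unit speed; rounding adds at
        most one mesh, so \<open>i * h k < 2 * \<epsilon>\<close>.\<close>
      define i where "i = nat \<lceil>\<epsilon> / h k\<rceil>"
      have i: "\<epsilon> \<le> of_nat i * h k" "of_nat i * h k \<le> \<epsilon> + h k"
      proof -
        have "\<epsilon> / h k \<ge> 0" using \<epsilon>(1) h_pos[of k] by simp
        then have "0 \<le> \<lceil>\<epsilon> / h k\<rceil>" by linarith
        then have "real i = of_int \<lceil>\<epsilon> / h k\<rceil>" by (simp add: i_def)
        then have "\<epsilon> / h k \<le> real i" "real i \<le> \<epsilon> / h k + 1" by linarith+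
        then show "\<epsilon> \<le> of_nat i * h k" "of_nat i * h k \<le> \<epsilon> + h k" using h_pos[of k] by (simp_all add: field_simps)
      qed
      have "h k * of_int (lo s k) \<le> h k * of_int (- 2 * int i)"
      proof -
        have "s < s0" using s(2) by simp
        then have "s + h k \<le> - 2 * (of_nat i * h k)" using i(2) elim(2) \<epsilon>(1,2) by linarith
        moreover have "- 2 * (of_nat i * h k) = h k * of_int (- 2 * int i)" by simp
        ultimately show ?thesis using lo_bounds(2)[where s = s and k = k] by (metis order_trans)
      qed
      then have lo_i: "lo s k \<le> - 2 * int i" using h_pos[of k] by (simp only: mult_le_cancel_left_pos of_int_le_iff)
      have "of_nat (2 * i) * h k \<le> of_nat (N k) * h k" using i(2) elim(2,3) by simp
      then have "2 * i \<le> N k" using h_pos[of k] by simp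
      then have "icost (h k) (X k) (lo s k) 0 \<le> 2 * (of_nat i * h k * speed_const)"
        using elim(1) i(1) lo_i by (intro icost_cut[OF bB]) auto
      also have "of_nat i * h k * speed_const \<le> 2 * \<epsilon> * speed_const"
        using i(2) elim(2) speed_const(1) by (intro mult_right_mono) auto
      finally show ?case by (simp add: hi_def)
    qed
    then have "integral {s..0} f \<le> 4 * \<epsilon> * speed_const"
      unfolding f_def using s s0 S_0 by (intro action_le_bound) auto
    moreover have "\<kappa> \<le> integral {s..0} f"
      unfolding \<kappa>_def f_def using s s0 S_0 by (intro integral_mono_left) auto
    ultimately show False using \<epsilon>(3) by simp
  qed
  then show thesis using that[of \<xi>] \<xi>(4) by blast
qed (use W_end_left in blast)

text \<open>\<open>W\<close> becomes small towards the right end, whereas \<open>G\<close> is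
  nonnegative.\<close>

lemma energy_nonneg:
  assumes "\<And>t. t \<in> S \<Longrightarrow> G (norm (D t)) = W (q t) + E" shows "E \<ge> 0"
proof (rule field_le_epsilon)
  fix e :: real assume "e > 0"
  then obtain s where s: "s \<in> S" "\<forall>t\<in>S. s < t \<longrightarrow> W (q t) < e" using W_end_right by blast
  obtain t where t: "t \<in> S" "s < t" using S_expand[OF s(1)] by blast
  have "0 \<le> G (norm (D t))" by (rule G_nonneg) simp
  then show "0 \<le> E + e" using assms[OF t(1)] s(2) t by force
qed

text \<open>Slowing time down by the factor \<open>\<mu>\<close> changes the Lagrangian \<open>\<Phi> s + w\<close> into
  \<open>(\<Phi> (\<mu> s) + w) / \<mu>\<close>, whose derivative in \<open>\<mu>\<close> at \<open>1\<close> is the energy \<open>G s - w\<close>.\<close>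

lemma slow_down_gain:
  assumes E: "E > 0" and C: "C > 0"
  obtains \<mu> where "0 < \<mu>" "\<mu> < 1"
    "\<And>s w. 0 < s \<Longrightarrow> s \<le> C \<Longrightarrow> G s = w + E \<Longrightarrow> (\<Phi> (\<mu> * s) + w) / \<mu> \<le> \<Phi> s + w - (1 - \<mu>) * (E / 2)"
proof -
  have "uniformly_continuous_on {0..C} G"
    by (intro compact_uniformly_continuous continuous_on_subset[OF G_continuous]) auto
  then obtain d where d: "d > 0" "\<And>x y. x \<in> {0..C} \<Longrightarrow> y \<in> {0..C} \<Longrightarrow> dist y x < d \<Longrightarrow> dist (G y) (G x) < E / 2"
    using half_gt_zero[OF E] unfolding uniformly_continuous_on_def by meson
  \<comment> \<open>So close to 1 that all intermediate speeds \<open>z * s\<close> stay within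
    \<open>d\<close> of \<open>s\<close>, and \<open>G\<close> changes by less than
    \<open>E / 2\<close>.\<close>
  define \<mu> where "\<mu> = max (1/2) (1 - d / (2 * C))"
  have \<mu>: "0 < \<mu>" "\<mu> < 1" "(1 - \<mu>) * C < d"
  proof -
    show "0 < \<mu>" "\<mu> < 1" using d C by (auto simp: \<mu>_def)
    have "(1 - \<mu>) * C \<le> d / (2 * C) * C" using C by (intro mult_right_mono) (auto simp: \<mu>_def)
    then show "(1 - \<mu>) * C < d" using C d(1) by simp
  qed
  show thesis
  proof (rule that[OF \<mu>(1,2)])
    fix s w assume s: "0 < s" "s \<le> C" "G s = w + E"
    \<comment> \<open>Mean value theorem for \<open>\<lambda>z. (\<Phi> (z * s) + w) / z\<close>.
      The divisor \<open>z\<^sup>2\<close> is less than 1 and so only enlarges the gain.\<close>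
    have "\<exists>z>\<mu>. z < 1 \<and> (\<Phi> (1 * s) + w) / 1 - (\<Phi> (\<mu> * s) + w) / \<mu> = (1 - \<mu>) * ((G (z * s) - w) / z\<^sup>2)"
    proof (rule MVT2[OF \<mu>(2)])
      fix z assume z: "\<mu> \<le> z" "z \<le> 1"
      then have z0: "z > 0" using \<mu>(1) by simp
      have "((\<lambda>z. \<Phi> (z * s)) has_real_derivative P (z * s) * s) (at z)"
      proof (rule DERIV_chain2[where f = \<Phi> and g = "\<lambda>z. z * s"])
        show "(\<Phi> has_real_derivative P (z * s)) (at (z * s))" using z0 s(1) by (intro Phi_DERIV) simp
      qed (auto intro!: derivative_eq_intros)
      then show "((\<lambda>z. (\<Phi> (z * s) + w) / z) has_real_derivative (G (z * s) - w) / z\<^sup>2) (at z)"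
        using z0 by (auto intro!: derivative_eq_intros simp: G_eq power2_eq_square field_simps)
    qed
    then obtain z where z: "\<mu> < z" "z < 1" "\<Phi> s + w - (\<Phi> (\<mu> * s) + w) / \<mu> = (1 - \<mu>) * ((G (z * s) - w) / z\<^sup>2)" by auto
    have "dist (z * s) s < d"
    proof -
      have "dist (z * s) s = (1 - z) * s" using z s(1) by (simp add: dist_real_def algebra_simps abs_if)
      also have "\<dots> \<le> (1 - \<mu>) * C" using z s by (intro mult_mono) auto
      finally show ?thesis using \<mu>(3) by simp
    qed
    moreover have "z * s \<le> C" using z(2) s(1,2) mult_right_mono[of z 1 s] by linarith
    ultimately have "dist (G (z * s)) (G s) < E / 2" using z \<mu>(1) s by (intro d(2)) auto
    then have "G (z * s) - w \<ge> E / 2" using s(3) unfolding dist_real_def by linarith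
    moreover have "0 < z\<^sup>2" "z\<^sup>2 \<le> 1" using z \<mu>(1) by (auto simp: power_le_one)
    ultimately have "E / 2 \<le> (G (z * s) - w) / z\<^sup>2"
      using E by (simp add: pos_le_divide_eq) (meson half_gt_zero less_imp_le mult_left_le order_trans)
    then have "(1 - \<mu>) * (E / 2) \<le> (1 - \<mu>) * ((G (z * s) - w) / z\<^sup>2)" using \<mu>(2) by (intro mult_left_mono) auto
    then show "(\<Phi> (\<mu> * s) + w) / \<mu> \<le> \<Phi> s + w - (1 - \<mu>) * (E / 2)" using z(3) by linarith
  qed
qed

text \<open>With \<open>E > 0\<close> speeds are positive and bounded, so a uniform slowdown saves
  action at a fixed rate. On every interval containing \<open>{a1..b1}\<close> it saves at least
  \<open>gain\<close>, however far the interval extends; extending it until its ends are close to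
  \<open>A\<close> and \<open>B\<close> contradicts \<open>lower_bound\<close>.\<close>

lemma energy_zero: assumes t: "t \<in> S" shows "G (norm (D t)) = W (q t)"
proof -
  obtain E where E: "\<And>t. t \<in> S \<Longrightarrow> G (norm (D t)) = W (q t) + E" by (rule energy_constant) blast
  have "E \<ge> 0" by (rule energy_nonneg[OF E])
  moreover have "\<not> E > 0"
  proof
    assume Epos: "E > 0"
    obtain K where K: "\<And>x. W x \<le> K" using W_bounded by blast
    obtain b0 where b0: "\<And>s. s \<ge> 0 \<Longrightarrow> G s \<le> K + E \<Longrightarrow> s \<le> b0" using G_bounded_imp by blast
    define C where "C = max 1 b0"
    have D_bd: "norm (D u) \<le> C" if "u \<in> S" for u
      using b0[of "norm (D u)"] E[OF that] K[of "q u"] by (simp add: C_def)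
    have D_pos: "norm (D u) > 0" if "u \<in> S" for u
      using E[OF that] W_nonneg[of "q u"] Epos by (cases "D u = 0") auto
    obtain \<mu> where \<mu>: "0 < \<mu>" "\<mu> < 1"
      "\<And>s w. 0 < s \<Longrightarrow> s \<le> C \<Longrightarrow> G s = w + E \<Longrightarrow> (\<Phi> (\<mu> * s) + w) / \<mu> \<le> \<Phi> s + w - (1 - \<mu>) * (E / 2)"
      by (rule slow_down_gain[OF Epos, of C]) (auto simp: C_def)
    obtain \<xi> where \<xi>: "\<xi> \<in> Z" "\<And>e. e > 0 \<Longrightarrow> \<exists>s\<in>S. \<forall>t\<in>S. t < s \<longrightarrow> infdist (q t) (sublevel_at V c \<delta> \<xi>) < e"
      by (rule left_end) blast
    obtain \<eta> where \<eta>: "\<eta> \<in> int_lattice - Z" "\<And>e. e > 0 \<Longrightarrow> \<exists>s\<in>S. \<forall>t\<in>S. s < t \<longrightarrow> infdist (q t) (sublevel_at V c \<delta> \<eta>) < e"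
      by (rule right_end) blast
    obtain a1 b1 where ab1: "a1 \<in> S" "b1 \<in> S" "a1 < 0" "0 < b1" by (rule S_expand[OF S_0])
    define gain where "gain = (1 - \<mu>) * (E / 2) * (b1 - a1)"
    have "gain > 0" using \<mu> Epos ab1 by (simp add: gain_def)
    \<comment> \<open>The price \<open>2 * \<epsilon> * speed_const\<close> of joining the ends to
      \<open>A\<close> and \<open>B\<close> becomes \<open>gain / 2\<close>.\<close>
    define \<epsilon> where "\<epsilon> = gain / (4 * speed_const)"
    have \<epsilon>: "\<epsilon> > 0" "2 * \<epsilon> * speed_const < gain" using \<open>gain > 0\<close> speed_const(1) by (auto simp: \<epsilon>_def)
    obtain a2 where a2: "a2 \<in> S" "\<forall>t\<in>S. t < a2 \<longrightarrow> infdist (q t) (sublevel_at V c \<delta> \<xi>) < \<epsilon>" using \<xi>(2)[OF \<epsilon>(1)] by blast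
    obtain b2 where b2: "b2 \<in> S" "\<forall>t\<in>S. b2 < t \<longrightarrow> infdist (q t) (sublevel_at V c \<delta> \<eta>) < \<epsilon>" using \<eta>(2)[OF \<epsilon>(1)] by blast
    have "min a1 a2 \<in> S" "max b1 b2 \<in> S" using ab1 a2(1) b2(1) by (auto simp: min_def max_def)
    then obtain a b where ab: "a \<in> S" "a < min a1 a2" "b \<in> S" "max b1 b2 < b" using S_expand by metis
    obtain A0 where A0: "A0 \<in> sublevel_at V c \<delta> \<xi>" "dist (q a) A0 < \<epsilon>"
      by (rule sublevel_at_attained[of \<xi> "q a" \<epsilon>]) (use \<xi>(1) Z_sub a2 ab in auto)
    obtain B0 where B0: "B0 \<in> sublevel_at V c \<delta> \<eta>" "dist (q b) B0 < \<epsilon>"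
      by (rule sublevel_at_attained[of \<eta> "q b" \<epsilon>]) (use \<eta>(1) b2 ab in auto)
    have mem: "A0 \<in> A" "B0 \<in> B" using A0(1) B0(1) \<xi>(1) \<eta>(1) unfolding sublevel_part_def by blast+
    have "a < b" using ab ab1 by simp
    have sub: "{a..b} \<subseteq> S" by (rule Icc_S[OF ab(1,3)])
    define f where "f u = \<Phi> (norm (D u)) + W (q u)" for u
    define g where "g u = (\<Phi> (\<mu> * norm (D u)) + W (q u)) / \<mu>" for u
    define q1 where "q1 u = q (\<mu> * u)" for u
    define p where "p u = \<mu> *\<^sub>R D (\<mu> * u)" for u
    have inS: "\<mu> * u \<in> S" if "a / \<mu> \<le> u" "u \<le> b / \<mu>" for u
      using that \<mu>(1) sub by (auto simp: field_simps subset_iff)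
    have Dmu: "continuous_on {a / \<mu>..b / \<mu>} p"
      unfolding p_def by (intro continuous_intros continuous_on_compose2[OF D_continuous]) (use inS in auto)
    have dq1: "(q1 has_vector_derivative p u) (at u)" if "a / \<mu> \<le> u" "u \<le> b / \<mu>" for u
    proof -
      have "((\<lambda>u. \<mu> * u) has_vector_derivative \<mu>) (at u)" by (auto intro!: derivative_eq_intros)
      from vector_diff_chain_at[OF this D_derivative(1)[OF inS[OF that]]]
      show ?thesis by (simp add: q1_def[abs_def] p_def o_def)
    qed
    have contPhi: "continuous_on {a / \<mu>..b / \<mu>} (\<lambda>u. \<Phi> (norm (p u)))"
      by (rule continuous_on_compose2[OF Phi_norm_continuous Dmu]) auto
    have le: "L \<le> integral {a / \<mu>..b / \<mu>} (\<lambda>u. \<Phi> (norm (p u)) + W (q1 u)) + 2 * \<epsilon> * speed_const"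
    proof (rule lower_bound[of "a / \<mu>" "b / \<mu>" q1 p A0 \<epsilon> B0])
      show "a / \<mu> < b / \<mu>" using \<open>a < b\<close> \<mu>(1) by (simp add: divide_strict_right_mono)
      show "continuous_on {a / \<mu>..b / \<mu>} q1"
        using dq1 by (auto intro!: continuous_at_imp_continuous_on has_vector_derivative_continuous)
      show "(p has_integral (q1 t - q1 s)) {s..t}" if "a / \<mu> \<le> s" "s \<le> t" "t \<le> b / \<mu>" for s t
        using that by (intro fundamental_theorem_of_calculus has_vector_derivative_at_within[OF dq1]) auto
      show "(\<lambda>u. \<Phi> (norm (p u))) integrable_on {a / \<mu>..b / \<mu>}" by (rule integrable_continuous_real[OF contPhi])
      show "dist A0 (q1 (a / \<mu>)) \<le> \<epsilon>" "dist (q1 (b / \<mu>)) B0 \<le> \<epsilon>" using A0(2) B0(2) \<mu>(1) by (auto simp: q1_def dist_commute)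
    qed (use mem in auto)
    have g_cont: "continuous_on {a..b} g" unfolding g_def
    proof (intro continuous_intros Wq_cont)
      have "continuous_on {a..b} (\<lambda>u. \<Phi> (norm (\<mu> *\<^sub>R D u)))"
        by (rule continuous_on_compose2[OF Phi_norm_continuous]) (auto intro!: continuous_intros continuous_on_subset[OF D_continuous sub])
      then show "continuous_on {a..b} (\<lambda>u. \<Phi> (\<mu> * norm (D u)))" using \<mu>(1) by simp
    qed (use \<mu> in auto)
    have f_int: "f integrable_on {a..b}" unfolding f_def
      by (rule integrable_continuous_real[OF continuous_on_subset[OF action_integrand_continuous sub]])
    \<comment> \<open>Change of variables back to \<open>{a..b}\<close>; the denominator
      \<open>\<mu>\<close> in \<open>g\<close> accounts for the longer duration.\<close>
    have "((\<lambda>u. g (\<mu> * u)) has_integral (1 / \<mu>) * integral {a..b} g) {a / \<mu>..b / \<mu>}"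
    proof -
      have im: "(\<lambda>x. x / \<mu>) ` {a..b} = {a / \<mu>..b / \<mu>}" using \<mu>(1) \<open>a < b\<close> by (simp add: image_divide_atLeastAtMost)
      show ?thesis using has_integral_stretch_real[OF integrable_integral[OF integrable_continuous_real[OF g_cont]], of \<mu>] \<mu>(1)
        unfolding im by simp
    qed
    then have "((\<lambda>u. \<mu> * g (\<mu> * u)) has_integral \<mu> * ((1 / \<mu>) * integral {a..b} g)) {a / \<mu>..b / \<mu>}"
      by (rule has_integral_mult_right)
    moreover have "\<mu> * g (\<mu> * u) = \<Phi> (norm (p u)) + W (q1 u)" for u using \<mu>(1) by (simp add: g_def p_def q1_def)
    ultimately have eq: "integral {a / \<mu>..b / \<mu>} (\<lambda>u. \<Phi> (norm (p u)) + W (q1 u)) = integral {a..b} g"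
      using \<mu>(1) by (simp add: integral_unique)
    have "integral {a..b} g \<le> integral {a..b} (\<lambda>u. f u - (1 - \<mu>) * (E / 2))"
    proof (rule integral_le[OF integrable_continuous_real[OF g_cont]])
      show "(\<lambda>u. f u - (1 - \<mu>) * (E / 2)) integrable_on {a..b}" by (intro integrable_diff f_int integrable_const_ivl)
      show "g u \<le> f u - (1 - \<mu>) * (E / 2)" if "u \<in> {a..b}" for u
        unfolding g_def f_def using sub that by (intro \<mu>(3) D_pos D_bd E) auto
    qed
    also have "\<dots> = integral {a..b} f - (b - a) * ((1 - \<mu>) * (E / 2))"
      using \<open>a < b\<close> by (subst integral_diff[OF f_int integrable_const_ivl]) simp
    finally have "integral {a..b} g \<le> integral {a..b} f - (b - a) * ((1 - \<mu>) * (E / 2))" .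
    moreover have "gain \<le> (b - a) * ((1 - \<mu>) * (E / 2))"
    proof -
      have "(1 - \<mu>) * (E / 2) * (b1 - a1) \<le> (1 - \<mu>) * (E / 2) * (b - a)"
        using ab \<mu> Epos by (intro mult_left_mono) auto
      then show ?thesis by (simp add: gain_def mult.commute)
    qed
    moreover have "integral {a..b} f \<le> L" unfolding f_def by (rule action_le_L[OF ab(1,3) \<open>a < b\<close>])
    ultimately have "integral {a..b} g \<le> L - gain" by linarith
    then show False using le eq \<epsilon>(2) by simp
  qed
  ultimately show ?thesis using E[OF t] by simp
qed

text \<open>The left cell is centred at some \<open>\<zeta> \<in> Z\<close>; translation by
  \<open>- \<zeta>\<close> moves it to the origin and keeps the right one outside \<open>Z\<close>.
  Periodicity carries over to the gradient by uniqueness of derivatives.\<close>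

lemma connection_of_limit: "\<exists>\<alpha> \<omega> q D L \<xi>. connection \<phi> l V c \<delta> Z \<alpha> \<omega> q D L \<xi>"
proof -
  obtain \<zeta> where \<zeta>: "\<zeta> \<in> Z" "\<And>e. e > 0 \<Longrightarrow> \<exists>s\<in>S. \<forall>t\<in>S. t < s \<longrightarrow> infdist (q t) (sublevel_at V c \<delta> \<zeta>) < e"
    by (rule left_end) blast
  obtain \<eta> where \<eta>: "\<eta> \<in> int_lattice - Z" "\<And>e. e > 0 \<Longrightarrow> \<exists>s\<in>S. \<forall>t\<in>S. s < t \<longrightarrow> infdist (q t) (sublevel_at V c \<delta> \<eta>) < e"
    by (rule right_end) blast
  have \<zeta>l: "- \<zeta> \<in> int_lattice" using \<zeta>(1) Z_sub int_lattice_minus by blast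
  have Vs: "V (q t - \<zeta>) = V (q t)" for t using V_per[OF \<zeta>l, of "q t"] by simp
  have grads: "grad V (q t - \<zeta>) = grad V (q t)" for t
  proof -
    have "((\<lambda>x. V (x + - \<zeta>)) has_derivative (\<lambda>k. inner k (grad V (q t - \<zeta>)))) (at (q t))"
    proof (rule has_derivative_compose[where f = "\<lambda>x. x + - \<zeta>" and f' = "\<lambda>x. x" and g = V])
      show "(V has_derivative (\<lambda>k. inner k (grad V (q t - \<zeta>)))) (at (q t + - \<zeta>))"
        using V_has_derivative[of "q t - \<zeta>"] by simp
    qed (auto intro!: derivative_eq_intros)
    then have "(V has_derivative (\<lambda>k. inner k (grad V (q t - \<zeta>)))) (at (q t))" using V_per[OF \<zeta>l] by simp
    then have "(\<lambda>k. inner k (grad V (q t - \<zeta>))) = (\<lambda>k. inner k (grad V (q t)))"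
      using V_has_derivative has_derivative_unique by blast
    then have "inner k (grad V (q t - \<zeta>) - grad V (q t)) = 0" for k by (simp add: inner_diff_right fun_eq_iff)
    then show ?thesis using inner_eq_zero_iff[of "grad V (q t - \<zeta>) - grad V (q t)"] by simp
  qed
  have infd: "infdist (q t - \<zeta>) (sublevel_at V c \<delta> (\<xi> - \<zeta>)) = infdist (q t) (sublevel_at V c \<delta> \<xi>)"
    if "\<xi> \<in> int_lattice" for t \<xi>
  proof -
    have "sublevel_at V c \<delta> (\<xi> - \<zeta>) = (\<lambda>x. x - \<zeta>) ` sublevel_at V c \<delta> \<xi>"
    proof (intro equalityI subsetI)
      fix x assume "x \<in> sublevel_at V c \<delta> (\<xi> - \<zeta>)"
      then have "x + \<zeta> \<in> sublevel_at V c \<delta> \<xi>" using sublevel_at_shift[of \<zeta> x "\<xi> - \<zeta>"] \<zeta>(1) Z_sub by auto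
      then show "x \<in> (\<lambda>x. x - \<zeta>) ` sublevel_at V c \<delta> \<xi>" by (rule rev_image_eqI) simp
    next
      fix x assume "x \<in> (\<lambda>x. x - \<zeta>) ` sublevel_at V c \<delta> \<xi>"
      then show "x \<in> sublevel_at V c \<delta> (\<xi> - \<zeta>)" using sublevel_at_shift[OF \<zeta>l, of _ \<xi>] by auto
    qed
    then show ?thesis using lattice_in_sublevel_at[OF that]
      by (subst (1 2) infdist_notempty) (auto simp: image_image dist_norm)
  qed
  have "connection \<phi> l V c \<delta> Z \<alpha> \<omega> (\<lambda>t. q t - \<zeta>) D L (\<eta> - \<zeta>)"
  proof (unfold_locales, unfold S_eq Vs grads)
    show "\<alpha> < \<omega>"
    proof -
      have "0 \<in> einterval \<alpha> \<omega>" using S_0 S_eq by simp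
      then show ?thesis unfolding einterval_def by (auto intro: less_trans)
    qed
    show "continuous_on UNIV (\<lambda>t. q t - \<zeta>)" by (intro continuous_intros q_cont)
    show "((\<lambda>t. q t - \<zeta>) has_vector_derivative D t) (at t)" if "t \<in> S" for t
      using D_derivative(1)[OF that] by (auto intro!: derivative_eq_intros)
    show "((\<lambda>u. Pv (D u)) has_vector_derivative grad V (q t)) (at t)" if "t \<in> S" for t
      by (rule D_derivative(2)[OF that])
    show "c < V (q t)" if "t \<in> S" for t by (rule S_above[OF that])
    show "G (norm (D t)) = V (q t) - c" if "t \<in> S" for t using energy_zero[OF that] W_eq_S[OF that] by simp
    show "\<exists>s\<in>S. \<forall>t\<in>S. t < s \<longrightarrow> infdist (q t - \<zeta>) (sublevel_at V c \<delta> 0) < e" if "e > 0" for e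
    proof -
      have "infdist (q t - \<zeta>) (sublevel_at V c \<delta> 0) = infdist (q t) (sublevel_at V c \<delta> \<zeta>)" for t
        using infd[of \<zeta> t] \<zeta>(1) Z_sub by auto
      then show ?thesis using \<zeta>(2)[OF that] by simp
    qed
    show "\<exists>s\<in>S. \<forall>t\<in>S. s < t \<longrightarrow> infdist (q t - \<zeta>) (sublevel_at V c \<delta> (\<eta> - \<zeta>)) < e" if "e > 0" for e
      using \<eta>(2)[OF that] infd[of \<eta>] \<eta>(1) by simp
    show "\<eta> - \<zeta> \<in> int_lattice - Z" using Z_compl_add[OF \<eta>(1) Z_minus[OF \<zeta>(1)]] by simp
    show "integral {s..t} (\<lambda>u. \<Phi> (norm (D u)) + (V (q u) - c)) \<le> L" if "s \<in> S" "t \<in> S" "s < t" for s t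
    proof -
      have "integral {s..t} (\<lambda>u. \<Phi> (norm (D u)) + (V (q u) - c)) = integral {s..t} (\<lambda>u. \<Phi> (norm (D u)) + W (q u))"
        by (rule integral_cong) (use Icc_S[OF that(1,2)] W_eq_S in auto)
      then show ?thesis using action_le_L[OF that] by simp
    qed
  qed (rule lower_bound)
  then show ?thesis by blast
qed

end

context subgroup_step begin

lemma connection_exists: "\<exists>\<alpha> \<omega> q D L \<xi>. connection \<phi> l V c \<delta> Z \<alpha> \<omega> q D L \<xi>"
  using limit_curve_exists limit_curve.connection_of_limit by blast

end

section \<open>Smooth cutoffs and weak derivatives\<close>

text \<open>The building block of smooth bumps. The polynomial factor makes the family closed under
  differentiation.\<close>

definition flat :: "real poly \<Rightarrow> real \<Rightarrow> real" where
  "flat r x = (if x > 0 then poly r (1 / x) * exp (- 1 / x) else 0)"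

lemma poly_exp_decay: "((\<lambda>y. poly r y * exp (- y)) \<longlongrightarrow> 0) at_top" for r :: "real poly"
proof -
  have "((\<lambda>y. \<Sum>i\<le>degree r. coeff r i * (y ^ i / exp y)) \<longlongrightarrow> (\<Sum>i\<le>degree r. coeff r i * 0)) at_top"
    by (intro tendsto_intros tendsto_power_div_exp_0)
  then show ?thesis
    by (simp add: poly_altdef exp_minus divide_inverse sum_distrib_right mult.assoc)
qed

text \<open>For \<open>x > 0\<close> the factor \<open>[:0, 0, 1:]\<close> stands for the
  \<open>1 / x\<^sup>2\<close> of the chain rule. At 0 the right difference quotient is, with
  \<open>y = 1 / h\<close>, again a polynomial in \<open>y\<close> times
  \<open>exp (- y)\<close>.\<close>

lemma flat_has_derivative: "(flat r has_real_derivative flat ([:0, 0, 1:] * (r - pderiv r)) x) (at x)"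
proof -
  consider "x > 0" | "x < 0" | "x = 0" by linarith
  then show ?thesis
  proof cases
    case 1
    have "((\<lambda>x. poly r (1 / x) * exp (- 1 / x)) has_real_derivative flat ([:0, 0, 1:] * (r - pderiv r)) x) (at x)"
      using 1 by (auto intro!: derivative_eq_intros simp: flat_def power2_eq_square field_simps)
    then show ?thesis
      by (rule has_field_derivative_transform_within[of _ _ _ _ x]) (use 1 in \<open>auto simp: flat_def dist_real_def\<close>)
  next
    case 2
    have "((\<lambda>x. 0) has_real_derivative 0) (at x)" by simp
    then have "(flat r has_real_derivative 0) (at x)"
      by (rule has_field_derivative_transform_within[of _ _ _ _ "- x"]) (use 2 in \<open>auto simp: flat_def dist_real_def\<close>)
    then show ?thesis using 2 by (simp add: flat_def)
  next
    case 3
    have right: "((\<lambda>h. flat r h / h) \<longlongrightarrow> 0) (at_right 0)"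
    proof -
      have "((\<lambda>h::real. poly ([:0, 1:] * r) (inverse h) * exp (- inverse h)) \<longlongrightarrow> 0) (at_right 0)"
        by (rule filterlim_compose[OF poly_exp_decay filterlim_inverse_at_top_right])
      moreover have "\<forall>\<^sub>F h::real in at_right 0. poly ([:0, 1:] * r) (inverse h) * exp (- inverse h) = flat r h / h"
        by (auto simp: eventually_at_right_field flat_def field_simps intro!: exI[of _ 1])
      ultimately show ?thesis by (rule Lim_transform_eventually)
    qed
    have "\<forall>\<^sub>F h in at_left 0. 0 = flat r h / h"
      by (auto simp: eventually_at_left_field flat_def intro!: exI[of _ "-1"])
    then have "((\<lambda>h. flat r h / h) \<longlongrightarrow> 0) (at_left 0)" by (rule Lim_transform_eventually[OF tendsto_const])
    then have "((\<lambda>h. flat r h / h) \<longlongrightarrow> 0) (at 0)" using right by (simp add: filterlim_at_split)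
    then show ?thesis using 3 by (simp add: has_field_derivative_iff flat_def)
  qed
qed

text \<open>A class of functions closed under differentiation consists of smooth functions; this one
  is just large enough to contain the cutoffs.\<close>

inductive flat_generated :: "(real \<Rightarrow> real) \<Rightarrow> bool" where
  const: "flat_generated (\<lambda>x. k)"
| flat: "flat_generated (\<lambda>x. flat r (a * x + b))"
| add: "flat_generated f \<Longrightarrow> flat_generated g \<Longrightarrow> flat_generated (\<lambda>x. f x + g x)"
| mult: "flat_generated f \<Longrightarrow> flat_generated g \<Longrightarrow> flat_generated (\<lambda>x. f x * g x)"
| inverse: "flat_generated f \<Longrightarrow> (\<And>x. f x \<noteq> 0) \<Longrightarrow> flat_generated (\<lambda>x. inverse (f x))"

lemma flat_generated_derivative:
  assumes "flat_generated f"
  shows "\<exists>f'. flat_generated f' \<and> (\<forall>x. (f has_real_derivative f' x) (at x))"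
  using assms
proof induction
  case (const k)
  show ?case by (rule exI[of _ "\<lambda>x. 0"]) (auto intro: flat_generated.const)
next
  case (flat r a b)
  let ?s = "[:0, 0, 1:] * (r - pderiv r)"
  have "((\<lambda>x. flat r (a * x + b)) has_real_derivative flat ?s (a * x + b) * a) (at x)" for x
    by (rule DERIV_chain2[OF flat_has_derivative]) (auto intro!: derivative_eq_intros)
  then show ?case
    by (intro exI[of _ "\<lambda>x. flat ?s (a * x + b) * a"]) (auto intro: flat_generated.intros)
next
  case (add f g)
  then obtain f' g' where "flat_generated f'" "flat_generated g'"
    "\<forall>x. (f has_real_derivative f' x) (at x)" "\<forall>x. (g has_real_derivative g' x) (at x)" by blast
  then show ?case by (intro exI[of _ "\<lambda>x. f' x + g' x"]) (auto intro: flat_generated.intros DERIV_add)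
next
  case (mult f g)
  then obtain f' g' where *: "flat_generated f'" "flat_generated g'"
    "\<forall>x. (f has_real_derivative f' x) (at x)" "\<forall>x. (g has_real_derivative g' x) (at x)" by blast
  have "((\<lambda>x. f x * g x) has_real_derivative f' x * g x + f x * g' x) (at x)" for x
    using DERIV_mult[OF *(3)[rule_format, of x] *(4)[rule_format, of x]] by (simp add: mult.commute add.commute)
  then show ?case using * mult.hyps
    by (intro exI[of _ "\<lambda>x. f' x * g x + f x * g' x"]) (auto intro!: flat_generated.intros(3,4))
next
  case (inverse f)
  then obtain f' where *: "flat_generated f'" "\<forall>x. (f has_real_derivative f' x) (at x)" by blast
  have "((\<lambda>x. inverse (f x)) has_real_derivative (- 1) * (f' x * (inverse (f x) * inverse (f x)))) (at x)" for x
    using DERIV_inverse_fun[OF *(2)[rule_format, of x] inverse(2)[of x]] by (simp add: power2_eq_square)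
  moreover have "flat_generated (\<lambda>x. (- 1) * (f' x * (inverse (f x) * inverse (f x))))"
    using * inverse.hyps by (intro flat_generated.mult flat_generated.const flat_generated.inverse)
  ultimately show ?case by blast
qed

lemma flat_generated_smooth:
  assumes "flat_generated f" shows "(deriv ^^ k) f differentiable (at t)"
proof -
  have "flat_generated ((deriv ^^ k) f)" for k
  proof (induction k)
    case (Suc k)
    obtain f' where "flat_generated f'" "\<And>x. ((deriv ^^ k) f has_real_derivative f' x) (at x)"
      using flat_generated_derivative[OF Suc] by blast
    then have "deriv ((deriv ^^ k) f) = f'" using DERIV_imp_deriv by blast
    then show ?case using \<open>flat_generated f'\<close> by simp
  qed (simp add: assms)
  then obtain f' where "((deriv ^^ k) f has_real_derivative f' t) (at t)"
    using flat_generated_derivative by blast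
  then show ?thesis using real_differentiable_def by blast
qed

text \<open>The usual smooth transition from 0 to 1 over the unit interval; the two summands of the
  denominator never vanish together.\<close>

definition smooth_step :: "real \<Rightarrow> real" where
  "smooth_step x = flat 1 x * inverse (flat 1 x + flat 1 (1 - x))"

lemma flat_1: "flat 1 x \<ge> 0" "x > 0 \<Longrightarrow> flat 1 x > 0" "x \<le> 0 \<Longrightarrow> flat 1 x = 0"
  by (auto simp: flat_def)

lemma smooth_step_denominator: "flat 1 x + flat 1 (1 - x) > 0"
  using flat_1(1)[of x] flat_1(1)[of "1 - x"] flat_1(2)[of x] flat_1(2)[of "1 - x"] by (cases "x > 0") auto

lemma smooth_step_bounds: "0 \<le> smooth_step x" "smooth_step x \<le> 1"
  "x \<le> 0 \<Longrightarrow> smooth_step x = 0" "x \<ge> 1 \<Longrightarrow> smooth_step x = 1"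
  using flat_1(1)[of x] flat_1(1)[of "1 - x"] smooth_step_denominator[of x] flat_1(3)[of x] flat_1(3)[of "1 - x"] flat_1(2)[of x]
  by (auto simp: smooth_step_def divide_inverse[symmetric] divide_le_eq_1_pos)

lemma smooth_step_affine_generated: "flat_generated (\<lambda>x. smooth_step (a * x + b))"
proof -
  have "flat_generated (\<lambda>x. flat 1 (a * x + b) * inverse (flat 1 (a * x + b) + flat 1 ((- a) * x + (1 - b))))"
  proof (intro flat_generated.intros)
    show "flat 1 (a * x + b) + flat 1 ((- a) * x + (1 - b)) \<noteq> 0" for x
      using smooth_step_denominator[of "a * x + b"] by (simp add: algebra_simps)
  qed
  then show ?thesis by (simp add: smooth_step_def algebra_simps)
qed

text \<open>Sign and support make \<open>n * s' (n * (x - a))\<close> a one-sided approximate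
  identity at \<open>a\<close>. The sign is read off the quotient rule.\<close>

lemma smooth_step_derivative:
  obtains s' where "continuous_on UNIV s'" "\<And>x. (smooth_step has_real_derivative s' x) (at x)"
    "\<And>x. s' x \<ge> 0" "\<And>x. x < 0 \<or> 1 < x \<Longrightarrow> s' x = 0"
proof -
  have "flat_generated smooth_step" using smooth_step_affine_generated[of 1 0] by simp
  then obtain s' where s': "flat_generated s'" "\<And>x. (smooth_step has_real_derivative s' x) (at x)"
    using flat_generated_derivative by blast
  obtain s'' where "\<And>x. (s' has_real_derivative s'' x) (at x)" using flat_generated_derivative[OF s'(1)] by blast
  then have cont: "continuous_on UNIV s'"
    by (intro continuous_at_imp_continuous_on ballI) (rule DERIV_isCont)
  let ?r = "[:0, 0, 1::real:]"
  have fd: "(flat 1 has_real_derivative flat ?r x) (at x)" for x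
    using flat_has_derivative[of 1 x] by simp
  have nn: "flat ?r x \<ge> 0" for x by (simp add: flat_def)
  have s'_nonneg: "s' x \<ge> 0" for x
  proof -
    let ?d = "flat 1 x + flat 1 (1 - x)"
    have d: "?d > 0" by (rule smooth_step_denominator)
    have "((\<lambda>x. flat 1 (1 - x)) has_real_derivative flat ?r (1 - x) * (- 1)) (at x)"
      by (rule DERIV_chain2[OF fd]) (auto intro!: derivative_eq_intros)
    then have "((\<lambda>x. flat 1 x / (flat 1 x + flat 1 (1 - x))) has_real_derivative
       (flat ?r x * ?d - flat 1 x * (flat ?r x + flat ?r (1 - x) * (- 1))) / (?d * ?d)) (at x)"
      using d by (intro DERIV_divide DERIV_add fd) auto
    then have "(smooth_step has_real_derivative
       (flat ?r x * ?d - flat 1 x * (flat ?r x + flat ?r (1 - x) * (- 1))) / (?d * ?d)) (at x)"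
      by (simp add: smooth_step_def[abs_def] divide_inverse)
    then have "s' x = (flat ?r x * ?d - flat 1 x * (flat ?r x + flat ?r (1 - x) * (- 1))) / (?d * ?d)"
      using s'(2) DERIV_unique by blast
    also have "flat ?r x * ?d - flat 1 x * (flat ?r x + flat ?r (1 - x) * (- 1)) =
        flat ?r x * flat 1 (1 - x) + flat 1 x * flat ?r (1 - x)" by (simp add: algebra_simps)
    also have "\<dots> / (?d * ?d) \<ge> 0" using nn flat_1(1) d by (intro divide_nonneg_pos add_nonneg_nonneg mult_nonneg_nonneg) auto
    finally show ?thesis .
  qed
  have "s' x = 0" if "x < 0 \<or> 1 < x" for x
  proof (cases "x < 0")
    case True
    have "((\<lambda>x. 0) has_real_derivative 0) (at x)" by simp
    then have "(smooth_step has_real_derivative 0) (at x)"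
      by (rule has_field_derivative_transform_within_open[of _ _ _ "{..<0}"]) (use True in \<open>auto simp: smooth_step_bounds\<close>)
    then show ?thesis using s'(2) DERIV_unique by blast
  next
    case False
    have "((\<lambda>x. 1) has_real_derivative 0) (at x)" by simp
    then have "(smooth_step has_real_derivative 0) (at x)"
      by (rule has_field_derivative_transform_within_open[of _ _ _ "{1<..}"]) (use False that in \<open>auto simp: smooth_step_bounds\<close>)
    then show ?thesis using s'(2) DERIV_unique by blast
  qed
  then show thesis using that[OF cont s'(2) s'_nonneg] by blast
qed

text \<open>Both ramps have width \<open>1 / n\<close> and lie to the right of \<open>a\<close> and
  of \<open>b\<close>. The derivative is therefore a difference of two one-sided kernels, at
  \<open>a\<close> and at \<open>b\<close>.\<close>

definition cutoff :: "real \<Rightarrow> real \<Rightarrow> nat \<Rightarrow> real \<Rightarrow> real" where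
  "cutoff a b n x = smooth_step (real n * (x - a)) - smooth_step (real n * (x - b))"

lemma cutoff_outside:
  assumes "n > 0" "a < b" "x \<notin> {a..b + 1 / real n}" shows "cutoff a b n x = 0"
proof (cases "x < a")
  case True
  then have "real n * (x - a) \<le> 0" "real n * (x - b) \<le> 0" using assms by (auto simp: mult_le_0_iff)
  then show ?thesis by (simp add: cutoff_def smooth_step_bounds)
next
  case False
  then have x: "x > b + 1 / real n" using assms by auto
  then have "real n * (x - b) \<ge> 1" using assms(1) by (simp add: field_simps)
  moreover have "real n * (x - a) \<ge> real n * (x - b)" using assms by (intro mult_left_mono) auto
  ultimately show ?thesis by (simp add: cutoff_def smooth_step_bounds)
qed

lemma cutoff_test_function:
  assumes n: "n > 0" and ab: "a < b" and U: "{a..b + 1 / real n} \<subseteq> U" shows "test_function U (cutoff a b n)"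
proof -
  have "flat_generated (\<lambda>x. smooth_step (real n * x + (- (real n * a))) + (- 1) * smooth_step (real n * x + (- (real n * b))))"
    by (intro flat_generated.add flat_generated.mult flat_generated.const smooth_step_affine_generated)
  then have "flat_generated (cutoff a b n)" by (simp add: cutoff_def[abs_def] algebra_simps)
  moreover have sub: "closure {t. cutoff a b n t \<noteq> 0} \<subseteq> {a..b + 1 / real n}"
  proof (rule closure_minimal)
    show "{t. cutoff a b n t \<noteq> 0} \<subseteq> {a..b + 1 / real n}" using cutoff_outside[OF n ab] by blast
  qed simp
  moreover have "compact (closure {t. cutoff a b n t \<noteq> 0})"
    using sub by (metis bounded_closed_interval bounded_subset closed_closure compact_eq_bounded_closed)
  ultimately show ?thesis unfolding test_function_def using flat_generated_smooth U by blast
qed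

text \<open>Once \<open>1 / n < b - a\<close> the kernel has integral 1 over \<open>{a..b}\<close>,
  by the fundamental theorem of calculus, and lives within \<open>1 / n\<close> of \<open>a\<close>,
  where \<open>q\<close> is close to \<open>q a\<close>.\<close>

lemma approximate_identity:
  fixes q :: "real \<Rightarrow> 'a::euclidean_space"
  assumes ab: "a < b" and q: "continuous_on {a..b} q"
    and s': "continuous_on UNIV s'" "\<And>x. (smooth_step has_real_derivative s' x) (at x)"
    "\<And>x. s' x \<ge> 0" "\<And>x. x < 0 \<or> 1 < x \<Longrightarrow> s' x = 0"
  shows "(\<lambda>n. integral {a..b} (\<lambda>x. (real n * s' (real n * (x - a))) *\<^sub>R q x)) \<longlonglongrightarrow> q a"
proof (rule tendstoI)
  fix e :: real assume e: "e > 0"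
  obtain d where d: "d > 0" "\<And>x. x \<in> {a..b} \<Longrightarrow> dist x a < d \<Longrightarrow> dist (q x) (q a) < e / 2"
    using q ab half_gt_zero[OF e] unfolding continuous_on_iff by (metis atLeastAtMost_iff less_imp_le order_refl)
  obtain n0 where n0: "1 / real (Suc n0) < min d (b - a)" using reals_Archimedean[of "min d (b - a)"] d ab by (auto simp: inverse_eq_divide)
  have "dist (integral {a..b} (\<lambda>x. (real n * s' (real n * (x - a))) *\<^sub>R q x)) (q a) < e" if n: "n \<ge> Suc n0" for n
  proof -
    have npos: "real n > 0" using n by simp
    have "1 / real n \<le> 1 / real (Suc n0)" using n by (intro divide_left_mono) auto
    then have n1: "1 / real n < d" "1 / real n < b - a" using n0 by auto
    let ?k = "\<lambda>x. real n * s' (real n * (x - a))"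
    have kc: "continuous_on T ?k" for T
      by (intro continuous_intros continuous_on_compose2[OF s'(1)]) auto
    have "((\<lambda>x. smooth_step (real n * (x - a))) has_real_derivative ?k x) (at x)" for x
    proof -
      have "((\<lambda>x. real n * (x - a)) has_real_derivative real n) (at x)" by (auto intro!: derivative_eq_intros)
      from DERIV_chain2[OF s'(2) this] show ?thesis by (simp only: mult.commute)
    qed
    then have "(?k has_integral (smooth_step (real n * (b - a)) - smooth_step (real n * (a - a)))) {a..b}"
      using ab by (intro fundamental_theorem_of_calculus) (auto simp: has_real_derivative_iff_has_vector_derivative[symmetric] intro: has_field_derivative_at_within)
    moreover have "real n * (b - a) \<ge> 1" using n1(2) npos by (simp add: field_simps)
    ultimately have kint: "(?k has_integral 1) {a..b}" by (simp add: smooth_step_bounds)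
    have "((\<lambda>x. ?k x *\<^sub>R q a) has_integral 1 *\<^sub>R q a) {a..b}" by (rule has_integral_scaleR_left[OF kint])
    moreover have "(\<lambda>x. ?k x *\<^sub>R q x) integrable_on {a..b}"
      by (intro integrable_continuous_real continuous_intros kc q)
    ultimately have "((\<lambda>x. ?k x *\<^sub>R q x - ?k x *\<^sub>R q a) has_integral
        (integral {a..b} (\<lambda>x. ?k x *\<^sub>R q x) - 1 *\<^sub>R q a)) {a..b}"
      by (intro has_integral_diff integrable_integral)
    then have eq: "integral {a..b} (\<lambda>x. ?k x *\<^sub>R q x) - q a = integral {a..b} (\<lambda>x. ?k x *\<^sub>R q x - ?k x *\<^sub>R q a)"
      by (simp add: integral_unique)
    have "norm (integral {a..b} (\<lambda>x. ?k x *\<^sub>R q x - ?k x *\<^sub>R q a)) \<le> integral {a..b} (\<lambda>x. ?k x * (e / 2))"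
    proof (rule integral_norm_bound_integral)
      show "(\<lambda>x. ?k x *\<^sub>R q x - ?k x *\<^sub>R q a) integrable_on {a..b}"
        by (intro integrable_continuous_real continuous_intros kc q)
      show "(\<lambda>x. ?k x * (e / 2)) integrable_on {a..b}" by (intro integrable_continuous_real continuous_intros kc)
      fix x assume x: "x \<in> {a..b}"
      show "norm (?k x *\<^sub>R q x - ?k x *\<^sub>R q a) \<le> ?k x * (e / 2)"
      proof (cases "real n * (x - a) > 1")
        case True then show ?thesis using s'(4) by simp
      next
        case False
        then have "x - a \<le> 1 / real n" using npos by (simp add: field_simps)
        then have "dist x a < d" using x n1(1) by (auto simp: dist_real_def)
        then have "norm (q x - q a) \<le> e / 2" using d(2) x by (force simp: dist_norm)
        moreover have "?k x \<ge> 0" using npos s'(3) by simp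
        ultimately have "?k x * norm (q x - q a) \<le> ?k x * (e / 2)" by (rule mult_left_mono)
        then show ?thesis using \<open>?k x \<ge> 0\<close> by (simp add: scaleR_diff_right[symmetric] del: scaleR_diff_right)
      qed
    qed
    also have "\<dots> = e / 2" using integral_unique[OF has_integral_mult_left[OF kint, of "e / 2"]] by (simp only: mult_1)
    finally show ?thesis using eq e by (simp add: dist_norm)
  qed
  then show "\<forall>\<^sub>F n in sequentially. dist (integral {a..b} (\<lambda>x. (real n * s' (real n * (x - a))) *\<^sub>R q x)) (q a) < e"
    unfolding eventually_sequentially by blast
qed

text \<open>At \<open>a\<close> itself every cutoff is 0 while the indicator is 1; the exception is
  a null set.\<close>

lemma cutoff_tendsto: assumes "a < b" "x \<noteq> a"
  shows "(\<lambda>n. cutoff a b n x) \<longlonglongrightarrow> indicator {a..b} x"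
proof -
  have one: "(\<lambda>n. smooth_step (real n * (x - y))) \<longlonglongrightarrow> 1" if "x > y" for y
  proof -
    obtain m where m: "1 < real m * (x - y)" using reals_Archimedean3[of "x - y"] \<open>x > y\<close> by auto
    have "real n * (x - y) \<ge> 1" if "n \<ge> m" for n
      using m that \<open>x > y\<close> mult_right_mono[of "real m" "real n" "x - y"] by linarith
    then have "\<forall>\<^sub>F n in sequentially. smooth_step (real n * (x - y)) = 1"
      unfolding eventually_sequentially using smooth_step_bounds(4) by blast
    then show ?thesis by (rule tendsto_eventually)
  qed
  have zero: "(\<lambda>n. smooth_step (real n * (x - y))) \<longlonglongrightarrow> 0" if "x \<le> y" for y
    using that by (intro tendsto_eventually always_eventually allI smooth_step_bounds(3)) (simp add: mult_nonneg_nonpos)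
  consider "x < a" | "a < x" "x \<le> b" | "b < x" using assms by linarith
  then show ?thesis
  proof cases
    case 1
    then show ?thesis using tendsto_diff[OF zero[of a] zero[of b]] assms by (simp add: cutoff_def)
  next
    case 2
    then show ?thesis using tendsto_diff[OF one[of a] zero[of b]] by (simp add: cutoff_def)
  next
    case 3
    then show ?thesis using tendsto_diff[OF one[of a] one[of b]] assms by (simp add: cutoff_def)
  qed
qed

lemma cutoff_bounds: "n > 0 \<Longrightarrow> a < b \<Longrightarrow> \<bar>cutoff a b n x\<bar> \<le> 1"
  using smooth_step_bounds(1,2)[of "real n * (x - a)"] smooth_step_bounds(1,2)[of "real n * (x - b)"]
  unfolding cutoff_def by linarith

lemma continuous_lebesgue_measurable:
  fixes f :: "real \<Rightarrow> 'a::euclidean_space"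
  assumes "continuous_on UNIV f" shows "f \<in> borel_measurable lebesgue"
proof -
  have "f \<in> borel_measurable lborel" using borel_measurable_continuous_onI[OF assms] by simp
  then show ?thesis by (rule measurable_completion)
qed

lemma compact_lebesgue: "compact K \<Longrightarrow> (K :: real set) \<in> sets lebesgue"
  by (simp add: lmeasurable_compact fmeasurableD)

section \<open>Weak derivatives of continuous curves\<close>

lemma weak_deriv_increment:
  fixes q p :: "real \<Rightarrow> real^'n"
  assumes w: "has_weak_deriv I q p" and q: "continuous_on UNIV q" and ab: "a < b" and sub: "{a..b} \<subseteq> interior I"
  shows "(p has_integral (q b - q a)) {a..b}"
proof -
  let ?U = "interior I"
  have "b \<in> ?U" using sub ab by auto
  then obtain d where d: "d > 0" "cball b d \<subseteq> ?U" using open_contains_cball open_interior by metis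
  \<comment> \<open>The right ramp lies beyond \<open>b\<close>, so the interval is enlarged within
    the open set that must contain the supports of test functions.\<close>
  define b' where "b' = b + d"
  have b': "b < b'" "{a..b'} \<subseteq> ?U"
  proof -
    show "b < b'" using d by (simp add: b'_def)
    have "t \<in> ?U" if "t \<in> {a..b'}" for t
    proof (cases "t \<le> b")
      case False
      then have "t \<in> cball b d" using that by (auto simp: b'_def dist_real_def)
      then show ?thesis using d by blast
    qed (use sub that in auto)
    then show "{a..b'} \<subseteq> ?U" by blast
  qed
  obtain s' where s': "continuous_on UNIV s'" "\<And>x. (smooth_step has_real_derivative s' x) (at x)"
    "\<And>x. s' x \<ge> 0" "\<And>x. x < 0 \<or> 1 < x \<Longrightarrow> s' x = 0" by (rule smooth_step_derivative) blast
  have pint: "set_integrable lebesgue {a..b'} p"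
    using w b' unfolding has_weak_deriv_def L1_loc_def by (meson compact_Icc)
  obtain n0 where n0: "1 / real (Suc n0) < d" using reals_Archimedean[OF d(1)] by (auto simp: inverse_eq_divide)
  \<comment> \<open>Skipping the first indices makes every ramp at most \<open>d\<close>
    wide.\<close>
  define m where "m n = n + Suc n0" for n
  have m: "m n > 0" "1 / real (m n) \<le> d" for n
  proof -
    have "1 / real (m n) \<le> 1 / real (Suc n0)" unfolding m_def by (intro divide_left_mono) auto
    then show "1 / real (m n) \<le> d" using n0 by linarith
  qed (simp add: m_def)
  define \<psi> where "\<psi> n = cutoff a b (m n)" for n
  have supp: "{a..b + 1 / real (m n)} \<subseteq> {a..b'}" for n using m(2)[of n] by (auto simp: b'_def)
  have test: "test_function ?U (\<psi> n)" for n
    unfolding \<psi>_def using supp b'(2) by (intro cutoff_test_function m(1) ab) blast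
  have \<psi>_out: "\<psi> n x = 0" if "x \<notin> {a..b'}" for n x
    unfolding \<psi>_def using cutoff_outside[OF m(1) ab] supp that by blast
  let ?k = "\<lambda>c n x. real (m n) * s' (real (m n) * (x - c))"
  have "((\<lambda>x. smooth_step (real (m n) * (x - c))) has_real_derivative ?k c n x) (at x)" for n c x
  proof -
    have "((\<lambda>x. real (m n) * (x - c)) has_real_derivative real (m n)) (at x)" by (auto intro!: derivative_eq_intros)
    from DERIV_chain2[OF s'(2) this] show ?thesis by (simp only: mult.commute)
  qed
  then have d\<psi>: "(\<psi> n has_real_derivative (?k a n x - ?k b n x)) (at x)" for n x
    unfolding \<psi>_def cutoff_def[abs_def] by (intro DERIV_diff)
  have der\<psi>: "deriv (\<psi> n) x = ?k a n x - ?k b n x" for n x by (rule DERIV_imp_deriv[OF d\<psi>])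
  have d_out: "deriv (\<psi> n) x = 0" if "x \<notin> {a..b'}" for n x
  proof -
    have "((\<lambda>x. 0) has_real_derivative 0) (at x)" by simp
    then have "(\<psi> n has_real_derivative 0) (at x)"
      by (rule has_field_derivative_transform_within_open[of _ _ _ "- {a..b'}"]) (use that \<psi>_out in auto)
    then show ?thesis by (rule DERIV_imp_deriv)
  qed
  have kc: "continuous_on T (?k c n)" for T c n
    by (intro continuous_intros continuous_on_compose2[OF s'(1)]) auto
  have dc: "continuous_on T (deriv (\<psi> n))" for T n
  proof -
    have "deriv (\<psi> n) = (\<lambda>x. ?k a n x - ?k b n x)" using der\<psi> by blast
    then show ?thesis by (simp only:) (intro continuous_on_diff kc)
  qed
  have qc: "continuous_on T q" for T using q continuous_on_subset by blast
  \<comment> \<open>The derivative of the cutoff consists of the kernels at \<open>a\<close> and at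
    \<open>b\<close>, so this side tends to \<open>q a - q b\<close>; the other side tends to minus
    the integral of \<open>p\<close> by dominated convergence.\<close>
  have lhs_eq: "(LINT t:?U|lebesgue. deriv (\<psi> n) t *\<^sub>R q t) =
      integral {a..b'} (\<lambda>x. ?k a n x *\<^sub>R q x) - integral {b..b'} (\<lambda>x. ?k b n x *\<^sub>R q x)" for n
  proof -
    have "(LINT t:?U|lebesgue. deriv (\<psi> n) t *\<^sub>R q t) = (LINT t:{a..b'}|lebesgue. deriv (\<psi> n) t *\<^sub>R q t)"
      unfolding set_lebesgue_integral_def
    proof (rule Bochner_Integration.integral_cong)
      show "indicator ?U x *\<^sub>R deriv (\<psi> n) x *\<^sub>R q x = indicator {a..b'} x *\<^sub>R deriv (\<psi> n) x *\<^sub>R q x" for x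
        using b'(2) d_out[of x n] by (cases "x \<in> {a..b'}") (auto simp: indicator_def)
    qed simp
    also have "\<dots> = integral {a..b'} (\<lambda>t. deriv (\<psi> n) t *\<^sub>R q t)"
      by (intro set_lebesgue_integral_eq_integral absolutely_integrable_continuous_real continuous_intros dc qc)
    also have "\<dots> = integral {a..b'} (\<lambda>x. ?k a n x *\<^sub>R q x) - integral {a..b'} (\<lambda>x. ?k b n x *\<^sub>R q x)"
      unfolding der\<psi> scaleR_left_diff_distrib
      by (intro Henstock_Kurzweil_Integration.integral_diff integrable_continuous_real continuous_on_scaleR kc qc)
    also have "integral {a..b'} (\<lambda>x. ?k b n x *\<^sub>R q x) =
        integral {a..b} (\<lambda>x. ?k b n x *\<^sub>R q x) + integral {b..b'} (\<lambda>x. ?k b n x *\<^sub>R q x)"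
      using ab b' by (intro Henstock_Kurzweil_Integration.integral_combine[symmetric] integrable_continuous_real continuous_on_scaleR kc qc) auto
    also have "integral {a..b} (\<lambda>x. ?k b n x *\<^sub>R q x) = integral {a..b} (\<lambda>x. 0)"
    proof (rule integral_spike[of "{b}"])
      show "0 = ?k b n x *\<^sub>R q x" if "x \<in> {a..b} - {b}" for x
        using that m(1)[of n] s'(4)[of "real (m n) * (x - b)"] by (simp add: mult_pos_neg)
    qed simp
    finally show ?thesis by simp
  qed
  have mlim: "filterlim m sequentially sequentially" unfolding m_def by (rule filterlim_add_const_nat_at_top)
  have "(\<lambda>n. integral {a..b'} (\<lambda>x. ?k a n x *\<^sub>R q x)) \<longlonglongrightarrow> q a"
    using filterlim_compose[OF approximate_identity[of a b' q s'] mlim] ab b' qc s' by auto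
  moreover have "(\<lambda>n. integral {b..b'} (\<lambda>x. ?k b n x *\<^sub>R q x)) \<longlonglongrightarrow> q b"
    using filterlim_compose[OF approximate_identity[of b b' q s'] mlim] b' qc s' by auto
  ultimately have lim1: "(\<lambda>n. LINT t:?U|lebesgue. deriv (\<psi> n) t *\<^sub>R q t) \<longlonglongrightarrow> q a - q b"
    unfolding lhs_eq by (rule tendsto_diff)
  have pm: "(\<lambda>x. indicator {a..b'} x *\<^sub>R p x) \<in> borel_measurable lebesgue" "integrable lebesgue (\<lambda>x. indicator {a..b'} x *\<^sub>R p x)"
    using pint unfolding set_integrable_def by auto
  have rhs_eq: "(LINT t:?U|lebesgue. \<psi> n t *\<^sub>R p t) = (LINT t|lebesgue. \<psi> n t *\<^sub>R (indicator {a..b'} t *\<^sub>R p t))" for n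
    unfolding set_lebesgue_integral_def
  proof (rule Bochner_Integration.integral_cong)
    show "indicator ?U x *\<^sub>R \<psi> n x *\<^sub>R p x = \<psi> n x *\<^sub>R indicator {a..b'} x *\<^sub>R p x" for x
      using b'(2) \<psi>_out[of x n] by (cases "x \<in> {a..b'}") (auto simp: indicator_def)
  qed simp
  have lim2: "(\<lambda>n. LINT t|lebesgue. \<psi> n t *\<^sub>R (indicator {a..b'} t *\<^sub>R p t)) \<longlonglongrightarrow> (LINT t|lebesgue. indicator {a..b} t *\<^sub>R p t)"
  proof (rule integral_dominated_convergence[where w = "\<lambda>x. norm (indicator {a..b'} x *\<^sub>R p x)"])
    have "{a..b} \<subseteq> {a..b'}" using b' by auto
    then have "set_integrable lebesgue {a..b} p" using set_integrable_subset[OF pint] by simp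
    then show "(\<lambda>t. indicator {a..b} t *\<^sub>R p t) \<in> borel_measurable lebesgue" unfolding set_integrable_def by auto
    show "(\<lambda>t. \<psi> n t *\<^sub>R (indicator {a..b'} t *\<^sub>R p t)) \<in> borel_measurable lebesgue" for n
    proof -
      have "continuous_on UNIV (\<psi> n)" using d\<psi> DERIV_isCont by (intro continuous_at_imp_continuous_on) blast
      then have "\<psi> n \<in> borel_measurable lebesgue"
        by (rule continuous_lebesgue_measurable)
      then show ?thesis using pm(1) by (rule borel_measurable_scaleR)
    qed
    show "integrable lebesgue (\<lambda>x. norm (indicator {a..b'} x *\<^sub>R p x))" by (rule integrable_norm[OF pm(2)])
    have "{a} \<in> null_sets lebesgue" by (simp add: negligible_iff_null_sets[symmetric])
    then have "AE x in lebesgue. x \<notin> {a}" by (rule AE_not_in)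
    then show "AE x in lebesgue. (\<lambda>n. \<psi> n x *\<^sub>R (indicator {a..b'} x *\<^sub>R p x)) \<longlonglongrightarrow> indicator {a..b} x *\<^sub>R p x"
    proof eventually_elim
      case (elim x)
      have "(\<lambda>n. \<psi> n x) \<longlonglongrightarrow> indicator {a..b} x"
        unfolding \<psi>_def by (rule filterlim_compose[OF cutoff_tendsto[OF ab] mlim]) (use elim in simp)
      then have "(\<lambda>n. \<psi> n x *\<^sub>R (indicator {a..b'} x *\<^sub>R p x)) \<longlonglongrightarrow> indicator {a..b} x *\<^sub>R (indicator {a..b'} x *\<^sub>R p x)"
        by (intro tendsto_scaleR tendsto_const)
      then show ?case using b' by (cases "x \<in> {a..b}") auto
    qed
    show "AE x in lebesgue. norm (\<psi> n x *\<^sub>R (indicator {a..b'} x *\<^sub>R p x)) \<le> norm (indicator {a..b'} x *\<^sub>R p x)" for n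
    proof (rule AE_I2)
      fix x
      have "norm (\<psi> n x *\<^sub>R v) \<le> norm v" for v :: "real^'n"
        unfolding norm_scaleR \<psi>_def using cutoff_bounds[OF m(1)[of n] ab, of x] by (intro mult_left_le_one_le) auto
      then show "norm (\<psi> n x *\<^sub>R (indicator {a..b'} x *\<^sub>R p x)) \<le> norm (indicator {a..b'} x *\<^sub>R p x)" .
    qed
  qed
  have "(LINT t:?U|lebesgue. deriv (\<psi> n) t *\<^sub>R q t) = - (LINT t|lebesgue. \<psi> n t *\<^sub>R (indicator {a..b'} t *\<^sub>R p t))" for n
    using w test[of n] unfolding has_weak_deriv_def rhs_eq[symmetric] by blast
  then have "(\<lambda>n. - (LINT t|lebesgue. \<psi> n t *\<^sub>R (indicator {a..b'} t *\<^sub>R p t))) \<longlonglongrightarrow> q a - q b"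
    using lim1 by simp
  then have "q a - q b = - (LINT t|lebesgue. indicator {a..b} t *\<^sub>R p t)"
    using LIMSEQ_unique tendsto_minus[OF lim2] by blast
  then have "q b - q a = (LINT t:{a..b}|lebesgue. p t)" unfolding set_lebesgue_integral_def by (metis minus_diff_eq minus_minus)
  moreover have "set_integrable lebesgue {a..b} p" using set_integrable_subset[OF pint] b' by auto
  ultimately show ?thesis using has_integral_set_lebesgue by metis
qed

lemma sigma_finite_lebesgue: "sigma_finite_measure (lebesgue :: real measure)"
proof
  obtain F :: "real set set" where "countable F" "F \<subseteq> sets lborel" "\<Union>F = space lborel" "\<forall>a\<in>F. emeasure lborel a \<noteq> \<infinity>"
    using lborel.sigma_finite_countable by blast
  then show "\<exists>F :: real set set. countable F \<and> F \<subseteq> sets lebesgue \<and> \<Union>F = space lebesgue \<and> (\<forall>a\<in>F. emeasure lebesgue a \<noteq> \<infinity>)"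
    by (intro exI[of _ F]) (auto simp: subset_iff)
qed

text \<open>Integrals over Borel sets vanish by induction from intervals, the total integral serving
  for complements. A Lebesgue set differs from a Borel set by a null set, and uniqueness of
  densities concludes.\<close>

lemma AE_0_if_interval_integrals_0:
  fixes f :: "real \<Rightarrow> 'a::euclidean_space"
  assumes int: "integrable lebesgue f" and zero: "\<And>a b. a \<le> b \<Longrightarrow> (LINT x:{a..b}|lebesgue. f x) = 0"
    and tot: "(LINT x|lebesgue. f x) = 0"
  shows "AE x in lebesgue. f x = 0"
proof (rule sigma_finite_measure.density_unique_banach[OF sigma_finite_lebesgue int])
  have si: "set_integrable lebesgue A f" if "A \<in> sets lebesgue" for A
    using int that unfolding set_integrable_def by (simp add: integrable_mult_indicator)
  have borel: "(LINT x:A|lebesgue. f x) = 0" if "A \<in> sets borel" for A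
    using that
  proof (induction rule: borel_set_induct)
    case empty then show ?case by (simp add: set_lebesgue_integral_def)
  next
    case (interval a b) then show ?case by (rule zero)
  next
    case (compl A)
    then have A: "A \<in> sets lebesgue" "- A \<in> sets lebesgue" by auto
    have "(LINT x:A \<union> - A|lebesgue. f x) = (LINT x:A|lebesgue. f x) + (LINT x:- A|lebesgue. f x)"
      by (rule set_integral_Un) (use si A in auto)
    then show ?case using tot compl by (simp add: set_lebesgue_integral_def)
  next
    case (union F)
    have "(LINT x:(\<Union>i. F i)|lebesgue. f x) = (\<Sum>i. (LINT x:(F i)|lebesgue. f x))"
    proof (rule lebesgue_integral_countable_add)
      show "F i \<in> sets lebesgue" for i using union by auto
      show "F i \<inter> F j = {}" if "i \<noteq> j" for i j using union(1) that unfolding disjoint_family_on_def by blast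
      show "set_integrable lebesgue (\<Union>i. F i) f" using union(2) by (intro si) auto
    qed
    then show ?case using union by simp
  qed
  fix A :: "real set" assume A: "A \<in> sets lebesgue"
  then obtain S N N' where S: "A = S \<union> N" "N \<subseteq> N'" "N' \<in> null_sets lborel" "S \<in> sets lborel"
    by (rule sets_completionE)
  have N': "N' \<in> null_sets lebesgue" using S(3) by (rule null_sets_completionI)
  have "(LINT x:A|lebesgue. f x) = (LINT x:S|lebesgue. f x)"
  proof (rule set_integral_cong_set)
    have "S \<in> sets lebesgue" using S(4) by auto
    then show "set_borel_measurable lebesgue S f" "set_borel_measurable lebesgue A f"
      using si A unfolding set_borel_measurable_def set_integrable_def by auto
    show "AE x in lebesgue. (x \<in> S) = (x \<in> A)" using AE_not_in[OF N'] by eventually_elim (use S in auto)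
  qed
  also have "\<dots> = 0" using borel S(4) by simp
  finally show "(LINT x:A|lebesgue. f x) = (LINT x:A|lebesgue. 0)" by (simp add: set_lebesgue_integral_def)
qed simp

lemma AE_eq_if_same_increments:
  fixes p1 p2 :: "real \<Rightarrow> real^'n"
  assumes int: "set_integrable lebesgue {c..d} p1" "set_integrable lebesgue {c..d} p2"
    and same: "\<And>a b. c \<le> a \<Longrightarrow> a < b \<Longrightarrow> b \<le> d \<Longrightarrow> integral {a..b} p1 = integral {a..b} p2"
  shows "AE t in lebesgue. t \<in> {c..d} \<longrightarrow> p1 t = p2 t"
proof -
  define f where "f t = indicator {c..d} t *\<^sub>R (p1 t - p2 t)" for t
  have fint: "integrable lebesgue f" using int unfolding f_def set_integrable_def by (simp add: scaleR_diff_right)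
  have Icc: "(LINT x:{a..b}|lebesgue. f x) = 0" for a b
  proof -
    \<comment> \<open>The interval is cut down to \<open>{c..d}\<close>; an empty or one-point
      intersection is negligible.\<close>
    let ?a = "max a c" and ?b = "min b d"
    have "(LINT x:{a..b}|lebesgue. f x) = (LINT x:{?a..?b}|lebesgue. p1 x - p2 x)"
      unfolding set_lebesgue_integral_def f_def
      by (rule Bochner_Integration.integral_cong) (auto simp: indicator_def)
    also have "\<dots> = 0"
    proof (cases "?a < ?b")
      case True
      have sub: "{?a..?b} \<subseteq> {c..d}" by auto
      have si: "set_integrable lebesgue {?a..?b} p1" "set_integrable lebesgue {?a..?b} p2"
        using int by (auto intro: set_integrable_subset[OF _ _ sub])
      have "(LINT x:{?a..?b}|lebesgue. p1 x - p2 x) = integral {?a..?b} p1 - integral {?a..?b} p2"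
        using si by (simp add: set_integral_diff set_lebesgue_integral_eq_integral)
      then show ?thesis using same[of ?a ?b] True by simp
    next
      case False
      then have "negligible {?a..?b}" by (cases "?a = ?b") (auto simp: negligible_iff_null_sets[symmetric])
      then have "AE x in lebesgue. x \<notin> {?a..?b}" by (intro AE_not_in) (simp add: negligible_iff_null_sets)
      then have "AE x in lebesgue. indicator {?a..?b} x *\<^sub>R (p1 x - p2 x) = 0" by eventually_elim simp
      then show ?thesis unfolding set_lebesgue_integral_def by (rule integral_eq_zero_AE)
    qed
    finally show ?thesis .
  qed
  have "AE t in lebesgue. f t = 0"
  proof (rule AE_0_if_interval_integrals_0[OF fint Icc])
    have "(LINT x|lebesgue. f x) = (LINT x:{c..d}|lebesgue. f x)"
      unfolding set_lebesgue_integral_def f_def by (rule Bochner_Integration.integral_cong) (auto simp: indicator_def)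
    then show "(LINT x|lebesgue. f x) = 0" using Icc by simp
  qed
  then show ?thesis by eventually_elim (auto simp: f_def)
qed

lemma test_function_derivative:
  assumes "test_function U \<psi>"
  shows "(\<psi> has_real_derivative deriv \<psi> t) (at t)" "continuous_on T (deriv \<psi>)" "continuous_on T \<psi>"
proof -
  have "(deriv ^^ 0) \<psi> differentiable (at t)" "(deriv ^^ 1) \<psi> differentiable (at t)" for t
    using assms unfolding test_function_def by blast+
  then have 1: "\<psi> differentiable (at t)" "deriv \<psi> differentiable (at t)" for t by auto
  then show "(\<psi> has_real_derivative deriv \<psi> t) (at t)"
    using DERIV_deriv_iff_real_differentiable by blast
  show "continuous_on T (deriv \<psi>)" "continuous_on T \<psi>"
    by (intro continuous_at_imp_continuous_on ballI differentiable_imp_continuous_within 1)+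
qed

lemma test_function_support:
  assumes "test_function U \<psi>"
  obtains R where "R > 0" "\<And>t. \<psi> t \<noteq> 0 \<or> deriv \<psi> t \<noteq> 0 \<Longrightarrow> t \<in> U \<and> \<bar>t\<bar> < R"
proof -
  let ?K = "closure {t. \<psi> t \<noteq> 0}"
  have K: "compact ?K" "?K \<subseteq> U" using assms unfolding test_function_def by auto
  obtain r where "\<forall>t\<in>?K. norm t \<le> r" using compact_imp_bounded[OF K(1)] bounded_iff by blast
  then have R: "max 1 (r + 1) > 0" "t \<in> ?K \<Longrightarrow> \<bar>t\<bar> < max 1 (r + 1)" for t by force+
  have out: "\<psi> t = 0 \<and> deriv \<psi> t = 0" if "t \<notin> ?K" for t
  proof -
    have z: "\<psi> s = 0" if "s \<notin> ?K" for s using that closure_subset[of "{t. \<psi> t \<noteq> 0}"] by auto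
    have "((\<lambda>x. 0) has_real_derivative 0) (at t)" by simp
    then have "(\<psi> has_real_derivative 0) (at t)"
    proof (rule has_field_derivative_transform_within_open[of _ _ _ "- ?K"])
      show "0 = \<psi> s" if "s \<in> - ?K" for s using z[of s] that by simp
    qed (use that in \<open>simp_all add: open_Compl\<close>)
    from DERIV_imp_deriv[OF this] show ?thesis using z[OF that] by simp
  qed
  show thesis
  proof (rule that[OF R(1)])
    fix t assume "\<psi> t \<noteq> 0 \<or> deriv \<psi> t \<noteq> 0"
    then have "t \<in> ?K" using out by blast
    then show "t \<in> U \<and> \<bar>t\<bar> < max 1 (r + 1)" using K(2) R(2) by blast
  qed
qed

lemma L1_loc_continuous: "continuous_on UNIV q \<Longrightarrow> L1_loc U q"
  unfolding L1_loc_def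
proof (intro allI impI)
  fix K :: "real set" assume q: "continuous_on UNIV q" and K: "compact K \<and> K \<subseteq> U"
  obtain a b where ab: "K \<subseteq> {a..b}" using compact_imp_bounded[of K] K bounded_subset_cbox_symmetric[of K] by (metis cbox_interval)
  have "set_integrable lebesgue {a..b} q"
    by (intro absolutely_integrable_continuous_real continuous_on_subset[OF q]) auto
  then show "set_integrable lebesgue K q" using K ab compact_lebesgue by (intro set_integrable_subset[of lebesgue "{a..b}" q K]) blast+
qed

text \<open>Integration by parts on a symmetric interval containing the support of the test
  function, where the boundary terms vanish.\<close>

lemma has_weak_deriv_C1:
  fixes q p :: "real \<Rightarrow> real^'n"
  assumes q: "\<And>t. (q has_vector_derivative p t) (at t)" and p: "continuous_on UNIV p"
  shows "has_weak_deriv I q p"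
proof -
  have qc: "continuous_on UNIV q"
    using q by (intro continuous_at_imp_continuous_on ballI has_vector_derivative_continuous)
  let ?U = "interior I"
  have "(LINT t:?U|lebesgue. deriv \<psi> t *\<^sub>R q t) = - (LINT t:?U|lebesgue. \<psi> t *\<^sub>R p t)" if test: "test_function ?U \<psi>" for \<psi>
  proof -
    obtain R where R: "R > 0" "\<And>t. \<psi> t \<noteq> 0 \<or> deriv \<psi> t \<noteq> 0 \<Longrightarrow> t \<in> ?U \<and> \<bar>t\<bar> < R"
      by (rule test_function_support[OF test]) blast
    have red: "(LINT t:?U|lebesgue. f t *\<^sub>R g t) = integral {- R..R} (\<lambda>t. f t *\<^sub>R g t)"
      if "continuous_on {- R..R} f" "continuous_on {- R..R} g" "\<And>t. f t \<noteq> 0 \<Longrightarrow> \<psi> t \<noteq> 0 \<or> deriv \<psi> t \<noteq> 0"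
      for f :: "real \<Rightarrow> real" and g :: "real \<Rightarrow> real^'n"
    proof -
      have "(LINT t:?U|lebesgue. f t *\<^sub>R g t) = (LINT t:{- R..R}|lebesgue. f t *\<^sub>R g t)"
        unfolding set_lebesgue_integral_def
      proof (rule Bochner_Integration.integral_cong)
        show "indicator ?U t *\<^sub>R f t *\<^sub>R g t = indicator {- R..R} t *\<^sub>R f t *\<^sub>R g t" for t
          using R(2)[of t] that(3)[of t] by (cases "f t = 0") (auto simp: indicator_def)
      qed simp
      also have "\<dots> = integral {- R..R} (\<lambda>t. f t *\<^sub>R g t)"
        by (intro set_lebesgue_integral_eq_integral absolutely_integrable_continuous_real continuous_on_scaleR that)
      finally show ?thesis .
    qed
    note tf = test_function_derivative[OF test]
    have c: "continuous_on {- R..R} (\<lambda>t. deriv \<psi> t *\<^sub>R q t)" "continuous_on {- R..R} (\<lambda>t. \<psi> t *\<^sub>R p t)"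
      by (intro continuous_on_scaleR tf(2,3) continuous_on_subset[OF qc] continuous_on_subset[OF p] subset_UNIV)+
    have "((\<lambda>t. \<psi> t *\<^sub>R p t + deriv \<psi> t *\<^sub>R q t) has_integral (\<psi> R *\<^sub>R q R - \<psi> (- R) *\<^sub>R q (- R))) {- R..R}"
      using R(1) by (intro fundamental_theorem_of_calculus has_vector_derivative_at_within[OF has_vector_derivative_scaleR[OF tf(1) q]]) auto
    moreover have "\<psi> R = 0" "\<psi> (- R) = 0" using R(2)[of R] R(2)[of "- R"] R(1) by auto
    ultimately have "integral {- R..R} (\<lambda>t. \<psi> t *\<^sub>R p t + deriv \<psi> t *\<^sub>R q t) = 0" by (simp add: integral_unique)
    then have "integral {- R..R} (\<lambda>t. \<psi> t *\<^sub>R p t) + integral {- R..R} (\<lambda>t. deriv \<psi> t *\<^sub>R q t) = 0"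
      by (subst (asm) Henstock_Kurzweil_Integration.integral_add) (intro integrable_continuous_real c)+
    then show ?thesis
      using red[of "deriv \<psi>" q] red[of \<psi> p] tf continuous_on_subset[OF qc] continuous_on_subset[OF p]
      by (simp add: eq_neg_iff_add_eq_0 add.commute)
  qed
  then show ?thesis unfolding has_weak_deriv_def using L1_loc_continuous qc p by blast
qed

text \<open>\<open>weak_deriv\<close> is an arbitrary choice, so equality can hold only almost
  everywhere. Both functions integrate to the increments of \<open>q\<close> over compact intervals,
  and countably many rational intervals exhaust the open set.\<close>

lemma weak_deriv_eq_C1:
  fixes q p :: "real \<Rightarrow> real^'n"
  assumes q: "\<And>t. (q has_vector_derivative p t) (at t)" and p: "continuous_on UNIV p" and I: "open I" "is_interval I"
  shows "AE t in lebesgue. t \<in> I \<longrightarrow> weak_deriv I q t = p t"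
proof -
  have w: "has_weak_deriv I q (weak_deriv I q)"
    unfolding weak_deriv_def by (rule someI[of "has_weak_deriv I q"]) (rule has_weak_deriv_C1[OF q p])
  have qc: "continuous_on UNIV q"
    using q by (intro continuous_at_imp_continuous_on ballI has_vector_derivative_continuous)
  have ab: "AE t in lebesgue. t \<in> {a..b} \<longrightarrow> weak_deriv I q t = p t" if "{a..b} \<subseteq> I" for a b
  proof (rule AE_eq_if_same_increments)
    show "set_integrable lebesgue {a..b} (weak_deriv I q)"
      using w that I(1) unfolding has_weak_deriv_def L1_loc_def by (simp add: interior_open)
    show "set_integrable lebesgue {a..b} p"
      by (intro absolutely_integrable_continuous_real continuous_on_subset[OF p]) auto
    show "integral {s..t} (weak_deriv I q) = integral {s..t} p" if "a \<le> s" "s < t" "t \<le> b" for s t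
    proof -
      have "{s..t} \<subseteq> interior I" using that \<open>{a..b} \<subseteq> I\<close> I(1) by (auto simp: interior_open)
      then have "(weak_deriv I q has_integral (q t - q s)) {s..t}" by (rule weak_deriv_increment[OF w qc that(2)])
      moreover have "(p has_integral (q t - q s)) {s..t}"
        using that by (intro fundamental_theorem_of_calculus has_vector_derivative_at_within[OF q]) auto
      ultimately show ?thesis by (simp add: integral_unique)
    qed
  qed
  have "AE t in lebesgue. \<forall>x\<in>\<rat> \<times> \<rat>. {fst x..snd x} \<subseteq> I \<longrightarrow> t \<in> {fst x..snd x} \<longrightarrow> weak_deriv I q t = p t"
  proof (subst AE_ball_countable)
    show "countable (\<rat> \<times> \<rat> :: (real \<times> real) set)" by (intro countable_SIGMA countable_rat)
    show "\<forall>x\<in>\<rat> \<times> \<rat>. AE t in lebesgue. {fst x..snd x} \<subseteq> I \<longrightarrow> t \<in> {fst x..snd x} \<longrightarrow> weak_deriv I q t = p t"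
      using ab by auto
  qed
  then show ?thesis
  proof eventually_elim
    case (elim t)
    show ?case
    proof
      assume t: "t \<in> I"
      then obtain e where e: "e > 0" "ball t e \<subseteq> I" using I(1) open_contains_ball by blast
      obtain a b where "a \<in> \<rat>" "t - e < a" "a < t" "b \<in> \<rat>" "t < b" "b < t + e"
        using Rats_dense_in_real[of "t - e" t] Rats_dense_in_real[of t "t + e"] e(1) by auto
      moreover from this have "{a..b} \<subseteq> ball t e" by (auto simp: dist_real_def)
      ultimately show "weak_deriv I q t = p t" using elim e(2) by (force dest!: bspec[of _ _ "(a, b)"])
    qed
  qed
qed

text \<open>Local Sobolev regularity gives a weak derivative on each compact interval separately.
  These agree almost everywhere and are glued, which justifies the choice made by
  \<open>weak_deriv UNIV\<close>.\<close>

lemma weak_deriv_global: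
  fixes q :: "real \<Rightarrow> real^'n"
  assumes q: "continuous_on UNIV q" and loc: "\<And>a b. a < b \<Longrightarrow> \<exists>p. has_weak_deriv {a..b} q p"
  shows "has_weak_deriv UNIV q (weak_deriv UNIV q)"
proof -
  have "\<exists>p. has_weak_deriv {- real k - 1..real k + 1} q p" for k by (rule loc) simp
  \<comment> \<open>The extra 1 puts \<open>{- real k..real k}\<close> into the interior, where
    local integrability is available.\<close>
  then obtain P where P: "\<And>k. has_weak_deriv {- real k - 1..real k + 1} q (P k)" by metis
  define p where "p t = P (nat \<lceil>\<bar>t\<bar>\<rceil>) t" for t
  have inc: "(P k has_integral (q b - q a)) {a..b}" if "a < b" "- real k \<le> a" "b \<le> real k" for k a b
    by (rule weak_deriv_increment[OF P q that(1)]) (use that in \<open>auto simp: interior_atLeastAtMost_real\<close>)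
  have Pint: "set_integrable lebesgue K (P k)" if "compact K" "K \<subseteq> {- real k..real k}" for K k
  proof -
    have "K \<subseteq> interior {- real k - 1..real k + 1}" using that(2) by (fastforce simp: interior_atLeastAtMost_real)
    then show ?thesis using P[of k] that(1) unfolding has_weak_deriv_def L1_loc_def by blast
  qed
  have PQ: "AE t in lebesgue. t \<in> {- real j..real j} \<longrightarrow> P j t = P k t" if "j \<le> k" for j k
  proof (rule AE_eq_if_same_increments)
    show "set_integrable lebesgue {- real j..real j} (P j)" "set_integrable lebesgue {- real j..real j} (P k)"
      using that by (auto intro!: Pint)
    show "integral {a..b} (P j) = integral {a..b} (P k)" if "- real j \<le> a" "a < b" "b \<le> real j" for a b
      using inc[of a b j] inc[of a b k] that \<open>j \<le> k\<close> by (auto dest!: integral_unique)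
  qed
  have pP: "AE t in lebesgue. t \<in> {- real k..real k} \<longrightarrow> p t = P k t" for k
  proof -
    have "AE t in lebesgue. \<forall>j\<in>{..k}. t \<in> {- real j..real j} \<longrightarrow> P j t = P k t"
      using PQ by (intro AE_ball_countable[THEN iffD2]) auto
    then show ?thesis
    proof eventually_elim
      case (elim t)
      show ?case
      proof
        assume "t \<in> {- real k..real k}"
        then have "\<bar>t\<bar> \<le> real k" by auto
        then have "nat \<lceil>\<bar>t\<bar>\<rceil> \<le> k" by (simp add: ceiling_le_iff nat_le_iff)
        moreover have "t \<in> {- real (nat \<lceil>\<bar>t\<bar>\<rceil>)..real (nat \<lceil>\<bar>t\<bar>\<rceil>)}"
          using real_nat_ceiling_ge[of "\<bar>t\<bar>"] unfolding atLeastAtMost_iff by linarith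
        ultimately show "p t = P k t" using elim unfolding p_def by blast
      qed
    qed
  qed
  \<comment> \<open>Integrability is checked on the finitely many layers of constant
    \<open>nat \<lceil>\<bar>t\<bar>\<rceil>\<close>, on each of which the glued function is a
    single \<open>P j\<close>.\<close>
  have pint: "set_integrable lebesgue {- real k..real k} p" for k
  proof -
    have ceil: "- of_int \<lceil>\<bar>t\<bar>\<rceil> \<le> t" "t \<le> of_int \<lceil>\<bar>t\<bar>\<rceil>" for t :: real
      using le_of_int_ceiling[of "\<bar>t\<bar>"] by linarith+
    have "set_integrable lebesgue ({- real k..real k} \<inter> {t. nat \<lceil>\<bar>t\<bar>\<rceil> = j}) p" if "j \<in> {..k}" for j
    proof -
      have "{t::real. nat \<lceil>\<bar>t\<bar>\<rceil> = j} \<in> sets borel" by measurable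
      then have m: "{- real k..real k} \<inter> {t. nat \<lceil>\<bar>t\<bar>\<rceil> = j} \<in> sets lebesgue" by auto
      have "set_integrable lebesgue {- real j..real j} (P j)" by (rule Pint) auto
      then have "set_integrable lebesgue ({- real k..real k} \<inter> {t. nat \<lceil>\<bar>t\<bar>\<rceil> = j}) (P j)"
        using m by (rule set_integrable_subset) (use ceil in auto)
      then show ?thesis by (subst set_integrable_cong) (auto simp: p_def)
    qed
    then have "set_integrable lebesgue (\<Union>j\<in>{..k}. {- real k..real k} \<inter> {t. nat \<lceil>\<bar>t\<bar>\<rceil> = j}) p"
      by (intro set_integrable_UN) auto
    moreover have "(\<Union>j\<in>{..k}. {- real k..real k} \<inter> {t. nat \<lceil>\<bar>t\<bar>\<rceil> = j}) = {- real k..real k}"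
      by (auto simp: nat_le_iff ceiling_le_iff abs_le_iff)
    ultimately show ?thesis by simp
  qed
  have bounded_in: "\<exists>k. K \<subseteq> {- real k..real k}" if K: "compact K" for K :: "real set"
  proof -
    obtain r where r: "\<forall>x\<in>K. norm x \<le> r" using compact_imp_bounded[OF K] bounded_iff by blast
    obtain k where "r \<le> real k" using real_arch_simple by blast
    then show ?thesis using r by (intro exI[of _ k]) force
  qed
  have "L1_loc UNIV p" unfolding L1_loc_def
  proof (intro allI impI)
    fix K :: "real set" assume K: "compact K \<and> K \<subseteq> UNIV"
    then obtain k where "K \<subseteq> {- real k..real k}" using bounded_in by blast
    then show "set_integrable lebesgue K p" using K compact_lebesgue by (intro set_integrable_subset[OF pint]) blast+
  qed
  moreover have "(LINT t:UNIV|lebesgue. deriv \<psi> t *\<^sub>R q t) = - (LINT t:UNIV|lebesgue. \<psi> t *\<^sub>R p t)"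
    if test: "test_function UNIV \<psi>" for \<psi>
  proof -
    have "compact (closure {t. \<psi> t \<noteq> 0})" using test unfolding test_function_def by blast
    then obtain k where k: "closure {t. \<psi> t \<noteq> 0} \<subseteq> {- real k..real k}" using bounded_in by blast
    let ?U = "interior {- real k - 1..real k + 1}"
    have sub: "{- real k..real k} \<subseteq> ?U" by (auto simp: interior_atLeastAtMost_real)
    have "test_function ?U \<psi>" using test k sub unfolding test_function_def by blast
    then have w: "(LINT t:?U|lebesgue. deriv \<psi> t *\<^sub>R q t) = - (LINT t:?U|lebesgue. \<psi> t *\<^sub>R P k t)"
      using P[of k] unfolding has_weak_deriv_def by blast
    have z: "\<psi> t = 0" if "t \<notin> {- real k..real k}" for t
      using that k closure_subset[of "{t. \<psi> t \<noteq> 0}"] by auto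
    have z': "deriv \<psi> t = 0" if "t \<notin> {- real k..real k}" for t
    proof -
      have "((\<lambda>x. 0) has_real_derivative 0) (at t)" by simp
      then have "(\<psi> has_real_derivative 0) (at t)"
        by (rule has_field_derivative_transform_within_open[of _ _ _ "- {- real k..real k}"]) (use that z in auto)
      then show ?thesis by (rule DERIV_imp_deriv)
    qed
    have 1: "(LINT t:UNIV|lebesgue. deriv \<psi> t *\<^sub>R q t) = (LINT t:?U|lebesgue. deriv \<psi> t *\<^sub>R q t)"
      unfolding set_lebesgue_integral_def
    proof (rule Bochner_Integration.integral_cong)
      show "indicator UNIV t *\<^sub>R deriv \<psi> t *\<^sub>R q t = indicator ?U t *\<^sub>R deriv \<psi> t *\<^sub>R q t" for t
        using z'[of t] sub by (cases "t \<in> {- real k..real k}") (auto simp: indicator_def)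
    qed simp
    have red: "(LINT t:T|lebesgue. \<psi> t *\<^sub>R f t) = (LINT t|lebesgue. \<psi> t *\<^sub>R (indicator {- real k..real k} t *\<^sub>R f t))"
      if "{- real k..real k} \<subseteq> T" for T and f :: "real \<Rightarrow> real^'n"
      unfolding set_lebesgue_integral_def
    proof (rule Bochner_Integration.integral_cong)
      show "indicator T t *\<^sub>R \<psi> t *\<^sub>R f t = \<psi> t *\<^sub>R indicator {- real k..real k} t *\<^sub>R f t" for t
        using z[of t] that by (cases "t \<in> {- real k..real k}") (auto simp: indicator_def)
    qed simp
    have \<psi>m: "\<psi> \<in> borel_measurable lebesgue"
      by (rule continuous_lebesgue_measurable[OF test_function_derivative(3)[OF test]])
    have "(LINT t|lebesgue. \<psi> t *\<^sub>R (indicator {- real k..real k} t *\<^sub>R P k t)) =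
        (LINT t|lebesgue. \<psi> t *\<^sub>R (indicator {- real k..real k} t *\<^sub>R p t))"
    proof (rule integral_cong_AE)
      show "(\<lambda>t. \<psi> t *\<^sub>R (indicator {- real k..real k} t *\<^sub>R P k t)) \<in> borel_measurable lebesgue"
        "(\<lambda>t. \<psi> t *\<^sub>R (indicator {- real k..real k} t *\<^sub>R p t)) \<in> borel_measurable lebesgue"
        using Pint[of "{- real k..real k}" k] pint[of k] unfolding set_integrable_def
        by (auto intro!: borel_measurable_scaleR[OF \<psi>m borel_measurable_integrable] simp del: scaleR_scaleR)
      show "AE t in lebesgue. \<psi> t *\<^sub>R (indicator {- real k..real k} t *\<^sub>R P k t) = \<psi> t *\<^sub>R (indicator {- real k..real k} t *\<^sub>R p t)"
        using pP[of k] by eventually_elim (auto simp: indicator_def)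
    qed
    then show ?thesis using w 1 red[OF sub, of "P k"] red[of UNIV p] by simp
  qed
  ultimately have "has_weak_deriv UNIV q p"
    unfolding has_weak_deriv_def using L1_loc_continuous[OF q] by simp
  then show ?thesis unfolding weak_deriv_def by (rule someI[of "has_weak_deriv UNIV q"])
qed

lemma nn_integral_Icc_eq_integral:
  fixes f :: "real \<Rightarrow> real"
  assumes "continuous_on {a..b} f" "\<And>t. t \<in> {a..b} \<Longrightarrow> f t \<ge> 0"
  shows "(\<integral>\<^sup>+t\<in>{a..b}. ennreal (f t) \<partial>lebesgue) = ennreal (integral {a..b} f)"
  unfolding nn_integral_completion
  by (rule nn_integral_has_integral_lebesgue'[OF assms(2) integrable_integral[OF integrable_continuous_real[OF assms(1)]]])

lemma (in young) L_Phi_continuous: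
  fixes f :: "real \<Rightarrow> real^'n"
  assumes "continuous_on UNIV f" shows "L_Phi \<phi> {a..b} f"
proof -
  have "continuous_on {a..b} (\<lambda>t. \<Phi> (norm (f t)))"
    by (rule continuous_on_compose2[OF Phi_norm_continuous continuous_on_subset[OF assms]]) auto
  then have "(\<integral>\<^sup>+t\<in>{a..b}. ennreal (\<Phi> (norm (f t) / 1)) \<partial>lebesgue) = ennreal (integral {a..b} (\<lambda>t. \<Phi> (norm (f t))))"
    by (simp add: nn_integral_Icc_eq_integral Phi_nonneg)
  also have "\<dots> < \<infinity>" by simp
  finally show ?thesis unfolding L_Phi_def using L1_loc_continuous[OF assms] zero_less_one by blast
qed

lemma (in young) W1_Phi_loc_C1:
  fixes q :: "real \<Rightarrow> real^'n"
  assumes q: "\<And>t. (q has_vector_derivative p t) (at t)" and p: "continuous_on UNIV p"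
  shows "W1_Phi_loc \<phi> q"
proof -
  have "continuous_on UNIV q"
    using q by (intro continuous_at_imp_continuous_on ballI has_vector_derivative_continuous)
  then show ?thesis unfolding W1_Phi_loc_def W1_Phi_def
    using L_Phi_continuous p has_weak_deriv_C1[OF q p] by blast
qed

section \<open>Minimality among Sobolev curves\<close>

context connection begin

abbreviation "I \<equiv> einterval \<alpha> \<omega>"

lemma I_open: "open I" by (rule open_einterval)

lemma I_interval: "is_interval I"
proof -
  have "u \<in> I" if "s \<in> I" "t \<in> I" "s \<le> u" "u \<le> t" for s t u
    using that unfolding einterval_def mem_Collect_eq by (meson ereal_less_eq(3) le_less_trans less_le_trans)
  then show ?thesis unfolding is_interval_1 by blast
qed

lemma I_Icc: "s \<in> I \<Longrightarrow> t \<in> I \<Longrightarrow> {s..t} \<subseteq> I"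
  using I_interval unfolding is_interval_1 by (meson atLeastAtMost_iff subsetI)

lemma I_convex: "convex I" using I_interval by (simp add: is_interval_convex_1[symmetric])

lemma not_in_I: "t \<notin> I \<Longrightarrow> ereal t \<le> \<alpha> \<or> \<omega> \<le> ereal t" by (auto simp: einterval_def)

lemma before_I: "ereal t \<le> \<alpha> \<Longrightarrow> s \<in> I \<Longrightarrow> t < s"
  unfolding einterval_def mem_Collect_eq by (metis ereal_less(2) le_less_trans less_ereal.simps(1))

lemma after_I: "\<omega> \<le> ereal t \<Longrightarrow> s \<in> I \<Longrightarrow> s < t"
  unfolding einterval_def mem_Collect_eq by (metis less_le_trans less_ereal.simps(1))

lemma \<xi>_lattice: "\<xi> \<in> int_lattice" using \<xi> by blast

lemma W_q: "t \<in> I \<Longrightarrow> W (q t) = V (q t) - c" using above[of t] by (simp add: W_def)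

lemma D_continuous: "continuous_on I D"
proof -
  have "continuous_on I (\<lambda>u. Pv (D u))"
    using Euler_Lagrange by (intro continuous_at_imp_continuous_on ballI has_vector_derivative_continuous) blast
  then have "continuous_on I (\<lambda>u. Psi (Pv (D u)))" by (rule continuous_on_compose2[OF Psi_continuous]) auto
  then show ?thesis by simp
qed

text \<open>Near the sublevel set \<open>W\<close> is small by uniform continuity, and zero energy
  turns this into small \<open>G\<close>, hence small speed.\<close>

lemma D_small:
  assumes "e > 0"
  obtains d where "d > 0" "\<And>t \<eta>. t \<in> I \<Longrightarrow> \<eta> \<in> int_lattice \<Longrightarrow> infdist (q t) (sublevel_at V c \<delta> \<eta>) < d \<Longrightarrow> norm (D t) < e"
proof -
  obtain e' where e': "e' > 0" "\<And>s. s \<ge> 0 \<Longrightarrow> G s < e' \<Longrightarrow> s < e" using G_small_imp[OF assms] by blast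
  obtain d where d: "d > 0" "\<forall>s t. dist s t < d \<longrightarrow> dist (W s) (W t) < e'"
    using uniformly_continuous_on_UNIV_D[OF W_uniform e'(1)] by blast
  show thesis
  proof (rule that[OF d(1)])
    fix t \<eta> assume t: "t \<in> I" and \<eta>: "\<eta> \<in> int_lattice" "infdist (q t) (sublevel_at V c \<delta> \<eta>) < d"
    obtain y where y: "y \<in> sublevel_at V c \<delta> \<eta>" "dist (q t) y < d" by (rule sublevel_at_attained[OF \<eta>])
    have "W y = 0" using y(1) by (simp add: sublevel_at_def W_eq_0)
    then have "W (q t) < e'" using d(2) y(2) W_nonneg[of "q t"] by (force simp: dist_real_def)
    then show "norm (D t) < e" using energy[OF t] W_q[OF t] by (intro e'(2)) auto
  qed
qed

text \<open>The speed tends to 0 at a finite end of the interval, so the extension by 0 is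
  continuous.\<close>

definition D0 :: "real \<Rightarrow> real^'n" where "D0 t = (if t \<in> I then D t else 0)"

lemma D0_continuous: "continuous_on UNIV D0"
proof (intro continuous_at_imp_continuous_on ballI)
  fix t :: real
  show "isCont D0 t"
  proof (cases "t \<in> I")
    case True
    have "continuous_on I D0" by (rule continuous_on_eq[OF D_continuous]) (simp add: D0_def)
    then show ?thesis using True I_open by (simp add: continuous_on_eq_continuous_at)
  next
    case False
    have "(D0 \<longlongrightarrow> 0) (at t)"
    proof (rule tendstoI)
      fix e :: real assume e: "e > 0"
      obtain d where d: "d > 0" "\<And>t \<eta>. t \<in> I \<Longrightarrow> \<eta> \<in> int_lattice \<Longrightarrow> infdist (q t) (sublevel_at V c \<delta> \<eta>) < d \<Longrightarrow> norm (D t) < e"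
        by (rule D_small[OF e]) blast
      obtain s where s: "s \<in> I" "\<forall>t\<in>I. t < s \<longrightarrow> infdist (q t) (sublevel_at V c \<delta> 0) < d" using left_cell[OF d(1)] by blast
      obtain u where u: "u \<in> I" "\<forall>t\<in>I. u < t \<longrightarrow> infdist (q t) (sublevel_at V c \<delta> \<xi>) < d" using right_cell[OF d(1)] by blast
      from not_in_I[OF False] show "\<forall>\<^sub>F x in at t. dist (D0 x) 0 < e"
      proof
        assume "ereal t \<le> \<alpha>"
        then have "t \<in> {..<s}" using before_I s(1) by simp
        then have "\<forall>\<^sub>F x in at t. x \<in> {..<s}" by (intro eventually_at_in_open') auto
        then show ?thesis by eventually_elim (use s(2) d(2)[OF _ int_lattice_0] e in \<open>auto simp: D0_def dist_norm\<close>)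
      next
        assume "\<omega> \<le> ereal t"
        then have "t \<in> {u<..}" using after_I u(1) by simp
        then have "\<forall>\<^sub>F x in at t. x \<in> {u<..}" by (intro eventually_at_in_open') auto
        then show ?thesis by eventually_elim (use u(2) d(2)[OF _ \<xi>_lattice] e in \<open>auto simp: D0_def dist_norm\<close>)
      qed
    qed
    then show ?thesis using False by (simp add: isCont_def D0_def)
  qed
qed

text \<open>Integrating \<open>D0\<close> extends the curve to the whole line by waiting at its
  finite ends. There \<open>V\<close> equals \<open>c\<close>, at most by membership in the cell and
  at least as a limit of values above \<open>c\<close>; so the extension respects the constraint of
  \<open>Gamma_class\<close> and adds no action.\<close>

lemma C1_extension:
  obtains Q where "\<And>t. (Q has_vector_derivative D0 t) (at t)" "\<And>t. t \<in> I \<Longrightarrow> Q t = q t"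
    "\<And>t. ereal t \<le> \<alpha> \<Longrightarrow> Q t \<in> sublevel_at V c \<delta> 0 \<and> V (Q t) = c"
    "\<And>t. \<omega> \<le> ereal t \<Longrightarrow> Q t \<in> sublevel_at V c \<delta> \<xi> \<and> V (Q t) = c"
proof -
  obtain F where F: "\<And>t. (F has_vector_derivative D0 t) (at t)" by (rule antiderivative_UNIV[OF D0_continuous]) blast
  obtain t0 where t0: "t0 \<in> I" using einterval_nonempty[OF \<alpha>_less_\<omega>] by blast
  define Q where "Q t = F t - F t0 + q t0" for t
  have dQ: "(Q has_vector_derivative D0 t) (at t)" for t
    unfolding Q_def[abs_def] using F by (auto intro!: derivative_eq_intros)
  have Qc: "continuous_on UNIV Q"
    using dQ by (intro continuous_at_imp_continuous_on ballI has_vector_derivative_continuous)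
  have "\<exists>k. \<forall>t\<in>I. Q t - q t = k"
  proof (rule has_vector_derivative_zero_constant[OF I_convex, of "\<lambda>t. Q t - q t"])
    show "((\<lambda>t. Q t - q t) has_vector_derivative 0) (at t within I)" if "t \<in> I" for t
    proof (rule has_vector_derivative_at_within)
      show "((\<lambda>t. Q t - q t) has_vector_derivative 0) (at t)"
        using has_vector_derivative_diff[OF dQ[of t] q_D[OF that]] that by (simp add: D0_def)
    qed
    fix k assume "\<And>t. t \<in> I \<Longrightarrow> Q t - q t = k"
    then show "\<exists>k. \<forall>t\<in>I. Q t - q t = k" by blast
  qed
  then obtain k where k: "\<forall>t\<in>I. Q t - q t = k" by blast
  have "k = 0" using k[rule_format, OF t0] by (simp add: Q_def)
  then have Qq: "Q t = q t" if "t \<in> I" for t using k[rule_format, OF that] by simp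
  have const: "Q s = Q t" if T: "convex T" "s \<in> T" "t \<in> T" "T \<inter> I = {}" for s t T
  proof (rule has_vector_derivative_zero_constant[OF T(1), of Q])
    show "(Q has_vector_derivative 0) (at u within T)" if "u \<in> T" for u
    proof -
      have "D0 u = 0" using that T(4) by (auto simp: D0_def)
      then have "(Q has_vector_derivative 0) (at u)" using dQ[of u] by simp
      then show ?thesis by (rule has_vector_derivative_at_within)
    qed
    fix k assume "\<And>u. u \<in> T \<Longrightarrow> Q u = k"
    then show "Q s = Q t" using T(2,3) by simp
  qed
  \<comment> \<open>A general filter \<open>F\<close> lets one argument serve
    \<open>at_right\<close> at the left end and \<open>at_left\<close> at the right end.\<close>
  have boundary: "Q a \<in> sublevel_at V c \<delta> \<eta> \<and> V (Q a) = c"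
    if F: "F \<noteq> bot" "F \<le> at a" "\<forall>\<^sub>F t in F. t \<in> I" and \<eta>: "\<eta> \<in> int_lattice"
      and small: "\<And>e. e > 0 \<Longrightarrow> \<forall>\<^sub>F t in F. infdist (q t) (sublevel_at V c \<delta> \<eta>) < e" for F a \<eta>
  proof -
    have Qa: "(Q \<longlongrightarrow> Q a) F" using Qc F(2) by (meson UNIV_I continuous_on_def tendsto_mono)
    have "infdist (Q a) (sublevel_at V c \<delta> \<eta>) \<le> 0 + e" if "e > 0" for e
    proof (rule tendsto_upperbound[OF tendsto_infdist[OF Qa]])
      show "\<forall>\<^sub>F t in F. infdist (Q t) (sublevel_at V c \<delta> \<eta>) \<le> 0 + e"
        using small[OF that] F(3) by eventually_elim (simp add: Qq)
    qed (rule F(1))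
    then have "infdist (Q a) (sublevel_at V c \<delta> \<eta>) \<le> 0" by (rule field_le_epsilon)
    then have "infdist (Q a) (sublevel_at V c \<delta> \<eta>) = 0" using infdist_nonneg[of "Q a"] by (metis antisym)
    then have mem: "Q a \<in> sublevel_at V c \<delta> \<eta>"
      using in_closed_iff_infdist_zero[OF sublevel_at_closed] lattice_in_sublevel_at[OF \<eta>] by blast
    have "c \<le> V (Q a)"
    proof (rule tendsto_lowerbound[OF continuous_on_tendsto_compose[OF V_cont Qa]])
      show "\<forall>\<^sub>F t in F. c \<le> V (Q t)" using F(3) by eventually_elim (use Qq above in force)
    qed (use F(1) in auto)
    then show ?thesis using mem by (auto simp: sublevel_at_def)
  qed
  show thesis
  proof (rule that[OF dQ Qq])
    fix t assume t: "ereal t \<le> \<alpha>"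
    then obtain a where a: "\<alpha> = ereal a" using \<alpha>_less_\<omega> by (cases \<alpha>) auto
    have "Q t = Q a" by (rule const[of "{..a}"]) (use t a in \<open>auto simp: einterval_def\<close>)
    moreover have "Q a \<in> sublevel_at V c \<delta> 0 \<and> V (Q a) = c"
    proof (rule boundary[of "at_right a"])
      have ev: "\<forall>\<^sub>F t in at_right a. t \<in> I \<and> t < s" if "s \<in> I" for s
      proof -
        have "a < s" using that by (simp add: a einterval_def)
        then have "\<forall>\<^sub>F t in at_right a. t \<in> {a<..<s}" by (rule eventually_at_right_real)
        then show ?thesis
        proof eventually_elim
          case (elim t)
          have "ereal t < \<omega>" using that elim unfolding einterval_def mem_Collect_eq
            by (metis greaterThanLessThan_iff less_ereal.simps(1) less_trans)
          then show ?case using elim by (simp add: a einterval_def)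
        qed
      qed
      show "\<forall>\<^sub>F t in at_right a. t \<in> I" using ev[OF t0] by eventually_elim simp
      fix e :: real assume "e > 0"
      then obtain s where s: "s \<in> I" "\<forall>t\<in>I. t < s \<longrightarrow> infdist (q t) (sublevel_at V c \<delta> 0) < e" using left_cell by blast
      show "\<forall>\<^sub>F t in at_right a. infdist (q t) (sublevel_at V c \<delta> 0) < e"
        using ev[OF s(1)] by eventually_elim (use s(2) in blast)
    qed (auto simp: at_le)
    ultimately show "Q t \<in> sublevel_at V c \<delta> 0 \<and> V (Q t) = c" by simp
  next
    fix t assume t: "\<omega> \<le> ereal t"
    then obtain a where a: "\<omega> = ereal a" using \<alpha>_less_\<omega> by (cases \<omega>) auto
    have "Q t = Q a" by (rule const[of "{a..}"]) (use t a in \<open>auto simp: einterval_def\<close>)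
    moreover have "Q a \<in> sublevel_at V c \<delta> \<xi> \<and> V (Q a) = c"
    proof (rule boundary[of "at_left a"])
      have ev: "\<forall>\<^sub>F t in at_left a. t \<in> I \<and> s < t" if "s \<in> I" for s
      proof -
        have "s < a" using that by (simp add: a einterval_def)
        then have "\<forall>\<^sub>F t in at_left a. t \<in> {s<..<a}" by (rule eventually_at_left_real)
        then show ?thesis
        proof eventually_elim
          case (elim t)
          have "\<alpha> < ereal t" using that elim unfolding einterval_def mem_Collect_eq
            by (metis greaterThanLessThan_iff less_ereal.simps(1) less_trans)
          then show ?case using elim by (simp add: a einterval_def)
        qed
      qed
      show "\<forall>\<^sub>F t in at_left a. t \<in> I" using ev[OF t0] by eventually_elim simp
      fix e :: real assume "e > 0"
      then obtain s where s: "s \<in> I" "\<forall>t\<in>I. s < t \<longrightarrow> infdist (q t) (sublevel_at V c \<delta> \<xi>) < e" using right_cell by blast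
      show "\<forall>\<^sub>F t in at_left a. infdist (q t) (sublevel_at V c \<delta> \<xi>) < e"
        using ev[OF s(1)] by eventually_elim (use s(2) in blast)
    qed (auto simp: at_le \<xi>_lattice)
    ultimately show "Q t \<in> sublevel_at V c \<delta> \<xi> \<and> V (Q t) = c" by simp
  qed
qed

lemma cell_0_subset_A: "sublevel_at V c \<delta> 0 \<subseteq> A" using Z_0 unfolding sublevel_part_def by blast
lemma cell_\<xi>_subset_B: "sublevel_at V c \<delta> \<xi> \<subseteq> B" using \<xi> unfolding sublevel_part_def by blast
lemma cells_nonempty: "sublevel_at V c \<delta> 0 \<noteq> {}" "sublevel_at V c \<delta> \<xi> \<noteq> {}"
  using lattice_in_sublevel_at[OF int_lattice_0] lattice_in_sublevel_at[OF \<xi>_lattice] by blast+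

text \<open>The lower limits provide times \<open>a < b\<close> at which the competitor is within
  \<epsilon> of \<open>A\<close> and \<open>B\<close>. Its action on \<open>{a..b}\<close> is at
  most the total one, and \<open>L_le\<close> applies there with the weak derivative as
  \<open>p\<close>; then \<epsilon> tends to 0.\<close>

lemma L_le_action:
  assumes q1: "q1 \<in> Gamma_class \<phi> V c A B" shows "ennreal L \<le> action \<phi> V c UNIV q1"
proof (cases "action \<phi> V c UNIV q1 = \<infinity>")
  case False
  define p where "p = weak_deriv UNIV q1"
  have g: "W1_Phi_loc \<phi> q1" "\<And>t. V (q1 t) \<ge> c" "Liminf at_bot (\<lambda>t. ereal (infdist (q1 t) A)) = 0"
    "Liminf at_top (\<lambda>t. ereal (infdist (q1 t) B)) = 0" using q1 unfolding Gamma_class_def by auto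
  have qc: "continuous_on UNIV q1" using g(1) unfolding W1_Phi_loc_def by blast
  have w: "has_weak_deriv UNIV q1 p" unfolding p_def
    by (rule weak_deriv_global[OF qc]) (use g(1) in \<open>auto simp: W1_Phi_loc_def W1_Phi_def\<close>)
  have inc: "(p has_integral (q1 t - q1 s)) {s..t}" if "s \<le> t" for s t
  proof (cases "s = t")
    case False
    then show ?thesis using that by (intro weak_deriv_increment[OF w qc]) auto
  qed (simp add: has_integral_refl(2)[of p t])
  obtain r where r: "r \<ge> 0" "action \<phi> V c UNIV q1 = ennreal r" using False by (cases "action \<phi> V c UNIV q1") auto
  define f where "f t = \<Phi> (norm (p t)) + V (q1 t) - c" for t
  have f_nn: "f t \<ge> 0" for t using g(2)[of t] Phi_nonneg[of "norm (p t)"] by (simp add: f_def)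
  have act: "(\<integral>\<^sup>+t. ennreal (f t) \<partial>lebesgue) = ennreal r"
    using r(2) unfolding action_def p_def[symmetric] f_def by simp
  have "L \<le> r + 2 * \<epsilon> * speed_const" if \<epsilon>: "\<epsilon> > 0" for \<epsilon>
  proof -
    have "\<exists>a. infdist (q1 a) A < \<epsilon>"
    proof (rule ccontr)
      assume "\<not> ?thesis"
      then have "\<forall>\<^sub>F t in at_bot. ereal \<epsilon> \<le> ereal (infdist (q1 t) A)" by (intro always_eventually) (auto simp: not_less)
      then have "ereal \<epsilon> \<le> Liminf at_bot (\<lambda>t. ereal (infdist (q1 t) A))" by (rule Liminf_bounded)
      then show False using g(3) \<epsilon> by simp
    qed
    then obtain a where a: "infdist (q1 a) A < \<epsilon>" by blast
    \<comment> \<open>A time after \<open>a\<close> exists because the second lower limit is taken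
      at infinity.\<close>
    have "\<exists>b>a. infdist (q1 b) B < \<epsilon>"
    proof (rule ccontr)
      assume "\<not> ?thesis"
      then have "ereal \<epsilon> \<le> ereal (infdist (q1 t) B)" if "a < t" for t using that by (simp add: not_less) (meson not_less)
      then have "\<forall>\<^sub>F t in at_top. ereal \<epsilon> \<le> ereal (infdist (q1 t) B)"
        by (rule eventually_mono[OF eventually_gt_at_top[of a]])
      then have "ereal \<epsilon> \<le> Liminf at_top (\<lambda>t. ereal (infdist (q1 t) B))" by (rule Liminf_bounded)
      then show False using g(4) \<epsilon> by simp
    qed
    then obtain b where b: "a < b" "infdist (q1 b) B < \<epsilon>" by blast
    obtain A0 where A0: "A0 \<in> A" "infdist (q1 a) A = dist (q1 a) A0"
      using infdist_attains_inf[OF closed_A] cell_0_subset_A cells_nonempty by blast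
    obtain B0 where B0: "B0 \<in> B" "infdist (q1 b) B = dist (q1 b) B0"
      using infdist_attains_inf[OF closed_B] cell_\<xi>_subset_B cells_nonempty by blast
    have le: "(\<integral>\<^sup>+t. ennreal (indicator {a..b} t * g t) \<partial>lebesgue) \<le> ennreal r" if "\<And>t. g t \<le> f t" for g
      unfolding act[symmetric] using that f_nn by (intro nn_integral_mono ennreal_leI) (auto simp: indicator_def)
    have "set_integrable lebesgue {a..b} p" using w unfolding has_weak_deriv_def L1_loc_def by simp
    then have "(\<lambda>t. indicator {a..b} t *\<^sub>R p t) \<in> borel_measurable lebesgue" unfolding set_integrable_def by simp
    then have "(\<lambda>t. \<Phi> (norm (indicator {a..b} t *\<^sub>R p t))) \<in> borel_measurable lebesgue"
      by (rule measurable_compose[OF _ borel_measurable_continuous_onI[OF Phi_norm_continuous]])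
    moreover have "\<Phi> (norm (indicator {a..b} t *\<^sub>R p t)) = indicator {a..b} t * \<Phi> (norm (p t))" for t
      by (cases "t \<in> {a..b}") auto
    ultimately have pm: "(\<lambda>t. indicator {a..b} t * \<Phi> (norm (p t))) \<in> borel_measurable lebesgue" by simp
    have "integrable lebesgue (\<lambda>t. indicator {a..b} t * \<Phi> (norm (p t)))"
    proof (rule integrableI_nonneg[OF pm])
      show "AE t in lebesgue. 0 \<le> indicator {a..b} t * \<Phi> (norm (p t))" by (simp add: Phi_nonneg)
      have "(\<integral>\<^sup>+t. ennreal (indicator {a..b} t * \<Phi> (norm (p t))) \<partial>lebesgue) \<le> ennreal r"
        by (rule le) (use g(2) in \<open>simp add: f_def\<close>)
      then show "(\<integral>\<^sup>+t. ennreal (indicator {a..b} t * \<Phi> (norm (p t))) \<partial>lebesgue) < \<infinity>"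
        by (rule le_less_trans) simp
    qed
    then have si: "set_integrable lebesgue {a..b} (\<lambda>t. \<Phi> (norm (p t)))" by (simp add: set_integrable_def)
    have "set_integrable lebesgue {a..b} (\<lambda>t. W (q1 t))"
      by (intro absolutely_integrable_continuous_real continuous_on_compose2[OF W_cont continuous_on_subset[OF qc]]) auto
    with si have si': "set_integrable lebesgue {a..b} (\<lambda>t. \<Phi> (norm (p t)) + W (q1 t))" by (rule set_integral_add)
    have eq: "\<Phi> (norm (p t)) + W (q1 t) = f t" for t using g(2)[of t] by (simp add: f_def W_def)
    have "ennreal (integral {a..b} (\<lambda>t. \<Phi> (norm (p t)) + W (q1 t))) = ennreal (LINT t|lebesgue. indicator {a..b} t * f t)"
      using set_lebesgue_integral_eq_integral(2)[OF si'] by (simp add: set_lebesgue_integral_def eq)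
    also have "\<dots> = (\<integral>\<^sup>+t. ennreal (indicator {a..b} t * f t) \<partial>lebesgue)"
      using si' f_nn unfolding set_integrable_def eq by (intro nn_integral_eq_integral[symmetric]) auto
    also have "\<dots> \<le> ennreal r" by (rule le) simp
    finally have "integral {a..b} (\<lambda>t. \<Phi> (norm (p t)) + W (q1 t)) \<le> r" using r(1) by simp
    moreover have "L \<le> integral {a..b} (\<lambda>t. \<Phi> (norm (p t)) + W (q1 t)) + 2 * \<epsilon> * speed_const"
    proof (rule L_le[OF b(1) _ _ _ A0(1) _ B0(1)])
      show "continuous_on {a..b} q1" using qc continuous_on_subset by blast
      show "(\<lambda>t. \<Phi> (norm (p t))) integrable_on {a..b}" using set_lebesgue_integral_eq_integral(1)[OF si] .
    qed (use inc a b(2) A0(2) B0(2) in \<open>auto simp: dist_commute\<close>)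
    ultimately show ?thesis by simp
  qed
  note bound = this
  have "L \<le> r"
  proof (rule field_le_epsilon)
    fix e :: real assume "e > 0"
    then show "L \<le> r + e" using bound[of "e / (2 * speed_const)"] speed_const(1) by simp
  qed
  then show ?thesis using r(2) by (simp add: ennreal_leI)
qed simp

text \<open>The minimum over the class is at most the action of \<open>Q\<close> over the line,
  which equals that over \<open>I\<close> because the integrand vanishes outside; this is at most
  \<open>L\<close> by exhaustion and monotone convergence, and \<open>L\<close> is at most the
  minimum. All are equal.\<close>

lemma Q_minimal:
  assumes dQ: "\<And>t. (Q has_vector_derivative D0 t) (at t)" and Qq: "\<And>t. t \<in> I \<Longrightarrow> Q t = q t"
    and left: "\<And>t. ereal t \<le> \<alpha> \<Longrightarrow> Q t \<in> sublevel_at V c \<delta> 0 \<and> V (Q t) = c"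
    and right: "\<And>t. \<omega> \<le> ereal t \<Longrightarrow> Q t \<in> sublevel_at V c \<delta> \<xi> \<and> V (Q t) = c"
  shows "action \<phi> V c I Q = min_action \<phi> V c A B"
proof -
  have Qc: "continuous_on UNIV Q"
    using dQ by (intro continuous_at_imp_continuous_on ballI has_vector_derivative_continuous)
  have VQ: "V (Q t) \<ge> c" for t using above[of t] Qq[of t] left[of t] right[of t] not_in_I[of t] by fastforce
  define f where "f t = \<Phi> (norm (D0 t)) + V (Q t) - c" for t
  have f_nn: "f t \<ge> 0" for t using VQ[of t] Phi_nonneg[of "norm (D0 t)"] by (simp add: f_def)
  have f_out: "f t = 0" if "t \<notin> I" for t using that left[of t] right[of t] not_in_I[of t] by (auto simp: f_def D0_def)
  have f_cont: "continuous_on T f" for T unfolding f_def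
    by (intro continuous_on_add continuous_on_diff continuous_on_const
        continuous_on_compose2[OF Phi_norm_continuous continuous_on_subset[OF D0_continuous]]
        continuous_on_compose2[OF V_cont continuous_on_subset[OF Qc]]) auto
  \<comment> \<open>\<open>weak_deriv\<close> depends on the domain, so the actions over
    \<open>I\<close> and over the line use separate choices; both agree with \<open>D0\<close>
    almost everywhere.\<close>
  have act: "action \<phi> V c T Q = (\<integral>\<^sup>+t\<in>T. ennreal (f t) \<partial>lebesgue)" if "open T" "is_interval T" for T
    unfolding action_def
  proof (rule nn_integral_cong_AE)
    show "AE t in lebesgue. ennreal (\<Phi> (norm (weak_deriv T Q t)) + V (Q t) - c) * indicator T t = ennreal (f t) * indicator T t"
      using weak_deriv_eq_C1[OF dQ D0_continuous that] by eventually_elim (auto simp: f_def indicator_def)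
  qed
  have eq: "action \<phi> V c UNIV Q = action \<phi> V c I Q"
    unfolding act[OF open_UNIV is_interval_univ] act[OF I_open I_interval]
    by (rule nn_integral_cong) (use f_out in \<open>auto simp: indicator_def\<close>)
  have upper: "action \<phi> V c I Q \<le> ennreal L"
  proof -
    obtain u l' :: "nat \<Rightarrow> real" where ul: "I = (\<Union>i. {l' i..u i})" "incseq u" "decseq l'" "\<And>i. l' i < u i"
      by (rule einterval_Icc_approximation[OF \<alpha>_less_\<omega>]) (rule that)
    define g where "g i t = ennreal (f t) * indicator {l' i..u i} t" for i t
    have gm: "g i \<in> borel_measurable lebesgue" for i
    proof -
      have "f \<in> borel_measurable lebesgue" by (rule continuous_lebesgue_measurable[OF f_cont])
      then have "(\<lambda>t. ennreal (f t)) \<in> borel_measurable lebesgue" by (rule measurable_compose[OF _ measurable_ennreal])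
      then show ?thesis unfolding g_def
        by (rule borel_measurable_times_ennreal[OF _ borel_measurable_indicator]) simp
    qed
    have inc: "incseq g"
    proof (rule incseq_SucI, rule le_funI)
      fix i t
      have "{l' i..u i} \<subseteq> {l' (Suc i)..u (Suc i)}"
        using incseq_SucD[OF ul(2), of i] decseq_SucD[OF ul(3), of i] by auto
      then show "g i t \<le> g (Suc i) t" by (auto simp: g_def indicator_def)
    qed
    have sup: "ennreal (f t) * indicator I t = (SUP i. g i t)" for t
    proof (cases "t \<in> I")
      case True
      then obtain i where "t \<in> {l' i..u i}" using ul(1) by blast
      then have "ennreal (f t) * indicator I t = g i t" using True by (simp add: g_def)
      also have "\<dots> \<le> (SUP i. g i t)" by (rule SUP_upper) simp
      finally have "ennreal (f t) * indicator I t \<le> (SUP i. g i t)" .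
      moreover have "(SUP i. g i t) \<le> ennreal (f t) * indicator I t"
        by (rule SUP_least) (use True in \<open>simp add: g_def indicator_def\<close>)
      ultimately show ?thesis by (rule antisym)
    next
      case False
      then show ?thesis using f_out by (simp add: g_def)
    qed
    have "action \<phi> V c I Q = (\<integral>\<^sup>+t. (SUP i. g i t) \<partial>lebesgue)"
      unfolding act[OF I_open I_interval] sup ..
    also have "\<dots> = (SUP i. \<integral>\<^sup>+t. g i t \<partial>lebesgue)" by (rule nn_integral_monotone_convergence_SUP[OF inc gm])
    also have "\<dots> \<le> ennreal L"
    proof (rule SUP_least)
      fix i
      have mem: "l' i \<in> I" "u i \<in> I" using ul(1) ul(4)[of i] by (auto intro!: exI[of _ i])
      have "(\<integral>\<^sup>+t. g i t \<partial>lebesgue) = ennreal (integral {l' i..u i} f)"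
        unfolding g_def by (rule nn_integral_Icc_eq_integral[OF f_cont f_nn])
      also have "integral {l' i..u i} f = integral {l' i..u i} (\<lambda>t. \<Phi> (norm (D t)) + (V (q t) - c))"
        by (rule integral_cong) (use I_Icc[OF mem] Qq in \<open>auto simp: f_def D0_def\<close>)
      also have "\<dots> \<le> L" by (rule action_le[OF mem ul(4)])
      finally show "(\<integral>\<^sup>+t. g i t \<partial>lebesgue) \<le> ennreal L" by (simp add: ennreal_leI)
    qed
    finally show ?thesis .
  qed
  have "Q \<in> Gamma_class \<phi> V c A B"
  proof -
    have lim_left: "((\<lambda>t. ereal (infdist (Q t) A)) \<longlongrightarrow> ereal 0) at_bot"
    proof (rule tendsto_ereal, rule tendstoI)
      fix e :: real assume e: "e > 0"
      then obtain s where s: "s \<in> I" "\<forall>t\<in>I. t < s \<longrightarrow> infdist (q t) (sublevel_at V c \<delta> 0) < e" using left_cell by blast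
      have "dist (infdist (Q t) A) 0 < e" if "t < s" for t
      proof (cases "t \<in> I")
        case True
        have "infdist (Q t) A \<le> infdist (Q t) (sublevel_at V c \<delta> 0)" by (rule infdist_mono[OF cell_0_subset_A cells_nonempty(1)])
        then show ?thesis using s(2) that True Qq[OF True] infdist_nonneg[of "Q t" A] by (auto simp: dist_real_def)
      next
        case False
        then have "ereal t \<le> \<alpha>" using not_in_I[OF False] after_I[OF _ s(1), of t] that by auto
        then have "Q t \<in> A" using left cell_0_subset_A by blast
        then show ?thesis using e by simp
      qed
      then show "\<forall>\<^sub>F t in at_bot. dist (infdist (Q t) A) 0 < e" unfolding eventually_at_bot_dense by blast
    qed
    have lim_right: "((\<lambda>t. ereal (infdist (Q t) B)) \<longlongrightarrow> ereal 0) at_top"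
    proof (rule tendsto_ereal, rule tendstoI)
      fix e :: real assume e: "e > 0"
      then obtain s where s: "s \<in> I" "\<forall>t\<in>I. s < t \<longrightarrow> infdist (q t) (sublevel_at V c \<delta> \<xi>) < e" using right_cell by blast
      have "dist (infdist (Q t) B) 0 < e" if "s < t" for t
      proof (cases "t \<in> I")
        case True
        have "infdist (Q t) B \<le> infdist (Q t) (sublevel_at V c \<delta> \<xi>)" by (rule infdist_mono[OF cell_\<xi>_subset_B cells_nonempty(2)])
        then show ?thesis using s(2) that True Qq[OF True] infdist_nonneg[of "Q t" B] by (auto simp: dist_real_def)
      next
        case False
        then have "\<omega> \<le> ereal t" using not_in_I[OF False] before_I[OF _ s(1), of t] that by auto
        then have "Q t \<in> B" using right cell_\<xi>_subset_B by blast
        then show ?thesis using e by simp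
      qed
      then show "\<forall>\<^sub>F t in at_top. dist (infdist (Q t) B) 0 < e" by (rule eventually_mono[OF eventually_gt_at_top[of s]])
    qed
    show ?thesis unfolding Gamma_class_def
      using W1_Phi_loc_C1[OF dQ D0_continuous] VQ lim_imp_Liminf[OF _ lim_left] lim_imp_Liminf[OF _ lim_right]
      by (simp add: zero_ereal_def trivial_limit_at_bot_linorder trivial_limit_at_top_linorder)
  qed
  then have "min_action \<phi> V c A B \<le> action \<phi> V c I Q" unfolding min_action_def eq[symmetric] by (rule INF_lower)
  moreover have "ennreal L \<le> min_action \<phi> V c A B" unfolding min_action_def by (rule INF_greatest) (rule L_le_action)
  ultimately show ?thesis using upper by (meson antisym order_trans)
qed

lemma limits_of_extension:
  assumes Qq: "\<And>t. t \<in> I \<Longrightarrow> Q t = q t"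
  shows "limit_dist_left \<alpha> Q (sublevel_at V c \<delta> 0)" "limit_dist_right \<omega> Q (sublevel_at V c \<delta> \<xi>)"
proof -
  have real: "real_of_ereal t \<in> I \<and> ereal (real_of_ereal t) = t" if "\<alpha> < t" "t < \<omega>" for t
    using that by (cases t) (auto simp: einterval_def)
  show "limit_dist_left \<alpha> Q (sublevel_at V c \<delta> 0)" unfolding limit_dist_left_def
  proof (rule tendstoI)
    fix e :: real assume "e > 0"
    then obtain s where s: "s \<in> I" "\<forall>t\<in>I. t < s \<longrightarrow> infdist (q t) (sublevel_at V c \<delta> 0) < e" using left_cell by blast
    have "\<alpha> < ereal s" "ereal s < \<omega>" using s(1) by (auto simp: einterval_def)
    have "dist (infdist (Q (real_of_ereal t)) (sublevel_at V c \<delta> 0)) 0 < e" if t: "\<alpha> < t" "t < ereal s" for t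
    proof -
      have r: "real_of_ereal t \<in> I" "ereal (real_of_ereal t) = t" using real[of t] t \<open>ereal s < \<omega>\<close> by auto
      then have "real_of_ereal t < s" using t(2) by (metis less_ereal.simps(1))
      then show ?thesis using s(2) r(1) Qq[OF r(1)] infdist_nonneg[of "q (real_of_ereal t)"] by (auto simp: dist_real_def)
    qed
    then show "\<forall>\<^sub>F t in at_right \<alpha>. dist (infdist (Q (real_of_ereal t)) (sublevel_at V c \<delta> 0)) 0 < e"
      unfolding eventually_at_right[OF \<open>\<alpha> < ereal s\<close>] using \<open>\<alpha> < ereal s\<close> by blast
  qed
  show "limit_dist_right \<omega> Q (sublevel_at V c \<delta> \<xi>)" unfolding limit_dist_right_def
  proof (rule tendstoI)
    fix e :: real assume "e > 0"
    then obtain s where s: "s \<in> I" "\<forall>t\<in>I. s < t \<longrightarrow> infdist (q t) (sublevel_at V c \<delta> \<xi>) < e" using right_cell by blast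
    have "\<alpha> < ereal s" "ereal s < \<omega>" using s(1) by (auto simp: einterval_def)
    have "dist (infdist (Q (real_of_ereal t)) (sublevel_at V c \<delta> \<xi>)) 0 < e" if t: "t < \<omega>" "ereal s < t" for t
    proof -
      have r: "real_of_ereal t \<in> I" "ereal (real_of_ereal t) = t" using real[of t] t \<open>\<alpha> < ereal s\<close> by auto
      then have "s < real_of_ereal t" using t(2) by (metis less_ereal.simps(1))
      then show ?thesis using s(2) r(1) Qq[OF r(1)] infdist_nonneg[of "q (real_of_ereal t)"] by (auto simp: dist_real_def)
    qed
    then show "\<forall>\<^sub>F t in at_left \<omega>. dist (infdist (Q (real_of_ereal t)) (sublevel_at V c \<delta> \<xi>)) 0 < e"
      unfolding eventually_at_left[OF \<open>ereal s < \<omega>\<close>] using \<open>ereal s < \<omega>\<close> by blast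
  qed
qed

text \<open>Near its ends the curve is close to bounded cells, and the remaining arc is
  compact.\<close>

lemma q_bounded: "\<exists>M. \<forall>t\<in>I. norm (q t) \<le> M"
proof -
  obtain s where s: "s \<in> I" "\<forall>t\<in>I. t < s \<longrightarrow> infdist (q t) (sublevel_at V c \<delta> 0) < 1" using left_cell[of 1] by auto
  obtain u where u: "u \<in> I" "\<forall>t\<in>I. u < t \<longrightarrow> infdist (q t) (sublevel_at V c \<delta> \<xi>) < 1" using right_cell[of 1] by auto
  have cell: "norm (q t) \<le> norm \<eta> + 2" if \<eta>: "\<eta> \<in> int_lattice" "infdist (q t) (sublevel_at V c \<delta> \<eta>) < 1" for t \<eta>
  proof -
    obtain y where "y \<in> sublevel_at V c \<delta> \<eta>" "dist (q t) y < 1" by (rule sublevel_at_attained[OF \<eta>])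
    then have "dist (q t) \<eta> \<le> 2" using dist_triangle[of "q t" \<eta> y] delta_bounds
      by (auto simp: sublevel_at_def dist_commute)
    then show ?thesis using norm_triangle_ineq2[of "q t" \<eta>] by (simp add: dist_norm)
  qed
  have "compact (q ` {s..u})" by (intro compact_continuous_image continuous_on_subset[OF q_cont]) auto
  then obtain M where M: "\<forall>y\<in>q ` {s..u}. norm y \<le> M" using compact_imp_bounded bounded_iff by blast
  have "norm (q t) \<le> max M (norm \<xi> + 2)" if t: "t \<in> I" for t
  proof -
    consider "t < s" | "u < t" | "t \<in> {s..u}" by force
    then show ?thesis
    proof cases
      case 1 
      then have "norm (q t) \<le> norm (0 :: real^'n) + 2" using s(2) t by (intro cell) auto
      then have "norm (q t) \<le> 2" by simp
      then have "norm (q t) \<le> norm \<xi> + 2" using norm_ge_zero[of \<xi>] by linarith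
      then show ?thesis by simp
    next
      case 2 then show ?thesis using cell[of \<xi> t] u(2) t \<xi>_lattice by (simp add: le_max_iff_disj)
    next
      case 3 then show ?thesis using M by (simp add: le_max_iff_disj)
    qed
  qed
  then show ?thesis by blast
qed

text \<open>On \<open>I\<close> the value \<open>G (norm (D t)) = V (q t) - c\<close> is positive,
  so the momentum never vanishes and \<open>Pinv\<close> is differentiable at its norm. Hence the
  velocity is C1 although \<open>Psi\<close> may fail to be C1 at 0.\<close>

lemma D_C1: "\<exists>D'. (\<forall>t\<in>I. (D has_vector_derivative D' t) (at t)) \<and> continuous_on I D'"
proof -
  obtain E where E: "continuous_on {0<..} E" "\<And>r. r > 0 \<Longrightarrow> (Pinv has_real_derivative E r) (at r)" by (rule deriv_Pinv) blast
  define p where "p t = Pv (D t)" for t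
  define p' where "p' t = grad V (q t)" for t
  have dp: "(p has_vector_derivative p' t) (at t)" if "t \<in> I" for t
    unfolding p_def[abs_def] p'_def by (rule Euler_Lagrange[OF that])
  have pos: "norm (p t) > 0" if "t \<in> I" for t
  proof -
    have "G (norm (D t)) > 0" using energy[OF that] above[OF that] by simp
    then have "norm (D t) > 0" by (cases "D t = 0") auto
    then show ?thesis by (simp add: p_def norm_Pv P_pos)
  qed
  define r' where "r' t = inner (p t) (p' t) / norm (p t)" for t
  have dr: "((\<lambda>t. norm (p t)) has_real_derivative r' t) (at t)" if "t \<in> I" for t
  proof -
    have "((\<lambda>t. norm (p t)) has_derivative (\<lambda>k. inner (k *\<^sub>R p' t) (sgn (p t)))) (at t)"
      by (rule has_derivative_compose[OF dp[OF that, unfolded has_vector_derivative_def] has_derivative_norm]) (use pos[OF that] in auto)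
    moreover have "(\<lambda>k. inner (k *\<^sub>R p' t) (sgn (p t))) = (\<lambda>k. r' t * k)"
      by (auto simp: r'_def sgn_div_norm inner_commute divide_inverse)
    ultimately show ?thesis by (simp add: has_field_derivative_def)
  qed
  define s where "s t = Pinv (norm (p t)) / norm (p t)" for t
  define s' where "s' t = (E (norm (p t)) * r' t * norm (p t) - Pinv (norm (p t)) * r' t) / (norm (p t) * norm (p t))" for t
  have ds: "(s has_real_derivative s' t) (at t)" if "t \<in> I" for t
    unfolding s_def[abs_def] s'_def
    using pos[OF that] by (intro DERIV_divide DERIV_chain2[OF E(2)] dr that) auto
  have pc: "continuous_on I p"
    using dp by (intro continuous_at_imp_continuous_on ballI has_vector_derivative_continuous) blast
  have p'c: "continuous_on I p'" unfolding p'_def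
    by (rule continuous_on_compose2[OF grad_cont continuous_on_subset[OF q_cont]]) auto
  have nc: "continuous_on I (\<lambda>t. norm (p t))" by (intro continuous_on_norm pc)
  have r'c: "continuous_on I r'" unfolding r'_def
    by (intro continuous_on_divide continuous_on_inner pc p'c nc) (use pos in force)
  have Ec: "continuous_on I (\<lambda>t. E (norm (p t)))" by (rule continuous_on_compose2[OF E(1) nc]) (use pos in auto)
  have Pc: "continuous_on I (\<lambda>t. Pinv (norm (p t)))" by (rule continuous_on_compose2[OF Pinv_continuous nc]) auto
  have sc: "continuous_on I s" unfolding s_def by (intro continuous_on_divide Pc nc) (use pos in force)
  have s'c: "continuous_on I s'" unfolding s'_def
    by (intro continuous_on_divide continuous_on_diff continuous_on_mult Ec Pc nc r'c) (use pos in force)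
  have "(D has_vector_derivative (s t *\<^sub>R p' t + s' t *\<^sub>R p t)) (at t)" if "t \<in> I" for t
  proof -
    have "((\<lambda>t. s t *\<^sub>R p t) has_vector_derivative (s t *\<^sub>R p' t + s' t *\<^sub>R p t)) (at t)"
      by (rule has_vector_derivative_scaleR[OF ds[OF that] dp[OF that]])
    moreover have "(\<lambda>t. s t *\<^sub>R p t) = D"
    proof
      show "s t *\<^sub>R p t = D t" for t using Psi_Pv[of "D t"] unfolding Psi_def s_def p_def .
    qed
    ultimately show ?thesis by simp
  qed
  moreover have "continuous_on I (\<lambda>t. s t *\<^sub>R p' t + s' t *\<^sub>R p t)"
    by (intro continuous_on_add continuous_on_scaleR sc s'c pc p'c)
  ultimately show ?thesis by (intro exI[of _ "\<lambda>t. s t *\<^sub>R p' t + s' t *\<^sub>R p t"]) simp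
qed

lemma minimal_connection_exists:
  "\<exists>Q. minimal_connection \<phi> V c A B \<alpha> \<omega> Q \<and>
     limit_dist_left \<alpha> Q (sublevel_at V c \<delta> 0) \<and> limit_dist_right \<omega> Q (sublevel_at V c \<delta> \<xi>)"
proof -
  obtain Q where Q: "\<And>t. (Q has_vector_derivative D0 t) (at t)" "\<And>t. t \<in> I \<Longrightarrow> Q t = q t"
    "\<And>t. ereal t \<le> \<alpha> \<Longrightarrow> Q t \<in> sublevel_at V c \<delta> 0 \<and> V (Q t) = c"
    "\<And>t. \<omega> \<le> ereal t \<Longrightarrow> Q t \<in> sublevel_at V c \<delta> \<xi> \<and> V (Q t) = c" by (rule C1_extension) (rule that)
  have vd: "vector_derivative Q (at t) = D0 t" for t by (rule vector_derivative_at[OF Q(1)])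
  have Qc: "continuous_on UNIV Q"
    using Q(1) by (intro continuous_at_imp_continuous_on ballI has_vector_derivative_continuous)
  note lims = limits_of_extension[OF Q(2)]
  have limA: "limit_dist_left \<alpha> Q A"
    unfolding limit_dist_left_def
    by (rule tendsto_sandwich[OF _ _ tendsto_const lims(1)[unfolded limit_dist_left_def]])
      (auto intro!: always_eventually infdist_nonneg infdist_mono[OF cell_0_subset_A cells_nonempty(1)])
  have limB: "limit_dist_right \<omega> Q B"
    unfolding limit_dist_right_def
    by (rule tendsto_sandwich[OF _ _ tendsto_const lims(2)[unfolded limit_dist_right_def]])
      (auto intro!: always_eventually infdist_nonneg infdist_mono[OF cell_\<xi>_subset_B cells_nonempty(2)])
  have "L_infinity I Q" unfolding L_infinity_def
  proof
    have "I \<in> sets lebesgue" using I_open by auto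
    then show "set_borel_measurable lebesgue I Q" unfolding set_borel_measurable_def
      using continuous_lebesgue_measurable[OF Qc] by (intro borel_measurable_scaleR borel_measurable_indicator)
    obtain M where "\<forall>t\<in>I. norm (q t) \<le> M" using q_bounded by blast
    then show "\<exists>M. AE t in lebesgue. t \<in> I \<longrightarrow> norm (Q t) \<le> M" using Q(2) by (intro exI[of _ M] AE_I2) auto
  qed
  moreover have "C1_on_closure I Q" unfolding C1_on_closure_def
    using has_vector_derivative_at_within[OF Q(1)] continuous_on_subset[OF D0_continuous] by blast
  moreover have "C2_on_open I Q" unfolding C2_on_open_def vd C1_differentiable_on_def
  proof
    show "\<exists>D. (\<forall>x\<in>I. (Q has_vector_derivative D x) (at x)) \<and> continuous_on I D"
      using Q(1) continuous_on_subset[OF D0_continuous] by blast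
    obtain D' where D': "\<forall>t\<in>I. (D has_vector_derivative D' t) (at t)" "continuous_on I D'" using D_C1 by blast
    have "(D0 has_vector_derivative D' t) (at t)" if "t \<in> I" for t
      by (rule has_vector_derivative_transform_within_open[OF D'(1)[rule_format, OF that] I_open that]) (simp add: D0_def)
    then show "\<exists>D'. (\<forall>t\<in>I. (D0 has_vector_derivative D' t) (at t)) \<and> continuous_on I D'" using D'(2) by blast
  qed
  moreover have "((\<lambda>s. \<phi> (norm (D0 s)) *\<^sub>R D0 s) has_vector_derivative grad V (Q t)) (at t)" if "t \<in> I" for t
    unfolding Pv_def[symmetric] Q(2)[OF that]
    by (rule has_vector_derivative_transform_within_open[OF Euler_Lagrange[OF that] I_open that]) (simp add: D0_def)
  moreover have "V (Q t) > c \<and> G (norm (D0 t)) - V (Q t) = - c" if "t \<in> I" for t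
    using that energy[OF that] above[OF that] Q(2)[OF that] by (simp add: D0_def)
  ultimately have "minimal_connection \<phi> V c A B \<alpha> \<omega> Q"
    unfolding minimal_connection_def Let_def vd using \<alpha>_less_\<omega> limA limB Q_minimal[OF Q] by blast
  then show ?thesis using lims by blast
qed

end

context subgroup_step begin

lemma step_connection:
  "\<exists>\<xi>\<in>int_lattice - Z. \<exists>\<alpha> \<omega> q. minimal_connection \<phi> V c A B \<alpha> \<omega> q \<and>
     limit_dist_left \<alpha> q (sublevel_at V c \<delta> 0) \<and> limit_dist_right \<omega> q (sublevel_at V c \<delta> \<xi>)"
proof -
  obtain \<alpha> \<omega> q D L \<xi> where "connection \<phi> l V c \<delta> Z \<alpha> \<omega> q D L \<xi>" using connection_exists by blast
  then interpret connection \<phi> l V c \<delta> Z \<alpha> \<omega> q D L \<xi> .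
  show ?thesis using minimal_connection_exists \<xi> by blast
qed

end

section \<open>Chains of subgroups of the lattice\<close>

lemma finite_int_lattice_bounded: "finite (int_lattice \<inter> cball 0 R :: (real^'n) set)"
proof -
  define N where "N = \<lceil>R\<rceil>"
  have "int_lattice \<inter> cball 0 R \<subseteq> (\<lambda>f. \<chi> i. real_of_int (f i)) ` (PiE (UNIV :: 'n set) (\<lambda>_. {- N..N}))"
  proof
    fix x :: "real^'n" assume x: "x \<in> int_lattice \<inter> cball 0 R"
    have "\<forall>i. \<exists>k. x $ i = of_int k" using x by (auto simp: int_lattice_def elim!: Ints_cases)
    then obtain f where f: "\<And>i. x $ i = of_int (f i)" by metis
    have "f i \<in> {- N..N}" for i
    proof -
      have "\<bar>x $ i\<bar> \<le> R" using component_le_norm_cart[of x i] x by simp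
      then have "\<bar>real_of_int (f i)\<bar> \<le> real_of_int N" unfolding f N_def using le_of_int_ceiling[of R] by linarith
      then show ?thesis by (simp add: abs_le_iff)
    qed
    then show "x \<in> (\<lambda>f. \<chi> i. real_of_int (f i)) ` (PiE UNIV (\<lambda>_. {- N..N}))"
      using f by (intro image_eqI[of _ _ f]) (auto simp: vec_eq_iff)
  qed
  then show ?thesis by (rule finite_subset) (intro finite_imageI finite_PiE, auto)
qed

lemma int_scaleR_mem:
  assumes diff: "\<And>x y. x \<in> H \<Longrightarrow> y \<in> H \<Longrightarrow> x - y \<in> H" and v: "(v :: 'a::real_vector) \<in> H"
  shows "of_int n *\<^sub>R v \<in> H"
proof -
  have "0 \<in> H" using diff[OF v v] by simp
  then have minus: "- x \<in> H" if "x \<in> H" for x using diff[of 0 x] that by simp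
  then have add: "x + y \<in> H" if "x \<in> H" "y \<in> H" for x y using diff[of x "- y"] that by simp
  have nat: "of_nat k *\<^sub>R v \<in> H" for k
    by (induction k) (use \<open>0 \<in> H\<close> add v in \<open>auto simp: scaleR_add_left\<close>)
  show ?thesis using nat[of "nat n"] minus[OF nat[of "nat (- n)"]] by (cases "n \<ge> 0") auto
qed

text \<open>Modulo the integer span of a maximal independent subset of the union, every element of the
  chain reduces to one of finitely many lattice points of bounded norm.\<close>

lemma no_infinite_int_lattice_chain:
  fixes H :: "nat \<Rightarrow> (real^'n) set"
  assumes sub: "\<And>j. H j \<subseteq> int_lattice"
    and diff: "\<And>j x y. x \<in> H j \<Longrightarrow> y \<in> H j \<Longrightarrow> x - y \<in> H j"
    and mono: "\<And>j. H j \<subseteq> H (Suc j)"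
    and x: "\<And>j. x j \<in> H (Suc j) - H j"
  shows False
proof -
  define U where "U = (\<Union>j. H j)"
  \<comment> \<open>A finite subset of the increasing union lies in some \<open>H j0\<close>; from
    then on every group of the chain absorbs integer combinations of \<open>b\<close>.\<close>
  obtain b where b: "b \<subseteq> U" "independent b" "U \<subseteq> span b" by (rule maximal_independent_subset)
  have bf: "finite b" using b(2) by (rule independent_imp_finite)
  have le: "H i \<subseteq> H j" if "i \<le> j" for i j using mono that by (rule lift_Suc_mono_le)
  have "\<exists>j. b \<subseteq> H j" using bf b(1)
  proof (induction b)
    case (insert v F)
    then obtain i j where "F \<subseteq> H i" "v \<in> H j" by (auto simp: U_def)
    then show ?case using le[of i "max i j"] le[of j "max i j"] by (intro exI[of _ "max i j"]) auto
  qed simp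
  then obtain j0 where j0: "b \<subseteq> H j0" by blast
  have xU: "x j \<in> U" for j using x[of j] by (auto simp: U_def)
  have "\<exists>t. x j = (\<Sum>v\<in>b. t v *\<^sub>R v)" for j using b(3) xU[of j] span_finite[OF bf] by auto
  then obtain t where t: "\<And>j. x j = (\<Sum>v\<in>b. t j v *\<^sub>R v)" by metis
  \<comment> \<open>Rounding down leaves coordinates between 0 and 1, so the residue
    \<open>x j - e j\<close> has norm at most the sum of the norms in \<open>b\<close>.\<close>
  define e where "e j = (\<Sum>v\<in>b. of_int \<lfloor>t j v\<rfloor> *\<^sub>R v)" for j
  have H_add: "u + w \<in> H i" if "u \<in> H i" "w \<in> H i" for u w i
    using diff[OF that(1) diff[OF diff[OF that(2) that(2)] that(2)]] by simp
  have sum_mem: "u + (\<Sum>v\<in>b. of_int (n v) *\<^sub>R v) \<in> H i" if u: "u \<in> H i" and i: "j0 \<le> i" for n :: "real^'n \<Rightarrow> int" and i u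
  proof -
    have "u + (\<Sum>v\<in>F. of_int (n v) *\<^sub>R v) \<in> H i" if "F \<subseteq> b" for F
      using finite_subset[OF that bf] that
    proof (induction F)
      case (insert v F)
      have "v \<in> H i" using insert j0 le[OF i] by blast
      then have "of_int (n v) *\<^sub>R v \<in> H i" using int_scaleR_mem[of "H i" v "n v"] diff by blast
      then have "(u + (\<Sum>v\<in>F. of_int (n v) *\<^sub>R v)) + of_int (n v) *\<^sub>R v \<in> H i" using H_add[of "u + (\<Sum>v\<in>F. of_int (n v) *\<^sub>R v)" i] insert by blast
      then show ?case using insert by (simp add: add.commute add.left_commute)
    qed (simp add: u)
    then show ?thesis by blast
  qed
  define R where "R = (\<Sum>v\<in>b. norm v)"
  have res: "x j - e j \<in> int_lattice \<inter> cball 0 R" if "j0 \<le> j" for j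
  proof
    have "x j + (\<Sum>v\<in>b. of_int (- \<lfloor>t j v\<rfloor>) *\<^sub>R v) \<in> H (Suc j)" using x[of j] that by (intro sum_mem) auto
    then show "x j - e j \<in> int_lattice" using sub by (auto simp: e_def sum_negf)
    have "x j - e j = (\<Sum>v\<in>b. (t j v - of_int \<lfloor>t j v\<rfloor>) *\<^sub>R v)"
      unfolding t[of j] e_def by (simp add: sum_subtractf scaleR_left_diff_distrib)
    also have "norm \<dots> \<le> R" unfolding R_def
    proof (rule sum_norm_le)
      fix v
      have "\<bar>t j v - of_int \<lfloor>t j v\<rfloor>\<bar> \<le> 1" by linarith
      then show "norm ((t j v - of_int \<lfloor>t j v\<rfloor>) *\<^sub>R v) \<le> norm v"
        unfolding norm_scaleR by (intro mult_left_le_one_le) auto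
    qed
    finally show "x j - e j \<in> cball 0 R" by simp
  qed
  \<comment> \<open>Infinitely many indices but finitely many residues: some \<open>i < k\<close>
    share one. Then \<open>x k\<close> differs from \<open>x i\<close> by an integer combination of
    \<open>b\<close> and already lies in \<open>H k\<close>.\<close>
  have "\<not> inj_on (\<lambda>j. x j - e j) {j0..}"
  proof
    assume "inj_on (\<lambda>j. x j - e j) {j0..}"
    moreover have "finite ((\<lambda>j. x j - e j) ` {j0..})"
      by (rule finite_subset[OF _ finite_int_lattice_bounded[of R]]) (use res in auto)
    ultimately have "finite {j0..}" using finite_imageD by blast
    then show False using infinite_Ici by blast
  qed
  then obtain i k where ik: "j0 \<le> i" "i < k" "x i - e i = x k - e k"
    unfolding inj_on_def by (metis atLeast_iff linorder_neqE_nat)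
  have "x i \<in> H k" using x[of i] le[of "Suc i" k] ik(2) by auto
  then have "x i + (\<Sum>v\<in>b. of_int (\<lfloor>t k v\<rfloor> - \<lfloor>t i v\<rfloor>) *\<^sub>R v) \<in> H k" using ik by (intro sum_mem) auto
  moreover have "(\<Sum>v\<in>b. of_int (\<lfloor>t k v\<rfloor> - \<lfloor>t i v\<rfloor>) *\<^sub>R v) = e k - e i"
    unfolding e_def by (simp add: sum_subtractf scaleR_left_diff_distrib)
  moreover have "x i + (e k - e i) = x k" using ik(3) by (simp add: algebra_simps)
  ultimately show False using x[of k] by simp
qed

lemma int_combinations_Suc:
  assumes "1 \<le> j"
  shows "int_combinations \<xi> {1..<Suc j} = {z + of_int n *\<^sub>R \<xi> j | z n. z \<in> int_combinations \<xi> {1..<j}}"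
proof -
  have set: "{1..<Suc j} = insert j {1..<j}" using assms by auto
  show ?thesis
  proof (intro equalityI subsetI)
    fix y assume "y \<in> int_combinations \<xi> {1..<Suc j}"
    then obtain n where y: "y = (\<Sum>i\<in>{1..<Suc j}. of_int (n i) *\<^sub>R \<xi> i)" unfolding int_combinations_def by blast
    then have "y = (\<Sum>i\<in>{1..<j}. of_int (n i) *\<^sub>R \<xi> i) + of_int (n j) *\<^sub>R \<xi> j" unfolding set by (simp add: add.commute)
    then show "y \<in> {z + of_int n *\<^sub>R \<xi> j | z n. z \<in> int_combinations \<xi> {1..<j}}" unfolding int_combinations_def by blast
  next
    fix y assume "y \<in> {z + of_int n *\<^sub>R \<xi> j | z n. z \<in> int_combinations \<xi> {1..<j}}"
    then obtain n m where y: "y = (\<Sum>i\<in>{1..<j}. of_int (n i) *\<^sub>R \<xi> i) + of_int m *\<^sub>R \<xi> j" unfolding int_combinations_def by blast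
    have "(\<Sum>i\<in>{1..<Suc j}. of_int ((n(j := m)) i) *\<^sub>R \<xi> i) = of_int m *\<^sub>R \<xi> j + (\<Sum>i\<in>{1..<j}. of_int ((n(j := m)) i) *\<^sub>R \<xi> i)"
      unfolding set by simp
    also have "(\<Sum>i\<in>{1..<j}. of_int ((n(j := m)) i) *\<^sub>R \<xi> i) = (\<Sum>i\<in>{1..<j}. of_int (n i) *\<^sub>R \<xi> i)"
      by (rule sum.cong) auto
    finally have "y = (\<Sum>i\<in>{1..<Suc j}. of_int ((n(j := m)) i) *\<^sub>R \<xi> i)" using y by (simp add: add.commute)
    then show "y \<in> int_combinations \<xi> {1..<Suc j}" unfolding int_combinations_def by blast
  qed
qed

lemma int_combinations_diff:
  assumes "x \<in> int_combinations \<xi> S" "y \<in> int_combinations \<xi> S" shows "x - y \<in> int_combinations \<xi> S"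
proof -
  obtain n m where "x = (\<Sum>i\<in>S. of_int (n i) *\<^sub>R \<xi> i)" "y = (\<Sum>i\<in>S. of_int (m i) *\<^sub>R \<xi> i)"
    using assms unfolding int_combinations_def by blast
  then have "x - y = (\<Sum>i\<in>S. of_int (n i - m i) *\<^sub>R \<xi> i)"
    by (simp add: sum_subtractf scaleR_left_diff_distrib)
  then show ?thesis unfolding int_combinations_def by (auto intro!: exI[of _ "\<lambda>i. n i - m i"])
qed

lemma int_combinations_0: "0 \<in> int_combinations \<xi> S"
  unfolding int_combinations_def by (auto intro!: exI[of _ "\<lambda>_. 0"])

text \<open>The lattice contains the standard basis, so its generators span the whole space.\<close>

lemma CARD_le_generators:
  assumes "int_lattice = int_combinations (\<xi> :: nat \<Rightarrow> real^'n) {1..k}" shows "CARD('n) \<le> k"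
proof -
  have "x \<in> span (\<xi> ` {1..k})" if x: "x \<in> int_lattice" for x
  proof -
    have "x \<in> int_combinations \<xi> {1..k}" using x assms by simp
    then obtain n where "x = (\<Sum>i\<in>{1..k}. of_int (n i) *\<^sub>R \<xi> i)" unfolding int_combinations_def by blast
    then show ?thesis using span_sum[of "{1..k}" "\<lambda>i. of_int (n i) *\<^sub>R \<xi> i"] by (simp add: span_scale span_base)
  qed
  moreover have "Basis \<subseteq> (int_lattice :: (real^'n) set)"
    by (auto simp: Basis_vec_def int_lattice_def axis_def)
  ultimately have "span Basis \<subseteq> span (\<xi> ` {1..k})" by (intro span_minimal subspace_span) blast
  then have "(UNIV :: (real^'n) set) \<subseteq> span (\<xi> ` {1..k})" by simp
  then have "dim (UNIV :: (real^'n) set) \<le> card (\<xi> ` {1..k})" by (rule dim_le_card) simp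
  also have "\<dots> \<le> k" using card_image_le[of "{1..k}" \<xi>] by simp
  finally show ?thesis by simp
qed

theorem proposition4p11:
  fixes \<phi> :: "real \<Rightarrow> real" and l m :: real
    and V :: "real^'n \<Rightarrow> real" and c \<delta> :: real
  assumes "1 < l" and "l \<le> m"
    and "\<phi> C1_differentiable_on {0<..}"
    and "\<And>s. s > 0 \<Longrightarrow> \<phi> s > 0"
    and "\<And>s. s > 0 \<Longrightarrow> deriv (\<lambda>r. \<phi> r * r) s > 0"
    and "\<And>s. s > 0 \<Longrightarrow> l - 1 \<le> deriv (\<lambda>r. \<phi> r * r) s / \<phi> s"
    and "\<And>s. s > 0 \<Longrightarrow> deriv (\<lambda>r. \<phi> r * r) s / \<phi> s \<le> m - 1"
    and "C1_scalar V"
    and "\<And>x \<xi>. \<xi> \<in> int_lattice \<Longrightarrow> V (x + \<xi>) = V x"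
    and "\<And>x. V x \<ge> 0"
    and "\<And>x. V x = 0 \<longleftrightarrow> x \<in> int_lattice"
    and "0 \<le> c" and "c < cstar V"
    and "admissible_delta V c \<delta>"
  shows "\<exists>(k::nat) (\<xi> :: nat \<Rightarrow> real^'n).
      k \<ge> CARD('n) \<and>
      (\<forall>j\<in>{1..k}. \<xi> j \<in> int_lattice - {0}) \<and>
      (\<forall>j\<in>{2..k}. \<xi> j \<notin> int_combinations \<xi> {1..<j}) \<and>
      int_lattice = int_combinations \<xi> {1..k} \<and>
      (\<forall>j\<in>{1..k}. \<exists>\<alpha> \<omega> q.
         minimal_connection \<phi> V c
           (sublevel_part V c \<delta> (int_combinations \<xi> {1..<j}))
           (sublevel_part V c \<delta> (int_lattice - int_combinations \<xi> {1..<j})) \<alpha> \<omega> q \<and>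
         limit_dist_left \<alpha> q (sublevel_at V c \<delta> 0) \<and>
         limit_dist_right \<omega> q (sublevel_at V c \<delta> (\<xi> j)))"
proof -
  interpret periodic_well \<phi> l V c \<delta>
    by unfold_locales (use assms in auto)
  define conn where "conn Z \<eta> \<longleftrightarrow> (\<exists>\<alpha> \<omega> q. minimal_connection \<phi> V c
      (sublevel_part V c \<delta> Z) (sublevel_part V c \<delta> (int_lattice - Z)) \<alpha> \<omega> q \<and>
      limit_dist_left \<alpha> q (sublevel_at V c \<delta> 0) \<and> limit_dist_right \<omega> q (sublevel_at V c \<delta> \<eta>))" for Z \<eta>
  \<comment> \<open>The implication keeps the choice meaningful when \<open>Z\<close> is the whole
    lattice: any lattice point then serves, and the recursion can continue.\<close>
  define nx where "nx Z = (SOME \<eta>. \<eta> \<in> int_lattice \<and> (Z \<noteq> int_lattice \<longrightarrow> \<eta> \<notin> Z \<and> conn Z \<eta>))" for Z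
  define H where "H = rec_nat {0} (\<lambda>_ Z. {z + of_int n *\<^sub>R nx Z | z n. z \<in> Z})"
  have H_0: "H 0 = {0}" and H_Suc: "H (Suc j) = {z + of_int n *\<^sub>R nx (H j) | z n. z \<in> H j}" for j
    by (simp_all add: H_def)
  \<comment> \<open>The shift matches the numbering from 1: \<open>\<xi> j\<close> is adjoined to
    the group generated by the first \<open>j - 1\<close> vectors.\<close>
  define \<xi> where "\<xi> j = nx (H (j - 1))" for j
  have H_comb: "H j = int_combinations \<xi> {1..<Suc j}" for j
  proof (induction j)
    case 0 then show ?case by (simp add: H_0 int_combinations_def)
  next
    case (Suc j)
    have "\<xi> (Suc j) = nx (H j)" by (simp add: \<xi>_def)
    then show ?case using int_combinations_Suc[of "Suc j" \<xi>] Suc.IH H_Suc[of j] by simp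
  qed
  have H_diff: "x - y \<in> H j" if "x \<in> H j" "y \<in> H j" for x y j
    using that int_combinations_diff unfolding H_comb by blast
  have H_zero: "0 \<in> H j" for j unfolding H_comb by (rule int_combinations_0)
  have nx: "nx Z \<in> int_lattice" "Z \<noteq> int_lattice \<Longrightarrow> nx Z \<notin> Z \<and> conn Z (nx Z)"
    if "Z \<subseteq> int_lattice" "0 \<in> Z" "\<And>x y. x \<in> Z \<Longrightarrow> y \<in> Z \<Longrightarrow> x - y \<in> Z" for Z
  proof -
    have "\<exists>\<eta>. \<eta> \<in> int_lattice \<and> (Z \<noteq> int_lattice \<longrightarrow> \<eta> \<notin> Z \<and> conn Z \<eta>)"
    proof (cases "Z = int_lattice")
      case False
      interpret subgroup_step \<phi> l V c \<delta> Z by unfold_locales (use that False in auto)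
      show ?thesis using step_connection unfolding conn_def by blast
    qed (use int_lattice_0 in blast)
    from someI_ex[OF this] show "nx Z \<in> int_lattice" "Z \<noteq> int_lattice \<Longrightarrow> nx Z \<notin> Z \<and> conn Z (nx Z)"
      unfolding nx_def by blast+
  qed
  have H_sub: "H j \<subseteq> int_lattice" for j
  proof (induction j)
    case (Suc j)
    have "nx (H j) \<in> int_lattice" by (rule nx(1)[OF Suc H_zero H_diff])
    then have "of_int n *\<^sub>R nx (H j) \<in> int_lattice" for n using int_scaleR_mem[of int_lattice] int_lattice_diff by blast
    then show ?case using Suc int_lattice_add unfolding H_Suc by blast
  qed (simp add: H_0)
  have step: "\<xi> (Suc j) \<in> int_lattice" "H j \<noteq> int_lattice \<Longrightarrow> \<xi> (Suc j) \<notin> H j \<and> conn (H j) (\<xi> (Suc j))" for j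
    using nx[OF H_sub H_zero H_diff, of j] by (auto simp: \<xi>_def)
  have H_mono: "H j \<subseteq> H (Suc j)" for j
  proof
    fix z assume "z \<in> H j"
    moreover have "z = z + of_int 0 *\<^sub>R nx (H j)" by simp
    ultimately show "z \<in> H (Suc j)" unfolding H_Suc by blast
  qed
  have "\<exists>k. H k = int_lattice"
  proof (rule ccontr)
    assume "\<not> ?thesis"
    then have "\<xi> (Suc j) \<notin> H j" for j using step(2) by blast
    moreover have "\<xi> (Suc j) \<in> H (Suc j)" for j
    proof -
      have "\<xi> (Suc j) = 0 + of_int 1 *\<^sub>R nx (H j)" by (simp add: \<xi>_def)
      then show ?thesis unfolding H_Suc using H_zero[of j] by blast
    qed
    ultimately show False
      by (intro no_infinite_int_lattice_chain[of H "\<lambda>j. \<xi> (Suc j)"] H_sub H_mono H_diff) auto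
  qed
  \<comment> \<open>With the least such \<open>k\<close> all earlier groups are proper, so each of
    the first \<open>k\<close> choices comes with a connection.\<close>
  then obtain k where k: "H k = int_lattice" "\<And>j. j < k \<Longrightarrow> H j \<noteq> int_lattice"
    using exists_least_iff[of "\<lambda>k. H k = int_lattice"] by blast
  have gen: "int_lattice = int_combinations \<xi> {1..k}"
    using H_comb[of k] k(1) by (simp add: atLeastLessThanSuc_atLeastAtMost)
  have main: "\<xi> j \<in> int_lattice - int_combinations \<xi> {1..<j} \<and> conn (int_combinations \<xi> {1..<j}) (\<xi> j)" if "j \<in> {1..k}" for j
  proof -
    define i where "i = j - 1"
    then have i: "j = Suc i" "i < k" using that by auto
    then show ?thesis using step[of i] k(2)[OF i(2)] H_comb[of i] by simp
  qed
  show ?thesis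
  proof (intro exI[of _ k] exI[of _ \<xi>] conjI ballI)
    show "CARD('n) \<le> k" by (rule CARD_le_generators[OF gen])
    \<comment> \<open>Zero lies in every group of the chain, while \<open>\<xi> j\<close> lies
      outside the group to which it is adjoined.\<close>
    show "\<xi> j \<in> int_lattice - {0}" if "j \<in> {1..k}" for j
      using main[OF that] int_combinations_0[of \<xi> "{1..<j}"] by auto
    show "\<xi> j \<notin> int_combinations \<xi> {1..<j}" if "j \<in> {2..k}" for j using main[of j] that by auto
    show "int_lattice = int_combinations \<xi> {1..k}" by (rule gen)
    show "\<exists>\<alpha> \<omega> q. minimal_connection \<phi> V c (sublevel_part V c \<delta> (int_combinations \<xi> {1..<j}))
           (sublevel_part V c \<delta> (int_lattice - int_combinations \<xi> {1..<j})) \<alpha> \<omega> q \<and>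
         limit_dist_left \<alpha> q (sublevel_at V c \<delta> 0) \<and> limit_dist_right \<omega> q (sublevel_at V c \<delta> (\<xi> j))"
      if "j \<in> {1..k}" for j using main[OF that] unfolding conn_def by blast
  qed
qed

end
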